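(* Let $k\ge 3$ be an odd integer and let $n>0$ be an integer with $n\equiv 0 \bmod 4$. Then there is no orientation-preserving, pseudofree, tame action of the dihedral group $D_k$ of order $2k$ on any closed, orientable $n$-manifold of type $(2,2,k)$, that is, whose singular orbit structure consists of exactly one orbit with isotropy group $C_k$ and exactly two orbits with isotropy groups of order $2$.
   Context: $D_k$ denotes the dihedral group of order $2k$, and $C_k\subset D_k$ its normal cyclic subgroup of order $k$. An action of a group is pseudofree if the fixed point set of each non-identity element is discrete (possibly empty). A pseudofree action of a finite group $G$ on an $n$-manifold is tame if each point $x$ has a (closed $n$-)disk neighborhood invariant under the isotropy group $G_x$; locally linear pseudofree actions are tame. An orbit is singular if its points have nontrivial isotropy group. *)

theory Defs
  imports "HOL-Analysis.Analysis" "HOL-Homology.Homology" "HOL-Algebra.Group_Action"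
begin

subsection \<open>Dihedral groups\<close>

text \<open>The pair \<open>(i, b)\<close> stands for the normal form \<open>r\<^sup>i s\<^sup>b\<close>, with \<open>i\<close> taken modulo \<open>k\<close>,
  where \<open>r\<close> is the rotation of order \<open>k\<close>, \<open>s\<close> is a reflection, and \<open>s r = r\<^sup>-\<^sup>1 s\<close>.\<close>

definition dihedral_group :: "nat \<Rightarrow> (int \<times> bool) monoid" where
  "dihedral_group k =
     \<lparr>carrier = {0..<int k} \<times> UNIV,
      monoid.mult = (\<lambda>(i, a) (j, b). ((if a then i - j else i + j) mod int k, a \<noteq> b)),
      one = (0, False)\<rparr>"

definition rotation_subgroup :: "nat \<Rightarrow> (int \<times> bool) set" where
  "rotation_subgroup k = {0..<int k} \<times> {False}"

lemma group_dihedral_group: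
  assumes "k > 0"
  shows "group (dihedral_group k)"
proof (rule groupI)
  fix x y z
  assume "x \<in> carrier (dihedral_group k)" "y \<in> carrier (dihedral_group k)"
    "z \<in> carrier (dihedral_group k)"
  show "x \<otimes>\<^bsub>dihedral_group k\<^esub> y \<otimes>\<^bsub>dihedral_group k\<^esub> z
      = x \<otimes>\<^bsub>dihedral_group k\<^esub> (y \<otimes>\<^bsub>dihedral_group k\<^esub> z)"
    by (cases x; cases y; cases z) (auto simp: dihedral_group_def mod_simps algebra_simps)
next
  fix x assume x: "x \<in> carrier (dihedral_group k)"
  obtain i a where [simp]: "x = (i, a)" by (cases x)
  show "\<exists>y\<in>carrier (dihedral_group k). y \<otimes>\<^bsub>dihedral_group k\<^esub> x = \<one>\<^bsub>dihedral_group k\<^esub>"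
    using assms x
    by (intro bexI[of _ "(if a then i else (- i) mod int k, a)"])
      (auto simp: dihedral_group_def mod_simps)
qed (use assms in \<open>auto simp: dihedral_group_def\<close>)

lemma order_dihedral_group: "order (dihedral_group k) = 2 * k"
  by (simp add: order_def dihedral_group_def card_cartesian_product)

lemma card_rotation_subgroup: "card (rotation_subgroup k) = k"
  by (simp add: rotation_subgroup_def card_cartesian_product)

lemma normal_rotation_subgroup:
  assumes "k > 0"
  shows "rotation_subgroup k \<lhd> dihedral_group k"
proof -
  interpret group "dihedral_group k"
    by (rule group_dihedral_group[OF assms])
  let ?R = "rotation_subgroup k"
  have char: "x \<in> ?R \<longleftrightarrow> x \<in> carrier (dihedral_group k) \<and> \<not> snd x" for x
    by (cases x) (auto simp: rotation_subgroup_def dihedral_group_def)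
  have snd_mult: "snd (x \<otimes>\<^bsub>dihedral_group k\<^esub> y) = (snd x \<noteq> snd y)" for x y
    by (cases x; cases y) (auto simp: dihedral_group_def)
  have snd_inv: "snd (inv\<^bsub>dihedral_group k\<^esub> x) = snd x"
    if "x \<in> carrier (dihedral_group k)" for x
    using snd_mult[of "inv\<^bsub>dihedral_group k\<^esub> x" x] that
    by (simp add: l_inv) (simp add: dihedral_group_def)
  have "(0, False) \<in> ?R"
    using assms by (simp add: rotation_subgroup_def)
  then have "?R \<noteq> {}"
    by blast
  then have "subgroup ?R (dihedral_group k)"
    by (intro subgroupI) (auto simp: char snd_mult snd_inv)
  then show ?thesis
    unfolding normal_inv_iff by (auto simp: char snd_mult snd_inv)
qed

lemma cyclic_rotation_subgroup:
  assumes "k > 1" "i \<in> {0..<int k}"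
  shows "(1, False) [^]\<^bsub>dihedral_group k\<^esub> nat i = (i, False)"
proof -
  have "(1, False) [^]\<^bsub>dihedral_group k\<^esub> m = (int m mod int k, False)" for m :: nat
    by (induction m) (auto simp: nat_pow_def dihedral_group_def mod_simps add.commute)
  then show ?thesis
    using assms by simp
qed


subsection \<open>Closed orientable topological manifolds\<close>

definition closed_manifold :: "nat \<Rightarrow> 'a topology \<Rightarrow> bool" where
  "closed_manifold n X \<longleftrightarrow>
     compact_space X \<and> Hausdorff_space X \<and> second_countable X \<and>
     (\<forall>x\<in>topspace X. \<exists>U. openin X U \<and> x \<in> U \<and>
        subtopology X U homeomorphic_space Euclidean_space n)"

text \<open>An orientation is a choice of a generator \<open>\<mu> x\<close> of the local homology group
  \<open>H\<^sub>n(X, X - {x}; \<int>)\<close> for every point \<open>x\<close>, such that near every point all the \<open>\<mu> y\<close> are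
  restrictions of a single class.\<close>

definition orientation :: "nat \<Rightarrow> 'a topology \<Rightarrow> ('a \<Rightarrow> 'a chain set) \<Rightarrow> bool" where
  "orientation n X \<mu> \<longleftrightarrow>
     (\<forall>x\<in>topspace X.
        \<mu> x \<in> carrier (relative_homology_group (int n) X (topspace X - {x})) \<and>
        subgroup_generated (relative_homology_group (int n) X (topspace X - {x})) {\<mu> x}
          = relative_homology_group (int n) X (topspace X - {x})) \<and>
     (\<forall>x\<in>topspace X. \<exists>U c. openin X U \<and> x \<in> U \<and>
        c \<in> carrier (relative_homology_group (int n) X (topspace X - U)) \<and>
        (\<forall>y\<in>U. hom_induced (int n) X (topspace X - U) X (topspace X - {y}) id c = \<mu> y))"

definition orientable :: "nat \<Rightarrow> 'a topology \<Rightarrow> bool" where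
  "orientable n X \<longleftrightarrow> (\<exists>\<mu>. orientation n X \<mu>)"


subsection \<open>Group actions on manifolds\<close>

definition topological_action ::
    "('g, 'm) monoid_scheme \<Rightarrow> 'a topology \<Rightarrow> ('g \<Rightarrow> 'a \<Rightarrow> 'a) \<Rightarrow> bool" where
  "topological_action G X \<phi> \<longleftrightarrow>
     group_action G (topspace X) \<phi> \<and> (\<forall>g\<in>carrier G. homeomorphic_map X X (\<phi> g))"

text \<open>If \<open>X\<close> is connected, it does not matter which orientation is used to test whether the
  action preserves orientation. Without connectedness, we ask for one orientation that is preserved
  by all group elements.\<close>

definition orientation_preserving_action ::
    "nat \<Rightarrow> ('g, 'm) monoid_scheme \<Rightarrow> 'a topology \<Rightarrow> ('g \<Rightarrow> 'a \<Rightarrow> 'a) \<Rightarrow> bool" where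
  "orientation_preserving_action n G X \<phi> \<longleftrightarrow>
     (\<exists>\<mu>. orientation n X \<mu> \<and>
        (\<forall>g\<in>carrier G. \<forall>x\<in>topspace X.
           hom_induced (int n) X (topspace X - {x}) X (topspace X - {\<phi> g x}) (\<phi> g) (\<mu> x)
             = \<mu> (\<phi> g x)))"

definition pseudofree_action ::
    "('g, 'm) monoid_scheme \<Rightarrow> 'a topology \<Rightarrow> ('g \<Rightarrow> 'a \<Rightarrow> 'a) \<Rightarrow> bool" where
  "pseudofree_action G X \<phi> \<longleftrightarrow>
     (\<forall>g\<in>carrier G - {\<one>\<^bsub>G\<^esub>}.
        subtopology X (invariants (topspace X) \<phi> g)
          = discrete_topology (invariants (topspace X) \<phi> g))"

definition closed_disk :: "nat \<Rightarrow> (nat \<Rightarrow> real) topology" where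
  "closed_disk n = subtopology (Euclidean_space n) {x. (\<Sum>i<n. (x i)\<^sup>2) \<le> 1}"

definition tame_action ::
    "nat \<Rightarrow> ('g, 'm) monoid_scheme \<Rightarrow> 'a topology \<Rightarrow> ('g \<Rightarrow> 'a \<Rightarrow> 'a) \<Rightarrow> bool" where
  "tame_action n G X \<phi> \<longleftrightarrow>
     (\<forall>x\<in>topspace X. \<exists>D\<subseteq>topspace X.
        x \<in> X interior_of D \<and>
        subtopology X D homeomorphic_space closed_disk n \<and>
        (\<forall>g\<in>stabilizer G \<phi> x. \<phi> g ` D = D))"

definition singular_orbits ::
    "('g, 'm) monoid_scheme \<Rightarrow> 'a topology \<Rightarrow> ('g \<Rightarrow> 'a \<Rightarrow> 'a) \<Rightarrow> 'a set set" where
  "singular_orbits G X \<phi> =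
     {S \<in> orbits G (topspace X) \<phi>. \<forall>x\<in>S. stabilizer G \<phi> x \<noteq> {\<one>\<^bsub>G\<^esub>}}"

definition type_2_2_k ::
    "nat \<Rightarrow> 'a topology \<Rightarrow> (int \<times> bool \<Rightarrow> 'a \<Rightarrow> 'a) \<Rightarrow> bool" where
  "type_2_2_k k X \<phi> \<longleftrightarrow>
     (let G = dihedral_group k;
          A = {S \<in> singular_orbits G X \<phi>. \<forall>x\<in>S. stabilizer G \<phi> x = rotation_subgroup k};
          B = {S \<in> singular_orbits G X \<phi>. \<forall>x\<in>S. card (stabilizer G \<phi> x) = 2}
      in singular_orbits G X \<phi> = A \<union> B \<and> card A = 1 \<and> card B = 2)"

end

theory Submission
  imports Defs
begin

text \<open>Let \<open>r\<close> be the rotation and \<open>s\<close> the reflection that generate the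
  dihedral group, \<open>x\<close> a point with isotropy group \<open>C\<^sub>k\<close> and
  \<open>y = s x\<close>. As \<open>k\<close> is odd, an isotropy group of order two contains no
  rotation, so a nontrivial power of \<open>r\<close> fixes only \<open>x\<close> and
  \<open>y\<close>.

  The action near \<open>x\<close> is compared with a linear one. On
  \<open>\<real>\<^sup>n\<close>, seen as a quaternionic vector space, let \<open>\<tau>\<close>
  be the multiplication by \<open>exp (2 \<pi> \<i> / k)\<close>. Multiplication by the
  quaternion \<open>j\<close> exchanges \<open>\<tau>\<close> with its inverse, just as
  \<open>s\<close> exchanges \<open>r\<close> with its inverse, and it has degree
  \<open>1\<close>; this is where \<open>n \<equiv> 0 mod 4\<close> enters. Let \<open>D\<close>
  be the invariant disk at \<open>x\<close> and \<open>S\<close> its boundary sphere, on which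
  \<open>r\<close> acts freely. There is a map \<open>f\<close> from
  \<open>S \<union> s S\<close> to the punctured space \<open>\<real>\<^sup>n - 0\<close> that
  carries \<open>r\<close> to \<open>\<tau>\<close>. An equivariant self-map of the linear
  sphere has degree \<open>1\<close> modulo \<open>k\<close> (\<open>radial_degree_mod\<close>);
  composing \<open>f\<close> with an equivariant map \<open>h\<close> from the linear sphere to
  \<open>S\<close> therefore gives \<open>a b \<equiv> 1\<close>, where \<open>a\<close> and
  \<open>b\<close> are the degrees of \<open>h\<close> and of \<open>f\<close> on
  \<open>S\<close> (\<open>sphere_degree_inverse\<close>). The map
  \<open>j \<circ> f \<circ> s\<close> on \<open>S\<close> is equivariant as well, so that
  \<open>a b' \<equiv> 1\<close> for the degree \<open>b'\<close> of \<open>f \<circ> s\<close>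
  on \<open>S\<close>.

  On the other hand, if \<open>y\<close> is not in \<open>D\<close>, then \<open>f\<close> extends
  to a map \<open>u\<close> from the whole manifold to \<open>\<real>\<^sup>n\<close> with
  finitely many zeros that is equivariant outside disjoint neighbourhoods of \<open>x\<close>
  and \<open>y\<close>, the interior of \<open>D\<close> without \<open>s D\<close> and the
  interior of \<open>s D\<close> without \<open>D\<close>
  (\<open>equivariant_extension_outside\<close>). The zeros of \<open>u\<close> cancel: their
  number, counted with the degrees given by the orientation, depends only on boundary values
  (\<open>degree_sum_boundary\<close>), and the manifold has no boundary, so that
  \<open>u\<close> may be compared with a nonzero constant. The zeros in the free part
  contribute multiples of \<open>k\<close> (\<open>degree_sum_free_dvd\<close>). The remaining
  ones contribute \<open>b\<close> at \<open>x\<close> and, because \<open>s\<close> preserves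
  the orientation, \<open>b'\<close> at \<open>y\<close>, up to a common sign and modulo
  \<open>k\<close>. Hence \<open>b + b' \<equiv> 0\<close>, and multiplication by
  \<open>a\<close> gives \<open>2 \<equiv> 0\<close> modulo \<open>k\<close>, which is
  impossible. If \<open>y\<close> lies in the interior of \<open>D\<close>, the same count gives
  \<open>b \<equiv> 0\<close>. Finally \<open>y\<close> is not on \<open>S\<close>
  (\<open>y_not_boundary\<close>), since \<open>S - {y}\<close> would be a contractible space
  with a free action of \<open>C\<^sub>k\<close>.

  Neither quotient spaces nor a fundamental class are used. The existence of all maps comes from
  two extension properties of compact sets \<open>K\<close>: maps from closed subsets to the
  punctured space extend over \<open>K\<close> if \<open>K\<close> is a cell of dimension less
  than \<open>n\<close> (\<open>extendable\<close>), and they extend to maps to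
  \<open>\<real>\<^sup>n\<close> with finitely many zeros if \<open>K\<close> is an
  \<open>n\<close>-dimensional cell (\<open>finite_zero_extendable\<close>). Both are made
  equivariant by working cell by cell on small cells that are disjoint from their translates.\<close>

section \<open>Extension of maps into punctured Euclidean space\<close>

abbreviation zvec :: "nat \<Rightarrow> real" where "zvec \<equiv> (\<lambda>_. 0)"

definition punct :: "nat \<Rightarrow> (nat \<Rightarrow> real) topology" where
  "punct n = subtopology (Euclidean_space n) (- {zvec})"

lemma continuous_map_Euclidean_iff:
  "continuous_map X (Euclidean_space n) u \<longleftrightarrow>
     (\<forall>i<n. continuous_map X euclideanreal (\<lambda>x. u x i)) \<and> (\<forall>x\<in>topspace X. \<forall>i\<ge>n. u x i = 0)"
  (is "?l \<longleftrightarrow> ?r")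
proof
  assume ?l
  then have "continuous_map X (powertop_real UNIV) u" "\<forall>x\<in>topspace X. \<forall>i\<ge>n. u x i = 0"
    by (auto simp: Euclidean_space_def continuous_map_in_subtopology)
  then show ?r by (auto simp: continuous_map_componentwise_UNIV)
next
  assume r: ?r
  have "continuous_map X euclideanreal (\<lambda>x. u x i)" for i
  proof (cases "i < n")
    case False
    have "continuous_map X euclideanreal (\<lambda>x. 0)" by simp
    then show ?thesis by (rule continuous_map_eq) (use r False in auto)
  qed (use r in auto)
  then show ?l
    using r by (auto simp: Euclidean_space_def continuous_map_in_subtopology continuous_map_componentwise_UNIV)
qed

lemma continuous_map_Euclidean_coord:
  "continuous_map X (Euclidean_space n) u \<Longrightarrow> continuous_map X euclideanreal (\<lambda>x. u x i)"
  by (simp add: Euclidean_space_def continuous_map_in_subtopology continuous_map_componentwise_UNIV)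

lemma continuous_map_Euclidean_scale:
  assumes "continuous_map X (Euclidean_space n) u" "continuous_map X euclideanreal a"
  shows "continuous_map X (Euclidean_space n) (\<lambda>x i. a x * u x i)"
  using assms unfolding continuous_map_Euclidean_iff
  by (auto intro!: continuous_map_real_mult)

lemma topspace_punct: "topspace (punct n) = {x. (\<forall>i\<ge>n. x i = 0) \<and> x \<noteq> zvec}"
  by (auto simp: punct_def topspace_Euclidean_space)

lemma continuous_map_punct_iff:
  "continuous_map X (punct n) u \<longleftrightarrow>
     continuous_map X (Euclidean_space n) u \<and> (\<forall>x\<in>topspace X. u x \<noteq> zvec)"
  by (auto simp: punct_def continuous_map_in_subtopology)

lemma Euclidean_neq_zvec_iff:
  "x \<in> topspace (Euclidean_space n) \<Longrightarrow> x \<noteq> zvec \<longleftrightarrow> (\<exists>i<n. x i \<noteq> 0)"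
  by (auto simp: topspace_Euclidean_space fun_eq_iff not_less) (metis not_le)

text \<open>This is the property that obstruction theory gives for a finite complex \<open>Y\<close> of
  dimension less than \<open>n\<close> and the punctured space \<open>Q\<close>. Stated for all
  closed subsets and arbitrary maps, it passes to closed subsets and finite unions, which is all
  that is needed of cell structures.\<close>

definition extendable :: "'a topology \<Rightarrow> 'b topology \<Rightarrow> bool" where
  "extendable Y Q \<longleftrightarrow>
     (\<forall>A u. closedin Y A \<and> continuous_map (subtopology Y A) Q u \<longrightarrow>
        (\<exists>v. continuous_map Y Q v \<and> (\<forall>a\<in>A. v a = u a)))"

lemma extendableD:
  assumes "extendable Y Q" "closedin Y A" "continuous_map (subtopology Y A) Q u"
  obtains v where "continuous_map Y Q v" "\<And>a. a \<in> A \<Longrightarrow> v a = u a"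
  using assms unfolding extendable_def by blast

lemma extendable_closed_subset:
  assumes "extendable Y Q" "closedin Y C"
  shows "extendable (subtopology Y C) Q"
  unfolding extendable_def
proof (intro allI impI, elim conjE)
  fix A u
  assume A: "closedin (subtopology Y C) A" and u: "continuous_map (subtopology (subtopology Y C) A) Q u"
  have "A \<subseteq> C" using A closedin_subset by fastforce
  then have "continuous_map (subtopology Y A) Q u"
    using u by (simp add: subtopology_subtopology inf.absorb2)
  moreover have "closedin Y A" using A assms(2) closedin_trans_full by blast
  ultimately obtain v where "continuous_map Y Q v" "\<And>a. a \<in> A \<Longrightarrow> v a = u a"
    using extendableD[OF assms(1)] by metis
  then show "\<exists>v. continuous_map (subtopology Y C) Q v \<and> (\<forall>a\<in>A. v a = u a)"
    using continuous_map_from_subtopology by blast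
qed

text \<open>Extend over \<open>C\<close> first; then the map is given on the closed set
  \<open>D \<inter> (A \<union> C)\<close> and extends over \<open>D\<close>.\<close>

lemma extendable_Un:
  assumes 1: "extendable (subtopology Y C) Q" and 2: "extendable (subtopology Y D) Q"
    and C: "closedin Y C" and D: "closedin Y D"
  shows "extendable (subtopology Y (C \<union> D)) Q"
  unfolding extendable_def
proof (intro allI impI, elim conjE)
  fix A u
  assume A: "closedin (subtopology Y (C \<union> D)) A"
    and u: "continuous_map (subtopology (subtopology Y (C \<union> D)) A) Q u"
  have clA: "closedin Y A" using A C D closedin_trans_full by blast
  have AS: "A \<subseteq> C \<union> D" using A closedin_subset by fastforce
  have u': "continuous_map (subtopology Y A) Q u"
    using u AS by (simp add: subtopology_subtopology inf.absorb2)
  have "closedin (subtopology Y C) (A \<inter> C)"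
    by (metis clA closedin_subtopology)
  moreover have "continuous_map (subtopology (subtopology Y C) (A \<inter> C)) Q u"
    using u' by (auto simp: subtopology_subtopology intro: continuous_map_from_subtopology_mono)
  ultimately obtain v where v: "continuous_map (subtopology Y C) Q v" "\<And>a. a \<in> A \<inter> C \<Longrightarrow> v a = u a"
    using extendableD[OF 1] by metis
  let ?T = "\<lambda>b::bool. if b then C else A" and ?f = "\<lambda>b::bool. if b then v else u"
  obtain w where w: "continuous_map (subtopology Y (C \<union> A)) Q w"
      "\<And>x i. i \<in> {True,False} \<Longrightarrow> x \<in> topspace (subtopology Y (C \<union> A)) \<inter> ?T i \<Longrightarrow> w x = ?f i x"
  proof (rule pasting_lemma_exists_closed[where I="{True,False}" and T="?T" and f="?f" and X="subtopology Y (C \<union> A)" and Y=Q])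
    fix i :: bool assume "i \<in> {True,False}"
    show "closedin (subtopology Y (C \<union> A)) (?T i)"
      using clA C by (auto intro!: closedin_subset_topspace)
    show "continuous_map (subtopology (subtopology Y (C \<union> A)) (?T i)) Q (?f i)"
      using v u' by (auto simp: subtopology_subtopology Int_absorb1)
  qed (use v in auto)
  have wA: "w a = u a" if "a \<in> A" for a
    using w(2)[of False a] that closedin_subset[OF clA] by auto
  have clCA: "closedin Y (C \<union> A)" using clA C by blast
  have "closedin (subtopology Y D) ((C \<union> A) \<inter> D)"
    by (metis clCA closedin_subtopology)
  moreover have "continuous_map (subtopology (subtopology Y D) ((C \<union> A) \<inter> D)) Q w"
    using w(1) by (auto simp: subtopology_subtopology intro: continuous_map_from_subtopology_mono)
  ultimately obtain x where x: "continuous_map (subtopology Y D) Q x" "\<And>a. a \<in> (C \<union> A) \<inter> D \<Longrightarrow> x a = w a"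
    using extendableD[OF 2] by metis
  let ?T = "\<lambda>b::bool. if b then C \<union> A else D" and ?f = "\<lambda>b::bool. if b then w else x"
  have eq: "C \<union> D = C \<union> A \<union> D" using AS by auto
  obtain z where z: "continuous_map (subtopology Y (C \<union> D)) Q z"
      "\<And>y i. i \<in> {True,False} \<Longrightarrow> y \<in> topspace (subtopology Y (C \<union> D)) \<inter> ?T i \<Longrightarrow> z y = ?f i y"
  proof (rule pasting_lemma_exists_closed[where I="{True,False}" and T="?T" and f="?f" and X="subtopology Y (C \<union> D)" and Y=Q])
    fix i :: bool assume "i \<in> {True,False}"
    show "closedin (subtopology Y (C \<union> D)) (?T i)"
      using clCA D AS by (auto intro!: closedin_subset_topspace)
    show "continuous_map (subtopology (subtopology Y (C \<union> D)) (?T i)) Q (?f i)"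
      using w x AS by (auto simp: subtopology_subtopology Int_absorb1)
  qed (use x AS in auto)
  have "z a = u a" if "a \<in> A" for a
    using z(2)[of True a] that AS closedin_subset[OF clA] wA by auto
  then show "\<exists>v. continuous_map (subtopology Y (C \<union> D)) Q v \<and> (\<forall>a\<in>A. v a = u a)"
    using z(1) by blast
qed

lemma extendable_empty: "extendable trivial_topology Q"
  by (auto simp: extendable_def)

lemma extendable_Union:
  assumes "finite I" "\<And>i. i \<in> I \<Longrightarrow> closedin Y (C i)" "\<And>i. i \<in> I \<Longrightarrow> extendable (subtopology Y (C i)) Q"
  shows "extendable (subtopology Y (\<Union>i\<in>I. C i)) Q"
  using assms
proof (induction I rule: finite_induct)
  case (insert j I)
  then show ?case by (auto intro!: extendable_Un closedin_Union)
qed (use extendable_empty in auto)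

lemma extendable_homeomorphic_space:
  assumes "extendable Y Q" "Y homeomorphic_space Z"
  shows "extendable Z Q"
  unfolding extendable_def
proof (intro allI impI, elim conjE)
  fix A u
  assume A: "closedin Z A" and u: "continuous_map (subtopology Z A) Q u"
  obtain f g where fg: "homeomorphic_maps Y Z f g"
    using assms(2) by (auto simp: homeomorphic_space_def)
  then have f: "continuous_map Y Z f" and g: "continuous_map Z Y g"
    and fg': "\<And>z. z \<in> topspace Z \<Longrightarrow> f (g z) = z"
    by (auto simp: homeomorphic_maps_def)
  let ?B = "{y \<in> topspace Y. f y \<in> A}"
  have clB: "closedin Y ?B" using f A by (rule closedin_continuous_map_preimage)
  have uf: "continuous_map (subtopology Y ?B) Q (u \<circ> f)"
    by (rule continuous_map_compose[OF _ u])
       (use f in \<open>auto simp: continuous_map_in_subtopology continuous_map_from_subtopology\<close>)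
  obtain v where v: "continuous_map Y Q v" "\<And>a. a \<in> ?B \<Longrightarrow> v a = (u \<circ> f) a"
    by (rule extendableD[OF assms(1) clB uf]) (blast intro: that)
  have "(v \<circ> g) a = u a" if "a \<in> A" for a
  proof -
    have "a \<in> topspace Z" using A closedin_subset that by blast
    then have "g a \<in> ?B" using g fg' that by (auto simp: continuous_map_def)
    then show ?thesis using v fg' \<open>a \<in> topspace Z\<close> by auto
  qed
  then show "\<exists>v. continuous_map Z Q v \<and> (\<forall>a\<in>A. v a = u a)"
    using continuous_map_compose[OF g v(1)] by blast
qed

lemma extendable_retract:
  assumes "extendable Y Q" and r: "continuous_map Q Q' r" and i: "continuous_map Q' Q i"
    and ri: "\<And>q. q \<in> topspace Q' \<Longrightarrow> r (i q) = q"
  shows "extendable Y Q'"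
  unfolding extendable_def
proof (intro allI impI, elim conjE)
  fix A u
  assume A: "closedin Y A" and u: "continuous_map (subtopology Y A) Q' u"
  obtain v where v: "continuous_map Y Q v" "\<And>a. a \<in> A \<Longrightarrow> v a = (i \<circ> u) a"
    using extendableD[OF assms(1) A continuous_map_compose[OF u i]] by metis
  have "(r \<circ> v) a = u a" if "a \<in> A" for a
  proof -
    have "u a \<in> topspace Q'" using u that closedin_subset[OF A] by (auto simp: continuous_map_def)
    then show ?thesis using v that ri by auto
  qed
  then show "\<exists>v. continuous_map Y Q' v \<and> (\<forall>a\<in>A. v a = u a)"
    using continuous_map_compose[OF v(1) r] by blast
qed

lemma extendable_Euclidean:
  assumes "normal_space Y"
  shows "extendable Y (Euclidean_space n)"
  unfolding extendable_def
proof (intro allI impI, elim conjE)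
  fix A u
  assume A: "closedin Y A" and u: "continuous_map (subtopology Y A) (Euclidean_space n) u"
  have "\<exists>g. continuous_map Y euclideanreal g \<and> (\<forall>x\<in>A. g x = u x i)" for i
  proof -
    have c: "continuous_map (subtopology Y A) euclideanreal (\<lambda>x. u x i)"
      using u continuous_map_Euclidean_coord by blast
    obtain g where "continuous_map Y euclideanreal g" "\<And>x. x \<in> A \<Longrightarrow> g x = u x i"
      by (rule Tietze_extension_realinterval[OF assms A is_interval_univ _ c]) auto
    then show ?thesis by blast
  qed
  then obtain g where g: "\<And>i. continuous_map Y euclideanreal (g i)" "\<And>i x. x \<in> A \<Longrightarrow> g i x = u x i"
    by metis
  let ?v = "\<lambda>x i. if i < n then g i x else 0"
  have "continuous_map Y (Euclidean_space n) ?v"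
    using g by (simp add: continuous_map_componentwise_Euclidean_space)
  moreover have "?v a = u a" if "a \<in> A" for a
  proof
    fix i
    have "a \<in> topspace (subtopology Y A)" using that closedin_subset[OF A] by auto
    then have "i \<ge> n \<Longrightarrow> u a i = 0" using u by (auto simp: continuous_map_Euclidean_iff)
    then show "?v a i = u a i" using g that by auto
  qed
  ultimately show "\<exists>v. continuous_map Y (Euclidean_space n) v \<and> (\<forall>a\<in>A. v a = u a)" by blast
qed

lemma paste_closed2:
  assumes C: "closedin Y C" and D: "closedin Y D"
    and u: "continuous_map (subtopology Y C) Q u" and v: "continuous_map (subtopology Y D) Q v"
    and eq: "\<And>x. x \<in> C \<inter> D \<Longrightarrow> u x = v x"
  shows "continuous_map (subtopology Y (C \<union> D)) Q (\<lambda>x. if x \<in> C then u x else v x)"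
proof (rule pasting_lemma_closed[where I="{True,False}" and T="\<lambda>b. if b then C else D" and f="\<lambda>b. if b then u else v"])
  fix i :: bool assume "i \<in> {True,False}"
  show "closedin (subtopology Y (C \<union> D)) (if i then C else D)"
    using C D by (auto intro!: closedin_subset_topspace)
  show "continuous_map (subtopology (subtopology Y (C \<union> D)) (if i then C else D)) Q (if i then u else v)"
    using u v by (auto simp: subtopology_subtopology Int_absorb1)
qed (use eq in auto)

section \<open>Boxes of dimension less than n\<close>

lemma nat_floor_same_close:
  fixes a b :: real
  assumes "a \<ge> 0" "b \<ge> 0" "nat \<lfloor>a\<rfloor> = nat \<lfloor>b\<rfloor>"
  shows "\<bar>a - b\<bar> < 1"
proof -
  have "\<lfloor>a\<rfloor> = \<lfloor>b\<rfloor>" using assms by (simp add: nat_eq_iff2)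
  then show ?thesis by linarith
qed

text \<open>A counting argument replaces Sard's theorem: a Lipschitz map on a box of dimension less than
  \<open>n\<close> cannot hit all points of a fine grid. With mesh proportional to
  \<open>1 / M\<close> the grid has \<open>M ^ n\<close> points, while the box is covered by
  \<open>(q * M) ^ card J\<close> cells whose images each contain at most one grid point, where
  \<open>q\<close> depends only on the Lipschitz constant. As \<open>card J < n\<close>, the
  grid wins for large \<open>M\<close>.\<close>

lemma lipschitz_image_misses_small_vector:
  fixes p :: "nat \<Rightarrow> (nat \<Rightarrow> real) \<Rightarrow> real"
  assumes J: "finite J" "card J < n" and e: "e > 0" and L: "L \<ge> 0"
    and lh: "\<And>x j. x \<in> B \<Longrightarrow> j \<in> J \<Longrightarrow> l j \<le> x j \<and> x j \<le> h j"
    and p: "\<And>i x y. i < n \<Longrightarrow> x \<in> B \<Longrightarrow> y \<in> B \<Longrightarrow> \<bar>p i x - p i y\<bar> \<le> L * (\<Sum>j\<in>J. \<bar>x j - y j\<bar>)"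
  obtains v where "\<And>i. 0 \<le> v i \<and> v i \<le> e" "\<And>x. x \<in> B \<Longrightarrow> \<exists>i<n. p i x \<noteq> v i"
proof -
  define W where "W = 1 + (\<Sum>j\<in>J. \<bar>h j - l j\<bar>)"
  have Wpos: "W > 0" unfolding W_def by (simp add: add_pos_nonneg sum_nonneg)
  have W: "h j - l j < W" if "j \<in> J" for j
  proof -
    have "h j - l j \<le> \<bar>h j - l j\<bar>" by simp
    also have "\<dots> \<le> (\<Sum>j\<in>J. \<bar>h j - l j\<bar>)" using J that by (intro member_le_sum) auto
    finally show ?thesis by (simp add: W_def)
  qed
  obtain q0 :: nat where q0: "real q0 > L * real (card J) * W / e" using reals_Archimedean2 by blast
  define q where "q = Suc q0"
  have q: "L * real (card J) * W < e * real q" "q > 0"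
    using q0 e by (auto simp: q_def field_simps)
  \<comment> \<open>just large enough for \<open>M ^ n > (q * M) ^ (n - 1)\<close>\<close>
  define M where "M = q ^ (n - 1) + 1"
  have M: "M > 0" by (simp add: M_def)
  define s where "s = e / M"
  have s: "s > 0" using e M by (simp add: s_def)
  let ?K = "{..<n} \<rightarrow>\<^sub>E {..<M}"
  have "\<exists>k\<in>?K. \<forall>x\<in>B. \<exists>i<n. p i x \<noteq> s * real (k i)"
  proof (rule ccontr)
    assume "\<not> ?thesis"
    then have "\<forall>k\<in>?K. \<exists>x. x \<in> B \<and> (\<forall>i<n. p i x = s * real (k i))" by blast
    then obtain xx where xx: "\<And>k. k \<in> ?K \<Longrightarrow> xx k \<in> B" "\<And>k i. k \<in> ?K \<Longrightarrow> i < n \<Longrightarrow> p i (xx k) = s * real (k i)"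
      by metis
    define cell where "cell x = (\<lambda>j\<in>J. nat \<lfloor>(x j - l j) * real (q * M) / W\<rfloor>)" for x :: "nat \<Rightarrow> real"
    have im: "(cell \<circ> xx) ` ?K \<subseteq> J \<rightarrow>\<^sub>E {..<q * M}"
    proof
      fix c assume "c \<in> (cell \<circ> xx) ` ?K"
      then obtain k where k: "k \<in> ?K" "c = cell (xx k)" by auto
      have "nat \<lfloor>(xx k j - l j) * real (q * M) / W\<rfloor> < q * M" if "j \<in> J" for j
      proof -
        have "(xx k j - l j) < W" using lh[OF xx(1)[OF k(1)] that] W[OF that] by linarith
        then have "(xx k j - l j) * real (q * M) < W * real (q * M)"
          using q M by (intro mult_strict_right_mono) auto
        then have "(xx k j - l j) * real (q * M) / W < real (q * M)"
          using Wpos by (simp add: field_simps)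
        moreover have "0 \<le> (xx k j - l j) * real (q * M) / W"
          using lh[OF xx(1)[OF k(1)] that] Wpos by (intro divide_nonneg_pos mult_nonneg_nonneg) auto
        ultimately show ?thesis by linarith
      qed
      then show "c \<in> J \<rightarrow>\<^sub>E {..<q * M}" using k by (auto simp: cell_def)
    qed
    have "inj_on (cell \<circ> xx) ?K"
    proof (rule inj_onI)
      fix k k' assume k: "k \<in> ?K" and k': "k' \<in> ?K" and eq: "(cell \<circ> xx) k = (cell \<circ> xx) k'"
      have qM: "real (q * M) > 0" using q M by simp
      have d: "\<bar>xx k j - xx k' j\<bar> \<le> W / real (q * M)" if "j \<in> J" for j
      proof -
        let ?a = "(xx k j - l j) * real (q * M) / W" and ?b = "(xx k' j - l j) * real (q * M) / W"
        have "nat \<lfloor>?a\<rfloor> = nat \<lfloor>?b\<rfloor>" using fun_cong[OF eq, of j] that by (simp add: cell_def)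
        moreover have "?a \<ge> 0" "?b \<ge> 0"
          using lh[OF xx(1)[OF k] that] lh[OF xx(1)[OF k'] that] Wpos
          by (auto intro!: divide_nonneg_pos mult_nonneg_nonneg)
        ultimately have "\<bar>?a - ?b\<bar> < 1" by (intro nat_floor_same_close)
        moreover have "?a - ?b = (xx k j - xx k' j) * (real (q * M) / W)"
          unfolding times_divide_eq_right diff_divide_distrib[symmetric] left_diff_distrib[symmetric] by simp
        ultimately have "\<bar>xx k j - xx k' j\<bar> * (real (q * M) / W) < 1"
          using Wpos qM by (simp add: abs_mult)
        then show ?thesis using Wpos qM by (simp add: field_simps)
      qed
      have "k i = k' i" if "i < n" for i
      proof -
        have "s * \<bar>real (k i) - real (k' i)\<bar> = \<bar>p i (xx k) - p i (xx k')\<bar>"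
          using xx(2)[OF k that] xx(2)[OF k' that] s by (simp add: abs_mult flip: right_diff_distrib)
        also have "\<dots> \<le> L * (\<Sum>j\<in>J. \<bar>xx k j - xx k' j\<bar>)" using p[OF that xx(1)[OF k] xx(1)[OF k']] .
        also have "\<dots> \<le> L * (\<Sum>j\<in>J. W / real (q * M))" using d L by (intro mult_left_mono sum_mono) auto
        also have "\<dots> = (L * real (card J) * W) / real (q * M)" by simp
        also have "\<dots> < (e * real q) / real (q * M)" using q qM by (intro divide_strict_right_mono) auto
        also have "\<dots> = s" using q by (simp add: s_def)
        finally have "\<bar>real (k i) - real (k' i)\<bar> < 1" using s by simp
        then show ?thesis by linarith
      qed
      then show "k = k'" using k k' by (intro PiE_ext[OF k k']) auto
    qed
    then have "card ?K \<le> card (J \<rightarrow>\<^sub>E {..<q * M})"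
      using im J by (intro card_inj_on_le[of "cell \<circ> xx"]) (auto intro: finite_PiE)
    then have "M ^ n \<le> (q * M) ^ card J" using J by (simp add: card_PiE)
    also have "\<dots> \<le> (q * M) ^ (n - 1)" using J q M by (intro power_increasing) auto
    finally have "M * M ^ (n - 1) \<le> q ^ (n - 1) * M ^ (n - 1)"
      using J by (simp add: power_mult_distrib flip: power_Suc)
    then have "M \<le> q ^ (n - 1)" using M by simp
    then show False by (simp add: M_def)
  qed
  then obtain k where k: "k \<in> ?K" "\<And>x. x \<in> B \<Longrightarrow> \<exists>i<n. p i x \<noteq> s * real (k i)" by blast
  show thesis
  proof (rule that[of "\<lambda>i. if i < n then s * real (k i) else 0"])
    fix i
    show "0 \<le> (if i < n then s * real (k i) else 0) \<and> (if i < n then s * real (k i) else 0) \<le> e"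
    proof (cases "i < n")
      case True
      then have "k i < M" using k by auto
      then have "s * real (k i) \<le> s * real M" using s by (intro mult_left_mono) auto
      then show ?thesis using True s e M by (simp add: s_def)
    qed (use e in auto)
  next
    fix x assume "x \<in> B"
    then show "\<exists>i<n. p i x \<noteq> (if i < n then s * real (k i) else 0)" using k(2) by auto
  qed
qed

lemma compact_box: "compact {x::nat \<Rightarrow> real. \<forall>i. l i \<le> x i \<and> x i \<le> h i}"
proof -
  have "{x::nat \<Rightarrow> real. \<forall>i. l i \<le> x i \<and> x i \<le> h i} = PiE UNIV (\<lambda>i. {l i..h i})"
    by (auto simp: PiE_def)
  moreover have "compactin (powertop_real UNIV) (PiE UNIV (\<lambda>i. {l i..h i}))"
    by (simp add: compactin_PiE)
  ultimately show ?thesis by (metis compactin_euclidean_iff euclidean_product_topology)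
qed

text \<open>The Lipschitz functions on the box form an algebra that separates points, so the
  Stone-Weierstrass theorem applies.\<close>

lemma lipschitz_approximation_on_box:
  fixes l h :: "nat \<Rightarrow> real" and f :: "(nat \<Rightarrow> real) \<Rightarrow> real"
  defines "B \<equiv> {x. \<forall>i. l i \<le> x i \<and> x i \<le> h i}"
  assumes J: "finite J" and lh: "\<And>i. i \<notin> J \<Longrightarrow> l i = h i"
    and f: "continuous_on B f" and e: "e > 0"
  obtains g L where "continuous_on B g" "\<And>x. x \<in> B \<Longrightarrow> \<bar>f x - g x\<bar> < e" "L \<ge> 0"
    "\<And>x y. x \<in> B \<Longrightarrow> y \<in> B \<Longrightarrow> \<bar>g x - g y\<bar> \<le> L * (\<Sum>j\<in>J. \<bar>x j - y j\<bar>)"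
proof -
  let ?d = "\<lambda>x y. (\<Sum>j\<in>J. \<bar>x j - y j\<bar>) :: real"
  have d0: "?d x y \<ge> 0" for x y :: "nat \<Rightarrow> real" by (simp add: sum_nonneg)
  let ?R = "{g. continuous_on B g \<and> (\<exists>L\<ge>0. \<forall>x\<in>B. \<forall>y\<in>B. \<bar>g x - g y\<bar> \<le> L * ?d x y) \<and> (\<exists>C. \<forall>x\<in>B. \<bar>g x\<bar> \<le> C)}"
  have RI: "g \<in> ?R" if "continuous_on B g" "L \<ge> 0" "\<And>x y. x \<in> B \<Longrightarrow> y \<in> B \<Longrightarrow> \<bar>g x - g y\<bar> \<le> L * ?d x y"
    "\<And>x. x \<in> B \<Longrightarrow> \<bar>g x\<bar> \<le> C" for g L C
    using that by blast
  have RE: "\<exists>L C. continuous_on B g \<and> L \<ge> 0 \<and> (\<forall>x\<in>B. \<forall>y\<in>B. \<bar>g x - g y\<bar> \<le> L * ?d x y) \<and> (\<forall>x\<in>B. \<bar>g x\<bar> \<le> C)"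
    if "g \<in> ?R" for g
    using that by blast
  interpret function_ring_on ?R B
  proof
    show "compact B" unfolding B_def by (rule compact_box)
  next
    fix f g assume fR: "f \<in> ?R" and gR: "g \<in> ?R"
    obtain L C where f0: "continuous_on B f \<and> L \<ge> 0 \<and> (\<forall>x\<in>B. \<forall>y\<in>B. \<bar>f x - f y\<bar> \<le> L * ?d x y) \<and> (\<forall>x\<in>B. \<bar>f x\<bar> \<le> C)"
      using RE[OF fR] by blast
    obtain L' C' where g0: "continuous_on B g \<and> L' \<ge> 0 \<and> (\<forall>x\<in>B. \<forall>y\<in>B. \<bar>g x - g y\<bar> \<le> L' * ?d x y) \<and> (\<forall>x\<in>B. \<bar>g x\<bar> \<le> C')"
      using RE[OF gR] by blast
    have f: "continuous_on B f" "L \<ge> 0" "\<And>x y. x \<in> B \<Longrightarrow> y \<in> B \<Longrightarrow> \<bar>f x - f y\<bar> \<le> L * ?d x y" "\<And>x. x \<in> B \<Longrightarrow> \<bar>f x\<bar> \<le> C"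
      and g: "continuous_on B g" "L' \<ge> 0" "\<And>x y. x \<in> B \<Longrightarrow> y \<in> B \<Longrightarrow> \<bar>g x - g y\<bar> \<le> L' * ?d x y" "\<And>x. x \<in> B \<Longrightarrow> \<bar>g x\<bar> \<le> C'"
      using f0 g0 by auto
    have "\<bar>f x + g x - (f y + g y)\<bar> \<le> (L + L') * ?d x y" if "x \<in> B" "y \<in> B" for x y
      using f(3)[OF that] g(3)[OF that] by (simp add: distrib_right)
    moreover have "\<bar>f x + g x\<bar> \<le> C + C'" if "x \<in> B" for x
      using f(4)[OF that] g(4)[OF that] by linarith
    ultimately show "(\<lambda>x. f x + g x) \<in> ?R"
      using f(1,2) g(1,2) by (intro RI[where L="L + L'" and C="C + C'"] continuous_on_add) auto
    have "\<bar>f x * g x - f y * g y\<bar> \<le> (\<bar>C\<bar> * L' + \<bar>C'\<bar> * L) * ?d x y" if "x \<in> B" "y \<in> B" for x y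
    proof -
      have "f x * g x - f y * g y = f x * (g x - g y) + g y * (f x - f y)" by (simp add: algebra_simps)
      then have "\<bar>f x * g x - f y * g y\<bar> \<le> \<bar>f x\<bar> * \<bar>g x - g y\<bar> + \<bar>g y\<bar> * \<bar>f x - f y\<bar>"
        by (metis abs_mult abs_triangle_ineq)
      also have "\<dots> \<le> \<bar>C\<bar> * (L' * ?d x y) + \<bar>C'\<bar> * (L * ?d x y)"
        using f(3)[OF that] g(3)[OF that] f(4)[OF that(1)] g(4)[OF that(2)]
        by (intro add_mono mult_mono) (auto simp: d0 f(2) g(2))
      finally show ?thesis by (simp add: algebra_simps)
    qed
    moreover have "\<bar>f x * g x\<bar> \<le> \<bar>C\<bar> * \<bar>C'\<bar>" if "x \<in> B" for x
      unfolding abs_mult using f(4)[OF that] g(4)[OF that] by (intro mult_mono) auto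
    ultimately show "(\<lambda>x. f x * g x) \<in> ?R"
      using f(1,2) g(1,2)
      by (intro RI[where L="\<bar>C\<bar> * L' + \<bar>C'\<bar> * L" and C="\<bar>C\<bar> * \<bar>C'\<bar>"] continuous_on_mult) auto
  next
    fix c show "(\<lambda>_. c) \<in> ?R" by (auto intro!: exI[of _ 0] exI[of _ "\<bar>c\<bar>"])
  next
    fix x y assume xy: "x \<in> B" "y \<in> B" "x \<noteq> y"
    then obtain j where j: "x j \<noteq> y j" by auto
    have jJ: "j \<in> J" using j xy lh unfolding B_def by (metis (mono_tags, lifting) mem_Collect_eq order_antisym)
    have "\<bar>z j - w j\<bar> \<le> ?d z w" for z w :: "nat \<Rightarrow> real"
      using J jJ by (intro member_le_sum) auto
    moreover have "\<bar>z j\<bar> \<le> \<bar>l j\<bar> + \<bar>h j\<bar>" if "z \<in> B" for z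
    proof -
      have "l j \<le> z j \<and> z j \<le> h j" using that unfolding B_def by blast
      then show ?thesis by linarith
    qed
    ultimately have "(\<lambda>x. x j) \<in> ?R"
      by (intro RI[where L=1 and C="\<bar>l j\<bar> + \<bar>h j\<bar>"]) (auto intro: continuous_on_subset[OF continuous_on_product_coordinates])
    then show "\<exists>f\<in>?R. f x \<noteq> f y" using j by (intro bexI[of _ "\<lambda>x. x j"])
  qed auto
  obtain g where "g \<in> ?R" "\<forall>x\<in>B. \<bar>f x - g x\<bar> < e"
    using Stone_Weierstrass_basic[OF f e] by blast
  then show thesis using that by blast
qed

text \<open>Extend the map to \<open>\<real>\<^sup>n\<close> and approximate the extension by a Lipschitz
  map; a translation by a small vector \<open>v\<close> outside its image makes the
  approximation nowhere zero. A cut-off function passes from it to the extension itself where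
  the latter is large, in particular on \<open>A\<close>.\<close>

lemma extendable_box:
  fixes l h :: "nat \<Rightarrow> real"
  defines "B \<equiv> {x. \<forall>i. l i \<le> x i \<and> x i \<le> h i}"
  assumes J: "finite J" "card J < n" and lh: "\<And>i. i \<notin> J \<Longrightarrow> l i = h i"
  shows "extendable (top_of_set B) (punct n)"
  unfolding extendable_def
proof (intro allI impI, elim conjE)
  fix A u
  assume A: "closedin (top_of_set B) A" and u: "continuous_map (subtopology (top_of_set B) A) (punct n) u"
  have AB: "A \<subseteq> B" using A closedin_subset by fastforce
  have cB: "compact B" unfolding B_def by (rule compact_box)
  have cA: "compact A" using A cB closedin_compact by blast
  have "normal_space (top_of_set B)"
    by (intro compact_Hausdorff_or_regular_imp_normal_space)
       (auto simp: compact_space_subtopology cB compactin_subtopology Hausdorff_space_subtopology)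
  then obtain g where g: "continuous_map (top_of_set B) (Euclidean_space n) g" "\<And>a. a \<in> A \<Longrightarrow> g a = u a"
    by (rule extendableD[OF extendable_Euclidean A]) (use u in \<open>auto simp: continuous_map_punct_iff\<close>)
  define N where "N x = (\<Sum>i<n. \<bar>g x i\<bar>)" for x
  have gi: "continuous_on B (\<lambda>x. g x i)" for i
    using continuous_map_Euclidean_coord[OF g(1)] by simp
  have g0: "g x i = 0" if "x \<in> B" "i \<ge> n" for x i
    using g(1) that by (auto simp: continuous_map_Euclidean_iff)
  have Ncont: "continuous_on B N" unfolding N_def by (intro continuous_intros gi)
  have Npos: "N a > 0" if "a \<in> A" for a
  proof -
    have "u a \<noteq> zvec" "\<forall>i\<ge>n. u a i = 0"
      using u that AB by (auto simp: continuous_map_punct_iff continuous_map_Euclidean_iff)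
    then obtain i where "i < n" "u a i \<noteq> 0" by (metis not_le ext)
    then have "0 < \<bar>g a i\<bar>" "\<bar>g a i\<bar> \<le> N a"
      unfolding N_def using g(2)[OF that] by (auto intro!: member_le_sum)
    then show ?thesis by linarith
  qed
  obtain e where e: "e > 0" "\<And>a. a \<in> A \<Longrightarrow> 4 * e \<le> N a"
  proof (cases "A = {}")
    case True then show ?thesis using that[of 1] by auto
  next
    case False
    have "continuous_on A N" using Ncont AB continuous_on_subset by blast
    then obtain a where "a \<in> A" "\<And>b. b \<in> A \<Longrightarrow> N a \<le> N b"
      using continuous_attains_inf[OF cA False] by metis
    then show ?thesis using that[of "N a / 4"] Npos by auto
  qed
  define e' where "e' = e / real (n + 1)"
  have e': "e' > 0" "real n * e' \<le> e" using e by (auto simp: e'_def field_simps)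
  have "\<exists>pL. continuous_on B (fst pL) \<and> (\<forall>x\<in>B. \<bar>g x i - fst pL x\<bar> < e') \<and> snd pL \<ge> 0 \<and>
          (\<forall>x\<in>B. \<forall>y\<in>B. \<bar>fst pL x - fst pL y\<bar> \<le> snd pL * (\<Sum>j\<in>J. \<bar>x j - y j\<bar>))" for i
    unfolding split_paired_Ex fst_conv snd_conv
    by (rule lipschitz_approximation_on_box[of J l h "\<lambda>x. g x i" e', folded B_def, OF J(1) lh gi e'(1)])
       blast+
  then obtain pL where pL: "\<And>i. continuous_on B (fst (pL i)) \<and> (\<forall>x\<in>B. \<bar>g x i - fst (pL i) x\<bar> < e') \<and> snd (pL i) \<ge> 0 \<and>
          (\<forall>x\<in>B. \<forall>y\<in>B. \<bar>fst (pL i) x - fst (pL i) y\<bar> \<le> snd (pL i) * (\<Sum>j\<in>J. \<bar>x j - y j\<bar>))"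
    using choice[where Q="\<lambda>i pL. continuous_on B (fst pL) \<and> (\<forall>x\<in>B. \<bar>g x i - fst pL x\<bar> < e') \<and> snd pL \<ge> 0 \<and>
          (\<forall>x\<in>B. \<forall>y\<in>B. \<bar>fst pL x - fst pL y\<bar> \<le> snd pL * (\<Sum>j\<in>J. \<bar>x j - y j\<bar>))"] by blast
  define p where "p i = fst (pL i)" for i
  define L where "L i = snd (pL i)" for i
  have p: "\<And>i. continuous_on B (p i)" "\<And>i x. x \<in> B \<Longrightarrow> \<bar>g x i - p i x\<bar> < e'" "\<And>i. L i \<ge> (0::real)"
     "\<And>i x y. x \<in> B \<Longrightarrow> y \<in> B \<Longrightarrow> \<bar>p i x - p i y\<bar> \<le> L i * (\<Sum>j\<in>J. \<bar>x j - y j\<bar>)"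
    using pL unfolding p_def L_def by blast+
  define L' where "L' = (\<Sum>i<n. L i)"
  have L': "L' \<ge> 0" unfolding L'_def using p(3) by (simp add: sum_nonneg)
  have pL': "\<bar>p i x - p i y\<bar> \<le> L' * (\<Sum>j\<in>J. \<bar>x j - y j\<bar>)" if "i < n" "x \<in> B" "y \<in> B" for i x y
  proof -
    have "L i \<le> L'" unfolding L'_def using that p(3) by (intro member_le_sum) auto
    then show ?thesis using p(4)[OF that(2,3), of i]
      by (meson mult_right_mono order_trans sum_nonneg abs_ge_zero)
  qed
  obtain v where v: "\<And>i. 0 \<le> v i \<and> v i \<le> e'" "\<And>x. x \<in> B \<Longrightarrow> \<exists>i<n. p i x \<noteq> v i"
    by (rule lipschitz_image_misses_small_vector[OF J e'(1) L', of B l h p])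
       (use pL' in \<open>auto simp: B_def\<close>)
  \<comment> \<open>\<open>t = 1\<close> where the extension \<open>g\<close> has sum norm at least \<open>4 * e\<close>, which includes \<open>A\<close>\<close>
  define w where "w x = (\<lambda>i. if i < n then
     (let t = min 1 (max 0 ((N x - 2 * e) / (2 * e))) in (1 - t) * (p i x - v i) + t * g x i) else 0)" for x
  have wc: "continuous_map (top_of_set B) (Euclidean_space n) w"
    unfolding w_def continuous_map_componentwise_Euclidean_space Let_def
    using p(1) gi Ncont e by (auto intro!: continuous_intros)
  have wA: "w a = u a" if "a \<in> A" for a
  proof
    fix i
    have "min 1 (max 0 ((N a - 2 * e) / (2 * e))) = 1" using e(1) e(2)[OF that] by (simp add: field_simps)
    moreover have "\<forall>i\<ge>n. u a i = 0"
      using u that AB by (auto simp: continuous_map_punct_iff continuous_map_Euclidean_iff)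
    ultimately show "w a i = u a i" using g(2)[OF that] by (auto simp: w_def)
  qed
  have "w x \<noteq> zvec" if x: "x \<in> B" for x
  proof (cases "N x \<le> 2 * e")
    case True
    then have t: "min 1 (max 0 ((N x - 2 * e) / (2 * e))) = 0" using e(1) by (simp add: field_simps)
    obtain i where "i < n" "p i x \<noteq> v i" using v(2)[OF x] by blast
    then have "w x i \<noteq> 0" by (simp add: w_def t)
    then show ?thesis by auto
  next
    case False
    define t where "t = min 1 (max 0 ((N x - 2 * e) / (2 * e)))"
    have t: "0 \<le> t" "t \<le> 1" by (auto simp: t_def)
    show ?thesis
    proof
      assume wx: "w x = zvec"
      then have z: "(1 - t) * (p i x - v i) + t * g x i = 0" if "i < n" for i
      proof -
        have "w x i = 0" using wx by simp
        then show ?thesis using that by (simp add: w_def t_def Let_def)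
      qed
      have "\<bar>g x i\<bar> \<le> 2 * e'" if "i < n" for i
      proof -
        have "g x i = (1 - t) * (g x i - (p i x - v i))" using z[OF that] by (simp add: algebra_simps)
        then have "\<bar>g x i\<bar> = (1 - t) * \<bar>g x i - (p i x - v i)\<bar>" using t by (metis abs_mult abs_of_nonneg diff_ge_0_iff_ge)
        also have "\<dots> \<le> 1 * \<bar>g x i - (p i x - v i)\<bar>" using t by (intro mult_right_mono) auto
        also have "\<dots> \<le> 2 * e'" using p(2)[OF x, of i] v(1)[of i] unfolding mult_1 abs_le_iff abs_less_iff by arith
        finally show ?thesis .
      qed
      then have "N x \<le> (\<Sum>i<n. 2 * e')" unfolding N_def by (intro sum_mono) auto
      also have "\<dots> \<le> 2 * e" using e' by simp
      finally show False using False by simp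
    qed
  qed
  then show "\<exists>v. continuous_map (top_of_set B) (punct n) v \<and> (\<forall>a\<in>A. v a = u a)"
    using wc wA by (auto simp: continuous_map_punct_iff)
qed

section \<open>Cubes and spheres\<close>

lemma Euclidean_space_top_of_set: "Euclidean_space n = top_of_set (topspace (Euclidean_space n))"
  by (simp add: Euclidean_space_def euclidean_product_topology)

lemma subtopology_Euclidean_eq:
  "S \<subseteq> topspace (Euclidean_space n) \<Longrightarrow> subtopology (Euclidean_space n) S = top_of_set S"
  by (metis Euclidean_space_top_of_set subtopology_subtopology inf.absorb2)

definition cube :: "nat \<Rightarrow> (nat \<Rightarrow> real) \<Rightarrow> real \<Rightarrow> (nat \<Rightarrow> real) set" where
  "cube n c r = {x \<in> topspace (Euclidean_space n). \<forall>i<n. \<bar>x i - c i\<bar> \<le> r}"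

definition open_cube :: "nat \<Rightarrow> (nat \<Rightarrow> real) \<Rightarrow> real \<Rightarrow> (nat \<Rightarrow> real) set" where
  "open_cube n c r = {x \<in> topspace (Euclidean_space n). \<forall>i<n. \<bar>x i - c i\<bar> < r}"

lemma cube_subset: "cube n c r \<subseteq> topspace (Euclidean_space n)"
  and open_cube_subset: "open_cube n c r \<subseteq> topspace (Euclidean_space n)"
  and open_cube_subset_cube: "open_cube n c r \<subseteq> cube n c r"
  by (auto simp: cube_def open_cube_def intro: less_imp_le)

lemma cube_eq_box:
  "cube n c r = {x. \<forall>i. (if i < n then c i - r else 0) \<le> x i \<and> x i \<le> (if i < n then c i + r else 0)}"
  (is "_ = ?B")
proof
  show "cube n c r \<subseteq> ?B" by (auto simp: cube_def topspace_Euclidean_space abs_le_iff)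
  show "?B \<subseteq> cube n c r"
  proof
    fix x assume x: "x \<in> ?B"
    have "x i = 0" if "i \<ge> n" for i
    proof -
      have "(if i < n then c i - r else 0) \<le> x i \<and> x i \<le> (if i < n then c i + r else 0)" using x by blast
      then show ?thesis using that by auto
    qed
    moreover have "\<bar>x i - c i\<bar> \<le> r" if "i < n" for i
    proof -
      have "c i - r \<le> x i \<and> x i \<le> c i + r" using x that by (auto dest!: spec[of _ i])
      then show ?thesis by (simp add: abs_le_iff)
    qed
    ultimately show "x \<in> cube n c r" by (auto simp: cube_def topspace_Euclidean_space)
  qed
qed

lemma compact_cube: "compact (cube n c r)"
  unfolding cube_eq_box by (rule compact_box)

lemma compactin_Euclidean_iff:
  "compactin (Euclidean_space n) S \<longleftrightarrow> compact S \<and> S \<subseteq> topspace (Euclidean_space n)"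
  by (subst Euclidean_space_top_of_set) (auto simp: compactin_subtopology)

lemma compactin_cube: "compactin (Euclidean_space n) (cube n c r)"
  by (simp add: compactin_Euclidean_iff compact_cube cube_subset)

lemma closedin_cube: "closedin (Euclidean_space n) (cube n c r)"
  by (rule compactin_imp_closedin[OF Hausdorff_Euclidean_space compactin_cube])

lemma openin_open_cube: "openin (Euclidean_space n) (open_cube n c r)"
proof -
  have "open_cube n c r = (\<Inter>i\<in>{..<n}. {x \<in> topspace (Euclidean_space n). x i - c i \<in> {-r<..<r}}) \<inter> topspace (Euclidean_space n)"
  proof -
    have "y \<in> {-r<..<r} \<longleftrightarrow> \<bar>y\<bar> < r" for y :: real by auto
    then show ?thesis unfolding open_cube_def by auto
  qed
  moreover have "openin (Euclidean_space n) {x \<in> topspace (Euclidean_space n). x i - c i \<in> {-r<..<r}}" for i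
  proof (rule openin_continuous_map_preimage)
    have "continuous_map (Euclidean_space n) euclideanreal (\<lambda>x. x i)"
      by (rule continuous_map_Euclidean_coord[where u="\<lambda>x. x" and n=n]) simp
    then show "continuous_map (Euclidean_space n) euclideanreal (\<lambda>x. x i - c i)"
      by (intro continuous_map_diff) auto
  qed auto
  ultimately show ?thesis
    by (cases "n = 0") (auto intro!: openin_Int openin_INT)
qed

text \<open>The boundary of a cube is the union of its \<open>2 * n\<close> faces, which are boxes of
  dimension \<open>n - 1\<close>.\<close>

lemma extendable_cube_boundary:
  "extendable (subtopology (Euclidean_space n) (cube n c r - open_cube n c r)) (punct n)"
proof -
  let ?lo = "\<lambda>i b j. if j = i then (if b then c j + r else c j - r) else if j < n then c j - r else (0::real)"
  let ?hi = "\<lambda>i b j. if j = i then (if b then c j + r else c j - r) else if j < n then c j + r else (0::real)"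
  define B where "B = (\<lambda>(i, b). {x. \<forall>j. ?lo i b j \<le> x j \<and> x j \<le> ?hi i b j})"
  define F where "F p = B p \<inter> cube n c r" for p
  have eq: "cube n c r - open_cube n c r = (\<Union>p\<in>{..<n} \<times> UNIV. F p)"
  proof
    show "cube n c r - open_cube n c r \<subseteq> (\<Union>p\<in>{..<n} \<times> UNIV. F p)"
    proof
      fix x assume x: "x \<in> cube n c r - open_cube n c r"
      then obtain i where i: "i < n" "\<bar>x i - c i\<bar> = r"
        by (auto simp: cube_def open_cube_def not_less intro: antisym)
      have xb: "\<And>j. (if j < n then c j - r else 0) \<le> x j \<and> x j \<le> (if j < n then c j + r else 0)"
        using x unfolding cube_eq_box by blast
      have "x \<in> F (i, x i > c i)"
      proof -
        have "?lo i (x i > c i) j \<le> x j \<and> x j \<le> ?hi i (x i > c i) j" for j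
          using xb[of j] i by (auto simp: abs_if split: if_splits)
        then show ?thesis using x unfolding F_def B_def by blast
      qed
      then show "x \<in> (\<Union>p\<in>{..<n} \<times> UNIV. F p)" using i by blast
    qed
    show "(\<Union>p\<in>{..<n} \<times> UNIV. F p) \<subseteq> cube n c r - open_cube n c r"
    proof
      fix x assume "x \<in> (\<Union>p\<in>{..<n} \<times> UNIV. F p)"
      then obtain i b where ib: "i < n" "x \<in> F (i, b)" by auto
      have xi: "?lo i b i \<le> x i \<and> x i \<le> ?hi i b i" using ib(2) unfolding F_def B_def by blast
      have xc: "x \<in> cube n c r" using ib(2) by (simp add: F_def)
      have "\<not> \<bar>x i - c i\<bar> < r" using xi by (auto split: if_splits)
      then show "x \<in> cube n c r - open_cube n c r" using xc ib(1) by (auto simp: open_cube_def)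
    qed
  qed
  show ?thesis unfolding eq
  proof (rule extendable_Union)
    fix p assume p: "p \<in> {..<n} \<times> (UNIV::bool set)"
    obtain i b where ib: "p = (i, b)" "i < n" using p by auto
    have cl: "closed (B p)" unfolding B_def ib prod.case
      by (rule compact_imp_closed[OF compact_box[of "?lo i b" "?hi i b"]])
    have top: "F p \<subseteq> topspace (Euclidean_space n)"
      using cube_subset by (auto simp: F_def)
    show clF: "closedin (Euclidean_space n) (F p)"
      unfolding closedin_Euclidean_space_iff
      using closed_Int[OF cl compact_imp_closed[OF compact_cube[of n c r]]] top unfolding F_def by blast
    define lo where "lo = ?lo i b"
    define hi where "hi = ?hi i b"
    have Bp: "B p = {x. \<forall>j. lo j \<le> x j \<and> x j \<le> hi j}"
      unfolding B_def ib(1) prod.case lo_def hi_def by (rule refl)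
    have card: "card ({..<n} - {i}) < n" using ib(2) by simp
    have lohi: "lo j = hi j" if "j \<notin> {..<n} - {i}" for j
      using that by (auto simp: lo_def hi_def)
    have "extendable (top_of_set (B p)) (punct n)"
      unfolding Bp using card lohi by (intro extendable_box) auto
    moreover have "closedin (top_of_set (B p)) (F p)"
      unfolding F_def by (rule closedin_closed_Int[OF compact_imp_closed[OF compact_cube]])
    ultimately have "extendable (subtopology (top_of_set (B p)) (F p)) (punct n)"
      by (rule extendable_closed_subset)
    moreover have "subtopology (top_of_set (B p)) (F p) = subtopology (Euclidean_space n) (F p)"
    proof -
      have "B p \<inter> F p = F p" by (auto simp: F_def)
      then show ?thesis using top by (simp only: subtopology_subtopology subtopology_Euclidean_eq)
    qed
    ultimately show "extendable (subtopology (Euclidean_space n) (F p)) (punct n)" by simp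
  qed auto
qed

text \<open>Two norms are used: the maximum norm has spheres made of boxes, the Euclidean norm is invariant
  under the linear action. Both are treated as positively homogeneous functions with compact
  unit sphere.\<close>

definition hom_gauge :: "nat \<Rightarrow> ((nat \<Rightarrow> real) \<Rightarrow> real) \<Rightarrow> bool" where
  "hom_gauge n N \<longleftrightarrow> continuous_map (Euclidean_space n) euclideanreal N \<and>
     (\<forall>x\<in>topspace (Euclidean_space n). N x \<ge> 0 \<and> (N x = 0 \<longleftrightarrow> x = zvec)) \<and>
     (\<forall>x a. a \<ge> 0 \<longrightarrow> N (\<lambda>i. a * x i) = a * N x) \<and>
     compactin (Euclidean_space n) {x \<in> topspace (Euclidean_space n). N x = 1}"

abbreviation gauge_sphere :: "nat \<Rightarrow> ((nat \<Rightarrow> real) \<Rightarrow> real) \<Rightarrow> (nat \<Rightarrow> real) set" where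
  "gauge_sphere n N \<equiv> {x \<in> topspace (Euclidean_space n). N x = 1}"

text \<open>The degree of a map \<open>f\<close> defined on a sphere is taken to be the degree at
  \<open>0\<close> of this homogeneous extension.\<close>

definition radial :: "((nat \<Rightarrow> real) \<Rightarrow> real) \<Rightarrow> ((nat \<Rightarrow> real) \<Rightarrow> (nat \<Rightarrow> real)) \<Rightarrow> (nat \<Rightarrow> real) \<Rightarrow> (nat \<Rightarrow> real)" where
  "radial N f x = (if x = zvec then zvec else (\<lambda>i. N x * f (\<lambda>j. x j / N x) i))"

lemma Euclidean_scale: "x \<in> topspace (Euclidean_space n) \<Longrightarrow> (\<lambda>i. a * x i) \<in> topspace (Euclidean_space n)"
  by (auto simp: topspace_Euclidean_space)

lemma gauge_scale: "hom_gauge n N \<Longrightarrow> a \<ge> 0 \<Longrightarrow> N (\<lambda>i. a * x i) = a * N x"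
  by (simp add: hom_gauge_def)

lemma gauge_divide: "hom_gauge n N \<Longrightarrow> a > 0 \<Longrightarrow> N (\<lambda>i. x i / a) = N x / a"
  using gauge_scale[of n N "1 / a" x] by simp

lemma gauge_normalize:
  assumes "hom_gauge n N" "x \<in> topspace (Euclidean_space n)" "x \<noteq> zvec"
  shows "(\<lambda>j. x j / N x) \<in> gauge_sphere n N" "N x > 0"
proof -
  have N: "N x > 0" using assms by (auto simp: hom_gauge_def less_le)
  show "(\<lambda>j. x j / N x) \<in> gauge_sphere n N"
    using N assms(2) gauge_divide[OF assms(1) N, of x] by (auto simp: topspace_Euclidean_space)
  show "N x > 0" by fact
qed

lemma radial_on_sphere: "hom_gauge n N \<Longrightarrow> x \<in> gauge_sphere n N \<Longrightarrow> radial N f x = f x"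
  by (auto simp: radial_def hom_gauge_def)

lemma radial_in_topspace:
  assumes "hom_gauge n N" "continuous_map (subtopology (Euclidean_space n) (gauge_sphere n N)) (Euclidean_space n) f"
    "x \<in> topspace (Euclidean_space n)"
  shows "radial N f x \<in> topspace (Euclidean_space n)"
proof (cases "x = zvec")
  case False
  have "f (\<lambda>j. x j / N x) \<in> topspace (Euclidean_space n)"
    using gauge_normalize[OF assms(1,3) False] assms(2) by (auto simp: continuous_map_def)
  then show ?thesis using False by (auto simp: radial_def topspace_Euclidean_space)
qed (auto simp: radial_def topspace_Euclidean_space)

lemma radial_nonzero:
  assumes "hom_gauge n N" "continuous_map (subtopology (Euclidean_space n) (gauge_sphere n N)) (punct n) f"
    "x \<in> topspace (Euclidean_space n)" "x \<noteq> zvec"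
  shows "radial N f x \<noteq> zvec"
proof -
  have "f (\<lambda>j. x j / N x) \<noteq> zvec"
    using gauge_normalize[OF assms(1,3,4)] assms(2) by (auto simp: continuous_map_punct_iff)
  then show ?thesis using gauge_normalize(2)[OF assms(1,3,4)] assms(4)
    by (auto simp: radial_def fun_eq_iff)
qed

lemma continuous_map_radial:
  assumes N: "hom_gauge n N"
    and f: "continuous_map (subtopology (Euclidean_space n) (gauge_sphere n N)) (Euclidean_space n) f"
  shows "continuous_map (Euclidean_space n) (Euclidean_space n) (radial N f)"
  unfolding continuous_map_Euclidean_iff
proof (intro conjI allI impI ballI)
  fix x i assume "x \<in> topspace (Euclidean_space n)" "n \<le> i"
  then show "radial N f x i = 0" using radial_in_topspace[OF N f] by (auto simp: topspace_Euclidean_space)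
next
  fix i assume "i < n"
  let ?T = "topspace (Euclidean_space n)" and ?S = "gauge_sphere n N"
  have Nc: "continuous_on ?T N"
    using N unfolding hom_gauge_def by (subst (asm) (1) continuous_map_Euclidean_space_iff) blast
  have cS: "compact ?S" using N by (simp add: hom_gauge_def compactin_Euclidean_iff)
  have fi: "continuous_on ?S (\<lambda>x. f x i)"
  proof -
    have "continuous_map (top_of_set ?S) euclideanreal (\<lambda>x. f x i)"
      using continuous_map_Euclidean_coord[OF f] by (simp add: subtopology_Euclidean_eq)
    then show ?thesis by simp
  qed
  obtain B where B: "\<And>x. x \<in> ?S \<Longrightarrow> \<bar>f x i\<bar> \<le> B"
    using compact_imp_bounded[OF compact_continuous_image[OF fi cS]] by (auto simp: bounded_iff)
  have N0: "N zvec = 0" using N by (auto simp: hom_gauge_def topspace_Euclidean_space)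
  have nzN: "x \<in> ?T \<Longrightarrow> x \<noteq> zvec \<Longrightarrow> N x \<noteq> 0" for x using N by (auto simp: hom_gauge_def)
  have c1: "continuous_on (?T - {zvec}) (\<lambda>x. N x * f (\<lambda>j. x j / N x) i)"
  proof (intro continuous_on_mult)
    show cN: "continuous_on (?T - {zvec}) N" using Nc continuous_on_subset by blast
    have "continuous_on (?T - {zvec}) (\<lambda>x j. x j / N x)"
      by (intro continuous_on_coordinatewise_then_product continuous_on_divide cN)
         (use nzN in \<open>auto intro: continuous_on_subset[OF continuous_on_product_coordinates]\<close>)
    moreover have "(\<lambda>x j. x j / N x) ` (?T - {zvec}) \<subseteq> ?S"
      using gauge_normalize[OF N] by blast
    ultimately show "continuous_on (?T - {zvec}) (\<lambda>x. f (\<lambda>j. x j / N x) i)"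
      using continuous_on_compose2[OF fi] by blast
  qed
  have "continuous_on ?T (\<lambda>x. radial N f x i)"
    unfolding continuous_on_eq_continuous_within
  proof
    fix x assume x: "x \<in> ?T"
    show "continuous (at x within ?T) (\<lambda>x. radial N f x i)"
    proof (cases "x = zvec")
      case False
      have "continuous_on (?T - {zvec}) (\<lambda>x. radial N f x i)"
        by (rule continuous_on_eq[OF c1]) (auto simp: radial_def)
      then have "continuous (at x within (?T - {zvec})) (\<lambda>x. radial N f x i)"
        using x False by (simp add: continuous_on_eq_continuous_within)
      moreover have "at x within (?T - {zvec}) = at x within ?T"
        by (rule at_within_nhd[of _ "- {zvec}"]) (use False in auto)
      ultimately show ?thesis by simp
    next
      case True
      have lim: "(N \<longlongrightarrow> 0) (at x within ?T)"
        using Nc x True N0 by (metis continuous_on_def)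
      have bound: "\<bar>radial N f y i\<bar> \<le> \<bar>B\<bar> * N y" if "y \<in> ?T" for y
      proof (cases "y = zvec")
        case False
        have "\<bar>f (\<lambda>j. y j / N y) i\<bar> \<le> \<bar>B\<bar>" using B[OF gauge_normalize(1)[OF N that False]] by simp
        then show ?thesis using gauge_normalize(2)[OF N that False] False
          by (simp add: radial_def abs_mult mult.commute mult_left_mono)
      qed (simp add: radial_def N0)
      have "((\<lambda>y. radial N f y i) \<longlongrightarrow> 0) (at x within ?T)"
      proof (rule Lim_null_comparison)
        show "\<forall>\<^sub>F y in at x within ?T. norm (radial N f y i) \<le> \<bar>B\<bar> * N y"
          using bound by (auto simp: eventually_at_filter)
        show "((\<lambda>y. \<bar>B\<bar> * N y) \<longlongrightarrow> 0) (at x within ?T)"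
          using tendsto_mult_right_zero[OF lim] by simp
      qed
      then show ?thesis using True by (simp add: continuous_within radial_def)
    qed
  qed
  then show "continuous_map (Euclidean_space n) euclideanreal (\<lambda>x. radial N f x i)"
    by (simp add: continuous_map_Euclidean_space_iff)
qed

lemma continuous_map_coord: "continuous_map (Euclidean_space n) euclideanreal (\<lambda>x. x i)"
  by (rule continuous_map_Euclidean_coord[where u="\<lambda>x. x" and n=n]) simp

lemma compactin_closed_in_cube:
  assumes "closedin (Euclidean_space n) S" "S \<subseteq> cube n c r"
  shows "compactin (Euclidean_space n) S"
  using assms closed_compactin compactin_cube by blast

definition sup_gauge :: "nat \<Rightarrow> (nat \<Rightarrow> real) \<Rightarrow> real" where
  "sup_gauge n x = Max (insert 0 ((\<lambda>i. \<bar>x i\<bar>) ` {..<n}))"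

lemma sup_gauge_le_iff: "sup_gauge n x \<le> r \<longleftrightarrow> 0 \<le> r \<and> (\<forall>i<n. \<bar>x i\<bar> \<le> r)"
  by (auto simp: sup_gauge_def)

lemma sup_gauge_less_iff: "sup_gauge n x < r \<longleftrightarrow> 0 < r \<and> (\<forall>i<n. \<bar>x i\<bar> < r)"
  by (auto simp: sup_gauge_def)

lemma mem_cube_zero: "r \<ge> 0 \<Longrightarrow> x \<in> cube n zvec r \<longleftrightarrow> x \<in> topspace (Euclidean_space n) \<and> sup_gauge n x \<le> r"
  and mem_open_cube_zero: "r > 0 \<Longrightarrow> x \<in> open_cube n zvec r \<longleftrightarrow> x \<in> topspace (Euclidean_space n) \<and> sup_gauge n x < r"
  by (simp_all add: sup_gauge_le_iff sup_gauge_less_iff cube_def open_cube_def)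

lemma hom_gauge_sup: "hom_gauge n (sup_gauge n)"
  unfolding hom_gauge_def
proof (intro conjI ballI allI impI)
  have "continuous_map (Euclidean_space n) euclideanreal (\<lambda>x. Max (insert 0 ((\<lambda>i. \<bar>x i\<bar>) ` {..<m})))" for m
  proof (induction m)
    case (Suc m)
    have "Max (insert 0 ((\<lambda>i. \<bar>x i\<bar>) ` {..<Suc m})) = max \<bar>x m\<bar> (Max (insert 0 ((\<lambda>i. \<bar>x i\<bar>) ` {..<m})))" for x :: "nat \<Rightarrow> real"
      by (subst Max_insert[symmetric]) (auto simp: lessThan_Suc insert_commute)
    then show ?case using Suc by (auto intro!: continuous_map_real_max continuous_map_real_abs continuous_map_coord)
  qed simp
  then show "continuous_map (Euclidean_space n) euclideanreal (sup_gauge n)"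
    by (simp add: sup_gauge_def[abs_def])
  then have "closedin (Euclidean_space n) {x \<in> topspace (Euclidean_space n). sup_gauge n x \<in> {1}}"
    by (rule closedin_continuous_map_preimage) auto
  then have "closedin (Euclidean_space n) (gauge_sphere n (sup_gauge n))" by simp
  moreover have "gauge_sphere n (sup_gauge n) \<subseteq> cube n zvec 1"
    by (auto simp: mem_cube_zero)
  ultimately show "compactin (Euclidean_space n) (gauge_sphere n (sup_gauge n))"
    by (rule compactin_closed_in_cube)
next
  fix x assume x: "x \<in> topspace (Euclidean_space n)"
  show "0 \<le> sup_gauge n x" by (simp add: sup_gauge_def)
  have "sup_gauge n x \<le> 0 \<longleftrightarrow> x = zvec"
    unfolding sup_gauge_le_iff using x Euclidean_neq_zvec_iff[OF x] by auto
  then show "sup_gauge n x = 0 \<longleftrightarrow> x = zvec" using \<open>0 \<le> sup_gauge n x\<close> by linarith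
next
  fix x :: "nat \<Rightarrow> real" and a :: real assume a: "a \<ge> 0"
  show "sup_gauge n (\<lambda>i. a * x i) = a * sup_gauge n x"
  proof -
    have "mono (\<lambda>t. a * t)" using a by (simp add: mono_def mult_left_mono)
    then have "a * Max (insert 0 ((\<lambda>i. \<bar>x i\<bar>) ` {..<n})) = Max ((\<lambda>t. a * t) ` (insert 0 ((\<lambda>i. \<bar>x i\<bar>) ` {..<n})))"
      by (intro mono_Max_commute) auto
    also have "(\<lambda>t. a * t) ` (insert 0 ((\<lambda>i. \<bar>x i\<bar>) ` {..<n})) = insert 0 ((\<lambda>i. \<bar>a * x i\<bar>) ` {..<n})"
      using a by (auto simp: abs_mult image_image)
    finally show ?thesis by (simp add: sup_gauge_def)
  qed
qed

definition l2 :: "nat \<Rightarrow> (nat \<Rightarrow> real) \<Rightarrow> real" where "l2 n x = sqrt (\<Sum>i<n. (x i)\<^sup>2)"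

lemma hom_gauge_l2: "hom_gauge n (l2 n)"
  unfolding hom_gauge_def
proof (intro conjI ballI allI impI)
  show c: "continuous_map (Euclidean_space n) euclideanreal (l2 n)"
    unfolding l2_def[abs_def]
    by (intro continuous_map_sqrt continuous_map_sum continuous_map_real_pow continuous_map_coord) auto
  have "closedin (Euclidean_space n) {x \<in> topspace (Euclidean_space n). l2 n x \<in> {1}}"
    using c by (rule closedin_continuous_map_preimage) auto
  then have "closedin (Euclidean_space n) (gauge_sphere n (l2 n))" by simp
  moreover have "gauge_sphere n (l2 n) \<subseteq> cube n zvec 1"
  proof -
    have "\<bar>x i\<bar> \<le> 1" if "l2 n x = 1" "i < n" for x i
    proof -
      have "(x i)\<^sup>2 \<le> (\<Sum>i<n. (x i)\<^sup>2)" using that(2) by (intro member_le_sum) auto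
      then have "(x i)\<^sup>2 \<le> 1" using that(1) by (simp add: l2_def)
      then show ?thesis by (simp add: abs_square_le_1)
    qed
    then show ?thesis by (auto simp: cube_def)
  qed
  ultimately show "compactin (Euclidean_space n) (gauge_sphere n (l2 n))"
    by (rule compactin_closed_in_cube)
next
  fix x assume x: "x \<in> topspace (Euclidean_space n)"
  show "0 \<le> l2 n x" by (simp add: l2_def sum_nonneg)
  show "l2 n x = 0 \<longleftrightarrow> x = zvec"
    using Euclidean_neq_zvec_iff[OF x] by (auto simp: l2_def sum_nonneg_eq_0_iff)
next
  fix x :: "nat \<Rightarrow> real" and a :: real assume a: "a \<ge> 0"
  show "l2 n (\<lambda>i. a * x i) = a * l2 n x"
    using a by (simp add: l2_def power_mult_distrib real_sqrt_mult flip: sum_distrib_left)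
qed

text \<open>Radial projection identifies the Euclidean sphere with the boundary of a cube.\<close>

lemma extendable_sphere:
  assumes "n > 0"
  shows "extendable (subtopology (Euclidean_space n) (gauge_sphere n (l2 n))) (punct n)"
proof (rule extendable_homeomorphic_space)
  let ?Q = "gauge_sphere n (sup_gauge n)" and ?S = "gauge_sphere n (l2 n)"
  have "?Q = cube n zvec 1 - open_cube n zvec 1"
    by (auto simp: mem_cube_zero mem_open_cube_zero)
  then show "extendable (subtopology (Euclidean_space n) ?Q) (punct n)"
    using extendable_cube_boundary by simp
  have *: "continuous_map (subtopology (Euclidean_space n) (gauge_sphere n N)) (subtopology (Euclidean_space n) (gauge_sphere n N')) (\<lambda>x i. x i / N' x)"
    if N: "hom_gauge n N" and N': "hom_gauge n N'" for N N'
  proof -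
    have nz: "x \<noteq> zvec" if "x \<in> gauge_sphere n N" for x using that N by (auto simp: hom_gauge_def)
    have "continuous_map (subtopology (Euclidean_space n) (gauge_sphere n N)) (Euclidean_space n) (\<lambda>x i. (1 / N' x) * x i)"
    proof (rule continuous_map_Euclidean_scale)
      show "continuous_map (subtopology (Euclidean_space n) (gauge_sphere n N)) euclideanreal (\<lambda>x. 1 / N' x)"
        using N' nz by (intro continuous_map_real_divide continuous_map_from_subtopology)
          (auto simp: hom_gauge_def)
    qed (auto intro: continuous_map_from_subtopology)
    moreover have "(\<lambda>i. x i / N' x) \<in> gauge_sphere n N'" if "x \<in> gauge_sphere n N" for x
      by (rule gauge_normalize(1)[OF N' _ nz[OF that]]) (use that in auto)
    ultimately show ?thesis by (auto simp: continuous_map_in_subtopology)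
  qed
  have inv: "(\<lambda>i. (x i / N' x) / N (\<lambda>i. x i / N' x)) = x"
    if N: "hom_gauge n N" and N': "hom_gauge n N'" and x: "x \<in> gauge_sphere n N" for N N' x
  proof -
    have nz: "x \<noteq> zvec" using x N by (auto simp: hom_gauge_def)
    have p: "N' x > 0" using gauge_normalize(2)[OF N' _ nz] x by auto
    have "N (\<lambda>i. x i / N' x) = 1 / N' x" using x gauge_divide[OF N p] by simp
    then show ?thesis using p by simp
  qed
  show "subtopology (Euclidean_space n) ?Q homeomorphic_space subtopology (Euclidean_space n) ?S"
    unfolding homeomorphic_space_def homeomorphic_maps_def
    apply (rule exI[of _ "\<lambda>x i. x i / l2 n x"], rule exI[of _ "\<lambda>x i. x i / sup_gauge n x"])
    using *[OF hom_gauge_sup hom_gauge_l2] *[OF hom_gauge_l2 hom_gauge_sup]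
      inv[OF hom_gauge_sup hom_gauge_l2] inv[OF hom_gauge_l2 hom_gauge_sup]
    by auto
qed

section \<open>Extensions with finitely many zeros\<close>

lemma continuous_map_affine:
  assumes "c \<in> topspace (Euclidean_space n)"
  shows "continuous_map (Euclidean_space n) (Euclidean_space n) (\<lambda>x i. c i + a * x i)"
  unfolding continuous_map_Euclidean_iff using assms
  by (auto simp: topspace_Euclidean_space intro!: continuous_map_add continuous_map_real_mult continuous_map_coord)

text \<open>The cone construction: the map on the boundary is scaled down linearly to \<open>0\<close> at
  the centre.\<close>

lemma cube_cone_fill:
  assumes c: "c \<in> topspace (Euclidean_space n)" and r: "r > 0"
    and w: "continuous_map (subtopology (Euclidean_space n) (cube n c r - open_cube n c r)) (punct n) w"
  obtains v where "continuous_map (subtopology (Euclidean_space n) (cube n c r)) (Euclidean_space n) v"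
    "\<And>x. x \<in> cube n c r - open_cube n c r \<Longrightarrow> v x = w x"
    "\<And>x. x \<in> cube n c r \<Longrightarrow> v x = zvec \<Longrightarrow> x = c"
proof -
  let ?N = "sup_gauge n" and ?E = "Euclidean_space n"
  define a where "a x = (\<lambda>i. c i + r * x i)" for x :: "nat \<Rightarrow> real"
  define b where "b x = (\<lambda>i. - c i / r + (1 / r) * x i)" for x :: "nat \<Rightarrow> real"
  have ac: "continuous_map ?E ?E a" unfolding a_def by (rule continuous_map_affine[OF c])
  have bc: "continuous_map ?E ?E b" unfolding b_def
    by (rule continuous_map_affine) (use c in \<open>auto simp: topspace_Euclidean_space\<close>)
  have ab: "a (b x) = x" for x using r by (auto simp: a_def b_def field_simps)
  have bnd: "x \<in> cube n c r - open_cube n c r \<longleftrightarrow> x \<in> topspace ?E \<and> ?N (b x) = 1" for x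
  proof -
    have 1: "\<bar>b x i\<bar> \<le> 1 \<longleftrightarrow> \<bar>x i - c i\<bar> \<le> r" "\<bar>b x i\<bar> < 1 \<longleftrightarrow> \<bar>x i - c i\<bar> < r" for i
    proof -
      have "b x i = (x i - c i) / r" by (simp add: b_def diff_divide_distrib)
      then have "\<bar>b x i\<bar> = \<bar>x i - c i\<bar> / r" using r by simp
      then show "\<bar>b x i\<bar> \<le> 1 \<longleftrightarrow> \<bar>x i - c i\<bar> \<le> r" "\<bar>b x i\<bar> < 1 \<longleftrightarrow> \<bar>x i - c i\<bar> < r"
        using r by (simp_all add: divide_le_eq divide_less_eq)
    qed
    have "?N (b x) = 1 \<longleftrightarrow> ?N (b x) \<le> 1 \<and> \<not> ?N (b x) < 1" by auto
    then show ?thesis unfolding sup_gauge_le_iff sup_gauge_less_iff 1 by (auto simp: cube_def open_cube_def)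
  qed
  have inv: "b (a y) = y" for y using r by (auto simp: a_def b_def field_simps)
  have asph: "a y \<in> cube n c r - open_cube n c r" if "y \<in> gauge_sphere n ?N" for y
    unfolding bnd inv using that ac by (auto simp: continuous_map_def)
  have phi: "continuous_map (subtopology ?E (gauge_sphere n ?N)) (punct n) (w \<circ> a)"
    by (rule continuous_map_compose[OF _ w])
       (use asph ac in \<open>auto simp: continuous_map_in_subtopology intro: continuous_map_from_subtopology\<close>)
  have phiE: "continuous_map (subtopology ?E (gauge_sphere n ?N)) ?E (w \<circ> a)"
    using phi by (simp add: continuous_map_punct_iff)
  let ?v = "radial ?N (w \<circ> a) \<circ> b"
  show thesis
  proof (rule that[of ?v])
    show "continuous_map (subtopology ?E (cube n c r)) ?E ?v"
      by (rule continuous_map_from_subtopology)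
         (rule continuous_map_compose[OF bc continuous_map_radial[OF hom_gauge_sup phiE]])
  next
    fix x assume x: "x \<in> cube n c r - open_cube n c r"
    then have "b x \<in> gauge_sphere n ?N" using bnd[of x] bc by (auto simp: continuous_map_def)
    then show "?v x = w x" using radial_on_sphere[OF hom_gauge_sup] ab by simp
  next
    fix x assume x: "x \<in> cube n c r" and z: "?v x = zvec"
    have "x \<in> topspace ?E" using x cube_subset by blast
    then have bx: "b x \<in> topspace ?E" using bc by (auto simp: continuous_map_def)
    have "b x = zvec" using radial_nonzero[OF hom_gauge_sup phi bx] z by auto
    then show "x = c" using ab[of x] by (simp add: a_def)
  qed
qed

lemma grid_coordinate:
  fixes t r :: real and M :: nat
  assumes "M > 0" "r > 0" "\<bar>t\<bar> \<le> r"
  obtains k where "k < M" "\<bar>t - ((2 * real k + 1) * r / M - r)\<bar> \<le> r / M"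
proof -
  define z where "z = (t + r) * M / (2 * r)"
  have t: "t = 2 * r * z / M - r" using assms by (simp add: z_def field_simps)
  have tr: "0 \<le> t + r" "t + r \<le> 2 * r" using assms(3) by auto
  have z: "0 \<le> z" "z \<le> M"
    using mult_nonneg_nonneg[OF tr(1), of "real M"] mult_right_mono[OF tr(2), of "real M"] assms(1,2) by (auto simp: z_def field_simps)
  obtain k where k: "k < M" "real k \<le> z" "z \<le> real k + 1"
  proof (cases "z = M")
    case True
    then show ?thesis using that[of "M - 1"] assms(1) by (auto simp: of_nat_diff)
  next
    case False
    then have "nat \<lfloor>z\<rfloor> < M" using z by linarith
    then show ?thesis using that[of "nat \<lfloor>z\<rfloor>"] z by linarith
  qed
  have "t - ((2 * real k + 1) * r / M - r) = (r / M) * (2 * z - 2 * k - 1)"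
    using assms by (simp add: t field_simps)
  moreover have "\<bar>(r / M) * (2 * z - 2 * k - 1)\<bar> \<le> r / M"
  proof -
    have "\<bar>2 * z - 2 * k - 1\<bar> \<le> 1" using k by (simp add: abs_le_iff)
    then have "(r / M) * \<bar>2 * z - 2 * k - 1\<bar> \<le> (r / M) * 1" using assms by (intro mult_left_mono) auto
    then show ?thesis using assms by (simp add: abs_mult)
  qed
  ultimately show thesis using that[OF k(1)] by simp
qed

text \<open>The substitute for transversality: in dimension \<open>n\<close> a nowhere zero map cannot be
  extended without zeros in general, but the zeros of the extension can be made finite in
  number.\<close>

definition finite_zero_extendable :: "nat \<Rightarrow> 'a topology \<Rightarrow> bool" where
  "finite_zero_extendable n Y \<longleftrightarrow>
     (\<forall>A u. closedin Y A \<and> continuous_map (subtopology Y A) (punct n) u \<longrightarrow>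
        (\<exists>v. continuous_map Y (Euclidean_space n) v \<and> (\<forall>a\<in>A. v a = u a) \<and>
             finite {y \<in> topspace Y. v y = zvec}))"

lemma finite_zero_extendableD:
  assumes "finite_zero_extendable n Y" "closedin Y A" "continuous_map (subtopology Y A) (punct n) u"
  obtains v where "continuous_map Y (Euclidean_space n) v" "\<And>a. a \<in> A \<Longrightarrow> v a = u a"
    "finite {y \<in> topspace Y. v y = zvec}"
  using assms(1)[unfolded finite_zero_extendable_def, rule_format, OF conjI[OF assms(2,3)]] that by blast

lemma finite_zero_extendable_homeomorphic_space:
  assumes "finite_zero_extendable n Y" "Y homeomorphic_space Z"
  shows "finite_zero_extendable n Z"
  unfolding finite_zero_extendable_def
proof (intro allI impI, elim conjE)
  fix A u
  assume A: "closedin Z A" and u: "continuous_map (subtopology Z A) (punct n) u"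
  obtain f g where fg: "homeomorphic_maps Y Z f g"
    using assms(2) by (auto simp: homeomorphic_space_def)
  then have f: "continuous_map Y Z f" and g: "continuous_map Z Y g"
    and fg': "\<And>z. z \<in> topspace Z \<Longrightarrow> f (g z) = z"
    by (auto simp: homeomorphic_maps_def)
  define B where "B = {y \<in> topspace Y. f y \<in> A}"
  have clB: "closedin Y B" unfolding B_def using f A by (rule closedin_continuous_map_preimage)
  have uf: "continuous_map (subtopology Y B) (punct n) (u \<circ> f)"
    by (rule continuous_map_compose[OF _ u])
       (use f in \<open>auto simp: B_def continuous_map_in_subtopology continuous_map_from_subtopology\<close>)
  obtain v where v: "continuous_map Y (Euclidean_space n) v" "\<And>a. a \<in> B \<Longrightarrow> v a = (u \<circ> f) a"
      "finite {y \<in> topspace Y. v y = zvec}"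
    using finite_zero_extendableD[OF assms(1) clB uf] by blast
  have gZ: "g z \<in> topspace Y" if "z \<in> topspace Z" for z using g that by (auto simp: continuous_map_def)
  have "(v \<circ> g) a = u a" if "a \<in> A" for a
  proof -
    have "a \<in> topspace Z" using A closedin_subset that by blast
    then show ?thesis using v gZ fg' that by (auto simp: B_def)
  qed
  moreover have "finite {z \<in> topspace Z. (v \<circ> g) z = zvec}"
  proof (rule finite_subset)
    show "{z \<in> topspace Z. (v \<circ> g) z = zvec} \<subseteq> f ` {y \<in> topspace Y. v y = zvec}"
      using gZ fg' by (force intro!: image_eqI[where x="g _"])
  qed (use v(3) in simp)
  ultimately show "\<exists>v. continuous_map Z (Euclidean_space n) v \<and> (\<forall>a\<in>A. v a = u a) \<and> finite {y \<in> topspace Z. v y = zvec}"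
    using continuous_map_compose[OF g v(1)] by blast
qed

lemma compact_disjoint_l1_separated:
  fixes A Z :: "(nat \<Rightarrow> real) set"
  assumes "compact A" "compact Z" "A \<inter> Z = {}" "A \<subseteq> topspace (Euclidean_space n)" "Z \<subseteq> topspace (Euclidean_space n)"
  obtains m where "m > 0" "\<And>a z. a \<in> A \<Longrightarrow> z \<in> Z \<Longrightarrow> m \<le> (\<Sum>i<n. \<bar>a i - z i\<bar>)"
proof (cases "A \<times> Z = {}")
  case True
  then show ?thesis using that[of 1] by auto
next
  case False
  define d where "d p = (\<Sum>i<n. \<bar>fst p i - snd p i\<bar>)" for p :: "(nat \<Rightarrow> real) \<times> (nat \<Rightarrow> real)"
  have c: "continuous_on (A \<times> Z) (\<lambda>p. fst p i)" "continuous_on (A \<times> Z) (\<lambda>p. snd p i)" for i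
    using continuous_on_compose2[OF continuous_on_product_coordinates[of i] continuous_on_fst[OF continuous_on_id[of "A \<times> Z"]] subset_UNIV]
      continuous_on_compose2[OF continuous_on_product_coordinates[of i] continuous_on_snd[OF continuous_on_id[of "A \<times> Z"]] subset_UNIV]
    by blast+
  have "continuous_on (A \<times> Z) d" unfolding d_def by (intro continuous_intros c)
  then obtain p where p: "p \<in> A \<times> Z" "\<And>q. q \<in> A \<times> Z \<Longrightarrow> d p \<le> d q"
    using continuous_attains_inf[OF compact_Times[OF assms(1,2)] False] by blast
  have "fst p \<noteq> snd p" using p(1) assms(3) by (auto simp: mem_Times_iff)
  then obtain i where i: "fst p i \<noteq> snd p i" by auto
  have "i < n" using i p(1) assms(4,5) by (cases "i < n") (auto simp: mem_Times_iff topspace_Euclidean_space subset_iff)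
  then have "\<bar>fst p i - snd p i\<bar> \<le> d p" unfolding d_def by (intro member_le_sum) auto
  then have "d p > 0" using i by auto
  then show ?thesis using that[of "d p"] p(2) by (auto simp: d_def)
qed

lemma normal_space_cube: "normal_space (subtopology (Euclidean_space n) (cube n c r))"
  by (rule compact_Hausdorff_or_regular_imp_normal_space
        [OF compact_space_subtopology[OF compactin_cube] disjI1[OF Hausdorff_space_subtopology[OF Hausdorff_Euclidean_space]]])

text \<open>Extend to \<open>\<real>\<^sup>n\<close> and cut the cube into a grid so fine that no grid cube
  meets both \<open>A\<close> and a zero of the extension \<open>g\<close>. On the grid cubes
  that meet \<open>A\<close> keep \<open>g\<close>. On the union of the boundaries of all grid
  cubes a nowhere zero map exists by \<open>extendable_cube_boundary\<close>; every remaining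
  cube is filled with a cone, which has a single zero.\<close>

lemma finite_zero_extendable_cube:
  assumes c: "c \<in> topspace (Euclidean_space n)" and r: "r > 0"
  shows "finite_zero_extendable n (subtopology (Euclidean_space n) (cube n c r))"
  unfolding finite_zero_extendable_def
proof (intro allI impI, elim conjE)
  fix A u
  let ?E = "Euclidean_space n" and ?C = "cube n c r"
  assume A: "closedin (subtopology ?E ?C) A" and u: "continuous_map (subtopology (subtopology ?E ?C) A) (punct n) u"
  have AC: "A \<subseteq> ?C" using A closedin_subset by fastforce
  have clA: "closedin ?E A" using A closedin_cube closedin_trans_full by blast
  obtain g where g: "continuous_map (subtopology ?E ?C) ?E g" "\<And>a. a \<in> A \<Longrightarrow> g a = u a"
    by (rule extendableD[OF extendable_Euclidean[OF normal_space_cube] A, of n u])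
       (use u in \<open>auto simp: continuous_map_punct_iff\<close>)
  define Z where "Z = {x \<in> topspace (subtopology ?E ?C). g x \<in> {zvec}}"
  have "closedin (subtopology ?E ?C) Z"
    unfolding Z_def
    by (rule closedin_continuous_map_preimage[OF g(1)])
       (auto intro!: closedin_Hausdorff_singleton Hausdorff_Euclidean_space simp: topspace_Euclidean_space)
  then have clZ: "closedin ?E Z" using closedin_cube closedin_trans_full by blast
  have ZC: "Z \<subseteq> ?C" by (auto simp: Z_def)
  have "u a \<noteq> zvec" if "a \<in> A" for a
  proof -
    have "a \<in> topspace (subtopology (subtopology ?E ?C) A)" using AC cube_subset that by fastforce
    then show ?thesis using u by (auto simp: continuous_map_punct_iff)
  qed
  then have AZ: "A \<inter> Z = {}" using g(2) by (auto simp: Z_def)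
  have cAZ: "compact A" "compact Z"
    using compactin_closed_in_cube[OF clA AC] compactin_closed_in_cube[OF clZ ZC] by (auto simp: compactin_Euclidean_iff)
  have sub: "A \<subseteq> topspace ?E" "Z \<subseteq> topspace ?E" using AC ZC cube_subset by blast+
  obtain m where m: "m > 0" "\<And>a z. a \<in> A \<Longrightarrow> z \<in> Z \<Longrightarrow> m \<le> (\<Sum>i<n. \<bar>a i - z i\<bar>)"
    using compact_disjoint_l1_separated[OF cAZ AZ sub] by metis
  obtain M0 :: nat where M0: "real M0 > real n * 2 * r / m" using reals_Archimedean2 by blast
  define M where "M = Suc M0"
  have M: "M > 0" "real n * (2 * r / M) < m"
  proof -
    show "M > 0" by (simp add: M_def)
    have "real M > real n * 2 * r / m" using M0 by (simp add: M_def)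
    then show "real n * (2 * r / M) < m" using m(1) by (simp add: M_def field_simps)
  qed
  define \<rho> where "\<rho> = r / M"
  have \<rho>: "\<rho> > 0" "real n * (2 * \<rho>) < m" using r M by (auto simp: \<rho>_def)
  define K where "K = PiE {..<n} (\<lambda>_. {..<M})"
  have finK: "finite K" unfolding K_def by (intro finite_PiE) auto
  define ctr where "ctr k = (\<lambda>i. if i < n then c i + ((2 * real (k i) + 1) * \<rho> - r) else 0)" for k :: "nat \<Rightarrow> nat"
  define q where "q k = cube n (ctr k) \<rho>" for k
  define bd where "bd k = cube n (ctr k) \<rho> - open_cube n (ctr k) \<rho>" for k
  have bdq: "bd k \<subseteq> q k" for k by (auto simp: bd_def q_def)
  have ctrE: "ctr k \<in> topspace ?E" for k by (auto simp: ctr_def topspace_Euclidean_space)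
  have clq: "closedin ?E (q k)" for k unfolding q_def by (rule closedin_cube)
  have clbd: "closedin ?E (bd k)" for k unfolding bd_def
    by (intro closedin_diff closedin_cube openin_open_cube)
  have qC: "q k \<subseteq> ?C" if "k \<in> K" for k
  proof
    fix x assume x: "x \<in> q k"
    have "\<bar>x i - c i\<bar> \<le> r" if "i < n" for i
    proof -
      have kM: "k i < M" using \<open>k \<in> K\<close> that by (auto simp: K_def)
      have 1: "\<bar>x i - c i - ((2 * real (k i) + 1) * \<rho> - r)\<bar> \<le> \<rho>"
        using x that by (auto simp: q_def cube_def ctr_def algebra_simps)
      have rM: "r = \<rho> * M" using M by (simp add: \<rho>_def)
      have "real (k i) \<le> real M - 1" using kM by linarith
      then have "2 * real (k i) * \<rho> \<le> 2 * (real M - 1) * \<rho>" using \<rho> by (intro mult_right_mono) auto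
      moreover have "0 \<le> 2 * real (k i) * \<rho>" using \<rho> by simp
      moreover have "(2 * real (k i) + 1) * \<rho> = 2 * real (k i) * \<rho> + \<rho>" by (simp add: algebra_simps)
      moreover have "2 * (real M - 1) * \<rho> = 2 * r - 2 * \<rho>" using rM by (simp add: algebra_simps)
      ultimately show ?thesis using 1 by linarith
    qed
    then show "x \<in> ?C" using x by (auto simp: q_def cube_def)
  qed
  have cover: "\<exists>k\<in>K. x \<in> q k" if x: "x \<in> ?C" for x
  proof -
    have "\<exists>k<M. \<bar>(x i - c i) - ((2 * real k + 1) * r / M - r)\<bar> \<le> r / M" if "i < n" for i
    proof -
      have "\<bar>x i - c i\<bar> \<le> r" using x that by (simp add: cube_def)
      then show ?thesis using grid_coordinate[OF M(1) r] by metis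
    qed
    then obtain k where k: "\<And>i. i < n \<Longrightarrow> k i < M" "\<And>i. i < n \<Longrightarrow> \<bar>(x i - c i) - ((2 * real (k i) + 1) * r / M - r)\<bar> \<le> r / M"
      by metis
    have "restrict k {..<n} \<in> K" using k(1) by (auto simp: K_def)
    moreover have "x \<in> q (restrict k {..<n})"
      using x k(2) by (auto simp: q_def cube_def ctr_def \<rho>_def diff_diff_eq[symmetric])
    ultimately show ?thesis by blast
  qed
  have overlap: "x \<in> bd k" if kk: "k \<in> K" "k' \<in> K" "k \<noteq> k'" and xq: "x \<in> q k" "x \<in> q k'" for x k k'
  proof -
    obtain i where i: "i < n" "k i \<noteq> k' i" using kk PiE_ext unfolding K_def by (metis lessThan_iff)
    have x: "\<bar>x i - ctr k i\<bar> \<le> \<rho>" "\<bar>x i - ctr k' i\<bar> \<le> \<rho>" using xq i by (auto simp: q_def cube_def)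
    have "ctr k i - ctr k' i = (real (k i) - real (k' i)) * (2 * \<rho>)" using i by (simp add: ctr_def algebra_simps)
    moreover have "1 \<le> \<bar>real (k i) - real (k' i)\<bar>" using i(2) by linarith
    ultimately have "1 * (2 * \<rho>) \<le> \<bar>ctr k i - ctr k' i\<bar>"
      using \<rho> by (simp add: abs_mult)
    then have "\<not> \<bar>x i - ctr k i\<bar> < \<rho>" using x by linarith
    then show ?thesis using xq(1) i by (auto simp: bd_def q_def open_cube_def)
  qed
  define K1 where "K1 = {k \<in> K. q k \<inter> A \<noteq> {}}"
  have gnz: "g x \<noteq> zvec" if "k \<in> K1" "x \<in> q k" for k x
  proof
    assume gx: "g x = zvec"
    have kK: "k \<in> K" and "q k \<inter> A \<noteq> {}" using that by (auto simp: K1_def)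
    then obtain a where a: "a \<in> q k" "a \<in> A" by blast
    have "x \<in> ?C" using qC[OF kK] that(2) by blast
    then have "x \<in> Z" using gx cube_subset[of n c r] by (auto simp: Z_def)
    then have "m \<le> (\<Sum>i<n. \<bar>a i - x i\<bar>)" using m(2) a by blast
    also have "\<dots> \<le> (\<Sum>i<n. 2 * \<rho>)"
    proof (rule sum_mono)
      fix i assume "i \<in> {..<n}"
      then have "\<bar>x i - ctr k i\<bar> \<le> \<rho>" "\<bar>a i - ctr k i\<bar> \<le> \<rho>" using a that(2) by (auto simp: q_def cube_def)
      then show "\<bar>a i - x i\<bar> \<le> 2 * \<rho>" by linarith
    qed
    finally show False using \<rho>(2) by simp
  qed
  define A' where "A' = (\<Union>k\<in>K1. q k)"
  define Y where "Y = (\<Union>k\<in>K. bd k)"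
  have finK1: "finite K1" using finK by (simp add: K1_def)
  have clA': "closedin ?E A'" unfolding A'_def using finK1 clq by (intro closedin_Union) auto
  have clY: "closedin ?E Y" unfolding Y_def using finK clbd by (intro closedin_Union) auto
  have A'C: "A' \<subseteq> ?C" using qC by (auto simp: A'_def K1_def)
  have YC: "Y \<subseteq> ?C" using qC bdq by (fastforce simp: Y_def)
  have extY: "extendable (subtopology ?E Y) (punct n)"
    unfolding Y_def using finK clbd extendable_cube_boundary by (intro extendable_Union) (auto simp: bd_def)
  have gA': "continuous_map (subtopology ?E (A' \<inter> Y)) (punct n) g"
    unfolding continuous_map_punct_iff
  proof
    show "continuous_map (subtopology ?E (A' \<inter> Y)) ?E g"
      using continuous_map_from_subtopology_mono[OF g(1)] A'C by blast
    show "\<forall>y\<in>topspace (subtopology ?E (A' \<inter> Y)). g y \<noteq> zvec" using gnz by (auto simp: A'_def)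
  qed
  obtain v0 where v0: "continuous_map (subtopology ?E Y) (punct n) v0" "\<And>a. a \<in> A' \<inter> Y \<Longrightarrow> v0 a = g a"
  proof (rule extendableD[OF extY])
    show "closedin (subtopology ?E Y) (A' \<inter> Y)" by (metis clA' closedin_subtopology)
    show "continuous_map (subtopology (subtopology ?E Y) (A' \<inter> Y)) (punct n) g"
      using gA' by (simp add: subtopology_subtopology inf.absorb2)
  qed (use that in blast)
  define P where "P k w \<longleftrightarrow> continuous_map (subtopology ?E (q k)) ?E w \<and> (\<forall>x\<in>bd k. w x = v0 x) \<and> (\<forall>x\<in>q k. w x = zvec \<longrightarrow> x = ctr k)" for k w
  have "\<exists>w. P k w" if "k \<in> K" for k
  proof -
    have "continuous_map (subtopology ?E (bd k)) (punct n) v0"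
      by (rule continuous_map_from_subtopology_mono[OF v0(1)]) (use that in \<open>auto simp: Y_def\<close>)
    then show ?thesis
      using cube_cone_fill[OF ctrE[of k] \<rho>(1), of v0] unfolding P_def bd_def q_def by metis
  qed
  then have "\<forall>k\<in>K. \<exists>w. P k w" by blast
  then obtain w0 where "\<forall>k\<in>K. P k (w0 k)" using bchoice by metis
  then have w0: "\<And>k. k \<in> K \<Longrightarrow> continuous_map (subtopology ?E (q k)) ?E (w0 k)"
     "\<And>k x. k \<in> K \<Longrightarrow> x \<in> bd k \<Longrightarrow> w0 k x = v0 x" "\<And>k x. k \<in> K \<Longrightarrow> x \<in> q k \<Longrightarrow> w0 k x = zvec \<Longrightarrow> x = ctr k"
    unfolding P_def by blast+
  define w where "w k = (if k \<in> K1 then g else w0 k)" for k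
  have wbd: "w k x = v0 x" if "k \<in> K" "x \<in> bd k" for k x
  proof (cases "k \<in> K1")
    case True
    then have "x \<in> A' \<inter> Y" using that bdq[of k] by (auto simp: A'_def Y_def)
    then show ?thesis using v0(2) True by (simp add: w_def)
  qed (use w0(2) that in \<open>simp add: w_def\<close>)
  have CE: "?C \<subseteq> topspace ?E" by (rule cube_subset)
  obtain v where v: "continuous_map (subtopology ?E ?C) ?E v"
      "\<And>x k. k \<in> K \<Longrightarrow> x \<in> topspace (subtopology ?E ?C) \<inter> q k \<Longrightarrow> v x = w k x"
  proof (rule pasting_lemma_exists_closed[OF finK, where X="subtopology ?E ?C" and T=q and f=w and Y="?E"])
    show "topspace (subtopology ?E ?C) \<subseteq> \<Union> (q ` K)" using cover CE by auto
  next
    fix k assume k: "k \<in> K"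
    show "closedin (subtopology ?E ?C) (q k)" using clq qC[OF k] by (rule closedin_subset_topspace)
    show "continuous_map (subtopology (subtopology ?E ?C) (q k)) ?E (w k)"
    proof (cases "k \<in> K1")
      case True
      then show ?thesis using g(1) by (simp add: w_def continuous_map_from_subtopology)
    next
      case False
      then show ?thesis using w0(1)[OF k] qC[OF k] by (simp add: w_def subtopology_subtopology inf.absorb2)
    qed
  next
    fix k k' x assume "k \<in> K" "k' \<in> K" "x \<in> topspace (subtopology ?E ?C) \<inter> q k \<inter> q k'"
    then show "w k x = w k' x" using overlap[of k k' x] overlap[of k' k x] wbd by (cases "k = k'") auto
  qed (use that in blast)
  have "v a = u a" if "a \<in> A" for a
  proof -
    have "a \<in> ?C" using AC that by blast
    then obtain k where k: "k \<in> K" "a \<in> q k" using cover by blast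
    then have "k \<in> K1" using that by (auto simp: K1_def)
    then show ?thesis using v(2)[OF k(1), of a] k that AC CE g(2)[OF that] by (auto simp: w_def)
  qed
  moreover have "finite {y \<in> topspace (subtopology ?E ?C). v y = zvec}"
  proof (rule finite_subset)
    show "{y \<in> topspace (subtopology ?E ?C). v y = zvec} \<subseteq> ctr ` K"
    proof
      fix y assume y: "y \<in> {y \<in> topspace (subtopology ?E ?C). v y = zvec}"
      then obtain k where k: "k \<in> K" "y \<in> q k" using cover by auto
      then have z: "w k y = zvec" using v(2)[OF k(1), of y] y by auto
      show "y \<in> ctr ` K"
      proof (cases "k \<in> K1")
        case True
        then show ?thesis using gnz[OF True k(2)] z by (simp add: w_def)
      next
        case False
        then show ?thesis using w0(3)[OF k] z k(1) by (simp add: w_def)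
      qed
    qed
  qed (use finK in simp)
  ultimately show "\<exists>v. continuous_map (subtopology ?E ?C) ?E v \<and> (\<forall>a\<in>A. v a = u a) \<and> finite {y \<in> topspace (subtopology ?E ?C). v y = zvec}"
    using v(1) by blast
qed

section \<open>Degrees in local homology\<close>

abbreviation local_group :: "nat \<Rightarrow> (nat \<Rightarrow> real) chain set monoid" where
  "local_group n \<equiv> relative_homology_group (int n) (Euclidean_space n) (topspace (Euclidean_space n) - {zvec})"

lemma local_group_iso_integer: "local_group n \<cong> integer_group"
proof -
  have top0: "topspace (Euclidean_space 0) = {zvec}" by (auto simp: topspace_Euclidean_space)
  have "closedin (Euclidean_space 0) {zvec}" by (metis closedin_topspace top0)
  from relative_homology_group_Euclidean_complement_step[OF this, of 0 n]
  have "homology_group 0 (Euclidean_space 0) \<cong> local_group n" by (simp add: top0)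
  moreover have "homology_group 0 (Euclidean_space 0) \<cong> integer_group"
    by (rule homology_coefficients[OF top0])
  ultimately show ?thesis
    by (meson group.iso_sym group_relative_homology_group iso_trans)
qed

text \<open>Only one identification of the local homology group with the integers is used throughout; the
  choice of its sign does not affect degrees of self-maps.\<close>

definition local_int :: "nat \<Rightarrow> (nat \<Rightarrow> real) chain set \<Rightarrow> int" where
  "local_int n = (SOME h. h \<in> iso (local_group n) integer_group)"

lemma local_int_iso: "local_int n \<in> iso (local_group n) integer_group"
  using local_group_iso_integer unfolding local_int_def is_iso_def by (metis ex_in_conv someI_ex)

lemma local_int_hom: "local_int n \<in> hom (local_group n) integer_group"
  using local_int_iso by (simp add: iso_def)

lemma local_int_mult:
  "a \<in> carrier (local_group n) \<Longrightarrow> b \<in> carrier (local_group n) \<Longrightarrow>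
     local_int n (a \<otimes>\<^bsub>local_group n\<^esub> b) = local_int n a + local_int n b"
  using hom_mult[OF local_int_hom] by simp

lemma local_int_one: "local_int n \<one>\<^bsub>local_group n\<^esub> = 0"
  using hom_one[OF local_int_hom] by simp

lemma local_int_surj: obtains a where "a \<in> carrier (local_group n)" "local_int n a = m"
proof -
  have "bij_betw (local_int n) (carrier (local_group n)) UNIV" using local_int_iso by (simp add: iso_def)
  then have "m \<in> local_int n ` carrier (local_group n)" by (simp add: bij_betw_def)
  then show ?thesis using that by blast
qed

text \<open>Every endomorphism of the local homology group of \<open>\<real>\<^sup>n\<close> at
  \<open>0\<close> is multiplication by an integer.\<close>

definition endo_degree :: "nat \<Rightarrow> ((nat \<Rightarrow> real) \<Rightarrow> (nat \<Rightarrow> real)) \<Rightarrow> int" where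
  "endo_degree n F = local_int n (hom_induced (int n) (Euclidean_space n) (topspace (Euclidean_space n) - {zvec})
      (Euclidean_space n) (topspace (Euclidean_space n) - {zvec}) F (inv_into (carrier (local_group n)) (local_int n) 1))"

lemma additive_int_eq_mult:
  fixes f :: "int \<Rightarrow> int"
  assumes "\<And>x y. f (x + y) = f x + f y"
  shows "f m = m * f 1"
proof -
  have 0: "f 0 = 0" using assms[of 0 0] by simp
  have p: "f (int k) = int k * f 1" for k
    by (induction k) (auto simp: 0 assms algebra_simps)
  have m: "f (- int k) = - int k * f 1" for k
    using assms[of "- int k" "int k"] p[of k] 0 by simp
  show ?thesis using p m by (metis int_cases2)
qed

lemma local_int_hom_induced:
  assumes "a \<in> carrier (local_group n)"
  shows "local_int n (hom_induced (int n) (Euclidean_space n) (topspace (Euclidean_space n) - {zvec})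
      (Euclidean_space n) (topspace (Euclidean_space n) - {zvec}) F a) = endo_degree n F * local_int n a"
proof -
  let ?L = "local_group n" and ?F = "hom_induced (int n) (Euclidean_space n) (topspace (Euclidean_space n) - {zvec})
      (Euclidean_space n) (topspace (Euclidean_space n) - {zvec}) F"
  let ?inv = "inv_into (carrier ?L) (local_int n)"
  have bij: "bij_betw (local_int n) (carrier ?L) UNIV" using local_int_iso by (simp add: iso_def)
  have invc: "?inv m \<in> carrier ?L" "local_int n (?inv m) = m" for m
    using bij by (metis UNIV_I bij_betw_def inv_into_into, metis UNIV_I bij_betw_def f_inv_into_f)
  have Fc: "?F b \<in> carrier ?L" for b by (rule hom_induced_carrier)
  let ?f = "\<lambda>m. local_int n (?F (?inv m))"
  have "?f (x + y) = ?f x + ?f y" for x y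
  proof -
    have mem: "?inv x \<otimes>\<^bsub>?L\<^esub> ?inv y \<in> carrier ?L"
      using invc(1) by (intro monoid.m_closed group.is_monoid) auto
    have "local_int n (?inv x \<otimes>\<^bsub>?L\<^esub> ?inv y) = x + y" using invc local_int_mult by simp
    then have "?inv (x + y) = ?inv x \<otimes>\<^bsub>?L\<^esub> ?inv y"
      using bij_betw_inv_into_left[OF bij mem] by simp
    moreover have "?F (?inv x \<otimes>\<^bsub>?L\<^esub> ?inv y) = ?F (?inv x) \<otimes>\<^bsub>?L\<^esub> ?F (?inv y)"
      by (rule hom_mult[OF hom_induced_hom invc(1) invc(1)])
    ultimately show ?thesis using local_int_mult[OF Fc Fc] by simp
  qed
  then have "?f m = m * ?f 1" for m by (rule additive_int_eq_mult)
  from this[of "local_int n a"] show ?thesis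
    using bij_betw_inv_into_left[OF bij assms] by (simp add: endo_degree_def mult.commute)
qed

lemma excision_open_closed:
  assumes "openin X Q" "closedin X Z" "Z \<subseteq> Q"
  shows "hom_induced p (subtopology X Q) (Q - Z) X (topspace X - Z) id
     \<in> iso (relative_homology_group p (subtopology X Q) (Q - Z)) (relative_homology_group p X (topspace X - Z))"
proof -
  have QX: "Q \<subseteq> topspace X" using assms(1) openin_subset by blast
  have eq1: "topspace X - (topspace X - Q) = Q" and eq2: "topspace X - Z - (topspace X - Q) = Q - Z"
    using QX by auto
  have "closedin X (topspace X - Q)" "openin X (topspace X - Z)" using assms(1,2) by auto
  then have "X closure_of (topspace X - Q) \<subseteq> X interior_of (topspace X - Z)"
    using assms(3) closure_of_closedin interior_of_openin by fastforce
  from homology_excision_axiom[OF this, of "topspace X" p] show ?thesis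
    by (simp add: eq1 eq2)
qed

text \<open>The situation in which a map \<open>u\<close> on \<open>Q\<close> has its zeros in the closed
  set \<open>Z\<close>, which need not be the exact zero set.\<close>

definition isolates :: "nat \<Rightarrow> 'a topology \<Rightarrow> 'a set \<Rightarrow> 'a set \<Rightarrow> ('a \<Rightarrow> nat \<Rightarrow> real) \<Rightarrow> bool" where
  "isolates n X Q Z u \<longleftrightarrow> openin X Q \<and> closedin X Z \<and> Z \<subseteq> Q \<and>
     continuous_map (subtopology X Q) (Euclidean_space n) u \<and> (\<forall>x\<in>Q - Z. u x \<noteq> zvec)"

text \<open>The class \<open>c\<close> of the pair \<open>(X, X - Z)\<close> is moved to
  \<open>(Q, Q - Z)\<close> by excision and then mapped to the local homology of
  \<open>\<real>\<^sup>n\<close> at \<open>0\<close>.\<close>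

definition map_degree :: "nat \<Rightarrow> 'a topology \<Rightarrow> 'a set \<Rightarrow> 'a set \<Rightarrow> 'a chain set \<Rightarrow> ('a \<Rightarrow> nat \<Rightarrow> real) \<Rightarrow> int" where
  "map_degree n X Q Z c u = local_int n (hom_induced (int n) (subtopology X Q) (Q - Z)
      (Euclidean_space n) (topspace (Euclidean_space n) - {zvec}) u
      (inv_into (carrier (relative_homology_group (int n) (subtopology X Q) (Q - Z)))
         (hom_induced (int n) (subtopology X Q) (Q - Z) X (topspace X - Z) id) c))"

abbreviation local_homology :: "nat \<Rightarrow> 'a topology \<Rightarrow> 'a set \<Rightarrow> 'a chain set monoid" where
  "local_homology n X Z \<equiv> relative_homology_group (int n) X (topspace X - Z)"

abbreviation restrict_class :: "nat \<Rightarrow> 'a topology \<Rightarrow> 'a set \<Rightarrow> 'a set \<Rightarrow> 'a chain set \<Rightarrow> 'a chain set" where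
  "restrict_class n X A B \<equiv> hom_induced (int n) X (topspace X - A) X (topspace X - B) id"

lemma isolates_funcset: "isolates n X Q Z u \<Longrightarrow> u \<in> Q - Z \<rightarrow> topspace (Euclidean_space n) - {zvec}"
  unfolding isolates_def using openin_subset by (fastforce simp: continuous_map_def)

lemma map_degree_eq:
  assumes "openin X Q" "closedin X Z" "Z \<subseteq> Q"
    and "a \<in> carrier (relative_homology_group (int n) (subtopology X Q) (Q - Z))"
    and "hom_induced (int n) (subtopology X Q) (Q - Z) X (topspace X - Z) id a = c"
  shows "map_degree n X Q Z c u = local_int n (hom_induced (int n) (subtopology X Q) (Q - Z)
      (Euclidean_space n) (topspace (Euclidean_space n) - {zvec}) u a)"
proof -
  have "bij_betw (hom_induced (int n) (subtopology X Q) (Q - Z) X (topspace X - Z) id)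
     (carrier (relative_homology_group (int n) (subtopology X Q) (Q - Z))) (carrier (local_homology n X Z))"
    using excision_open_closed[OF assms(1-3), of "int n"] by (simp add: iso_def)
  then show ?thesis unfolding map_degree_def using assms(4,5) bij_betw_inv_into_left by fastforce
qed

lemma excision_lift:
  assumes "openin X Q" "closedin X Z" "Z \<subseteq> Q" "c \<in> carrier (local_homology n X Z)"
  obtains a where "a \<in> carrier (relative_homology_group (int n) (subtopology X Q) (Q - Z))"
    "hom_induced (int n) (subtopology X Q) (Q - Z) X (topspace X - Z) id a = c"
proof -
  have "c \<in> hom_induced (int n) (subtopology X Q) (Q - Z) X (topspace X - Z) id `
      carrier (relative_homology_group (int n) (subtopology X Q) (Q - Z))"
    using excision_open_closed[OF assms(1-3), of "int n"] assms(4) by (simp add: iso_def bij_betw_def)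
  then show thesis using that by blast
qed

lemma continuous_map_id_subtopology:
  "A \<subseteq> B \<Longrightarrow> continuous_map (subtopology X A) (subtopology X B) id"
  by (auto simp: continuous_map_in_subtopology continuous_map_from_subtopology)

lemma continuous_map_id_from_subtopology: "continuous_map (subtopology X A) X id"
  by (simp add: continuous_map_from_subtopology)

lemma map_degree_shrink:
  assumes u: "isolates n X Q Z u" and Q': "openin X Q'" "Q' \<subseteq> Q" "Z \<subseteq> Q'"
    and c: "c \<in> carrier (local_homology n X Z)"
  shows "map_degree n X Q' Z c u = map_degree n X Q Z c u"
proof -
  let ?R = "relative_homology_group (int n)" and ?h = "hom_induced (int n)"
  let ?E = "Euclidean_space n" and ?P = "topspace (Euclidean_space n) - {zvec}"
  have Q: "openin X Q" "closedin X Z" "Z \<subseteq> Q" "continuous_map (subtopology X Q) ?E u"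
    using u by (auto simp: isolates_def)
  obtain a where a: "a \<in> carrier (?R (subtopology X Q') (Q' - Z))"
     "?h (subtopology X Q') (Q' - Z) X (topspace X - Z) id a = c"
    using excision_lift[OF Q'(1) Q(2) Q'(3) c] .
  define b where "b = ?h (subtopology X Q') (Q' - Z) (subtopology X Q) (Q - Z) id a"
  have QX: "Q \<subseteq> topspace X" using Q(1) openin_subset by blast
  have j: "continuous_map (subtopology X Q') (subtopology X Q) id" "id \<in> Q' - Z \<rightarrow> Q - Z"
    using Q'(2) continuous_map_id_subtopology by auto
  have i: "continuous_map (subtopology X Q) X id" "id \<in> Q - Z \<rightarrow> topspace X - Z"
    using QX continuous_map_id_from_subtopology by auto
  have "?h (subtopology X Q) (Q - Z) X (topspace X - Z) id b = c"
    unfolding b_def using hom_induced_compose'[OF j i, of "int n" a] a(2) by simp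
  moreover have "b \<in> carrier (?R (subtopology X Q) (Q - Z))" unfolding b_def by (rule hom_induced_carrier)
  ultimately have "map_degree n X Q Z c u = local_int n (?h (subtopology X Q) (Q - Z) ?E ?P u b)"
    using map_degree_eq[OF Q(1-3)] by blast
  also have "?h (subtopology X Q) (Q - Z) ?E ?P u b = ?h (subtopology X Q') (Q' - Z) ?E ?P u a"
    unfolding b_def using hom_induced_compose'[OF j Q(4) isolates_funcset[OF u], of "int n" a] by simp
  also have "local_int n \<dots> = map_degree n X Q' Z c u"
    using map_degree_eq[OF Q'(1) Q(2) Q'(3) a] by simp
  finally show ?thesis by simp
qed

lemma map_degree_restrict_class:
  assumes u: "isolates n X Q Z u" and Z': "closedin X Z'" "Z \<subseteq> Z'" "Z' \<subseteq> Q"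
    and c: "c \<in> carrier (local_homology n X Z')"
  shows "map_degree n X Q Z' c u = map_degree n X Q Z (restrict_class n X Z' Z c) u"
proof -
  let ?R = "relative_homology_group (int n)" and ?h = "hom_induced (int n)"
  let ?E = "Euclidean_space n" and ?P = "topspace (Euclidean_space n) - {zvec}"
  have Q: "openin X Q" "closedin X Z" "Z \<subseteq> Q" "continuous_map (subtopology X Q) ?E u"
    using u by (auto simp: isolates_def)
  obtain a where a: "a \<in> carrier (?R (subtopology X Q) (Q - Z'))"
     "?h (subtopology X Q) (Q - Z') X (topspace X - Z') id a = c"
    using excision_lift[OF Q(1) Z'(1,3) c] .
  define b where "b = ?h (subtopology X Q) (Q - Z') (subtopology X Q) (Q - Z) id a"
  have QX: "Q \<subseteq> topspace X" using Q(1) openin_subset by blast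
  have j: "continuous_map (subtopology X Q) (subtopology X Q) id" "id \<in> Q - Z' \<rightarrow> Q - Z"
    using Z'(2) by auto
  have i: "continuous_map (subtopology X Q) X id" "id \<in> Q - Z \<rightarrow> topspace X - Z" "id \<in> Q - Z' \<rightarrow> topspace X - Z'"
    using QX continuous_map_id_from_subtopology by auto
  have k: "continuous_map X X id" "id \<in> topspace X - Z' \<rightarrow> topspace X - Z" using Z'(2) by auto
  have "?h (subtopology X Q) (Q - Z) X (topspace X - Z) id b = restrict_class n X Z' Z c"
    unfolding b_def using hom_induced_compose'[OF j i(1,2), of "int n" a]
      hom_induced_compose'[OF i(1,3) k, of "int n" a] a(2) by simp
  moreover have "b \<in> carrier (?R (subtopology X Q) (Q - Z))" unfolding b_def by (rule hom_induced_carrier)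
  ultimately have "map_degree n X Q Z (restrict_class n X Z' Z c) u = local_int n (?h (subtopology X Q) (Q - Z) ?E ?P u b)"
    using map_degree_eq[OF Q(1-3)] by blast
  also have "?h (subtopology X Q) (Q - Z) ?E ?P u b = ?h (subtopology X Q) (Q - Z') ?E ?P u a"
    unfolding b_def using hom_induced_compose'[OF j Q(4) isolates_funcset[OF u], of "int n" a] by simp
  also have "local_int n \<dots> = map_degree n X Q Z' c u"
    using map_degree_eq[OF Q(1) Z'(1,3) a] by simp
  finally show ?thesis by (rule sym)
qed

lemma map_degree_cong:
  assumes "\<And>x. x \<in> topspace X \<Longrightarrow> x \<in> Q \<Longrightarrow> u x = v x"
  shows "map_degree n X Q Z c u = map_degree n X Q Z c v"
proof -
  have "hom_induced (int n) (subtopology X Q) (Q - Z) (Euclidean_space n) (topspace (Euclidean_space n) - {zvec}) u =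
    hom_induced (int n) (subtopology X Q) (Q - Z) (Euclidean_space n) (topspace (Euclidean_space n) - {zvec}) v"
    by (rule hom_induced_eq) (use assms in auto)
  then show ?thesis by (simp add: map_degree_def)
qed

lemma homotopic_with_linear_Euclidean:
  assumes u: "continuous_map Y (Euclidean_space n) u" and v: "continuous_map Y (Euclidean_space n) v"
    and P: "\<And>t. 0 \<le> t \<Longrightarrow> t \<le> 1 \<Longrightarrow> P (\<lambda>x i. (1 - t) * u x i + t * v x i)"
  shows "homotopic_with P Y (Euclidean_space n) u v"
  unfolding homotopic_with_def
proof (intro exI conjI ballI allI)
  let ?I = "subtopology euclideanreal {0..1}"
  show "continuous_map (prod_topology ?I Y) (Euclidean_space n) (\<lambda>p i. (1 - fst p) * u (snd p) i + fst p * v (snd p) i)"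
    unfolding continuous_map_Euclidean_iff
  proof (intro conjI allI impI ballI)
    fix i
    have f: "continuous_map (prod_topology ?I Y) euclideanreal fst"
      by (rule continuous_map_into_fulltopology[OF continuous_map_fst])
    have s: "continuous_map (prod_topology ?I Y) euclideanreal (\<lambda>p. w (snd p) i)"
      if "continuous_map Y (Euclidean_space n) w" for w
      using continuous_map_compose[OF continuous_map_snd continuous_map_Euclidean_coord[OF that]] unfolding o_def .
    show "continuous_map (prod_topology ?I Y) euclideanreal (\<lambda>p. (1 - fst p) * u (snd p) i + fst p * v (snd p) i)"
    proof (intro continuous_map_add continuous_map_real_mult f s[OF u] s[OF v])
      show "continuous_map (prod_topology ?I Y) euclideanreal (\<lambda>p. 1 - fst p)"
        by (intro continuous_map_diff f) auto
    qed
  next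
    fix p i assume "p \<in> topspace (prod_topology ?I Y)" "n \<le> i"
    then show "(1 - fst p) * u (snd p) i + fst p * v (snd p) i = 0"
      using u v by (auto simp: continuous_map_Euclidean_iff)
  qed
  show "P (\<lambda>x. (\<lambda>p i. (1 - fst p) * u (snd p) i + fst p * v (snd p) i) (t, x))" if "t \<in> {0..1}" for t
    using P[of t] that by simp
qed auto

lemma map_degree_linear_homotopy:
  assumes u: "continuous_map (subtopology X Q) (Euclidean_space n) u"
    and v: "continuous_map (subtopology X Q) (Euclidean_space n) v"
    and QX: "Q \<subseteq> topspace X"
    and nz: "\<And>x t. x \<in> Q - Z \<Longrightarrow> 0 \<le> t \<Longrightarrow> t \<le> 1 \<Longrightarrow> (\<lambda>i. (1 - t) * u x i + t * v x i) \<noteq> zvec"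
  shows "map_degree n X Q Z c u = map_degree n X Q Z c v"
proof -
  have "homotopic_with (\<lambda>h. h \<in> Q - Z \<rightarrow> topspace (Euclidean_space n) - {zvec}) (subtopology X Q) (Euclidean_space n) u v"
  proof (rule homotopic_with_linear_Euclidean[OF u v])
    fix t :: real assume t: "0 \<le> t" "t \<le> 1"
    show "(\<lambda>x i. (1 - t) * u x i + t * v x i) \<in> Q - Z \<rightarrow> topspace (Euclidean_space n) - {zvec}"
    proof
      fix x assume x: "x \<in> Q - Z"
      then have "x \<in> topspace (subtopology X Q)" using QX by auto
      then have "\<forall>i\<ge>n. u x i = 0" "\<forall>i\<ge>n. v x i = 0"
        using u v by (auto simp: continuous_map_Euclidean_iff)
      then show "(\<lambda>i. (1 - t) * u x i + t * v x i) \<in> topspace (Euclidean_space n) - {zvec}"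
        using nz[OF x t] by (auto simp: topspace_Euclidean_space)
    qed
  qed
  from homology_homotopy_axiom[OF this, of "int n"] show ?thesis by (simp add: map_degree_def)
qed

lemma map_degree_homeomorphic:
  assumes g: "homeomorphic_map X X' g" and u: "isolates n X' (g ` Q) (g ` Z) u"
    and Q: "openin X Q" "closedin X Z" "Z \<subseteq> Q"
    and c: "c \<in> carrier (local_homology n X Z)"
  shows "map_degree n X' (g ` Q) (g ` Z) (hom_induced (int n) X (topspace X - Z) X' (topspace X' - g ` Z) g c) u
     = map_degree n X Q Z c (u \<circ> g)"
proof -
  let ?R = "relative_homology_group (int n)" and ?h = "hom_induced (int n)"
  let ?E = "Euclidean_space n" and ?P = "topspace (Euclidean_space n) - {zvec}"
  have Q': "openin X' (g ` Q)" "closedin X' (g ` Z)" "g ` Z \<subseteq> g ` Q" "continuous_map (subtopology X' (g ` Q)) ?E u"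
    using u by (auto simp: isolates_def)
  have QX: "Q \<subseteq> topspace X" using Q(1) openin_subset by blast
  have gc: "continuous_map X X' g" and inj: "inj_on g (topspace X)"
    using g by (auto simp: homeomorphic_map_def homeomorphic_imp_continuous_map dest: homeomorphic_imp_injective_map)
  have Q'X: "g ` Q \<subseteq> topspace X'" using Q'(1) openin_subset by blast
  obtain a where a: "a \<in> carrier (?R (subtopology X Q) (Q - Z))"
     "?h (subtopology X Q) (Q - Z) X (topspace X - Z) id a = c"
    using excision_lift[OF Q c] .
  define b where "b = ?h (subtopology X Q) (Q - Z) (subtopology X' (g ` Q)) (g ` Q - g ` Z) g a"
  have nZ: "g x \<notin> g ` Z" if "x \<in> topspace X" "x \<notin> Z" for x
    using inj that closedin_subset[OF Q(2)] by (auto dest: inj_onD)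
  have j: "continuous_map (subtopology X Q) (subtopology X' (g ` Q)) g" "g \<in> Q - Z \<rightarrow> g ` Q - g ` Z"
    using gc nZ QX by (auto simp: continuous_map_in_subtopology continuous_map_from_subtopology)
  have i: "continuous_map (subtopology X' (g ` Q)) X' id" "id \<in> g ` Q - g ` Z \<rightarrow> topspace X' - g ` Z"
    using Q'X continuous_map_id_from_subtopology by auto
  have i': "continuous_map (subtopology X Q) X id" "id \<in> Q - Z \<rightarrow> topspace X - Z"
    using QX continuous_map_id_from_subtopology by auto
  have k: "g \<in> topspace X - Z \<rightarrow> topspace X' - g ` Z" using nZ gc by (auto simp: continuous_map_def)
  have "?h (subtopology X' (g ` Q)) (g ` Q - g ` Z) X' (topspace X' - g ` Z) id b = ?h X (topspace X - Z) X' (topspace X' - g ` Z) g c"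
    unfolding b_def using hom_induced_compose'[OF j i, of "int n" a]
      hom_induced_compose'[OF i' gc k, of "int n" a] a(2) by simp
  moreover have "b \<in> carrier (?R (subtopology X' (g ` Q)) (g ` Q - g ` Z))" unfolding b_def by (rule hom_induced_carrier)
  ultimately have "map_degree n X' (g ` Q) (g ` Z) (?h X (topspace X - Z) X' (topspace X' - g ` Z) g c) u
      = local_int n (?h (subtopology X' (g ` Q)) (g ` Q - g ` Z) ?E ?P u b)"
    using map_degree_eq[OF Q'(1-3)] by blast
  also have "?h (subtopology X' (g ` Q)) (g ` Q - g ` Z) ?E ?P u b = ?h (subtopology X Q) (Q - Z) ?E ?P (u \<circ> g) a"
    unfolding b_def using hom_induced_compose'[OF j Q'(4) isolates_funcset[OF u], of "int n" a] by simp
  also have "local_int n \<dots> = map_degree n X Q Z c (u \<circ> g)"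
    using map_degree_eq[OF Q a] by simp
  finally show ?thesis by simp
qed

lemma map_degree_compose:
  assumes u: "isolates n X Q Z u" and c: "c \<in> carrier (local_homology n X Z)"
    and F: "continuous_map (Euclidean_space n) (Euclidean_space n) F"
      "\<And>x. x \<in> topspace (Euclidean_space n) \<Longrightarrow> x \<noteq> zvec \<Longrightarrow> F x \<noteq> zvec"
  shows "map_degree n X Q Z c (F \<circ> u) = endo_degree n F * map_degree n X Q Z c u"
proof -
  let ?R = "relative_homology_group (int n)" and ?h = "hom_induced (int n)"
  let ?E = "Euclidean_space n" and ?P = "topspace (Euclidean_space n) - {zvec}"
  have Q: "openin X Q" "closedin X Z" "Z \<subseteq> Q" "continuous_map (subtopology X Q) ?E u"
    using u by (auto simp: isolates_def)
  obtain a where a: "a \<in> carrier (?R (subtopology X Q) (Q - Z))"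
     "?h (subtopology X Q) (Q - Z) X (topspace X - Z) id a = c"
    using excision_lift[OF Q(1-3) c] .
  have F0: "F \<in> ?P \<rightarrow> ?P" using F by (auto simp: continuous_map_def)
  have "map_degree n X Q Z c (F \<circ> u) = local_int n (?h (subtopology X Q) (Q - Z) ?E ?P (F \<circ> u) a)"
    using map_degree_eq[OF Q(1-3) a] .
  also have "?h (subtopology X Q) (Q - Z) ?E ?P (F \<circ> u) a = ?h ?E ?P ?E ?P F (?h (subtopology X Q) (Q - Z) ?E ?P u a)"
    using hom_induced_compose'[OF Q(4) isolates_funcset[OF u] F(1) F0] by simp
  also have "local_int n \<dots> = endo_degree n F * local_int n (?h (subtopology X Q) (Q - Z) ?E ?P u a)"
    by (rule local_int_hom_induced[OF hom_induced_carrier])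
  also have "local_int n (?h (subtopology X Q) (Q - Z) ?E ?P u a) = map_degree n X Q Z c u"
    using map_degree_eq[OF Q(1-3) a] by simp
  finally show ?thesis .
qed

lemma hom_induced_into_subspace_trivial:
  assumes "continuous_map X Y f" "f \<in> topspace X \<rightarrow> T" "S \<subseteq> topspace X"
  shows "hom_induced p X S Y T f c = \<one>\<^bsub>relative_homology_group p Y T\<^esub>"
proof -
  have i: "continuous_map X X id" "id \<in> S \<rightarrow> topspace X" using assms(3) by auto
  have "hom_induced p X S Y T f c = hom_induced p X (topspace X) Y T f (hom_induced p X S X (topspace X) id c)"
    using hom_induced_compose'[OF i assms(1,2), of p c] by simp
  also have "hom_induced p X S X (topspace X) id c = \<one>\<^bsub>relative_homology_group p X (topspace X)\<^esub>"
    using trivial_relative_homology_group_topspace[of p X] hom_induced_carrier[of p X S X "topspace X" id c]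
    by (auto simp: trivial_group_def)
  also have "hom_induced p X (topspace X) Y T f \<dots> = \<one>\<^bsub>relative_homology_group p Y T\<^esub>"
    by (rule hom_one[OF hom_induced_hom]) auto
  finally show ?thesis .
qed

lemma map_degree_empty:
  assumes u: "isolates n X Q {} u"
  shows "map_degree n X Q {} c u = 0"
proof -
  have "hom_induced (int n) (subtopology X Q) (Q - {}) (Euclidean_space n) (topspace (Euclidean_space n) - {zvec}) u d
     = \<one>\<^bsub>local_group n\<^esub>" for d
  proof (rule hom_induced_into_subspace_trivial)
    show "u \<in> topspace (subtopology X Q) \<rightarrow> topspace (Euclidean_space n) - {zvec}"
      using isolates_funcset[OF u] by auto
    show "Q - {} \<subseteq> topspace (subtopology X Q)" using u openin_subset by (fastforce simp: isolates_def)
  qed (use u in \<open>simp add: isolates_def\<close>)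
  then show ?thesis unfolding map_degree_def by (simp only: local_int_one)
qed

text \<open>Additivity. Lift the class by excision to the pair
  \<open>(Q1 \<union> Q2, (Q1 \<union> Q2) - (Z1 \<union> Z2))\<close> and subtract the image of
  its part on \<open>Q1\<close>. The difference restricts to zero near \<open>Z1\<close>, so by
  the exact sequence of a triple it comes from the complement of \<open>Z1\<close>, and there it
  can be excised to \<open>Q2\<close>.\<close>

lemma map_degree_Un:
  assumes u: "isolates n X Q (Z1 \<union> Z2) u" and Z: "closedin X Z1" "closedin X Z2"
    and Q1: "openin X Q1" "Z1 \<subseteq> Q1" "Q1 \<subseteq> Q" and Q2: "openin X Q2" "Z2 \<subseteq> Q2" "Q2 \<subseteq> Q"
    and disj: "Q1 \<inter> Q2 = {}" and c: "c \<in> carrier (local_homology n X (Z1 \<union> Z2))"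
  shows "map_degree n X Q (Z1 \<union> Z2) c u =
      map_degree n X Q1 Z1 (restrict_class n X (Z1 \<union> Z2) Z1 c) u
    + map_degree n X Q2 Z2 (restrict_class n X (Z1 \<union> Z2) Z2 c) u"
proof -
  let ?R = "relative_homology_group (int n)" and ?h = "hom_induced (int n)"
  let ?E = "Euclidean_space n" and ?P = "topspace (Euclidean_space n) - {zvec}"
  define W where "W = Q1 \<union> Q2"
  define Z where "Z = Z1 \<union> Z2"
  define S where "S = W - Z1"
  let ?T = "subtopology X W" and ?TS = "subtopology X S"
  have clZ: "closedin X Z" using assms(2,3) by (simp add: Z_def closedin_Un)
  have oW: "openin X W" using Q1 Q2 by (simp add: W_def openin_Un)
  have WQ: "W \<subseteq> Q" "Z \<subseteq> W" using Q1 Q2 by (auto simp: W_def Z_def)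
  have WX: "W \<subseteq> topspace X" using oW openin_subset by blast
  have uW: "isolates n X W Z u"
    unfolding isolates_def
  proof (intro conjI)
    show "continuous_map (subtopology X W) ?E u"
      by (rule continuous_map_from_subtopology_mono[OF _ WQ(1)]) (use u in \<open>simp add: isolates_def\<close>)
    show "\<forall>x\<in>W - Z. u x \<noteq> zvec" using u WQ by (auto simp: isolates_def Z_def)
  qed (use oW clZ WQ in auto)
  have cu: "continuous_map ?T ?E u" using uW by (simp add: isolates_def)
  have uP: "u \<in> W - Z \<rightarrow> ?P" by (rule isolates_funcset[OF uW])
  have cZ: "c \<in> carrier (local_homology n X Z)" using c by (simp add: Z_def)
  obtain a where a: "a \<in> carrier (?R ?T (W - Z))" "?h ?T (W - Z) X (topspace X - Z) id a = c"
    using excision_lift[OF oW clZ WQ(2) cZ] .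
  define c1 where "c1 = restrict_class n X Z Z1 c"
  define c2 where "c2 = restrict_class n X Z Z2 c"
  have c12: "c1 \<in> carrier (local_homology n X Z1)" "c2 \<in> carrier (local_homology n X Z2)"
    unfolding c1_def c2_def by (rule hom_induced_carrier)+
  obtain a1 where a1: "a1 \<in> carrier (?R (subtopology X Q1) (Q1 - Z1))"
      "?h (subtopology X Q1) (Q1 - Z1) X (topspace X - Z1) id a1 = c1"
    using excision_lift[OF Q1(1) assms(2) Q1(2) c12(1)] .
  have Q1W: "Q1 \<subseteq> W" and Q2W: "Q2 \<subseteq> W" by (auto simp: W_def)
  have Q1Z: "Q1 - Z1 \<subseteq> W - Z" using disj Q2(2) by (auto simp: W_def Z_def)
  have Q2Z: "Q2 - Z2 \<subseteq> W - Z" using disj Q1(2) by (auto simp: W_def Z_def)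
  have m1: "continuous_map (subtopology X Q1) ?T id" "id \<in> Q1 - Z1 \<rightarrow> W - Z"
    using continuous_map_id_subtopology[OF Q1W] Q1Z by auto
  have m2: "continuous_map (subtopology X Q2) ?T id" "id \<in> Q2 - Z2 \<rightarrow> W - Z"
    using continuous_map_id_subtopology[OF Q2W] Q2Z by auto
  define b1 where "b1 = ?h (subtopology X Q1) (Q1 - Z1) ?T (W - Z) id a1"
  have b1c: "b1 \<in> carrier (?R ?T (W - Z))" unfolding b1_def by (rule hom_induced_carrier)
  have mW1: "continuous_map ?T ?T id" "id \<in> W - Z \<rightarrow> W - Z1" by (auto simp: Z_def)
  have mW2: "continuous_map ?T ?T id" "id \<in> W - Z \<rightarrow> W - Z2" by (auto simp: Z_def)
  have mX1: "continuous_map ?T X id" "id \<in> W - Z1 \<rightarrow> topspace X - Z1"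
    and mX2: "continuous_map ?T X id" "id \<in> W - Z2 \<rightarrow> topspace X - Z2"
    and mXZ: "continuous_map ?T X id" "id \<in> W - Z \<rightarrow> topspace X - Z"
    using WX continuous_map_id_from_subtopology by auto
  have mr1: "continuous_map X X id" "id \<in> topspace X - Z \<rightarrow> topspace X - Z1"
    and mr2: "continuous_map X X id" "id \<in> topspace X - Z \<rightarrow> topspace X - Z2" by (auto simp: Z_def)
  let ?r1 = "?h ?T (W - Z) ?T (W - Z1) id" and ?r2 = "?h ?T (W - Z) ?T (W - Z2) id"
  let ?i1 = "?h ?T (W - Z1) X (topspace X - Z1) id"
  have inj1: "inj_on ?i1 (carrier (?R ?T (W - Z1)))"
    using excision_open_closed[OF oW assms(2), of "int n"] WQ by (auto simp: iso_def bij_betw_def Z_def)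
  have "?i1 (?r1 a) = c1"
    unfolding c1_def using hom_induced_compose'[OF mW1 mX1, of "int n" a] hom_induced_compose'[OF mXZ mr1, of "int n" a] a(2)
    by simp
  moreover have "?i1 (?r1 b1) = c1"
  proof -
    have m: "id \<in> Q1 - Z1 \<rightarrow> W - Z1" using Q1W by auto
    have "?r1 b1 = ?h (subtopology X Q1) (Q1 - Z1) ?T (W - Z1) id a1"
      unfolding b1_def using hom_induced_compose'[OF m1 mW1, of "int n" a1] by simp
    then have "?i1 (?r1 b1) = ?h (subtopology X Q1) (Q1 - Z1) X (topspace X - Z1) id a1"
      using hom_induced_compose'[OF m1(1) m mX1, of "int n" a1] by simp
    then show ?thesis using a1 by simp
  qed
  ultimately have r1eq: "?r1 a = ?r1 b1" using inj_onD[OF inj1] hom_induced_carrier by metis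
  let ?G = "?R ?T (W - Z)"
  interpret G: comm_group ?G by simp
  define d where "d = a \<otimes>\<^bsub>?G\<^esub> inv\<^bsub>?G\<^esub> b1"
  have dc: "d \<in> carrier ?G" unfolding d_def using a b1c by simp
  have "?r1 d = ?r1 a \<otimes>\<^bsub>?R ?T (W - Z1)\<^esub> inv\<^bsub>?R ?T (W - Z1)\<^esub> ?r1 b1"
  proof -
    interpret group_hom ?G "?R ?T (W - Z1)" ?r1
      by (rule group_hom.intro) (auto intro: group_hom_axioms.intro hom_induced_hom)
    show ?thesis unfolding d_def using a(1) b1c by simp
  qed
  also have "\<dots> = \<one>\<^bsub>?R ?T (W - Z1)\<^esub>"
    unfolding r1eq by (rule group.r_inv) (auto intro: hom_induced_carrier)
  finally have r1d: "?r1 d = \<one>\<^bsub>?R ?T (W - Z1)\<^esub>" .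
  have "W - Z \<subseteq> S" by (auto simp: S_def Z_def)
  from homology_exactness_triple_3[OF this, of "int n" ?T]
  have "kernel ?G (?R ?T S) (?h ?T (W - Z) ?T S id) = ?h (subtopology ?T S) (W - Z) ?T (W - Z) id ` carrier (?R (subtopology ?T S) (W - Z))"
    by simp
  moreover have TS: "subtopology ?T S = ?TS"
    by (simp add: subtopology_subtopology S_def inf.absorb2 Diff_subset)
  moreover have "d \<in> kernel ?G (?R ?T S) (?h ?T (W - Z) ?T S id)"
    using dc r1d by (simp add: kernel_def S_def)
  ultimately obtain g where g: "g \<in> carrier (?R ?TS (W - Z))" "?h ?TS (W - Z) ?T (W - Z) id g = d"
    by auto
  have SX: "topspace ?TS = S" using WX by (auto simp: S_def)
  have SZ: "S - Z2 = W - Z" by (auto simp: S_def Z_def)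
  have Q2S: "Q2 \<subseteq> S" using disj Q1(2) by (auto simp: S_def W_def)
  have oQ2: "openin ?TS Q2" using Q2(1) Q2S by (metis inf.absorb_iff2 inf_commute openin_subtopology_Int)
  have cZ2: "closedin ?TS Z2" using assms(3) Q2(2) Q2S by (intro closedin_subset_topspace) auto
  have gc: "g \<in> carrier (local_homology n ?TS Z2)" using g(1) by (simp add: SX SZ del: topspace_subtopology)
  obtain a2 where a2: "a2 \<in> carrier (?R (subtopology ?TS Q2) (Q2 - Z2))"
      "?h (subtopology ?TS Q2) (Q2 - Z2) ?TS (topspace ?TS - Z2) id a2 = g"
    using excision_lift[OF oQ2 cZ2 Q2(2) gc] .
  have TSQ2: "subtopology ?TS Q2 = subtopology X Q2" using Q2S by (simp add: subtopology_subtopology inf.absorb2)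
  have a2c: "a2 \<in> carrier (?R (subtopology X Q2) (Q2 - Z2))" using a2(1) TSQ2 by simp
  have a2g: "?h (subtopology X Q2) (Q2 - Z2) ?TS (W - Z) id a2 = g" using a2(2) unfolding TSQ2 SX SZ .
  define b2 where "b2 = ?h (subtopology X Q2) (Q2 - Z2) ?T (W - Z) id a2"
  have "b2 = d"
  proof -
    have m: "continuous_map (subtopology X Q2) ?TS id" "id \<in> Q2 - Z2 \<rightarrow> W - Z"
      "continuous_map ?TS ?T id" "id \<in> W - Z \<rightarrow> W - Z"
      using continuous_map_id_subtopology[OF Q2S] continuous_map_id_subtopology[of S W] Q2Z by (auto simp: S_def)
    show ?thesis using hom_induced_compose'[OF m, of "int n" a2] g(2) a2g by (simp add: b2_def)
  qed
  then have ab: "a = b2 \<otimes>\<^bsub>?G\<^esub> b1"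
    unfolding d_def using a(1) b1c by (simp add: G.m_assoc del: one_relative_homology_group)
  have b2c: "b2 \<in> carrier ?G" unfolding b2_def by (rule hom_induced_carrier)
  have "?h (subtopology X Q2) (Q2 - Z2) X (topspace X - Z2) id a2 = c2"
  proof -
    let ?i2 = "?h ?T (W - Z2) X (topspace X - Z2) id"
    have "?r2 b1 = \<one>\<^bsub>?R ?T (W - Z2)\<^esub>"
    proof -
      have m: "id \<in> Q1 - Z1 \<rightarrow> W - Z2" using Q1Z by (auto simp: Z_def)
      have "?r2 b1 = ?h (subtopology X Q1) (Q1 - Z1) ?T (W - Z2) id a1"
        unfolding b1_def using hom_induced_compose'[OF m1 mW2, of "int n" a1] by simp
      also have "\<dots> = \<one>\<^bsub>?R ?T (W - Z2)\<^esub>"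
      proof (rule hom_induced_into_subspace_trivial[OF m1(1)])
        show "id \<in> topspace (subtopology X Q1) \<rightarrow> W - Z2" using disj Q2(2) by (auto simp: W_def)
        show "Q1 - Z1 \<subseteq> topspace (subtopology X Q1)" using openin_subset[OF Q1(1)] by auto
      qed
      finally show ?thesis .
    qed
    moreover have "?r2 a = ?r2 b2 \<otimes>\<^bsub>?R ?T (W - Z2)\<^esub> ?r2 b1"
      unfolding ab by (rule hom_mult[OF hom_induced_hom b2c b1c])
    ultimately have "?r2 a = ?r2 b2"
      using monoid.r_one[OF group.is_monoid[OF group_relative_homology_group] hom_induced_carrier] by metis
    have "c2 = ?i2 (?r2 a)"
      unfolding c2_def using hom_induced_compose'[OF mW2 mX2, of "int n" a] hom_induced_compose'[OF mXZ mr2, of "int n" a] a(2)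
      by simp
    also have "\<dots> = ?i2 (?r2 b2)" using \<open>?r2 a = ?r2 b2\<close> by simp
    also have "?r2 b2 = ?h (subtopology X Q2) (Q2 - Z2) ?T (W - Z2) id a2"
      unfolding b2_def using hom_induced_compose'[OF m2 mW2, of "int n" a2] by simp
    also have "?i2 \<dots> = ?h (subtopology X Q2) (Q2 - Z2) X (topspace X - Z2) id a2"
    proof -
      have m: "id \<in> Q2 - Z2 \<rightarrow> W - Z2" using Q2W by auto
      show ?thesis using hom_induced_compose'[OF m2(1) m mX2, of "int n" a2] by simp
    qed
    finally show ?thesis by simp
  qed
  note deg2 = map_degree_eq[OF Q2(1) assms(3) Q2(2) a2c this, of u]
  note deg1 = map_degree_eq[OF Q1(1) assms(2) Q1(2) a1, of u]
  have "map_degree n X Q Z c u = map_degree n X W Z c u"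
    using map_degree_shrink[OF u[folded Z_def] oW WQ cZ] by simp
  also have "\<dots> = local_int n (?h ?T (W - Z) ?E ?P u (b2 \<otimes>\<^bsub>?G\<^esub> b1))"
    using map_degree_eq[OF oW clZ WQ(2) a, of u] ab by simp
  also have "?h ?T (W - Z) ?E ?P u (b2 \<otimes>\<^bsub>?G\<^esub> b1) =
      ?h ?T (W - Z) ?E ?P u b2 \<otimes>\<^bsub>local_group n\<^esub> ?h ?T (W - Z) ?E ?P u b1"
    by (rule hom_mult[OF hom_induced_hom b2c b1c])
  also have "local_int n \<dots> = local_int n (?h ?T (W - Z) ?E ?P u b2) + local_int n (?h ?T (W - Z) ?E ?P u b1)"
    by (rule local_int_mult) (rule hom_induced_carrier)+
  also have "?h ?T (W - Z) ?E ?P u b2 = ?h (subtopology X Q2) (Q2 - Z2) ?E ?P u a2"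
    unfolding b2_def using hom_induced_compose'[OF m2 cu uP, of "int n" a2] by simp
  also have "?h ?T (W - Z) ?E ?P u b1 = ?h (subtopology X Q1) (Q1 - Z1) ?E ?P u a1"
    unfolding b1_def using hom_induced_compose'[OF m1 cu uP, of "int n" a1] by simp
  finally show ?thesis using deg1 deg2 by (simp add: c1_def c2_def Z_def)
qed

section \<open>Isolated zeros\<close>

text \<open>By \<open>map_degree_shrink\<close> the value does not depend on the choice of \<open>Q\<close>;
  see \<open>local_degree_eq\<close>.\<close>

definition local_degree :: "nat \<Rightarrow> 'a topology \<Rightarrow> ('a \<Rightarrow> 'a chain set) \<Rightarrow> ('a \<Rightarrow> nat \<Rightarrow> real) \<Rightarrow> 'a \<Rightarrow> int" where
  "local_degree n X \<mu> u z = map_degree n X (SOME Q. isolates n X Q {z} u) {z} (\<mu> z) u"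

lemma isolates_subset:
  assumes "isolates n X Q Z u" "openin X Q'" "closedin X Z'" "Z' \<subseteq> Q'" "Q' \<subseteq> Q" "Q' \<inter> Z \<subseteq> Z'"
  shows "isolates n X Q' Z' u"
  using assms unfolding isolates_def
  by (auto intro: continuous_map_from_subtopology_mono)

lemma local_degree_eq:
  assumes "isolates n X Q {z} u" "\<mu> z \<in> carrier (local_homology n X {z})"
  shows "local_degree n X \<mu> u z = map_degree n X Q {z} (\<mu> z) u"
proof -
  define Q' where "Q' = (SOME Q. isolates n X Q {z} u)"
  have Q': "isolates n X Q' {z} u" unfolding Q'_def using someI_ex assms(1) by metis
  have "openin X (Q \<inter> Q')" using Q' assms(1) by (auto simp: isolates_def)
  then have "map_degree n X (Q \<inter> Q') {z} (\<mu> z) u = map_degree n X Q' {z} (\<mu> z) u"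
    "map_degree n X (Q \<inter> Q') {z} (\<mu> z) u = map_degree n X Q {z} (\<mu> z) u"
    using Q' assms by (intro map_degree_shrink; auto simp: isolates_def)+
  then show ?thesis by (simp add: local_degree_def Q'_def)
qed

lemma local_degree_cong:
  assumes "isolates n X Q {z} u" "\<mu> z \<in> carrier (local_homology n X {z})"
    and "openin X V" "z \<in> V" "\<And>x. x \<in> V \<Longrightarrow> u x = v x"
  shows "local_degree n X \<mu> u z = local_degree n X \<mu> v z"
proof -
  have o: "openin X (Q \<inter> V)" using assms by (auto simp: isolates_def)
  have u: "isolates n X (Q \<inter> V) {z} u"
    by (rule isolates_subset[OF assms(1) o]) (use assms in \<open>auto simp: isolates_def\<close>)
  have v: "isolates n X (Q \<inter> V) {z} v"
    using u assms(5) unfolding isolates_def by (auto intro: continuous_map_eq)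
  show ?thesis
    unfolding local_degree_eq[where \<mu>=\<mu> and z=z, OF u assms(2)] local_degree_eq[where \<mu>=\<mu> and z=z, OF v assms(2)]
    by (rule map_degree_cong) (use assms in auto)
qed

lemma Hausdorff_separate_finite:
  assumes "Hausdorff_space X" "finite Z" "Z \<subseteq> topspace X" "z \<in> topspace X" "z \<notin> Z"
  obtains U V where "openin X U" "openin X V" "z \<in> U" "Z \<subseteq> V" "U \<inter> V = {}"
proof -
  have "compactin X {z}" "compactin X Z" using assms by (auto intro: finite_imp_compactin)
  moreover have "disjnt {z} Z" using assms(5) by simp
  ultimately obtain U V where "openin X U" "openin X V" "{z} \<subseteq> U" "Z \<subseteq> V" "disjnt U V"
    using Hausdorff_space_compact_separation[OF assms(1)] by metis
  then show ?thesis using that by (auto simp: disjnt_def)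
qed

lemma map_degree_finite_sum:
  assumes X: "Hausdorff_space X" and "finite Z" and u: "isolates n X Q Z u"
    and c: "c \<in> carrier (local_homology n X Z)"
    and \<mu>: "\<And>z. z \<in> Z \<Longrightarrow> restrict_class n X Z {z} c = \<mu> z"
  shows "map_degree n X Q Z c u = (\<Sum>z\<in>Z. local_degree n X \<mu> u z)"
  using assms(2) u c \<mu>
proof (induction Z arbitrary: Q c rule: finite_induct)
  case empty
  then show ?case using map_degree_empty by simp
next
  case (insert z Z)
  have cl: "closedin X (insert z Z)" and oQ: "openin X Q" and sub: "insert z Z \<subseteq> Q"
    using insert.prems(1) by (auto simp: isolates_def)
  have ZX: "z \<in> topspace X" "Z \<subseteq> topspace X" using closedin_subset[OF cl] by auto
  have clz: "closedin X {z}" using X ZX by (simp add: closedin_Hausdorff_singleton)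
  have clZ: "closedin X Z" using X ZX insert.hyps by (simp add: closedin_Hausdorff_finite)
  obtain U V where UV: "openin X U" "openin X V" "z \<in> U" "Z \<subseteq> V" "U \<inter> V = {}"
    using Hausdorff_separate_finite[OF X insert.hyps(1) ZX(2,1) insert.hyps(2)] .
  have eq: "insert z Z = {z} \<union> Z" by simp
  let ?c1 = "restrict_class n X ({z} \<union> Z) {z} c" and ?c2 = "restrict_class n X ({z} \<union> Z) Z c"
  have sum: "map_degree n X Q ({z} \<union> Z) c u = map_degree n X (Q \<inter> U) {z} ?c1 u + map_degree n X (Q \<inter> V) Z ?c2 u"
    by (rule map_degree_Un) (use insert.prems UV oQ sub clz clZ in auto)
  have i1: "isolates n X (Q \<inter> U) {z} u"
    by (rule isolates_subset[OF insert.prems(1)]) (use UV oQ sub clz in auto)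
  have i2: "isolates n X (Q \<inter> V) Z u"
    by (rule isolates_subset[OF insert.prems(1)]) (use UV oQ sub clZ in auto)
  have mu: "?c1 = \<mu> z" using insert.prems(3)[of z] unfolding eq by blast
  have "map_degree n X (Q \<inter> U) {z} ?c1 u = local_degree n X \<mu> u z"
    unfolding mu by (rule local_degree_eq[OF i1, symmetric]) (simp add: mu[symmetric] hom_induced_carrier del: mu)
  moreover have "map_degree n X (Q \<inter> V) Z ?c2 u = (\<Sum>z\<in>Z. local_degree n X \<mu> u z)"
  proof (rule insert.IH[OF i2])
    show "?c2 \<in> carrier (local_homology n X Z)" by (rule hom_induced_carrier)
    fix y assume y: "y \<in> Z"
    have m: "continuous_map X X id" "id \<in> topspace X - ({z} \<union> Z) \<rightarrow> topspace X - Z" "continuous_map X X id" "id \<in> topspace X - Z \<rightarrow> topspace X - {y}"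
      using y by auto
    show "restrict_class n X Z {y} ?c2 = \<mu> y"
      using hom_induced_compose'[OF m, of "int n" c] insert.prems(3)[of y] y by simp
  qed
  ultimately show ?case using sum insert.hyps by simp
qed

section \<open>The number of zeros depends only on the boundary values\<close>

text \<open>The coherence condition of an orientation on a single open set.\<close>

definition oriented_near :: "nat \<Rightarrow> 'a topology \<Rightarrow> ('a \<Rightarrow> 'a chain set) \<Rightarrow> 'a set \<Rightarrow> bool" where
  "oriented_near n X \<mu> U \<longleftrightarrow> openin X U \<and>
     (\<exists>c\<in>carrier (local_homology n X U). \<forall>y\<in>U. restrict_class n X U {y} c = \<mu> y)"

definition locally_oriented :: "nat \<Rightarrow> 'a topology \<Rightarrow> ('a \<Rightarrow> 'a chain set) \<Rightarrow> bool" where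
  "locally_oriented n X \<mu> \<longleftrightarrow> (\<forall>x\<in>topspace X. \<exists>U. x \<in> U \<and> oriented_near n X \<mu> U)"

lemma oriented_near_carrier: "oriented_near n X \<mu> U \<Longrightarrow> y \<in> U \<Longrightarrow> \<mu> y \<in> carrier (local_homology n X {y})"
  unfolding oriented_near_def using hom_induced_carrier by metis

lemma locally_oriented_carrier:
  "locally_oriented n X \<mu> \<Longrightarrow> y \<in> topspace X \<Longrightarrow> \<mu> y \<in> carrier (local_homology n X {y})"
  unfolding locally_oriented_def using oriented_near_carrier by metis

definition zeros :: "('a \<Rightarrow> nat \<Rightarrow> real) \<Rightarrow> 'a set \<Rightarrow> 'a set" where
  "zeros u S = {x \<in> S. u x = zvec}"

definition degree_sum :: "nat \<Rightarrow> 'a topology \<Rightarrow> ('a \<Rightarrow> 'a chain set) \<Rightarrow> ('a \<Rightarrow> nat \<Rightarrow> real) \<Rightarrow> 'a set \<Rightarrow> int" where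
  "degree_sum n X \<mu> u S = (\<Sum>z\<in>zeros u S. local_degree n X \<mu> u z)"

lemma zeros_subset: "zeros u S \<subseteq> S" by (auto simp: zeros_def)

lemma zeros_mono: "S \<subseteq> T \<Longrightarrow> zeros u S \<subseteq> zeros u T" by (auto simp: zeros_def)

lemma degree_sum_Un:
  assumes "finite (zeros u S)" "finite (zeros u T)" "zeros u S \<inter> zeros u T = {}"
  shows "degree_sum n X \<mu> u (S \<union> T) = degree_sum n X \<mu> u S + degree_sum n X \<mu> u T"
proof -
  have "zeros u (S \<union> T) = zeros u S \<union> zeros u T" by (auto simp: zeros_def)
  then show ?thesis using assms by (simp add: degree_sum_def sum.union_disjoint)
qed

lemma isolates_at_zero:
  assumes X: "Hausdorff_space X" and Q: "openin X Q" "Q \<subseteq> C" and fin: "finite (zeros u Q)"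
    and u: "continuous_map (subtopology X C) (Euclidean_space n) u" and z: "z \<in> Q"
  shows "isolates n X (Q - (zeros u Q - {z})) {z} u"
proof -
  have QX: "Q \<subseteq> topspace X" using Q(1) openin_subset by blast
  have "closedin X (zeros u Q - {z})" "closedin X {z}"
    using X fin QX z zeros_subset[of u Q] by (auto intro!: closedin_Hausdorff_finite)
  then have o: "openin X (Q - (zeros u Q - {z}))" using Q(1) by (intro openin_diff)
  show ?thesis
    unfolding isolates_def
  proof (intro conjI o \<open>closedin X {z}\<close>)
    show "continuous_map (subtopology X (Q - (zeros u Q - {z}))) (Euclidean_space n) u"
      by (rule continuous_map_from_subtopology_mono[OF u]) (use Q in auto)
  qed (use z in \<open>auto simp: zeros_def\<close>)
qed

lemma isolates_zeros:
  assumes X: "Hausdorff_space X" and Q: "openin X Q" "Q \<subseteq> C" and fin: "finite (zeros u Q)"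
    and u: "continuous_map (subtopology X C) (Euclidean_space n) u"
  shows "isolates n X Q (zeros u Q) u"
proof -
  have QX: "Q \<subseteq> topspace X" using Q(1) openin_subset by blast
  then have "closedin X (zeros u Q)"
    using X fin zeros_subset[of u Q] by (intro closedin_Hausdorff_finite) auto
  then show ?thesis
    unfolding isolates_def using Q zeros_subset[of u Q] continuous_map_from_subtopology_mono[OF u Q(2)]
    by (auto simp: zeros_def)
qed

lemma degree_sum_cong:
  assumes X: "Hausdorff_space X" and Q: "openin X Q" "Q \<subseteq> C" and fin: "finite (zeros u Q)"
    and u: "continuous_map (subtopology X C) (Euclidean_space n) u"
    and \<mu>: "\<And>z. z \<in> Q \<Longrightarrow> \<mu> z \<in> carrier (local_homology n X {z})"
    and eq: "\<And>x. x \<in> Q \<Longrightarrow> u x = v x"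
  shows "degree_sum n X \<mu> u Q = degree_sum n X \<mu> v Q"
proof -
  have "zeros u Q = zeros v Q" using eq by (auto simp: zeros_def)
  moreover have "local_degree n X \<mu> u z = local_degree n X \<mu> v z" if "z \<in> zeros u Q" for z
    using that zeros_subset[of u Q] eq
    by (intro local_degree_cong[OF isolates_at_zero[OF X Q fin u] \<mu> Q(1)]) auto
  ultimately show ?thesis by (simp add: degree_sum_def)
qed

text \<open>Inside one oriented chart the sum is the value of a single homology class by
  \<open>map_degree_finite_sum\<close>, and hence invariant under a linear homotopy. The zeros
  of the homotopy lie in the closed set where
  \<open>\<bar>u - v\<bar> \<ge> \<bar>u\<bar>\<close>, and this set lies in \<open>Q\<close>
  because \<open>u = v \<noteq> 0\<close> outside \<open>Q\<close>.\<close>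

lemma degree_sum_local:
  assumes X: "Hausdorff_space X" and or: "oriented_near n X \<mu> U"
    and Q: "openin X Q" "Q \<subseteq> K" and K: "compactin X K" "K \<subseteq> U"
    and u: "continuous_map (subtopology X K) (Euclidean_space n) u"
    and v: "continuous_map (subtopology X K) (Euclidean_space n) v"
    and eq: "\<And>x. x \<in> K - Q \<Longrightarrow> u x = v x \<and> u x \<noteq> zvec"
    and fin: "finite (zeros u Q)" "finite (zeros v Q)"
  shows "degree_sum n X \<mu> u Q = degree_sum n X \<mu> v Q"
proof -
  obtain c where oU: "openin X U" and c: "c \<in> carrier (local_homology n X U)"
    and \<mu>: "\<And>y. y \<in> U \<Longrightarrow> restrict_class n X U {y} c = \<mu> y"
    using or by (auto simp: oriented_near_def)
  have KX: "K \<subseteq> topspace X" using K(1) compactin_subset_topspace by blast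
  have clK: "closedin X K" using X K compactin_imp_closedin by blast
  define f where "f x = (\<Sum>i<n. \<bar>u x i - v x i\<bar>) - (\<Sum>i<n. \<bar>u x i\<bar>)" for x
  define Z where "Z = {x \<in> topspace (subtopology X K). f x \<in> {0..}}"
  have "continuous_map (subtopology X K) euclideanreal f"
    unfolding f_def
    by (intro continuous_map_diff continuous_map_sum continuous_map_real_abs
        continuous_map_Euclidean_coord[OF u] continuous_map_Euclidean_coord[OF v]) auto
  then have "closedin (subtopology X K) Z" unfolding Z_def by (rule closedin_continuous_map_preimage) auto
  then have clZ: "closedin X Z" using clK closedin_trans_full by blast
  have uv0: "u x i = 0" "v x i = 0" if "x \<in> K" "i \<ge> n" for x i
    using u v that KX by (auto simp: continuous_map_Euclidean_iff)
  have ZQ: "Z \<subseteq> Q"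
  proof
    fix x assume x: "x \<in> Z"
    then have xK: "x \<in> K" "f x \<ge> 0" by (auto simp: Z_def)
    show "x \<in> Q"
    proof (rule ccontr)
      assume "x \<notin> Q"
      then have uv: "u x = v x" "u x \<noteq> zvec" using eq[of x] xK by blast+
      then have "(\<Sum>i<n. \<bar>u x i\<bar>) \<le> 0" using xK by (simp add: f_def)
      then have "(\<Sum>i<n. \<bar>u x i\<bar>) = 0" by (intro order.antisym sum_nonneg) auto
      then have "\<forall>i<n. u x i = 0" by (simp add: sum_nonneg_eq_0_iff)
      then have "u x i = 0" for i using uv0(1)[OF xK(1), of i] by (cases "i < n") auto
      then show False using uv(2) by auto
    qed
  qed
  have nz: "(\<lambda>i. (1 - t) * u x i + t * v x i) \<noteq> zvec" if x: "x \<in> Q - Z" and t: "0 \<le> t" "t \<le> 1" for x t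
  proof
    assume "(\<lambda>i. (1 - t) * u x i + t * v x i) = zvec"
    then have "(1 - t) * u x i + t * v x i = 0" for i by meson
    then have "u x i = t * (u x i - v x i)" for i by (simp add: algebra_simps)
    then have "\<bar>u x i\<bar> = t * \<bar>u x i - v x i\<bar>" for i using t by (metis abs_mult abs_of_nonneg)
    then have "\<bar>u x i\<bar> \<le> \<bar>u x i - v x i\<bar>" for i
      using mult_right_mono[OF t(2), of "\<bar>u x i - v x i\<bar>"] by simp
    then have "(\<Sum>i<n. \<bar>u x i\<bar>) \<le> (\<Sum>i<n. \<bar>u x i - v x i\<bar>)" by (intro sum_mono)
    then have "x \<in> Z" using x Q(2) KX by (auto simp: Z_def f_def)
    then show False using x by simp
  qed
  have QU: "Q \<subseteq> U" using Q(2) K(2) by blast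
  have cUZ: "restrict_class n X U Z c \<in> carrier (local_homology n X Z)" by (rule hom_induced_carrier)
  have main: "map_degree n X Q Z (restrict_class n X U Z c) w = degree_sum n X \<mu> w Q"
    if w: "continuous_map (subtopology X K) (Euclidean_space n) w" and fw: "finite (zeros w Q)"
      and wZ: "zeros w Q \<subseteq> Z" for w
  proof -
    have iso: "isolates n X Q (zeros w Q) w" by (rule isolates_zeros[OF X Q fw w])
    have "map_degree n X Q Z (restrict_class n X U Z c) w
        = map_degree n X Q (zeros w Q) (restrict_class n X Z (zeros w Q) (restrict_class n X U Z c)) w"
      by (rule map_degree_restrict_class[OF iso clZ wZ ZQ cUZ])
    also have "\<dots> = (\<Sum>z\<in>zeros w Q. local_degree n X \<mu> w z)"
    proof (rule map_degree_finite_sum[OF X fw iso hom_induced_carrier])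
      fix z assume z: "z \<in> zeros w Q"
      have zs: "z \<in> Z" "z \<in> Q" using z wZ by (auto simp: zeros_def)
      have m: "continuous_map X X id" "id \<in> topspace X - Z \<rightarrow> topspace X - zeros w Q"
        "continuous_map X X id" "id \<in> topspace X - zeros w Q \<rightarrow> topspace X - {z}"
        using z wZ by auto
      have m': "continuous_map X X id" "id \<in> topspace X - U \<rightarrow> topspace X - Z"
        "continuous_map X X id" "id \<in> topspace X - Z \<rightarrow> topspace X - {z}"
        using zs ZQ QU by auto
      show "restrict_class n X (zeros w Q) {z} (restrict_class n X Z (zeros w Q) (restrict_class n X U Z c)) = \<mu> z"
        using hom_induced_compose'[OF m] hom_induced_compose'[OF m'] \<mu>[of z] zs QU by auto
    qed
    finally show ?thesis by (simp add: degree_sum_def)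
  qed
  have "zeros u Q \<subseteq> Z" "zeros v Q \<subseteq> Z"
    using Q(2) KX by (auto simp: zeros_def Z_def f_def sum_nonneg)
  then have "degree_sum n X \<mu> u Q = map_degree n X Q Z (restrict_class n X U Z c) u"
    "degree_sum n X \<mu> v Q = map_degree n X Q Z (restrict_class n X U Z c) v"
    using main u v fin by auto
  moreover have "map_degree n X Q Z (restrict_class n X U Z c) u = map_degree n X Q Z (restrict_class n X U Z c) v"
    using nz openin_subset[OF Q(1)]
    by (intro map_degree_linear_homotopy continuous_map_from_subtopology_mono[OF u Q(2)] continuous_map_from_subtopology_mono[OF v Q(2)])
       auto
  ultimately show ?thesis by simp
qed

text \<open>Cells need neither be disjoint nor fit together; the two extension properties are the only
  information about them that is used.\<close>

definition Euclidean_cell :: "nat \<Rightarrow> 'a topology \<Rightarrow> 'a set \<Rightarrow> 'a set \<Rightarrow> bool" where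
  "Euclidean_cell n X K K0 \<longleftrightarrow> compactin X K \<and> openin X K0 \<and> K0 \<subseteq> K \<and>
     extendable (subtopology X (K - K0)) (punct n) \<and> finite_zero_extendable n (subtopology X K)"

lemma extendable_subset:
  assumes "extendable (subtopology X S) Q" "closedin X T" "T \<subseteq> S"
  shows "extendable (subtopology X T) Q"
  using extendable_closed_subset[OF assms(1) closedin_subset_topspace[OF assms(2,3)]] assms(3)
  by (simp add: subtopology_subtopology inf.absorb2)

text \<open>Any cover by cells allows one to pass from \<open>u\<close> to \<open>v\<close> by changes that
  are each confined to one oriented chart. For the first cell \<open>K\<close>, the intermediate
  map equals \<open>u\<close> outside the interior \<open>K0\<close> and outside
  \<open>Q\<close>, and equals \<open>v\<close> on the part of \<open>K\<close> that is not
  covered by the interiors of the later cells. On the boundaries of the cells it is extended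
  without zeros, and the rest of \<open>K\<close> is filled with finitely many zeros. The change
  from \<open>u\<close> takes place in \<open>K0\<close>, so that
  \<open>degree_sum_local\<close> applies, and the intermediate map differs from
  \<open>v\<close> only on the later cells.\<close>

lemma degree_sum_cells:
  assumes X: "Hausdorff_space X" and \<mu>: "\<And>z. z \<in> topspace X \<Longrightarrow> \<mu> z \<in> carrier (local_homology n X {z})"
    and C: "compactin X C" and Q: "openin X Q" "Q \<subseteq> C"
    and v: "continuous_map (subtopology X C) (Euclidean_space n) v" "finite (zeros v C)"
  shows "\<lbrakk>\<And>K K0. (K, K0) \<in> set cs \<Longrightarrow> Euclidean_cell n X K K0 \<and> (\<exists>U. K \<subseteq> U \<and> oriented_near n X \<mu> U);
     continuous_map (subtopology X C) (Euclidean_space n) u; finite (zeros u C);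
     \<And>x. x \<in> C - Q \<Longrightarrow> u x = v x \<and> u x \<noteq> zvec;
     \<And>K K0 x. (K, K0) \<in> set cs \<Longrightarrow> x \<in> C \<inter> (K - K0) \<Longrightarrow> u x \<noteq> zvec \<and> v x \<noteq> zvec;
     \<And>x. x \<in> C - \<Union>(snd ` set cs) \<Longrightarrow> u x = v x\<rbrakk>
   \<Longrightarrow> degree_sum n X \<mu> u Q = degree_sum n X \<mu> v Q"
proof (induction cs arbitrary: u)
  case Nil
  have fin: "finite (zeros u Q)" using Nil(3) zeros_mono[OF Q(2)] finite_subset by blast
  show ?case
    by (rule degree_sum_cong[OF X Q fin Nil(2)]) (use \<mu> openin_subset[OF Q(1)] Nil(6) Q(2) in auto)
next
  case (Cons KK cs)
  obtain K K0 where KK: "KK = (K, K0)" by (cases KK)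
  note u = Cons.prems(2,3)
  have cell: "Euclidean_cell n X K K0" and ex: "\<exists>U. K \<subseteq> U \<and> oriented_near n X \<mu> U"
    using Cons.prems(1)[of K K0] KK by auto
  obtain U where U: "K \<subseteq> U" "oriented_near n X \<mu> U" using ex by blast
  have K: "compactin X K" "openin X K0" "K0 \<subseteq> K" "finite_zero_extendable n (subtopology X K)"
    using cell by (auto simp: Euclidean_cell_def)
  have clC: "closedin X C" using X C compactin_imp_closedin by blast
  have clK: "closedin X K" using X K compactin_imp_closedin by blast
  have cells: "Euclidean_cell n X (fst p) (snd p)" if "p \<in> set (KK # cs)" for p
    using Cons.prems(1)[of "fst p" "snd p"] that by simp
  define R where "R = \<Union>(snd ` set cs)"
  define KR where "KR = \<Union>(fst ` set cs)"
  define Y where "Y = (\<Union>p\<in>set (KK # cs). C \<inter> (fst p - snd p))"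
  have oR: "openin X R" unfolding R_def
    by (rule openin_Union) (use cells in \<open>force simp: Euclidean_cell_def\<close>)
  have clKR: "closedin X KR" unfolding KR_def
    by (rule closedin_Union) (use cells X in \<open>auto simp: Euclidean_cell_def intro: compactin_imp_closedin\<close>)
  have RK: "R \<subseteq> KR" unfolding R_def KR_def using cells by (fastforce simp: Euclidean_cell_def)
  have clb: "closedin X (C \<inter> (fst p - snd p))" if "p \<in> set (KK # cs)" for p
    using cells[OF that] clC X compactin_imp_closedin[OF X]
    by (intro closedin_Int closedin_diff) (auto simp: Euclidean_cell_def)
  have clY: "closedin X Y" unfolding Y_def by (intro closedin_Union) (use clb in auto)
  have extY: "extendable (subtopology X Y) (punct n)" unfolding Y_def
  proof (rule extendable_Union)
    fix p assume p: "p \<in> set (KK # cs)"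
    show "closedin X (C \<inter> (fst p - snd p))" by (rule clb[OF p])
    show "extendable (subtopology X (C \<inter> (fst p - snd p))) (punct n)"
      by (rule extendable_subset[OF _ clb[OF p]]) (use cells[OF p] in \<open>auto simp: Euclidean_cell_def\<close>)
  qed auto
  have YC: "Y \<subseteq> C" by (auto simp: Y_def)
  have bK: "C \<inter> (K - K0) \<subseteq> Y" by (auto simp: Y_def KK)
  have Ynz: "u x \<noteq> zvec \<and> v x \<noteq> zvec" if "x \<in> Y" for x
  proof -
    obtain p where "p \<in> set (KK # cs)" "x \<in> C \<inter> (fst p - snd p)" using \<open>x \<in> Y\<close> unfolding Y_def by blast
    then show ?thesis using Cons.prems(5)[of "fst p" "snd p" x] by simp
  qed
  have bKR: "x \<in> Y" if "x \<in> C" "x \<in> KR" "x \<notin> R" for x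
    using that by (force simp: Y_def KR_def R_def)
  define A1 where "A1 = (C - K0) \<union> (C - Q)"
  define A2 where "A2 = (C \<inter> K) - R"
  have clA1: "closedin X A1" unfolding A1_def using clC K Q by (intro closedin_Un closedin_diff)
  have clA2: "closedin X A2" unfolding A2_def using clC clK oR by (intro closedin_Int closedin_diff)
  have A12: "A1 \<subseteq> C" "A2 \<subseteq> C" by (auto simp: A1_def A2_def)
  have uvA: "u x = v x" if "x \<in> A1 \<inter> A2" for x
    using that Cons.prems(4,6) by (auto simp: A1_def A2_def R_def KK)
  define w0 where "w0 x = (if x \<in> A1 then u x else v x)" for x
  have w0: "continuous_map (subtopology X (A1 \<union> A2)) (Euclidean_space n) w0"
    unfolding w0_def
    by (rule paste_closed2[OF clA1 clA2 continuous_map_from_subtopology_mono[OF u(1) A12(1)]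
        continuous_map_from_subtopology_mono[OF v(1) A12(2)] uvA])
  define A where "A = A1 \<union> A2"
  have clA: "closedin X A" unfolding A_def using clA1 clA2 by (rule closedin_Un)
  have AC: "A \<subseteq> C" using A12 by (auto simp: A_def)
  have w0P: "continuous_map (subtopology X (A \<inter> Y)) (punct n) w0"
    unfolding continuous_map_punct_iff
  proof
    show "continuous_map (subtopology X (A \<inter> Y)) (Euclidean_space n) w0"
      by (rule continuous_map_from_subtopology_mono[OF w0]) (auto simp: A_def)
    show "\<forall>x\<in>topspace (subtopology X (A \<inter> Y)). w0 x \<noteq> zvec" using Ynz by (auto simp: w0_def)
  qed
  obtain w1 where w1: "continuous_map (subtopology X Y) (punct n) w1" "\<And>a. a \<in> A \<inter> Y \<Longrightarrow> w1 a = w0 a"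
  proof (rule extendableD[OF extY])
    show "closedin (subtopology X Y) (A \<inter> Y)" by (metis clA closedin_subtopology)
    show "continuous_map (subtopology (subtopology X Y) (A \<inter> Y)) (punct n) w0"
      using w0P by (simp add: subtopology_subtopology inf.absorb2)
  qed (use that in blast)
  define w2 where "w2 x = (if x \<in> A then w0 x else w1 x)" for x
  have w1E: "continuous_map (subtopology X Y) (Euclidean_space n) w1"
    using w1(1) by (simp add: continuous_map_punct_iff)
  have w2: "continuous_map (subtopology X (A \<union> Y)) (Euclidean_space n) w2"
    unfolding w2_def by (rule paste_closed2[OF clA clY w0[folded A_def] w1E]) (use w1(2) in auto)
  have YX: "Y \<subseteq> topspace X" using clY closedin_subset by blast
  have w1nz: "w1 x \<noteq> zvec" if "x \<in> Y" for x
  proof -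
    have "x \<in> topspace (subtopology X Y)" using that YX by auto
    then show ?thesis using w1(1) by (auto simp: continuous_map_punct_iff)
  qed
  have w2Y: "w2 x \<noteq> zvec" if "x \<in> Y" for x
    using that w1nz Ynz by (auto simp: w2_def w0_def)
  define E where "E = C \<inter> K \<inter> KR"
  define B where "B = E \<inter> (A \<union> Y)"
  have clE: "closedin X E" unfolding E_def using clC clK clKR by (intro closedin_Int)
  have clAY: "closedin X (A \<union> Y)" using clA clY by (rule closedin_Un)
  have clB: "closedin X B" unfolding B_def using clE clAY by (rule closedin_Int)
  have BK: "B \<subseteq> K" by (auto simp: B_def E_def)
  have w2B: "w2 x \<noteq> zvec" if x: "x \<in> B" for x
  proof (cases "x \<in> Y")
    case False
    have xA: "x \<in> A" and xE: "x \<in> C" "x \<in> K" "x \<in> KR" using x False by (auto simp: B_def E_def)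
    have "x \<in> A1" using xA bKR[of x] False xE by (auto simp: A_def A2_def)
    moreover have "x \<in> K0" using bK xE False by auto
    ultimately have "x \<in> C - Q" by (auto simp: A1_def)
    then have "u x \<noteq> zvec" using Cons.prems(4)[of x] by blast
    then show ?thesis using xA \<open>x \<in> A1\<close> by (simp add: w2_def w0_def)
  qed (use w2Y in auto)
  obtain t where t: "continuous_map (subtopology X K) (Euclidean_space n) t" "\<And>a. a \<in> B \<Longrightarrow> t a = w2 a"
     "finite {y \<in> topspace (subtopology X K). t y = zvec}"
  proof (rule finite_zero_extendableD[OF K(4)])
    show "closedin (subtopology X K) B" using clB BK by (rule closedin_subset_topspace)
    show "continuous_map (subtopology (subtopology X K) B) (punct n) w2"
      unfolding continuous_map_punct_iff
    proof
      show "continuous_map (subtopology (subtopology X K) B) (Euclidean_space n) w2"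
        unfolding subtopology_subtopology
        by (rule continuous_map_from_subtopology_mono[OF w2]) (auto simp: B_def)
    qed (use w2B in auto)
  qed (use that in blast)
  define w where "w x = (if x \<in> A \<union> Y then w2 x else t x)" for x
  have "E \<subseteq> K" by (auto simp: E_def)
  have wc: "continuous_map (subtopology X ((A \<union> Y) \<union> E)) (Euclidean_space n) w"
    unfolding w_def
    by (rule paste_closed2[OF clAY clE w2 continuous_map_from_subtopology_mono[OF t(1) \<open>E \<subseteq> K\<close>]])
       (use t(2) in \<open>auto simp: B_def\<close>)
  have cover: "(A \<union> Y) \<union> E = C"
    using AC YC RK K(3) by (auto simp: A_def A1_def A2_def E_def)
  have wC: "continuous_map (subtopology X C) (Euclidean_space n) w" using wc cover by simp
  have w_eq_u: "w x = u x" if "x \<in> A1" for x using that by (simp add: w_def w2_def w0_def A_def)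
  have w_eq_v: "w x = v x" if "x \<in> A2" for x using that uvA by (auto simp: w_def w2_def w0_def A_def)
  have wY: "w x \<noteq> zvec" if "x \<in> Y" for x using that w2Y by (simp add: w_def)
  have finw: "finite (zeros w C)"
  proof (rule finite_subset)
    show "zeros w C \<subseteq> zeros u C \<union> zeros v C \<union> {y \<in> topspace (subtopology X K). t y = zvec}"
    proof
      fix x assume "x \<in> zeros w C"
      then have x: "x \<in> C" "w x = zvec" by (auto simp: zeros_def)
      show "x \<in> zeros u C \<union> zeros v C \<union> {y \<in> topspace (subtopology X K). t y = zvec}"
      proof (cases "x \<in> A \<union> Y")
        case True
        then have "x \<in> A1 \<or> x \<in> A2" using wY x by (auto simp: A_def)
        then show ?thesis using w_eq_u w_eq_v x by (auto simp: zeros_def)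
      next
        case False
        then have "x \<in> K" using cover x by (auto simp: E_def)
        then show ?thesis using False x compactin_subset_topspace[OF K(1)] by (auto simp: w_def)
      qed
    qed
  qed (use u(2) v(2) t(3) in auto)
  have IH: "degree_sum n X \<mu> w Q = degree_sum n X \<mu> v Q"
  proof (rule Cons.IH[OF _ wC finw])
    fix L L0 assume L: "(L, L0) \<in> set cs"
    show "Euclidean_cell n X L L0 \<and> (\<exists>U. L \<subseteq> U \<and> oriented_near n X \<mu> U)" using Cons.prems(1)[of L L0] L by simp
    fix x assume x: "x \<in> C \<inter> (L - L0)"
    then have "x \<in> Y" using L by (force simp: Y_def)
    then show "w x \<noteq> zvec \<and> v x \<noteq> zvec" using wY Ynz by blast
  next
    fix x assume x: "x \<in> C - Q"
    then have "x \<in> A1" by (simp add: A1_def)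
    then have "w x = u x" by (rule w_eq_u)
    then show "w x = v x \<and> w x \<noteq> zvec" using Cons.prems(4)[OF x] by metis
  next
    fix x assume x: "x \<in> C - \<Union>(snd ` set cs)"
    show "w x = v x"
    proof (cases "x \<in> K")
      case True
      then show ?thesis using x by (intro w_eq_v) (auto simp: A2_def R_def)
    next
      case False
      then have "x \<in> A1" using x K(3) by (auto simp: A1_def)
      moreover have "u x = v x" using Cons.prems(6)[of x] x False K(3) by (auto simp: KK)
      ultimately show ?thesis using w_eq_u by simp
    qed
  qed
  have QC: "Q \<inter> K0 \<subseteq> C \<inter> K" using Q(2) K(3) by auto
  have oQK: "openin X (Q \<inter> K0)" using Q(1) K(2) by (rule openin_Int)
  have fins: "finite (zeros u S)" "finite (zeros w S)" if "S \<subseteq> C" for S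
    using u(2) finw zeros_mono[OF that] finite_subset by blast+
  have local: "degree_sum n X \<mu> u (Q \<inter> K0) = degree_sum n X \<mu> w (Q \<inter> K0)"
  proof (rule degree_sum_local[OF X U(2) oQK QC])
    show "compactin X (C \<inter> K)" using C clK by (simp add: compact_Int_closedin)
    show "continuous_map (subtopology X (C \<inter> K)) (Euclidean_space n) u"
      "continuous_map (subtopology X (C \<inter> K)) (Euclidean_space n) w"
      using continuous_map_from_subtopology_mono[OF u(1)] continuous_map_from_subtopology_mono[OF wC] by blast+
    fix x assume x: "x \<in> C \<inter> K - Q \<inter> K0"
    then have "x \<in> A1" by (auto simp: A1_def)
    moreover have "u x \<noteq> zvec" using x Cons.prems(4)[of x] bK Ynz by auto
    ultimately show "u x = w x \<and> u x \<noteq> zvec" using w_eq_u by simp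
  next
    show "C \<inter> K \<subseteq> U" using U(1) by blast
    show "finite (zeros u (Q \<inter> K0))" "finite (zeros w (Q \<inter> K0))" using fins[of "Q \<inter> K0"] Q(2) by blast+
  qed
  have oQK': "openin X (Q - K)" using Q(1) clK by (rule openin_diff)
  have uw: "u x = w x" if "x \<in> Q - K" for x
    by (rule sym, rule w_eq_u) (use that Q(2) K(3) in \<open>auto simp: A1_def\<close>)
  have outer: "degree_sum n X \<mu> u (Q - K) = degree_sum n X \<mu> w (Q - K)"
    by (rule degree_sum_cong[OF X oQK' _ fins(1) u(1)])
       (use Q(2) \<mu> openin_subset[OF Q(1)] uw in auto)
  have split: "zeros f Q = zeros f (Q \<inter> K0) \<union> zeros f (Q - K)" if "\<And>x. x \<in> Y \<Longrightarrow> f x \<noteq> zvec" for f :: "'a \<Rightarrow> nat \<Rightarrow> real"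
    using that bK K(3) Q(2) by (auto simp: zeros_def)
  have parts: "degree_sum n X \<mu> f Q = degree_sum n X \<mu> f (Q \<inter> K0) + degree_sum n X \<mu> f (Q - K)"
    if "\<And>x. x \<in> Y \<Longrightarrow> f x \<noteq> zvec" "finite (zeros f Q)" for f
  proof -
    have "zeros f (Q \<inter> K0) \<inter> zeros f (Q - K) = {}" using K(3) by (auto simp: zeros_def)
    moreover have "finite (zeros f (Q \<inter> K0))" "finite (zeros f (Q - K))"
      using that(2) by (auto intro: finite_subset[OF zeros_mono])
    moreover have eq: "zeros f Q = zeros f (Q \<inter> K0) \<union> zeros f (Q - K)" by (rule split[OF that(1)])
    ultimately show ?thesis unfolding degree_sum_def eq by (intro sum.union_disjoint)
  qed
  have "degree_sum n X \<mu> u Q = degree_sum n X \<mu> w Q"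
    using parts[of u] parts[of w] Ynz wY fins[OF Q(2)] local outer by simp
  then show ?case using IH by simp
qed

definition locally_Euclidean :: "nat \<Rightarrow> 'a topology \<Rightarrow> bool" where
  "locally_Euclidean n X \<longleftrightarrow> (\<forall>x\<in>topspace X. \<exists>U. openin X U \<and> x \<in> U \<and>
        subtopology X U homeomorphic_space Euclidean_space n)"

lemma sup_gauge_diff_le_iff:
  "x \<in> topspace (Euclidean_space n) \<Longrightarrow> r \<ge> 0 \<Longrightarrow> x \<in> cube n a r \<longleftrightarrow> sup_gauge n (\<lambda>i. x i - a i) \<le> r"
  and sup_gauge_diff_less_iff:
  "x \<in> topspace (Euclidean_space n) \<Longrightarrow> r > 0 \<Longrightarrow> x \<in> open_cube n a r \<longleftrightarrow> sup_gauge n (\<lambda>i. x i - a i) < r"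
  by (simp_all add: sup_gauge_le_iff sup_gauge_less_iff cube_def open_cube_def)

lemma continuous_map_translate:
  "a \<in> topspace (Euclidean_space n) \<Longrightarrow>
     continuous_map (Euclidean_space n) (Euclidean_space n) (\<lambda>x i. x i - a i)"
  using continuous_map_affine[of "\<lambda>i. - a i" n 1] by (simp add: topspace_Euclidean_space)

lemma openin_contains_cube:
  assumes W: "openin (Euclidean_space n) W" and a: "a \<in> W"
  obtains m where "m > 0" "\<And>r. r < m \<Longrightarrow> cube n a r \<subseteq> W"
proof -
  let ?E = "Euclidean_space n"
  have aE: "a \<in> topspace ?E" using openin_subset[OF W] a by blast
  define d where "d x = sup_gauge n (\<lambda>i. x i - a i)" for x
  have dc: "continuous_map ?E euclideanreal d"
    using continuous_map_compose[OF continuous_map_translate[OF aE], of euclideanreal "sup_gauge n"] hom_gauge_sup[of n]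
    by (simp add: hom_gauge_def d_def[abs_def] o_def)
  define B where "B = cube n a 1 - W"
  have "closedin ?E B" unfolding B_def using closedin_cube W by (rule closedin_diff)
  then have cB: "compact B" using compactin_closed_in_cube[of n B a 1] by (auto simp: B_def compactin_Euclidean_iff)
  have BE: "B \<subseteq> topspace ?E" using cube_subset by (auto simp: B_def)
  have dB: "continuous_on B d"
    using continuous_on_subset[OF _ BE, of d] dc by (simp add: continuous_map_Euclidean_space_iff)
  have dpos: "d x > 0" if "x \<in> B" for x
  proof -
    have xa: "x \<noteq> a" and xE: "x \<in> topspace ?E" using that a BE by (auto simp: B_def)
    have "(\<lambda>i. x i - a i) \<noteq> zvec" using xa by (auto simp: fun_eq_iff)
    moreover have "(\<lambda>i. x i - a i) \<in> topspace ?E" using xE aE by (auto simp: topspace_Euclidean_space)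
    ultimately show ?thesis using gauge_normalize(2)[OF hom_gauge_sup] by (simp add: d_def)
  qed
  obtain m where m: "m > 0" "\<And>x. x \<in> B \<Longrightarrow> m \<le> d x"
  proof (cases "B = {}")
    case True then show ?thesis using that[of 1] by auto
  next
    case False
    then obtain x where "x \<in> B" "\<And>y. y \<in> B \<Longrightarrow> d x \<le> d y"
      using continuous_attains_inf[OF cB False dB] by metis
    then show ?thesis using that[of "d x"] dpos by auto
  qed
  show thesis
  proof (rule that[of "min m 1"])
    fix r assume r: "r < min m 1"
    show "cube n a r \<subseteq> W"
    proof
      fix x assume x: "x \<in> cube n a r"
      have xE: "x \<in> topspace ?E" using x cube_subset by blast
      show "x \<in> W"
      proof (cases "r < 0")
        case True
        then have "n = 0" using x by (force simp: cube_def)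
        then show ?thesis using xE aE a by (auto simp: topspace_Euclidean_space) (metis ext)
      next
        case False
        have "x \<in> cube n a 1" using x r by (auto simp: cube_def)
        moreover have "d x \<le> r" using x sup_gauge_diff_le_iff[OF xE, of r a] False by (simp add: d_def)
        ultimately show ?thesis using m(2)[of x] r by (auto simp: B_def)
      qed
    qed
  qed (use m in auto)
qed

text \<open>Among the concentric cubes of a chart, only finitely many have a boundary that meets the finite
  set \<open>S\<close>.\<close>

lemma Euclidean_cell_exists:
  assumes X: "Hausdorff_space X" "locally_Euclidean n X" and V: "openin X V" "x \<in> V" and S: "finite S"
  obtains K K0 where "Euclidean_cell n X K K0" "x \<in> K0" "K \<subseteq> V" "(K - K0) \<inter> S = {}"
proof -
  let ?E = "Euclidean_space n"
  have xX: "x \<in> topspace X" using V openin_subset by blast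
  obtain U where U: "openin X U" "x \<in> U" "subtopology X U homeomorphic_space ?E"
    using X(2) xX by (auto simp: locally_Euclidean_def)
  then obtain f g where fg: "homeomorphic_maps (subtopology X U) ?E f g" by (auto simp: homeomorphic_space_def)
  have UX: "U \<subseteq> topspace X" using U(1) openin_subset by blast
  have tU: "topspace (subtopology X U) = U" using UX by auto
  have f: "continuous_map (subtopology X U) ?E f" and g: "continuous_map ?E (subtopology X U) g"
    and gf: "\<And>y. y \<in> U \<Longrightarrow> g (f y) = y" and fg': "\<And>e. e \<in> topspace ?E \<Longrightarrow> f (g e) = e"
    using fg tU by (auto simp: homeomorphic_maps_def)
  have gh: "homeomorphic_maps ?E (subtopology X U) g f" using fg homeomorphic_maps_sym by blast
  have gm: "homeomorphic_map ?E (subtopology X U) g" using gh homeomorphic_maps_map by blast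
  have fE: "f y \<in> topspace ?E" if "y \<in> U" for y using f tU that by (auto simp: continuous_map_def)
  have gU: "g e \<in> U" if "e \<in> topspace ?E" for e using g tU that by (auto simp: continuous_map_def)
  have openg: "openin X (g ` W)" if "openin ?E W" for W
    using homeomorphic_map_openness_eq[OF gm] that U(1) openin_trans_full openin_subset by blast
  let ?W = "{e \<in> topspace ?E. g e \<in> U \<inter> V}"
  have "openin (subtopology X U) (U \<inter> V)" using V(1) by (auto simp: openin_subtopology_Int2)
  then have oW: "openin ?E ?W" using g by (rule openin_continuous_map_preimage[rotated])
  have fx: "f x \<in> ?W" using fE[OF U(2)] gf[OF U(2)] U(2) V(2) by simp
  obtain m where m: "m > 0" "\<And>r. r < m \<Longrightarrow> cube n (f x) r \<subseteq> ?W" using openin_contains_cube[OF oW fx] by blast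
  define D where "D = (\<lambda>y. sup_gauge n (\<lambda>i. f y i - f x i)) ` S"
  have "infinite {0<..<m}" using m by (simp add: infinite_Ioo)
  moreover have "finite D" using S by (simp add: D_def)
  ultimately have "infinite ({0<..<m} - D)" by (rule Diff_infinite_finite[rotated])
  then obtain r where "r \<in> {0<..<m} - D" using infinite_imp_nonempty by blast
  then have r: "0 < r" "r < m" "r \<notin> D" by auto
  define K where "K = g ` cube n (f x) r"
  define K0 where "K0 = g ` open_cube n (f x) r"
  have sub: "cube n (f x) r \<subseteq> ?W" using m r by blast
  have hs: "subtopology ?E A homeomorphic_space subtopology X (g ` A)" if "A \<subseteq> topspace ?E" for A
  proof -
    have "homeomorphic_map (subtopology ?E A) (subtopology (subtopology X U) (g ` A)) g"
      by (rule homeomorphic_map_subtopologies[OF gm]) (use that gU tU UX in auto)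
    moreover have "subtopology (subtopology X U) (g ` A) = subtopology X (g ` A)"
    proof -
      have "U \<inter> g ` A = g ` A" using that gU by blast
      then show ?thesis by (simp add: subtopology_subtopology)
    qed
    ultimately show ?thesis using homeomorphic_map_imp_homeomorphic_space by metis
  qed
  have inj: "inj_on g (topspace ?E)" using fg' by (metis inj_onI)
  have KK0: "K - K0 = g ` (cube n (f x) r - open_cube n (f x) r)"
    unfolding K_def K0_def by (rule inj_on_image_set_diff[OF inj, symmetric]) (use cube_subset open_cube_subset in auto)
  show thesis
  proof (rule that[of K K0])
    show "Euclidean_cell n X K K0"
      unfolding Euclidean_cell_def
    proof (intro conjI)
      have "compactin (subtopology X U) K" unfolding K_def by (rule image_compactin[OF compactin_cube g])
      then show "compactin X K" by (simp add: compactin_subtopology)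
      show "openin X K0" unfolding K0_def by (rule openg[OF openin_open_cube])
      show "K0 \<subseteq> K" unfolding K0_def K_def using open_cube_subset_cube by blast
      have sub2: "cube n (f x) r - open_cube n (f x) r \<subseteq> topspace ?E" using cube_subset by blast
      show "extendable (subtopology X (K - K0)) (punct n)"
        unfolding KK0 by (rule extendable_homeomorphic_space[OF extendable_cube_boundary hs[OF sub2]])
      show "finite_zero_extendable n (subtopology X K)"
        unfolding K_def
        by (rule finite_zero_extendable_homeomorphic_space[OF finite_zero_extendable_cube[OF _ r(1)] hs[OF cube_subset]])
           (use fx in auto)
    qed
    have "f x \<in> open_cube n (f x) r" using fx r by (auto simp: open_cube_def)
    then show "x \<in> K0" unfolding K0_def using gf[OF U(2)] by force
    show "K \<subseteq> V" unfolding K_def using sub by auto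
    show "(K - K0) \<inter> S = {}"
    proof (rule ccontr)
      assume "(K - K0) \<inter> S \<noteq> {}"
      then obtain e where e: "e \<in> cube n (f x) r - open_cube n (f x) r" "g e \<in> S" unfolding KK0 by auto
      have eE: "e \<in> topspace ?E" using e cube_subset by blast
      have "sup_gauge n (\<lambda>i. e i - f x i) = r"
        using e sup_gauge_diff_le_iff[OF eE, of r "f x"] sup_gauge_diff_less_iff[OF eE, of r "f x"] r by simp
      then have "r \<in> D" unfolding D_def using e fg'[OF eE] by force
      then show False using r by simp
    qed
  qed
qed

text \<open>The cells that cover \<open>C\<close> are chosen with boundaries that avoid the zeros of both
  maps.\<close>

theorem degree_sum_boundary:
  assumes X: "Hausdorff_space X" "locally_Euclidean n X" "locally_oriented n X \<mu>"
    and C: "compactin X C" and Q: "openin X Q" "Q \<subseteq> C"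
    and u: "continuous_map (subtopology X C) (Euclidean_space n) u" "finite (zeros u C)"
    and v: "continuous_map (subtopology X C) (Euclidean_space n) v" "finite (zeros v C)"
    and eq: "\<And>x. x \<in> C - Q \<Longrightarrow> u x = v x \<and> u x \<noteq> zvec"
  shows "degree_sum n X \<mu> u Q = degree_sum n X \<mu> v Q"
proof -
  let ?S = "zeros u C \<union> zeros v C"
  define good where "good p \<longleftrightarrow> Euclidean_cell n X (fst p) (snd p) \<and> (\<exists>U. fst p \<subseteq> U \<and> oriented_near n X \<mu> U) \<and>
     (fst p - snd p) \<inter> ?S = {}" for p
  have ex: "\<exists>p. good p \<and> x \<in> snd p" if "x \<in> C" for x
  proof -
    have "x \<in> topspace X" using C that compactin_subset_topspace by blast
    then obtain U where U: "x \<in> U" "oriented_near n X \<mu> U" using X(3) by (auto simp: locally_oriented_def)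
    then have "openin X U" by (simp add: oriented_near_def)
    then obtain K K0 where "Euclidean_cell n X K K0" "x \<in> K0" "K \<subseteq> U" "(K - K0) \<inter> ?S = {}"
      using Euclidean_cell_exists[OF X(1,2), of U x ?S] U(1) u(2) v(2) by blast
    then have "good (K, K0) \<and> x \<in> snd (K, K0)" using U by (auto simp: good_def)
    then show ?thesis by blast
  qed
  have "\<exists>\<F>. finite \<F> \<and> \<F> \<subseteq> snd ` {p. good p} \<and> C \<subseteq> \<Union>\<F>"
  proof (rule compactinD[OF C])
    show "C \<subseteq> \<Union>(snd ` {p. good p})" using ex by blast
  qed (auto simp: good_def Euclidean_cell_def)
  then obtain P where P: "finite P" "P \<subseteq> {p. good p}" "C \<subseteq> \<Union>(snd ` P)"
    by (metis finite_subset_image)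
  obtain cs where cs: "set cs = P" using finite_list[OF P(1)] by blast
  show ?thesis
  proof (rule degree_sum_cells[OF X(1) _ C Q v, of \<mu> cs u])
    show "\<And>z. z \<in> topspace X \<Longrightarrow> \<mu> z \<in> carrier (local_homology n X {z})"
      using locally_oriented_carrier[OF X(3)] .
    fix K K0 assume K: "(K, K0) \<in> set cs"
    then have g: "good (K, K0)" using P cs by auto
    then show "Euclidean_cell n X K K0 \<and> (\<exists>U. K \<subseteq> U \<and> oriented_near n X \<mu> U)" by (simp add: good_def)
    fix x assume "x \<in> C \<inter> (K - K0)"
    then show "u x \<noteq> zvec \<and> v x \<noteq> zvec" using g by (auto simp: good_def zeros_def)
  next
    fix x assume "x \<in> C - \<Union>(snd ` set cs)"
    then show "u x = v x" using P cs by auto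
  next
    show "\<And>x. x \<in> C - Q \<Longrightarrow> u x = v x \<and> u x \<noteq> zvec" using eq .
  qed (use u in auto)
qed

section \<open>Equivariant extension\<close>

definition free_on :: "nat \<Rightarrow> ('a \<Rightarrow> 'a) \<Rightarrow> 'a set \<Rightarrow> bool" where
  "free_on k T M \<longleftrightarrow> (\<forall>z\<in>M. T z \<in> M \<and> (T ^^ k) z = z \<and> (\<forall>j. 0 < j \<and> j < k \<longrightarrow> (T ^^ j) z \<noteq> z))"

lemma funpow_closed: "(\<And>z. z \<in> M \<Longrightarrow> T z \<in> M) \<Longrightarrow> z \<in> M \<Longrightarrow> (T ^^ j) z \<in> M"
  by (induction j) auto

lemma continuous_map_funpow: "continuous_map X X T \<Longrightarrow> continuous_map X X (T ^^ j)"
  by (induction j) (auto intro: continuous_map_compose)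

lemma funpow_add_apply: "(T ^^ (i + j)) z = (T ^^ i) ((T ^^ j) z)"
  by (simp add: funpow_add)

lemma funpow_inverse:
  assumes "j \<le> k" "(T ^^ k) z = z"
  shows "(T ^^ (k - j)) ((T ^^ j) z) = z" "(T ^^ j) ((T ^^ (k - j)) z) = z"
  using assms funpow_add_apply[of "k - j" j T z] funpow_add_apply[of j "k - j" T z] by auto

definition orbit_union :: "nat \<Rightarrow> ('a \<Rightarrow> 'a) \<Rightarrow> 'a set \<Rightarrow> 'a set" where
  "orbit_union k T K = (\<Union>j<k. (T ^^ j) ` K)"

lemma funpow_image_preimage:
  assumes T: "continuous_map X X T" and Tk: "\<And>z. z \<in> topspace X \<Longrightarrow> (T ^^ k) z = z"
    and j: "j \<le> k" and K: "K \<subseteq> topspace X"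
  shows "(T ^^ j) ` K = {z \<in> topspace X. (T ^^ (k - j)) z \<in> K}"
proof
  have TX: "(T ^^ i) z \<in> topspace X" if "z \<in> topspace X" for i z
    using continuous_map_funpow[OF T, of i] that by (auto simp: continuous_map_def)
  show "(T ^^ j) ` K \<subseteq> {z \<in> topspace X. (T ^^ (k - j)) z \<in> K}"
    using TX K funpow_inverse(1)[OF j Tk] by fastforce
  show "{z \<in> topspace X. (T ^^ (k - j)) z \<in> K} \<subseteq> (T ^^ j) ` K"
    using funpow_inverse(2)[OF j Tk] by force
qed

lemma closedin_funpow_image:
  assumes T: "continuous_map X X T" and Tk: "\<And>z. z \<in> topspace X \<Longrightarrow> (T ^^ k) z = z"
    and j: "j \<le> k" and K: "closedin X K"
  shows "closedin X ((T ^^ j) ` K)"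
proof -
  have "(T ^^ j) ` K = {z \<in> topspace X. (T ^^ (k - j)) z \<in> K}"
    using T Tk j closedin_subset[OF K] by (rule funpow_image_preimage)
  then show ?thesis using closedin_continuous_map_preimage[OF continuous_map_funpow[OF T] K] by simp
qed

lemma openin_funpow_image:
  assumes T: "continuous_map X X T" and Tk: "\<And>z. z \<in> topspace X \<Longrightarrow> (T ^^ k) z = z"
    and j: "j \<le> k" and K: "openin X K"
  shows "openin X ((T ^^ j) ` K)"
proof -
  have "(T ^^ j) ` K = {z \<in> topspace X. (T ^^ (k - j)) z \<in> K}"
    using T Tk j openin_subset[OF K] by (rule funpow_image_preimage)
  then show ?thesis using openin_continuous_map_preimage[OF continuous_map_funpow[OF T] K] by simp
qed

lemma homeomorphic_map_funpow:
  assumes T: "continuous_map X X T" and Tk: "\<And>z. z \<in> topspace X \<Longrightarrow> (T ^^ k) z = z" and j: "j \<le> k"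
  shows "homeomorphic_map X X (T ^^ j)"
  unfolding homeomorphic_map_maps homeomorphic_maps_def
  using continuous_map_funpow[OF T] funpow_inverse[OF j Tk] by (intro exI[of _ "T ^^ (k - j)"]) auto

lemma orbit_union_invariant:
  assumes "\<And>z. z \<in> K \<Longrightarrow> (T ^^ k) z = z" "z \<in> orbit_union k T K"
  shows "T z \<in> orbit_union k T K"
proof -
  obtain j w where jw: "j < k" "w \<in> K" "z = (T ^^ j) w" using assms(2) by (auto simp: orbit_union_def)
  show ?thesis
  proof (cases "Suc j < k")
    case True
    have "T z = (T ^^ Suc j) w" using jw by simp
    then show ?thesis using True jw(2) unfolding orbit_union_def by (intro UN_I[of "Suc j"]) auto
  next
    case False
    then have "Suc j = k" using jw by simp
    then have "T z = (T ^^ k) w" using jw by auto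
    then have "T z = (T ^^ 0) w" using assms(1)[OF jw(2)] by simp
    then show ?thesis using jw unfolding orbit_union_def by (intro UN_I[of 0]) auto
  qed
qed

lemma equivariant_funpow:
  assumes "\<And>z. z \<in> A \<Longrightarrow> T z \<in> A" "\<And>z. z \<in> A \<Longrightarrow> f (T z) = \<tau> (f z)" "z \<in> A"
  shows "f ((T ^^ j) z) = (\<tau> ^^ j) (f z)"
  by (induction j) (use assms funpow_closed[of A T z] in auto)

text \<open>If \<open>K\<close> is disjoint from its translates, any extension over \<open>K\<close>
  determines an equivariant extension over the union of the translates.\<close>

lemma equivariant_extension_step:
  assumes T: "continuous_map X X T" and Tk: "\<And>z. z \<in> topspace X \<Longrightarrow> (T ^^ k) z = z" and k: "k > 0"
    and \<tau>: "continuous_map Q Q \<tau>" and \<tau>k: "\<And>q. q \<in> topspace Q \<Longrightarrow> (\<tau> ^^ k) q = q"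
    and A: "closedin X A" and TA: "\<And>z. z \<in> A \<Longrightarrow> T z \<in> A"
    and f: "continuous_map (subtopology X A) Q f" and fT: "\<And>z. z \<in> A \<Longrightarrow> f (T z) = \<tau> (f z)"
    and K: "closedin X K" and disj: "\<And>j. 0 < j \<Longrightarrow> j < k \<Longrightarrow> K \<inter> (T ^^ j) ` K = {}"
    and h: "continuous_map (subtopology X K) Q h" and hf: "\<And>z. z \<in> A \<inter> K \<Longrightarrow> h z = f z"
  obtains g where "continuous_map (subtopology X (A \<union> orbit_union k T K)) Q g"
    "\<And>z. z \<in> A \<Longrightarrow> g z = f z" "\<And>j w. j < k \<Longrightarrow> w \<in> K \<Longrightarrow> g ((T ^^ j) w) = (\<tau> ^^ j) (h w)"
    "\<And>z. z \<in> A \<union> orbit_union k T K \<Longrightarrow> g (T z) = \<tau> (g z)"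
proof -
  let ?B = "A \<union> orbit_union k T K"
  define I where "I = insert None (Some ` {..<k})"
  define P where "P i = (case i of None \<Rightarrow> A | Some j \<Rightarrow> (T ^^ j) ` K)" for i
  define F where "F i = (case i of None \<Rightarrow> f | Some j \<Rightarrow> (\<lambda>z. (\<tau> ^^ j) (h ((T ^^ (k - j)) z))))" for i
  have AX: "A \<subseteq> topspace X" and KX: "K \<subseteq> topspace X" using A K closedin_subset by blast+
  have TX: "(T ^^ i) z \<in> topspace X" if "z \<in> topspace X" for i z
    using continuous_map_funpow[OF T, of i] that by (auto simp: continuous_map_def)
  have PB: "P i \<subseteq> ?B" if "i \<in> I" for i using that by (auto simp: P_def I_def orbit_union_def)
  have PX: "closedin X (P i)" if "i \<in> I" for i
    using that A closedin_funpow_image[OF T Tk _ K] by (auto simp: P_def I_def)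
  have inv: "(T ^^ (k - j)) ((T ^^ j) w) = w" if "w \<in> K" "j < k" for j w
    using funpow_inverse(1)[of j k T w] Tk KX that by auto
  have compat: "F i z = F j z" if ij: "i \<in> I" "j \<in> I" "z \<in> P i" "z \<in> P j" for i j z
  proof -
    have 1: "f z = (\<tau> ^^ a) (h ((T ^^ (k - a)) z))" if zA: "z \<in> A" and za: "z \<in> (T ^^ a) ` K" and ak: "a < k" for a
    proof -
      obtain w where w: "w \<in> K" "z = (T ^^ a) w" using za by auto
      have "(T ^^ (k - a)) z \<in> A" by (rule funpow_closed[of A T, OF TA zA])
      then have wA: "w \<in> A" using inv[OF w(1) ak] w by simp
      have "f z = (\<tau> ^^ a) (f w)" unfolding w(2) by (rule equivariant_funpow[of A T f \<tau> w a, OF TA fT wA])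
      then show ?thesis using inv[OF w(1) ak] w hf wA by simp
    qed
    have 2: "a = b" if za: "z \<in> (T ^^ a) ` K" and zb: "z \<in> (T ^^ b) ` K" and le: "a \<le> b" "b < k" for a b
    proof (rule ccontr)
      assume "a \<noteq> b"
      then have ab: "0 < b - a" "b - a < k" using le by auto
      obtain w where w1: "w \<in> K" "z = (T ^^ a) w" using za by auto
      obtain w' where w2: "w' \<in> K" "z = (T ^^ b) w'" using zb by auto
      note w = w1 w2
      have "w = (T ^^ (k - a)) z" using inv[OF w(1)] w(2) le by simp
      also have "\<dots> = (T ^^ (k - a)) ((T ^^ a) ((T ^^ (b - a)) w'))"
        using w(4) funpow_add_apply[of a "b - a" T w'] le by simp
      also have "\<dots> = (T ^^ (b - a)) w'"
        using funpow_inverse(1)[of a k T "(T ^^ (b - a)) w'"] Tk TX KX w(3) le by auto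
      finally show False using disj[OF ab] w by blast
    qed
    have 3: "a = b" if  "z \<in> (T ^^ a) ` K" "z \<in> (T ^^ b) ` K" "a < k" "b < k" for a b
      using 2[of a b] 2[of b a] that by (cases "a \<le> b") auto
    consider "i = None" "j = None" | a where "i = None" "j = Some a" "a < k" | a where "i = Some a" "j = None" "a < k"
      | a b where "i = Some a" "j = Some b" "a < k" "b < k"
      using ij(1,2) by (auto simp: I_def)
    then show ?thesis
    proof cases
      case (2 a)
      then show ?thesis using 1[of a] ij(3,4) by (simp add: P_def F_def)
    next
      case (3 a)
      then show ?thesis using 1[of a] ij(3,4) by (simp add: P_def F_def)
    next
      case (4 a b)
      then have "a = b" using 3 ij(3,4) by (simp add: P_def)
      then show ?thesis using 4 by simp
    qed simp
  qed
  obtain g where g: "continuous_map (subtopology X ?B) Q g"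
      "\<And>x i. i \<in> I \<Longrightarrow> x \<in> topspace (subtopology X ?B) \<inter> P i \<Longrightarrow> g x = F i x"
  proof (rule pasting_lemma_exists_closed[where I=I and X="subtopology X ?B" and T=P and f=F and Y=Q])
    show "finite I" by (simp add: I_def)
    show "topspace (subtopology X ?B) \<subseteq> \<Union> (P ` I)" by (auto simp: I_def P_def orbit_union_def)
  next
    fix i assume i: "i \<in> I"
    show "closedin (subtopology X ?B) (P i)" using PX[OF i] PB[OF i] by (rule closedin_subset_topspace)
    have "continuous_map (subtopology X (P i)) Q (F i)"
    proof (cases i)
      case None
      then show ?thesis using f by (simp add: P_def F_def)
    next
      case (Some j)
      then have j: "j < k" using i by (auto simp: I_def)
      have "continuous_map (subtopology X ((T ^^ j) ` K)) (subtopology X K) (T ^^ (k - j))"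
        using continuous_map_funpow[OF T] inv j
        by (auto simp: continuous_map_in_subtopology continuous_map_from_subtopology)
      from continuous_map_compose[OF this h]
      have "continuous_map (subtopology X ((T ^^ j) ` K)) Q ((\<tau> ^^ j) \<circ> (h \<circ> (T ^^ (k - j))))"
        using continuous_map_funpow[OF \<tau>] continuous_map_compose by blast
      then show ?thesis using Some by (simp add: P_def F_def o_def)
    qed
    then show "continuous_map (subtopology (subtopology X ?B) (P i)) Q (F i)"
      using PB[OF i] by (simp add: subtopology_subtopology inf.absorb2)
  next
    fix i j x assume "i \<in> I" "j \<in> I" "x \<in> topspace (subtopology X ?B) \<inter> P i \<inter> P j"
    then show "F i x = F j x" using compat by blast
  qed (use that in blast)
  have gA: "g z = f z" if "z \<in> A" for z
    using g(2)[of None z] that AX by (auto simp: I_def P_def F_def)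
  have gK: "g ((T ^^ j) w) = (\<tau> ^^ j) (h w)" if jw: "j < k" "w \<in> K" for j w
  proof -
    have "(T ^^ j) w \<in> topspace (subtopology X ?B) \<inter> P (Some j)"
      using jw KX TX by (auto simp: P_def orbit_union_def)
    then have "g ((T ^^ j) w) = F (Some j) ((T ^^ j) w)" using g(2) jw by (auto simp: I_def)
    then show ?thesis using inv[OF jw(2,1)] by (simp add: F_def)
  qed
  have "g (T z) = \<tau> (g z)" if zB: "z \<in> ?B" for z
  proof (cases "z \<in> A")
    case True
    then show ?thesis using gA TA fT by simp
  next
    case False
    then have "z \<in> orbit_union k T K" using zB by simp
    then obtain j w where jw: "j < k" "w \<in> K" "z = (T ^^ j) w" unfolding orbit_union_def by blast
    have hw: "h w \<in> topspace Q" using h jw KX by (auto simp: continuous_map_def)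
    show ?thesis
    proof (cases "Suc j < k")
      case True
      then show ?thesis using gK[OF True jw(2)] gK[OF jw(1,2)] jw(3) by simp
    next
      case False
      then have kj: "Suc j = k" using jw by simp
      have "T z = (T ^^ k) w" using jw kj by auto
      then have "T z = w" using Tk KX jw(2) by auto
      moreover have "\<tau> (g z) = (\<tau> ^^ k) (h w)" using gK[OF jw(1,2)] jw(3) kj by auto
      ultimately show ?thesis using gK[of 0 w] k jw(2) \<tau>k[OF hw] by simp
    qed
  qed
  then show thesis using that g(1) gA gK by blast
qed

lemma free_neighbourhood:
  assumes X: "Hausdorff_space X" and T: "continuous_map X X T" and z: "z \<in> topspace X"
    and free: "\<And>j. 0 < j \<Longrightarrow> j < k \<Longrightarrow> (T ^^ j) z \<noteq> z"
  obtains V where "openin X V" "z \<in> V" "\<And>j K. 0 < j \<Longrightarrow> j < k \<Longrightarrow> K \<subseteq> V \<Longrightarrow> K \<inter> (T ^^ j) ` K = {}"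
proof -
  have "\<exists>W. openin X W \<and> z \<in> W \<and> (\<forall>v\<in>W. (T ^^ j) v \<notin> W)" if j: "0 < j" "j < k" for j
  proof -
    have Tz: "(T ^^ j) z \<in> topspace X" using continuous_map_funpow[OF T, of j] z by (auto simp: continuous_map_def)
    obtain P R where PR: "openin X P" "openin X R" "z \<in> P" "(T ^^ j) z \<in> R" "disjnt P R"
      using X z Tz free[OF j] unfolding Hausdorff_space_def by metis
    have "openin X (P \<inter> {v \<in> topspace X. (T ^^ j) v \<in> R})"
      using PR openin_continuous_map_preimage[OF continuous_map_funpow[OF T] PR(2)] by (intro openin_Int)
    then show ?thesis using PR z by (intro exI[of _ "P \<inter> {v \<in> topspace X. (T ^^ j) v \<in> R}"]) (auto simp: disjnt_def)
  qed
  then obtain W where W: "\<And>j. 0 < j \<Longrightarrow> j < k \<Longrightarrow> openin X (W j) \<and> z \<in> W j \<and> (\<forall>v\<in>W j. (T ^^ j) v \<notin> W j)"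
    by metis
  define V where "V = topspace X \<inter> (\<Inter>j\<in>{0<..<k}. W j)"
  have "openin X V"
  proof (cases "{0<..<k} = {}")
    case False
    then have "openin X (\<Inter>j\<in>{0<..<k}. W j)" using W by (intro openin_INT2) auto
    then show ?thesis unfolding V_def by blast
  qed (simp add: V_def)
  moreover have "z \<in> V" using W z by (auto simp: V_def)
  moreover have "K \<inter> (T ^^ j) ` K = {}" if j: "0 < j" "j < k" and KV: "K \<subseteq> V" for j K
  proof -
    have "K \<subseteq> W j" using KV j unfolding V_def by auto
    then show ?thesis using W[OF j] by blast
  qed
  ultimately show thesis using that by blast
qed

lemma equivariant_extension_list:
  assumes T: "continuous_map Y Y T" and Tk: "\<And>z. z \<in> topspace Y \<Longrightarrow> (T ^^ k) z = z" and k: "k > 0"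
    and \<tau>: "continuous_map Q Q \<tau>" and \<tau>k: "\<And>q. q \<in> topspace Q \<Longrightarrow> (\<tau> ^^ k) q = q"
    and ext: "extendable Y Q"
    and A: "closedin Y A" and TA: "\<And>z. z \<in> A \<Longrightarrow> T z \<in> A"
    and f: "continuous_map (subtopology Y A) Q f" and fT: "\<And>z. z \<in> A \<Longrightarrow> f (T z) = \<tau> (f z)"
  shows "(\<And>K. K \<in> set Ks \<Longrightarrow> closedin Y K \<and> (\<forall>j. 0 < j \<and> j < k \<longrightarrow> K \<inter> (T ^^ j) ` K = {})) \<Longrightarrow>
    \<exists>B g. closedin Y B \<and> A \<subseteq> B \<and> \<Union>(set Ks) \<subseteq> B \<and> (\<forall>z\<in>B. T z \<in> B \<and> g (T z) = \<tau> (g z)) \<and>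
       continuous_map (subtopology Y B) Q g \<and> (\<forall>z\<in>A. g z = f z)"
proof (induction Ks)
  case Nil
  show ?case using A TA f fT by (intro exI[of _ A] exI[of _ f]) auto
next
  case (Cons K Ks)
  obtain B g where B: "closedin Y B" "A \<subseteq> B" "\<Union>(set Ks) \<subseteq> B" "\<forall>z\<in>B. T z \<in> B \<and> g (T z) = \<tau> (g z)"
    and g: "continuous_map (subtopology Y B) Q g" "\<forall>z\<in>A. g z = f z"
    using Cons.IH Cons.prems by (auto simp del: Union_iff)
  have K: "closedin Y K" "\<And>j. 0 < j \<Longrightarrow> j < k \<Longrightarrow> K \<inter> (T ^^ j) ` K = {}" using Cons.prems[of K] by auto
  have "closedin (subtopology Y K) (B \<inter> K)" by (metis B(1) closedin_subtopology)
  moreover have "continuous_map (subtopology (subtopology Y K) (B \<inter> K)) Q g"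
    using g(1) by (auto simp: subtopology_subtopology intro: continuous_map_from_subtopology_mono)
  ultimately obtain h where h: "continuous_map (subtopology Y K) Q h" "\<And>a. a \<in> B \<inter> K \<Longrightarrow> h a = g a"
    using extendableD[OF extendable_closed_subset[OF ext K(1)]] by metis
  obtain g' where g': "continuous_map (subtopology Y (B \<union> orbit_union k T K)) Q g'"
    "\<And>z. z \<in> B \<Longrightarrow> g' z = g z" "\<And>z. z \<in> B \<union> orbit_union k T K \<Longrightarrow> g' (T z) = \<tau> (g' z)"
    by (rule equivariant_extension_step[OF T Tk k \<tau> \<tau>k B(1) _ g(1) _ K h]) (use B(4) that in auto)
  have KY: "K \<subseteq> topspace Y" using K closedin_subset by blast
  have "closedin Y (B \<union> orbit_union k T K)"
    unfolding orbit_union_def using closedin_funpow_image[OF T Tk _ K(1)] B(1)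
    by (intro closedin_Un closedin_Union) auto
  moreover have "K \<subseteq> orbit_union k T K" using k by (auto simp: orbit_union_def intro!: bexI[of _ 0])
  moreover have "T z \<in> B \<union> orbit_union k T K" if "z \<in> B \<union> orbit_union k T K" for z
    using that B(4) orbit_union_invariant[where K=K and T=T and k=k and z=z] Tk KY by blast
  ultimately show ?case
    using B g g' by (intro exI[of _ "B \<union> orbit_union k T K"] exI[of _ g']) auto
qed

text \<open>By compactness finitely many closed sets that are disjoint from their translates cover the
  space, and the map is extended over their orbits one after the other.\<close>

theorem equivariant_extension:
  assumes Y: "compact_space Y" "Hausdorff_space Y"
    and T: "continuous_map Y Y T" and free: "free_on k T (topspace Y)" and k: "k > 0"
    and \<tau>: "continuous_map Q Q \<tau>" and \<tau>k: "\<And>q. q \<in> topspace Q \<Longrightarrow> (\<tau> ^^ k) q = q"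
    and ext: "extendable Y Q"
    and A: "closedin Y A" and TA: "\<And>z. z \<in> A \<Longrightarrow> T z \<in> A"
    and f: "continuous_map (subtopology Y A) Q f" and fT: "\<And>z. z \<in> A \<Longrightarrow> f (T z) = \<tau> (f z)"
  obtains g where "continuous_map Y Q g" "\<And>z. z \<in> A \<Longrightarrow> g z = f z"
    "\<And>z. z \<in> topspace Y \<Longrightarrow> g (T z) = \<tau> (g z)"
proof -
  have Tk: "\<And>z. z \<in> topspace Y \<Longrightarrow> (T ^^ k) z = z" using free by (auto simp: free_on_def)
  have reg: "neighbourhood_base_of (closedin Y) Y"
    using Y compact_Hausdorff_imp_regular_space neighbourhood_base_of_closedin by blast
  define good where "good K \<longleftrightarrow> closedin Y K \<and> (\<forall>j. 0 < j \<and> j < k \<longrightarrow> K \<inter> (T ^^ j) ` K = {})" for K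
  have "\<exists>p. openin Y (fst p) \<and> z \<in> fst p \<and> fst p \<subseteq> snd p \<and> good (snd p)" if z: "z \<in> topspace Y" for z
  proof -
    have fz: "(T ^^ j) z \<noteq> z" if "0 < j" "j < k" for j using free z that by (auto simp: free_on_def)
    obtain V where V: "openin Y V" "z \<in> V" "\<And>j K. 0 < j \<Longrightarrow> j < k \<Longrightarrow> K \<subseteq> V \<Longrightarrow> K \<inter> (T ^^ j) ` K = {}"
      using free_neighbourhood[OF Y(2) T z fz] by blast
    obtain U K where "openin Y U" "closedin Y K" "z \<in> U" "U \<subseteq> K" "K \<subseteq> V"
      using reg V(1,2) unfolding neighbourhood_base_of by meson
    then show ?thesis using V(3) by (intro exI[of _ "(U, K)"]) (auto simp: good_def)
  qed
  then obtain p where p: "\<And>z. z \<in> topspace Y \<Longrightarrow> openin Y (fst (p z)) \<and> z \<in> fst (p z) \<and> fst (p z) \<subseteq> snd (p z) \<and> good (snd (p z))"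
    by metis
  have "\<exists>\<F>. finite \<F> \<and> \<F> \<subseteq> (fst \<circ> p) ` topspace Y \<and> topspace Y \<subseteq> \<Union>\<F>"
    by (rule compactinD) (use Y(1) p in \<open>auto simp: compact_space_def\<close>)
  then obtain \<F> where F: "finite \<F>" "\<F> \<subseteq> (fst \<circ> p) ` topspace Y" "topspace Y \<subseteq> \<Union>\<F>" by blast
  obtain Z where Z0: "Z \<subseteq> topspace Y" "finite Z" "\<F> = (fst \<circ> p) ` Z"
    using finite_subset_image[OF F(1,2)] by metis
  have Z: "finite Z" "Z \<subseteq> topspace Y" "topspace Y \<subseteq> \<Union>((fst \<circ> p) ` Z)"
    using Z0(2,1) F(3)[unfolded Z0(3)] .
  have "\<exists>Ks. set Ks = (snd \<circ> p) ` Z" using finite_list[OF finite_imageI[OF Z(1)]] .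
  then   obtain Ks where Ks: "set Ks = (snd \<circ> p) ` Z" by (elim exE)
  have Ksgood: "closedin Y K \<and> (\<forall>j. 0 < j \<and> j < k \<longrightarrow> K \<inter> (T ^^ j) ` K = {})" if "K \<in> set Ks" for K
  proof -
    obtain z where "z \<in> Z" "K = snd (p z)" using \<open>K \<in> set Ks\<close> Ks by auto
    then have "good K" using p Z(2) by blast
    then show ?thesis by (simp add: good_def)
  qed
  define Pr where "Pr B g \<longleftrightarrow> closedin Y B \<and> A \<subseteq> B \<and> \<Union>(set Ks) \<subseteq> B \<and> (\<forall>z\<in>B. T z \<in> B \<and> g (T z) = \<tau> (g z)) \<and>
       continuous_map (subtopology Y B) Q g \<and> (\<forall>z\<in>A. g z = f z)" for B g
  have "\<exists>B g. Pr B g" unfolding Pr_def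
    by (rule equivariant_extension_list[OF T Tk k \<tau> \<tau>k ext A TA f fT Ksgood])
  then obtain B g where "Pr B g" by blast
  then have B: "closedin Y B" "\<Union>(set Ks) \<subseteq> B" "\<forall>z\<in>B. g (T z) = \<tau> (g z)"
    "continuous_map (subtopology Y B) Q g" "\<forall>z\<in>A. g z = f z" by (simp_all add: Pr_def)
  have "topspace Y \<subseteq> \<Union>(set Ks)"
  proof
    fix y assume "y \<in> topspace Y"
    then obtain z where z: "z \<in> Z" "y \<in> fst (p z)" using Z(3) by auto
    then have "y \<in> snd (p z)" using p Z(2) by blast
    then show "y \<in> \<Union>(set Ks)" using z(1) Ks by auto
  qed
  then have "B = topspace Y" using B(1,2) closedin_subset by blast
  then show thesis using that B by simp
qed

section \<open>Free orbits\<close>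

text \<open>Each orbit in \<open>S\<close> has exactly \<open>k\<close> points, on which \<open>d\<close> is
  constant.\<close>

lemma sum_free_dvd:
  fixes d :: "'a \<Rightarrow> int"
  assumes "finite S" "free_on k T S" "\<And>z. z \<in> S \<Longrightarrow> d (T z) = d z" "k > 0"
  shows "int k dvd (\<Sum>z\<in>S. d z)"
  using assms
proof (induction "card S" arbitrary: S rule: less_induct)
  case less
  show ?case
  proof (cases "S = {}")
    case False
    then obtain z where z: "z \<in> S" by blast
    define P where "P = (\<lambda>j. (T ^^ j) z) ` {..<k}"
    have TS: "\<And>w. w \<in> S \<Longrightarrow> T w \<in> S" using less.prems by (auto simp: free_on_def)
    have PS: "P \<subseteq> S" unfolding P_def using funpow_closed[of S T z, OF TS z] by auto
    have Tk: "(T ^^ k) w = w" if "w \<in> S" for w using less.prems(2) that by (auto simp: free_on_def)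
    have inj': "i = j" if "i \<le> j" "j < k" "(T ^^ i) z = (T ^^ j) z" for i j
    proof (rule ccontr)
      assume "i \<noteq> j"
      have "(T ^^ (j - i)) ((T ^^ i) z) = (T ^^ i) z" using funpow_add_apply[of "j - i" i T z] that by simp
      moreover have "(T ^^ i) z \<in> S" using funpow_closed[of S T z, OF TS z] .
      moreover have "0 < j - i" "j - i < k" using that \<open>i \<noteq> j\<close> by auto
      ultimately show False using less.prems(2) by (auto simp: free_on_def)
    qed
    have inj: "inj_on (\<lambda>j. (T ^^ j) z) {..<k}"
      by (rule inj_onI) (metis inj' lessThan_iff nle_le)
    have dz: "d ((T ^^ j) z) = d z" for j
      by (induction j) (use less.prems(3) funpow_closed[of S T z, OF TS z] in auto)
    have sumP: "(\<Sum>w\<in>P. d w) = int k * d z"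
      unfolding P_def using inj by (simp add: sum.reindex dz)
    have TP: "T w \<notin> P" if w: "w \<in> S - P" for w
    proof
      assume "T w \<in> P"
      then obtain j where j: "j < k" "T w = (T ^^ j) z" by (auto simp: P_def)
      have "w = (T ^^ (k - 1)) (T w)" using Tk[of w] w less.prems(4) funpow_inverse(1)[of 1 k T w] by simp
      also have "\<dots> = (T ^^ (k - 1 + j)) z" using j funpow_add_apply[of "k - 1" j T z] by simp
      also have "\<dots> \<in> P"
      proof (cases "j = 0")
        case True
        then show ?thesis using less.prems(4) by (auto simp: P_def)
      next
        case False
        then have "(T ^^ (k - 1 + j)) z = (T ^^ (j - 1)) ((T ^^ k) z)"
          using less.prems(4) funpow_add_apply[of "j - 1" k T z] by (simp add: add.commute)
        then show ?thesis using Tk[OF z] j by (auto simp: P_def)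
      qed
      finally show False using w by simp
    qed
    have "int k dvd (\<Sum>w\<in>S - P. d w)"
    proof (rule less.hyps)
      have "z \<in> P" using less.prems(4) by (force simp: P_def)
      then show "card (S - P) < card S" using less.prems(1) z by (intro psubset_card_mono) auto
      show "free_on k T (S - P)" using less.prems(2) TP by (auto simp: free_on_def)
    qed (use less.prems in auto)
    moreover have "(\<Sum>w\<in>S. d w) = (\<Sum>w\<in>S - P. d w) + (\<Sum>w\<in>P. d w)"
      using PS less.prems(1) by (simp add: sum.subset_diff)
    ultimately show ?thesis using sumP by simp
  qed simp
qed

lemma funpow_zero_imp:
  assumes "(\<tau> ^^ k) q = q" "\<tau> z = z" "j \<le> k" "(\<tau> ^^ j) q = z"
  shows "q = z"
proof -
  have "(\<tau> ^^ i) z = z" for i by (induction i) (auto simp: assms(2))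
  then show ?thesis using funpow_inverse(1)[OF assms(3,1)] assms(4) by simp
qed

lemma extendable_funpow_image:
  assumes T: "continuous_map X X T" and Tk: "\<And>z. z \<in> topspace X \<Longrightarrow> (T ^^ k) z = z" and j: "j \<le> k"
    and S: "S \<subseteq> topspace X" and ext: "extendable (subtopology X S) Q"
  shows "extendable (subtopology X ((T ^^ j) ` S)) Q"
proof (rule extendable_homeomorphic_space[OF ext])
  have h: "homeomorphic_map X X (T ^^ j)" using T Tk j by (rule homeomorphic_map_funpow)
  have "homeomorphic_map (subtopology X S) (subtopology X ((T ^^ j) ` S)) (T ^^ j)"
  proof (rule homeomorphic_map_subtopologies[OF h])
    show "(T ^^ j) ` (topspace X \<inter> S) = topspace X \<inter> (T ^^ j) ` S"
      using S continuous_map_funpow[OF T, of j] by (auto simp: continuous_map_def)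
  qed
  then show "subtopology X S homeomorphic_space subtopology X ((T ^^ j) ` S)"
    using homeomorphic_map_imp_homeomorphic_space by metis
qed

text \<open>Cover \<open>M\<close> by cells that are disjoint from their translates. Extend equivariantly
  without zeros over the union of all translates of the cell boundaries; then fill the cells one
  at a time with finitely many zeros and transport the map along the orbits. The part of a cell
  that lies in the translated interiors of the earlier cells is left out, so that the map
  already given on the rest has no zeros.\<close>

theorem equivariant_finite_zero_extension:
  assumes X: "Hausdorff_space X" "locally_Euclidean n X"
    and T: "continuous_map X X T" and Tk: "\<And>z. z \<in> topspace X \<Longrightarrow> (T ^^ k) z = z" and k: "k > 0"
    and M: "compactin X M" and free: "free_on k T M"
    and \<tau>: "continuous_map (Euclidean_space n) (Euclidean_space n) \<tau>"
    and \<tau>k: "\<And>q. q \<in> topspace (Euclidean_space n) \<Longrightarrow> (\<tau> ^^ k) q = q" and \<tau>0: "\<tau> zvec = zvec"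
    and A: "closedin X A" "A \<subseteq> M" and TA: "\<And>z. z \<in> A \<Longrightarrow> T z \<in> A"
    and f: "continuous_map (subtopology X A) (punct n) f" and fT: "\<And>z. z \<in> A \<Longrightarrow> f (T z) = \<tau> (f z)"
  obtains u where "continuous_map (subtopology X M) (Euclidean_space n) u" "\<And>z. z \<in> A \<Longrightarrow> u z = f z"
    "\<And>z. z \<in> M \<Longrightarrow> u (T z) = \<tau> (u z)" "finite (zeros u M)"
proof -
  let ?E = "Euclidean_space n"
  have MX: "M \<subseteq> topspace X" using M compactin_subset_topspace by blast
  have clM: "closedin X M" using X(1) M compactin_imp_closedin by blast
  have TM: "T z \<in> M" if "z \<in> M" for z using free that by (auto simp: free_on_def)
  have \<tau>nz: "q = zvec" if "q \<in> topspace ?E" "j \<le> k" "(\<tau> ^^ j) q = zvec" for q j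
    using funpow_zero_imp[OF \<tau>k[OF that(1)] \<tau>0 that(2,3)] .
  have \<tau>P: "continuous_map (punct n) (punct n) \<tau>"
    unfolding continuous_map_punct_iff
  proof
    show "continuous_map (punct n) ?E \<tau>" using \<tau> by (simp add: punct_def continuous_map_from_subtopology)
    show "\<forall>x\<in>topspace (punct n). \<tau> x \<noteq> zvec"
      using \<tau>nz[of _ 1] k by (auto simp: topspace_punct topspace_Euclidean_space)
  qed
  define good where "good p \<longleftrightarrow> Euclidean_cell n X (fst p) (snd p) \<and> (\<forall>j. 0 < j \<and> j < k \<longrightarrow> fst p \<inter> (T ^^ j) ` fst p = {})" for p
  have ex: "\<exists>p. good p \<and> z \<in> snd p" if z: "z \<in> M" for z
  proof -
    have fz: "(T ^^ j) z \<noteq> z" if "0 < j" "j < k" for j using free z that by (auto simp: free_on_def)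
    have zX: "z \<in> topspace X" using z MX by blast
    obtain V where V: "openin X V" "z \<in> V" "\<And>j K. 0 < j \<Longrightarrow> j < k \<Longrightarrow> K \<subseteq> V \<Longrightarrow> K \<inter> (T ^^ j) ` K = {}"
      using free_neighbourhood[OF X(1) T zX fz] by blast
    obtain K K0 where "Euclidean_cell n X K K0" "z \<in> K0" "K \<subseteq> V"
      using Euclidean_cell_exists[OF X V(1,2) finite.emptyI] by metis
    then have "good (K, K0) \<and> z \<in> snd (K, K0)" using V(3) by (auto simp: good_def)
    then show ?thesis by blast
  qed
  have "\<exists>\<F>. finite \<F> \<and> \<F> \<subseteq> snd ` {p. good p} \<and> M \<subseteq> \<Union>\<F>"
  proof (rule compactinD[OF M])
    show "M \<subseteq> \<Union>(snd ` {p. good p})" using ex by blast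
  qed (auto simp: good_def Euclidean_cell_def)
  then obtain \<F> where F: "finite \<F>" "\<F> \<subseteq> snd ` {p. good p}" "M \<subseteq> \<Union>\<F>" by blast
  obtain P where P0: "P \<subseteq> {p. good p}" "finite P" "\<F> = snd ` P"
    using finite_subset_image[OF F(1,2)] by metis
  have P: "finite P" "P \<subseteq> {p. good p}" "M \<subseteq> \<Union>(snd ` P)"
    using P0(2,1) F(3)[unfolded P0(3)] .
  have cell: "compactin X (fst p)" "openin X (snd p)" "snd p \<subseteq> fst p"
    "extendable (subtopology X (fst p - snd p)) (punct n)" "finite_zero_extendable n (subtopology X (fst p))"
    if "p \<in> P" for p
    using P(2) that by (auto simp: good_def Euclidean_cell_def)
  have disj: "fst p \<inter> (T ^^ j) ` fst p = {}" if "p \<in> P" "0 < j" "j < k" for p j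
    using P(2) that by (auto simp: good_def)
  have clc: "closedin X (fst p)" "fst p \<subseteq> topspace X" if "p \<in> P" for p
    using cell(1)[OF that] X(1) compactin_imp_closedin compactin_subset_topspace by blast+
  define bd where "bd p = fst p - snd p" for p :: "'a set \<times> 'a set"
  have clbd: "closedin X (bd p)" "bd p \<subseteq> topspace X" if "p \<in> P" for p
    unfolding bd_def using clc[OF that] cell(2)[OF that] by (auto intro: closedin_diff)
  define I where "I = P \<times> {..<k}"
  define G where "G i = (T ^^ snd i) ` bd (fst i)" for i
  define Bd0 where "Bd0 = (\<Union>i\<in>I. G i)"
  define Bd where "Bd = M \<inter> Bd0"
  have finI: "finite I" using P(1) by (simp add: I_def)
  have clG: "closedin X (G i)" if "i \<in> I" for i
    unfolding G_def using that clbd closedin_funpow_image[OF T Tk] by (auto simp: I_def)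
  have clBd0: "closedin X Bd0" unfolding Bd0_def using finI clG by (intro closedin_Union) auto
  have clBd: "closedin X Bd" unfolding Bd_def using clM clBd0 by (rule closedin_Int)
  have "extendable (subtopology X Bd0) (punct n)"
    unfolding Bd0_def
  proof (rule extendable_Union[OF finI clG])
    fix i assume i: "i \<in> I"
    then have p: "fst i \<in> P" and j: "snd i \<le> k" by (auto simp: I_def)
    show "extendable (subtopology X (G i)) (punct n)"
      unfolding G_def
      by (rule extendable_funpow_image[OF T Tk j clbd(2)[OF p]]) (use cell(4)[OF p] in \<open>simp_all add: bd_def\<close>)
  qed
  then have extBd: "extendable (subtopology X Bd) (punct n)"
    using extendable_subset clBd by (auto simp: Bd_def)
  have TBd: "T z \<in> Bd" if z: "z \<in> Bd" for z
  proof -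
    have "z \<in> Bd0" using z by (simp add: Bd_def)
    then obtain i where i: "i \<in> I" "z \<in> G i" by (auto simp: Bd0_def)
    then have "z \<in> orbit_union k T (bd (fst i))" by (auto simp: orbit_union_def G_def I_def)
    moreover have "fst i \<in> P" using i by (auto simp: I_def)
    ultimately have "T z \<in> orbit_union k T (bd (fst i))"
      using orbit_union_invariant[where K="bd (fst i)" and T=T and k=k and z=z] Tk clbd(2) by blast
    then obtain a where a: "a < k" "T z \<in> (T ^^ a) ` bd (fst i)" unfolding orbit_union_def by blast
    then have "T z \<in> G (fst i, a)" "(fst i, a) \<in> I" using i by (auto simp: G_def I_def)
    then have "T z \<in> Bd0" unfolding Bd0_def by blast
    then show ?thesis using z TM by (simp add: Bd_def)
  qed
  define Y where "Y = subtopology X Bd"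
  have BdX: "Bd \<subseteq> topspace X" using clBd closedin_subset by blast
  have tY: "topspace Y = Bd" using BdX by (auto simp: Y_def)
  have BdM: "Bd \<subseteq> M" by (auto simp: Bd_def)
  have cY: "compact_space Y" unfolding Y_def
    by (rule compact_space_subtopology) (rule closed_compactin[OF M BdM clBd])
  have HY: "Hausdorff_space Y" unfolding Y_def using X(1) by (rule Hausdorff_space_subtopology)
  have TY: "continuous_map Y Y T"
    unfolding Y_def using T TBd by (auto simp: continuous_map_in_subtopology continuous_map_from_subtopology)
  have freeY: "free_on k T (topspace Y)" unfolding tY using free TBd BdM by (auto simp: free_on_def)
  have \<tau>kP: "(\<tau> ^^ k) q = q" if "q \<in> topspace (punct n)" for q
    using \<tau>k that by (auto simp: topspace_punct topspace_Euclidean_space)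
  have clAY: "closedin Y (A \<inter> Bd)" unfolding Y_def by (metis A(1) closedin_subtopology)
  have fY: "continuous_map (subtopology Y (A \<inter> Bd)) (punct n) f"
    unfolding Y_def subtopology_subtopology by (rule continuous_map_from_subtopology_mono[OF f]) auto
  obtain f1 where f1: "continuous_map Y (punct n) f1" "\<And>z. z \<in> A \<inter> Bd \<Longrightarrow> f1 z = f z"
    "\<And>z. z \<in> topspace Y \<Longrightarrow> f1 (T z) = \<tau> (f1 z)"
    by (rule equivariant_extension[OF cY HY TY freeY k \<tau>P \<tau>kP extBd[folded Y_def] clAY _ fY])
       (use TA TBd fT in auto)
  define A' where "A' = A \<union> Bd"
  define f2 where "f2 z = (if z \<in> A then f z else f1 z)" for z
  have clA': "closedin X A'" unfolding A'_def using A(1) clBd by (rule closedin_Un)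
  have A'M: "A' \<subseteq> M" using A(2) BdM by (simp add: A'_def)
  have f2: "continuous_map (subtopology X A') (punct n) f2"
    unfolding A'_def f2_def by (rule paste_closed2[OF A(1) clBd f f1(1)[unfolded Y_def]]) (use f1(2) in auto)
  have TA': "T z \<in> A'" if "z \<in> A'" for z using that TA TBd by (auto simp: A'_def)
  have f2T: "f2 (T z) = \<tau> (f2 z)" if z: "z \<in> A'" for z
  proof (cases "z \<in> A")
    case True
    then show ?thesis using TA fT by (simp add: f2_def)
  next
    case False
    then have zB: "z \<in> Bd" using z by (simp add: A'_def)
    then have "f2 (T z) = f1 (T z)" using f1(2)[of "T z"] TBd by (auto simp: f2_def)
    then show ?thesis using f1(3) zB False tY by (simp add: f2_def)
  qed
  have f2nz: "f2 z \<noteq> zvec" if "z \<in> A'" for z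
  proof -
    have "z \<in> topspace (subtopology X A')" using that A'M MX by auto
    then show ?thesis using f2 by (auto simp: continuous_map_punct_iff)
  qed
  define Pr where "Pr cs B u \<longleftrightarrow> closedin X B \<and> A' \<subseteq> B \<and> B \<subseteq> M \<and> M \<inter> \<Union>(fst ` set cs) \<subseteq> B \<and>
      B \<subseteq> A' \<union> (\<Union>p\<in>set cs. orbit_union k T (fst p)) \<and> (\<forall>z\<in>B. T z \<in> B \<and> u (T z) = \<tau> (u z)) \<and>
      continuous_map (subtopology X B) ?E u \<and> (\<forall>z\<in>A'. u z = f2 z) \<and> finite (zeros u B)" for cs :: "('a set \<times> 'a set) list" and B u
  have main: "set cs \<subseteq> P \<Longrightarrow> \<exists>B u. Pr cs B u" for cs
  proof (induction cs)
    case Nil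
    have "zeros f2 A' = {}" using f2nz by (auto simp: zeros_def)
    then have "Pr [] A' f2" using clA' A'M TA' f2T f2 by (simp add: Pr_def continuous_map_punct_iff)
    then show ?case by blast
  next
    case (Cons p cs)
    obtain B u where BPr: "Pr cs B u" using Cons by auto
    have B: "closedin X B" "A' \<subseteq> B" "B \<subseteq> M" "M \<inter> \<Union>(fst ` set cs) \<subseteq> B"
      "B \<subseteq> A' \<union> (\<Union>p\<in>set cs. orbit_union k T (fst p))" "\<And>z. z \<in> B \<Longrightarrow> T z \<in> B" "\<And>z. z \<in> B \<Longrightarrow> u (T z) = \<tau> (u z)"
      "continuous_map (subtopology X B) ?E u" "\<And>z. z \<in> A' \<Longrightarrow> u z = f2 z" "finite (zeros u B)"
      using BPr unfolding Pr_def by blast+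
    have p: "p \<in> P" and csP: "set cs \<subseteq> P" using Cons.prems by auto
    define W where "W = (\<Union>q\<in>set cs. orbit_union k T (snd q))"
    have oW: "openin X W" unfolding W_def orbit_union_def
      using openin_funpow_image[OF T Tk] cell(2) csP by (intro openin_Union ballI) (auto intro!: openin_Union)
    define E where "E = fst p \<inter> M - W"
    have clE: "closedin X E" unfolding E_def using clc(1)[OF p] clM oW by (intro closedin_diff closedin_Int)
    have Ep: "E \<subseteq> fst p" and EM: "E \<subseteq> M" by (auto simp: E_def)
    have nz: "u x \<noteq> zvec" if x: "x \<in> E \<inter> B" for x
    proof -
      have "x \<in> A'"
      proof (rule ccontr)
        assume "x \<notin> A'"
        then obtain q j w where q: "q \<in> set cs" "j < k" "w \<in> fst q" "x = (T ^^ j) w"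
          using x B(5) by (auto simp: orbit_union_def)
        have "w \<notin> snd q"
        proof
          assume "w \<in> snd q"
          then have "x \<in> W" using q by (auto simp: W_def orbit_union_def)
          then show False using x by (simp add: E_def)
        qed
        then have "x \<in> G (q, j)" using q by (auto simp: G_def bd_def)
        moreover have "(q, j) \<in> I" using q csP by (auto simp: I_def)
        ultimately have "x \<in> Bd0" by (auto simp: Bd0_def)
        then have "x \<in> Bd" using x EM by (auto simp: Bd_def)
        then show False using \<open>x \<notin> A'\<close> by (simp add: A'_def)
      qed
      then show ?thesis using B(9) f2nz by simp
    qed
    obtain t where t: "continuous_map (subtopology X (fst p)) ?E t" "\<And>a. a \<in> E \<inter> B \<Longrightarrow> t a = u a"
      "finite {y \<in> topspace (subtopology X (fst p)). t y = zvec}"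
    proof (rule finite_zero_extendableD[OF cell(5)[OF p]])
      show "closedin (subtopology X (fst p)) (E \<inter> B)"
        using Ep clE B(1) by (intro closedin_subset_topspace closedin_Int) auto
      show "continuous_map (subtopology (subtopology X (fst p)) (E \<inter> B)) (punct n) u"
        unfolding continuous_map_punct_iff subtopology_subtopology
      proof
        show "continuous_map (subtopology X (fst p \<inter> (E \<inter> B))) ?E u"
          by (rule continuous_map_from_subtopology_mono[OF B(8)]) auto
      qed (use nz in auto)
    qed (use that in blast)
    have tE: "continuous_map (subtopology X E) ?E t" by (rule continuous_map_from_subtopology_mono[OF t(1) Ep])
    have disjE: "E \<inter> (T ^^ j) ` E = {}" if "0 < j" "j < k" for j using disj[OF p that] Ep by blast
    obtain g where g: "continuous_map (subtopology X (B \<union> orbit_union k T E)) ?E g"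
      "\<And>z. z \<in> B \<Longrightarrow> g z = u z" "\<And>j w. j < k \<Longrightarrow> w \<in> E \<Longrightarrow> g ((T ^^ j) w) = (\<tau> ^^ j) (t w)"
      "\<And>z. z \<in> B \<union> orbit_union k T E \<Longrightarrow> g (T z) = \<tau> (g z)"
      by (rule equivariant_extension_step[OF T Tk k \<tau> \<tau>k B(1,6,8,7) clE disjE tE]) (use t(2) in auto)
    define B' where "B' = B \<union> orbit_union k T E"
    have "Pr (p # cs) B' g"
      unfolding Pr_def
    proof (intro conjI)
      show "closedin X B'" unfolding B'_def orbit_union_def
        using closedin_funpow_image[OF T Tk _ clE] B(1) by (intro closedin_Un closedin_Union) auto
      show "A' \<subseteq> B'" using B(2) by (auto simp: B'_def)
      have "orbit_union k T E \<subseteq> M" using funpow_closed[of M T, OF TM] EM by (auto simp: orbit_union_def)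
      then show "B' \<subseteq> M" using B(3) by (auto simp: B'_def)
      show "M \<inter> \<Union>(fst ` set (p # cs)) \<subseteq> B'"
      proof
        fix x assume x: "x \<in> M \<inter> \<Union>(fst ` set (p # cs))"
        show "x \<in> B'"
        proof (cases "x \<in> W")
          case True
          then obtain q j w where q: "q \<in> set cs" "j < k" "w \<in> snd q" "x = (T ^^ j) w"
            by (auto simp: W_def orbit_union_def)
          have qP: "q \<in> P" using q csP by auto
          have w: "w \<in> fst q" using q cell(3)[OF qP] by auto
          have "w = (T ^^ (k - j)) x" using funpow_inverse(1)[of j k T w] q Tk clc(2)[OF qP] w by auto
          then have "w \<in> M" using funpow_closed[of M T x, OF TM] x by auto
          then have "w \<in> B" using B(4) w q by auto
          then show ?thesis using funpow_closed[of B T w, OF B(6)] q by (auto simp: B'_def)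
        next
          case False
          have "x \<in> B \<union> E" using x False B(4) by (auto simp: E_def)
          moreover have "E \<subseteq> orbit_union k T E" using k by (auto simp: orbit_union_def intro!: bexI[of _ 0])
          ultimately show ?thesis by (auto simp: B'_def)
        qed
      qed
      have "orbit_union k T E \<subseteq> orbit_union k T (fst p)" using Ep by (auto simp: orbit_union_def)
      then show "B' \<subseteq> A' \<union> (\<Union>p\<in>set (p # cs). orbit_union k T (fst p))"
        using B(5) by (auto simp: B'_def)
      show "\<forall>z\<in>B'. T z \<in> B' \<and> g (T z) = \<tau> (g z)"
      proof (intro ballI conjI)
        fix z assume z: "z \<in> B'"
        show "g (T z) = \<tau> (g z)" using g(4) z by (simp add: B'_def)
        have "\<And>z. z \<in> E \<Longrightarrow> (T ^^ k) z = z" using Tk EM MX by blast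
        then show "T z \<in> B'" using z B(6) orbit_union_invariant[where K=E and T=T and k=k and z=z] by (auto simp: B'_def)
      qed
      show "continuous_map (subtopology X B') ?E g" using g(1) by (simp add: B'_def)
      show "\<forall>z\<in>A'. g z = f2 z" using g(2) B(2,9) by auto
      show "finite (zeros g B')"
      proof (rule finite_subset)
        let ?Z = "{y \<in> topspace (subtopology X (fst p)). t y = zvec}"
        show "zeros g B' \<subseteq> zeros u B \<union> (\<Union>j<k. (T ^^ j) ` ?Z)"
        proof
          fix x assume "x \<in> zeros g B'"
          then have x: "x \<in> B'" "g x = zvec" by (auto simp: zeros_def)
          show "x \<in> zeros u B \<union> (\<Union>j<k. (T ^^ j) ` ?Z)"
          proof (cases "x \<in> B")
            case True
            then show ?thesis using x g(2) by (auto simp: zeros_def)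
          next
            case False
            then obtain j w where w: "j < k" "w \<in> E" "x = (T ^^ j) w" using x by (auto simp: B'_def orbit_union_def)
            have wt: "w \<in> topspace (subtopology X (fst p))" using w Ep clc(2)[OF p] by auto
            then have tw: "t w \<in> topspace ?E" using t(1) by (auto simp: continuous_map_def)
            have "(\<tau> ^^ j) (t w) = zvec" using g(3)[OF w(1,2)] w(3) x(2) by simp
            then have "t w = zvec" using \<tau>nz[OF tw, of j] w(1) by simp
            then show ?thesis using w wt by blast
          qed
        qed
      qed (use t(3) B(10) in auto)
    qed
    then show ?case by blast
  qed
  have "\<exists>cs. set cs = P" using finite_list[OF P(1)] .
  then obtain cs where cs: "set cs = P" by (elim exE)
  obtain B u where BPr: "Pr cs B u" using main[of cs] cs by auto
  have "M \<subseteq> \<Union>(fst ` P)"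
  proof
    fix x assume "x \<in> M"
    then obtain p where p: "p \<in> P" "x \<in> snd p" using P(3) by auto
    then show "x \<in> \<Union>(fst ` P)" using cell(3)[OF p(1)] by auto
  qed
  then have "B = M" using BPr cs unfolding Pr_def by blast
  then have u: "continuous_map (subtopology X M) ?E u" "\<And>z. z \<in> M \<Longrightarrow> u (T z) = \<tau> (u z)"
      "\<And>z. z \<in> A' \<Longrightarrow> u z = f2 z" "finite (zeros u M)"
    using BPr unfolding Pr_def by blast+
  have "u z = f z" if "z \<in> A" for z using u(3)[of z] that by (simp add: A'_def f2_def)
  then show thesis using that u(1,2,4) by blast
qed

text \<open>By naturality, the local degree is constant on orbits: \<open>T\<close> preserves the local
  orientations and \<open>\<tau>\<close> has degree \<open>1\<close>.\<close>

theorem degree_sum_free_dvd: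
  assumes X: "Hausdorff_space X" and T: "continuous_map X X T" and Tk: "\<And>z. z \<in> topspace X \<Longrightarrow> (T ^^ k) z = z" and k: "k > 0"
    and \<mu>: "\<And>z. z \<in> topspace X \<Longrightarrow> \<mu> z \<in> carrier (local_homology n X {z})"
    and \<mu>T: "\<And>z. z \<in> topspace X \<Longrightarrow> hom_induced (int n) X (topspace X - {z}) X (topspace X - {T z}) T (\<mu> z) = \<mu> (T z)"
    and Q: "openin X Q" "Q \<subseteq> C" and free: "free_on k T Q"
    and u: "continuous_map (subtopology X C) (Euclidean_space n) u" "finite (zeros u Q)"
    and uT: "\<And>z. z \<in> Q \<Longrightarrow> u (T z) = \<tau> (u z)"
    and \<tau>: "continuous_map (Euclidean_space n) (Euclidean_space n) \<tau>" "\<tau> zvec = zvec"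
      "\<And>x. x \<in> topspace (Euclidean_space n) \<Longrightarrow> x \<noteq> zvec \<Longrightarrow> \<tau> x \<noteq> zvec" "endo_degree n \<tau> = 1"
  shows "int k dvd degree_sum n X \<mu> u Q"
  unfolding degree_sum_def
proof (rule sum_free_dvd[OF u(2) _ _ k])
  show "free_on k T (zeros u Q)"
    using free uT \<tau>(2) by (auto simp: free_on_def zeros_def)
  fix z assume z: "z \<in> zeros u Q"
  have QX: "Q \<subseteq> topspace X" using Q(1) openin_subset by blast
  have zQ: "z \<in> Q" using z by (simp add: zeros_def)
  have TQ: "T w \<in> Q" if "w \<in> Q" for w using free that by (auto simp: free_on_def)
  let ?Q = "Q - (zeros u Q - {z})"
  have h: "homeomorphic_map X X T"
    using homeomorphic_map_funpow[OF T Tk, of 1] k by simp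
  have inj: "inj_on T (topspace X)" using h homeomorphic_imp_injective_map by blast
  have i1: "isolates n X ?Q {z} u" by (rule isolates_at_zero[OF X Q u(2,1) zQ])
  have i2: "isolates n X (Q - (zeros u Q - {T z})) {T z} u" by (rule isolates_at_zero[OF X Q u(2,1) TQ[OF zQ]])
  have im: "T ` ?Q = Q - (zeros u Q - {T z})"
  proof
    show "T ` ?Q \<subseteq> Q - (zeros u Q - {T z})"
    proof clarify
      fix w assume w: "w \<in> Q" "w \<notin> zeros u Q - {z}"
      show "T w \<in> Q - (zeros u Q - {T z})"
      proof (cases "w = z")
        case False
        then have "u w \<noteq> zvec" using w by (auto simp: zeros_def)
        moreover have "u w \<in> topspace (Euclidean_space n)" using u(1) w(1) Q QX by (auto simp: continuous_map_def)
        ultimately have "u (T w) \<noteq> zvec" using \<tau>(3) uT w(1) by simp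
        then show ?thesis using TQ[OF w(1)] by (simp add: zeros_def)
      qed (use TQ zQ in auto)
    qed
    show "Q - (zeros u Q - {T z}) \<subseteq> T ` ?Q"
    proof
      fix w assume w: "w \<in> Q - (zeros u Q - {T z})"
      define v where "v = (T ^^ (k - 1)) w"
      have vQ: "v \<in> Q" unfolding v_def using funpow_closed[of Q T w "k - 1", OF TQ] w by auto
      have Tv: "T v = w" using funpow_inverse(2)[of 1 k T w] Tk QX w k by (auto simp: v_def)
      have "v \<notin> zeros u Q - {z}"
      proof
        assume v: "v \<in> zeros u Q - {z}"
        then have "u w = zvec" using uT[OF vQ] \<tau>(2) Tv by (simp add: zeros_def)
        then have "w = T z" using w by (auto simp: zeros_def)
        then have "v = z" using Tv inj vQ zQ QX by (metis inj_onD subsetD)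
        then show False using v by simp
      qed
      then show "w \<in> T ` ?Q" using vQ Tv by auto
    qed
  qed
  have zX: "z \<in> topspace X" "T z \<in> topspace X" using zQ TQ QX by auto
  have qs: "openin X ?Q" "closedin X {z}" "{z} \<subseteq> ?Q" using i1 by (auto simp: isolates_def)
  have i2': "isolates n X (T ` ?Q) (T ` {z}) u" using i2 im by simp
  have "local_degree n X \<mu> u (T z) = map_degree n X (T ` ?Q) {T z} (\<mu> (T z)) u"
    by (rule local_degree_eq) (use i2' \<mu>[OF zX(2)] in auto)
  also have "\<dots> = map_degree n X ?Q {z} (\<mu> z) (u \<circ> T)"
    using map_degree_homeomorphic[OF h i2' qs \<mu>[OF zX(1)]] \<mu>T[OF zX(1)] by simp
  also have "\<dots> = map_degree n X ?Q {z} (\<mu> z) (\<tau> \<circ> u)"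
    by (rule map_degree_cong) (use uT in auto)
  also have "\<dots> = map_degree n X ?Q {z} (\<mu> z) u"
    using map_degree_compose[OF i1 \<mu>[OF zX(1)] \<tau>(1,3)] \<tau>(4) by simp
  also have "\<dots> = local_degree n X \<mu> u z"
    by (rule local_degree_eq[where \<mu>=\<mu> and z=z, OF i1 \<mu>[OF zX(1)], symmetric])
  finally show "local_degree n X \<mu> u (T z) = local_degree n X \<mu> u z" .
qed

section \<open>Degrees of self-maps of Euclidean space\<close>

definition proper_at_zero :: "nat \<Rightarrow> ((nat \<Rightarrow> real) \<Rightarrow> (nat \<Rightarrow> real)) \<Rightarrow> bool" where
  "proper_at_zero n F \<longleftrightarrow> continuous_map (Euclidean_space n) (Euclidean_space n) F \<and>
     (\<forall>x\<in>topspace (Euclidean_space n). x \<noteq> zvec \<longrightarrow> F x \<noteq> zvec)"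

lemma local_int_inj:
  "a \<in> carrier (local_group n) \<Longrightarrow> b \<in> carrier (local_group n) \<Longrightarrow> local_int n a = local_int n b \<Longrightarrow> a = b"
  using local_int_iso by (auto simp: iso_def bij_betw_def dest: inj_onD)

lemma proper_at_zero_funcset:
  "proper_at_zero n F \<Longrightarrow> F \<in> topspace (Euclidean_space n) - {zvec} \<rightarrow> topspace (Euclidean_space n) - {zvec}"
  by (auto simp: proper_at_zero_def continuous_map_def)

lemma endo_degree_eq:
  assumes "a \<in> carrier (local_group n)" "local_int n a = 1"
  shows "endo_degree n F = local_int n (hom_induced (int n) (Euclidean_space n) (topspace (Euclidean_space n) - {zvec})
      (Euclidean_space n) (topspace (Euclidean_space n) - {zvec}) F a)"
  using local_int_hom_induced[OF assms(1), of F] assms(2) by simp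

lemma endo_degree_id: "endo_degree n (\<lambda>x. x) = 1"
proof -
  obtain a where a: "a \<in> carrier (local_group n)" "local_int n a = 1" by (rule local_int_surj)
  show ?thesis
    using endo_degree_eq[OF a, of "\<lambda>x. x"] a hom_induced_id_gen[of "Euclidean_space n" "\<lambda>x. x" a "int n"] by simp
qed

lemma endo_degree_compose:
  assumes "proper_at_zero n F" "proper_at_zero n G"
  shows "endo_degree n (F \<circ> G) = endo_degree n F * endo_degree n G"
proof -
  obtain a where a: "a \<in> carrier (local_group n)" "local_int n a = 1" by (rule local_int_surj)
  have c: "continuous_map (Euclidean_space n) (Euclidean_space n) F" "continuous_map (Euclidean_space n) (Euclidean_space n) G"
    using assms by (auto simp: proper_at_zero_def)
  show ?thesis
    unfolding endo_degree_eq[OF a, of "F \<circ> G"] endo_degree_eq[OF a, of G]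
    using hom_induced_compose'[OF c(2) proper_at_zero_funcset[OF assms(2)] c(1) proper_at_zero_funcset[OF assms(1)], of "int n" a]
      local_int_hom_induced[OF hom_induced_carrier, of n F] by metis
qed

lemma endo_degree_cong:
  assumes "\<And>x. x \<in> topspace (Euclidean_space n) \<Longrightarrow> F x = G x"
  shows "endo_degree n F = endo_degree n G"
  unfolding endo_degree_def using hom_induced_eq[of "Euclidean_space n" F G] assms by simp

lemma endo_degree_linear_homotopy:
  assumes F: "proper_at_zero n F" and G: "proper_at_zero n G"
    and nz: "\<And>x t. x \<in> topspace (Euclidean_space n) \<Longrightarrow> x \<noteq> zvec \<Longrightarrow> 0 \<le> t \<Longrightarrow> t \<le> 1 \<Longrightarrow>
        (\<lambda>i. (1 - t) * F x i + t * G x i) \<noteq> zvec"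
  shows "endo_degree n F = endo_degree n G"
proof -
  let ?E = "Euclidean_space n" and ?P = "topspace (Euclidean_space n) - {zvec}"
  have c: "continuous_map ?E ?E F" "continuous_map ?E ?E G" using F G by (auto simp: proper_at_zero_def)
  have "homotopic_with (\<lambda>h. h \<in> ?P \<rightarrow> ?P) ?E ?E F G"
  proof (rule homotopic_with_linear_Euclidean[OF c])
    fix t :: real assume t: "0 \<le> t" "t \<le> 1"
    show "(\<lambda>x i. (1 - t) * F x i + t * G x i) \<in> ?P \<rightarrow> ?P"
    proof
      fix x assume x: "x \<in> ?P"
      then have "\<forall>i\<ge>n. F x i = 0" "\<forall>i\<ge>n. G x i = 0" using c by (auto simp: continuous_map_Euclidean_iff)
      then show "(\<lambda>i. (1 - t) * F x i + t * G x i) \<in> ?P"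
        using nz[of x t] x t by (auto simp: topspace_Euclidean_space)
    qed
  qed
  from homology_homotopy_axiom[OF this, of "int n"] show ?thesis by (simp add: endo_degree_def)
qed

section \<open>The standard orientation of Euclidean space\<close>

lemma iso_surj: "f \<in> iso G H \<Longrightarrow> y \<in> carrier H \<Longrightarrow> \<exists>x\<in>carrier G. f x = y"
proof -
  assume f: "f \<in> iso G H" and y: "y \<in> carrier H"
  then have "y \<in> f ` carrier G" by (simp add: iso_def bij_betw_def)
  then show ?thesis by blast
qed

text \<open>The radial projection onto the complement of the open cube is a homotopy inverse of the
  inclusion into the complement of \<open>0\<close>.\<close>

lemma local_homology_cube_surj:
  assumes n: "n > 0" and g: "g \<in> carrier (local_group n)"
  obtains c where "c \<in> carrier (local_homology n (Euclidean_space n) (open_cube n zvec 1))"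
    "restrict_class n (Euclidean_space n) (open_cube n zvec 1) {zvec} c = g"
proof -
  let ?E = "Euclidean_space n" and ?U = "open_cube n zvec 1"
  let ?S = "topspace ?E - ?U" and ?P = "topspace ?E - {zvec}"
  let ?N = "sup_gauge n"
  let ?H = "\<lambda>S. reduced_homology_group (int n - 1) (subtopology ?E S)"
  have SP: "?S \<subseteq> ?P" by (auto simp: open_cube_def)
  have Smem: "x \<in> ?S \<longleftrightarrow> x \<in> topspace ?E \<and> 1 \<le> ?N x" for x
    using mem_open_cube_zero[of 1 x n] by auto
  define e where "e = (\<lambda>i. if i < n then 1 else (0::real))"
  have "e \<in> ?S" using n by (auto simp: e_def open_cube_def topspace_Euclidean_space)
  then have ne: "topspace ?E \<inter> ?S \<noteq> {}" "topspace ?E \<inter> ?P \<noteq> {}" using SP by auto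
  note bS = iso_relative_homology_of_contractible[OF contractible_Euclidean_space ne(1), of "int n"]
  note bP = iso_relative_homology_of_contractible[OF contractible_Euclidean_space ne(2), of "int n"]
  define r where "r x = (\<lambda>i. (1 / min 1 (?N x)) * x i)" for x
  have Npos: "?N x > 0" if "x \<in> ?P" for x using gauge_normalize(2)[OF hom_gauge_sup] that by auto
  have Nc: "continuous_map ?E euclideanreal ?N" using hom_gauge_sup by (simp add: hom_gauge_def)
  have rc: "continuous_map (subtopology ?E ?P) ?E r"
    unfolding r_def
  proof (rule continuous_map_Euclidean_scale)
    show "continuous_map (subtopology ?E ?P) ?E (\<lambda>x. x)" by (simp add: continuous_map_from_subtopology)
    have "continuous_map (subtopology ?E ?P) euclideanreal (\<lambda>x. min 1 (?N x))"
      by (intro continuous_map_real_min continuous_map_from_subtopology[OF Nc]) auto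
    then show "continuous_map (subtopology ?E ?P) euclideanreal (\<lambda>x. 1 / min 1 (?N x))"
    proof (rule continuous_map_real_divide[rotated])
      show "min 1 (?N x) \<noteq> 0" if "x \<in> topspace (subtopology ?E ?P)" for x
        using Npos[of x] that by (auto simp: min_def)
    qed auto
  qed
  have rS: "r x \<in> ?S" if x: "x \<in> ?P" for x
  proof -
    have "?N (r x) = (1 / min 1 (?N x)) * ?N x"
      unfolding r_def using gauge_scale[OF hom_gauge_sup, of "1 / min 1 (?N x)" n x] Npos[OF x] by simp
    also have "\<dots> \<ge> 1" using Npos[OF x] by (simp add: min_def)
    finally have "1 \<le> ?N (r x)" .
    moreover have "r x \<in> topspace ?E" using x by (auto simp: r_def topspace_Euclidean_space)
    ultimately show ?thesis using Smem[of "r x"] by blast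
  qed
  have i: "continuous_map (subtopology ?E ?S) (subtopology ?E ?P) id" using SP by (rule continuous_map_id_subtopology)
  have r: "continuous_map (subtopology ?E ?P) (subtopology ?E ?S) r"
    using rc rS by (auto simp: continuous_map_in_subtopology)
  have "homotopic_with (\<lambda>h. True) (subtopology ?E ?S) (subtopology ?E ?S) (r \<circ> id) id"
  proof (rule homotopic_with_equal)
    fix x assume "x \<in> topspace (subtopology ?E ?S)"
    then have "1 \<le> ?N x" using Smem by auto
    then show "(r \<circ> id) x = id x" by (auto simp: r_def)
  qed (use continuous_map_compose[OF i r] in auto)
  moreover have "homotopic_with (\<lambda>h. True) (subtopology ?E ?P) (subtopology ?E ?P) (id \<circ> r) id"
  proof -
    have "homotopic_with (\<lambda>h. h \<in> ?P \<rightarrow> ?P) (subtopology ?E ?P) ?E r (\<lambda>x. x)"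
    proof (rule homotopic_with_linear_Euclidean[OF rc])
      show "continuous_map (subtopology ?E ?P) ?E (\<lambda>x. x)" by (simp add: continuous_map_from_subtopology)
      fix t :: real assume t: "0 \<le> t" "t \<le> 1"
      show "(\<lambda>x i. (1 - t) * r x i + t * x i) \<in> ?P \<rightarrow> ?P"
      proof
        fix x assume x: "x \<in> ?P"
        let ?a = "(1 - t) * (1 / min 1 (?N x)) + t"
        have "?a > 0"
        proof (cases "t = 1")
          case False
          then show ?thesis using t Npos[OF x] by (intro add_pos_nonneg mult_pos_pos) auto
        qed simp
        moreover have "(\<lambda>i. (1 - t) * r x i + t * x i) = (\<lambda>i. ?a * x i)" by (auto simp: r_def algebra_simps)
        ultimately show "(\<lambda>i. (1 - t) * r x i + t * x i) \<in> ?P" using x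
          by (auto simp: topspace_Euclidean_space fun_eq_iff)
      qed
    qed
    then show ?thesis
      unfolding homotopic_with_def
    proof (elim exE conjE)
      fix h assume h: "continuous_map (prod_topology (top_of_set {0..1::real}) (subtopology ?E ?P)) ?E h"
        "\<forall>x. h (0, x) = r x" "\<forall>x. h (1, x) = x" "\<forall>t\<in>{0..1}. (\<lambda>x. h (t, x)) \<in> ?P \<rightarrow> ?P"
      have "continuous_map (prod_topology (top_of_set {0..1::real}) (subtopology ?E ?P)) (subtopology ?E ?P) h"
        using h(1,4) by (auto simp: continuous_map_in_subtopology)
      then show "\<exists>h. continuous_map (prod_topology (top_of_set {0..1::real}) (subtopology ?E ?P)) (subtopology ?E ?P) h \<and>
          (\<forall>x. h (0, x) = (id \<circ> r) x) \<and> (\<forall>x. h (1, x) = id x) \<and> (\<forall>t\<in>{0..1}. True)"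
        using h by (intro exI[of _ h]) auto
    qed
  qed
  ultimately have ii: "hom_induced (int n - 1) (subtopology ?E ?S) {} (subtopology ?E ?P) {} id \<in> iso (?H ?S) (?H ?P)"
    by (rule homotopy_equivalence_reduced_homology_group_isomorphism[OF i r])
  let ?j = "restrict_class n ?E ?U {zvec}"
  have "hom_boundary (int n) ?E ?P g \<in> carrier (?H ?P)" using bP g by (auto simp: iso_def hom_def)
  then obtain d where d: "d \<in> carrier (?H ?S)" "hom_induced (int n - 1) (subtopology ?E ?S) {} (subtopology ?E ?P) {} id d = hom_boundary (int n) ?E ?P g"
    using iso_surj[OF ii] by metis
  obtain c where c: "c \<in> carrier (local_homology n ?E ?U)" "hom_boundary (int n) ?E ?S c = d"
    using iso_surj[OF bS d(1)] by metis
  have idS: "continuous_map ?E ?E id" "id \<in> ?S \<rightarrow> ?P" using SP by auto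
  have "hom_boundary (int n) ?E ?P (?j c) = hom_boundary (int n) ?E ?P g"
    using fun_cong[OF naturality_hom_induced[OF idS, of "int n"], of c] c(2) d(2) by simp
  moreover have "inj_on (hom_boundary (int n) ?E ?P) (carrier (local_group n))"
    using bP by (simp add: iso_def bij_betw_def)
  ultimately have "?j c = g" using g hom_induced_carrier by (meson inj_onD)
  then show thesis using that c(1) by blast
qed

definition translate :: "(nat \<Rightarrow> real) \<Rightarrow> (nat \<Rightarrow> real) \<Rightarrow> nat \<Rightarrow> real" where
  "translate a x = (\<lambda>i. x i + a i)"

lemma continuous_map_translate':
  "a \<in> topspace (Euclidean_space n) \<Longrightarrow> continuous_map (Euclidean_space n) (Euclidean_space n) (translate a)"
  using continuous_map_affine[of a n 1] by (simp add: translate_def[abs_def] add.commute)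

definition euclid_orientation :: "nat \<Rightarrow> (nat \<Rightarrow> real) chain set \<Rightarrow> (nat \<Rightarrow> real) \<Rightarrow> (nat \<Rightarrow> real) chain set" where
  "euclid_orientation n g z = hom_induced (int n) (Euclidean_space n) (topspace (Euclidean_space n) - {zvec})
     (Euclidean_space n) (topspace (Euclidean_space n) - {z}) (translate z) g"

lemma euclid_orientation_zero:
  "g \<in> carrier (local_group n) \<Longrightarrow> euclid_orientation n g zvec = g"
  unfolding euclid_orientation_def
  by (rule hom_induced_id_gen[OF continuous_map_translate']) (auto simp: translate_def topspace_Euclidean_space)

lemma translate_neq:
  assumes "z \<in> topspace (Euclidean_space n)"
  shows "translate z \<in> topspace (Euclidean_space n) - {zvec} \<rightarrow> topspace (Euclidean_space n) - {z}"
  using assms by (auto simp: translate_def topspace_Euclidean_space fun_eq_iff)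

lemma locally_oriented_Euclidean:
  assumes n: "n > 0" and g: "g \<in> carrier (local_group n)"
  shows "locally_oriented n (Euclidean_space n) (euclid_orientation n g)"
  unfolding locally_oriented_def
proof
  let ?E = "Euclidean_space n" and ?U = "open_cube n zvec 1"
  let ?P = "topspace ?E - {zvec}"
  fix a assume a: "a \<in> topspace ?E"
  obtain c where c: "c \<in> carrier (local_homology n ?E ?U)" "restrict_class n ?E ?U {zvec} c = g"
    using local_homology_cube_surj[OF n g] .
  let ?V = "open_cube n a 1"
  have mem: "x \<in> ?V \<longleftrightarrow> x \<in> topspace ?E \<and> (\<lambda>i. x i - a i) \<in> ?U" for x
    using a by (auto simp: open_cube_def topspace_Euclidean_space)
  define c' where "c' = hom_induced (int n) ?E (topspace ?E - ?U) ?E (topspace ?E - ?V) (translate a) c"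
  have tc: "continuous_map ?E ?E (translate z)" if "z \<in> topspace ?E" for z using that by (rule continuous_map_translate')
  have tE: "translate z x \<in> topspace ?E" if "z \<in> topspace ?E" "x \<in> topspace ?E" for z x
    using tc[OF that(1)] that(2) by (auto simp: continuous_map_def)
  have ta: "translate a \<in> topspace ?E - ?U \<rightarrow> topspace ?E - ?V"
    using tE[OF a] mem by (auto simp: translate_def)
  have "restrict_class n ?E ?V {y} c' = euclid_orientation n g y" if y: "y \<in> ?V" for y
  proof -
    have yE: "y \<in> topspace ?E" using y open_cube_subset by blast
    have r: "continuous_map ?E ?E id" "id \<in> topspace ?E - ?V \<rightarrow> topspace ?E - {y}" using y by auto
    have r0: "continuous_map ?E ?E id" "id \<in> topspace ?E - ?U \<rightarrow> ?P" by (auto simp: open_cube_def)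
    have "restrict_class n ?E ?V {y} c' = hom_induced (int n) ?E (topspace ?E - ?U) ?E (topspace ?E - {y}) (translate a) c"
      unfolding c'_def using hom_induced_compose'[OF tc[OF a] ta r, of "int n" c] by simp
    also have "\<dots> = hom_induced (int n) ?E (topspace ?E - ?U) ?E (topspace ?E - {y}) (translate y) c"
    proof -
      have "homotopic_with (\<lambda>h. h \<in> topspace ?E - ?U \<rightarrow> topspace ?E - {y}) ?E ?E (translate a) (translate y)"
      proof (rule homotopic_with_linear_Euclidean[OF tc[OF a] tc[OF yE]])
        fix t :: real assume t: "0 \<le> t" "t \<le> 1"
        show "(\<lambda>x i. (1 - t) * translate a x i + t * translate y x i) \<in> topspace ?E - ?U \<rightarrow> topspace ?E - {y}"
        proof
          fix x assume x: "x \<in> topspace ?E - ?U"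
          have 1: "(\<lambda>i. (1 - t) * translate a x i + t * translate y x i) \<in> topspace ?E"
            using a yE x by (auto simp: translate_def topspace_Euclidean_space)
          have "(\<lambda>i. (1 - t) * translate a x i + t * translate y x i) \<noteq> y"
          proof
            assume eq: "(\<lambda>i. (1 - t) * translate a x i + t * translate y x i) = y"
            have xi: "x i = (1 - t) * (y i - a i)" for i
              using fun_cong[OF eq, of i] by (simp add: translate_def algebra_simps)
            have "\<bar>x i\<bar> < 1" if "i < n" for i
            proof -
              have "\<bar>y i - a i\<bar> < 1" using y that by (simp add: open_cube_def)
              moreover have "(1 - t) * \<bar>y i - a i\<bar> \<le> 1 * \<bar>y i - a i\<bar>" using t by (intro mult_right_mono) auto
              ultimately show ?thesis using t by (simp add: xi abs_mult)
            qed
            then have "x \<in> ?U" using x by (auto simp: open_cube_def)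
            then show False using x by simp
          qed
          then show "(\<lambda>i. (1 - t) * translate a x i + t * translate y x i) \<in> topspace ?E - {y}" using 1 by simp
        qed
      qed
      from homology_homotopy_axiom[OF this, of "int n"] show ?thesis by simp
    qed
    also have "\<dots> = euclid_orientation n g y"
      unfolding euclid_orientation_def
      using hom_induced_compose'[OF r0 tc[OF yE] translate_neq[OF yE], of "int n" c] c(2) by simp
    finally show ?thesis .
  qed
  moreover have "a \<in> ?V" using a by (simp add: open_cube_def)
  moreover have "c' \<in> carrier (local_homology n ?E ?V)" unfolding c'_def by (rule hom_induced_carrier)
  ultimately show "\<exists>V. a \<in> V \<and> oriented_near n ?E (euclid_orientation n g) V"
    using openin_open_cube[of n a 1] unfolding oriented_near_def
    by (intro exI[of _ ?V] conjI bexI[of _ c'] ballI) auto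
qed

text \<open>An additive map commutes with translations up to replacing \<open>z\<close> by
  \<open>F z\<close>, which reduces the claim to the origin.\<close>

lemma euclid_orientation_equivariant:
  assumes g: "g \<in> carrier (local_group n)" and F: "proper_at_zero n F" and deg: "endo_degree n F = 1"
    and add: "\<And>x y. F (\<lambda>i. x i + y i) = (\<lambda>i. F x i + F y i)"
    and z: "z \<in> topspace (Euclidean_space n)"
  shows "hom_induced (int n) (Euclidean_space n) (topspace (Euclidean_space n) - {z})
      (Euclidean_space n) (topspace (Euclidean_space n) - {F z}) F (euclid_orientation n g z) = euclid_orientation n g (F z)"
proof -
  let ?E = "Euclidean_space n" and ?P = "topspace (Euclidean_space n) - {zvec}"
  have Fc: "continuous_map ?E ?E F" using F by (simp add: proper_at_zero_def)
  have Fz: "F z \<in> topspace ?E" using Fc z by (auto simp: continuous_map_def)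
  have Fg: "hom_induced (int n) ?E ?P ?E ?P F g = g"
    by (rule local_int_inj) (use g local_int_hom_induced[OF g, of F] deg hom_induced_carrier in auto)
  have Fm: "F \<in> topspace ?E - {z} \<rightarrow> topspace ?E - {F z}"
  proof
    fix x assume x: "x \<in> topspace ?E - {z}"
    define d where "d = (\<lambda>i. x i - z i)"
    have d: "d \<in> topspace ?E" "d \<noteq> zvec" using x z by (auto simp: d_def topspace_Euclidean_space fun_eq_iff)
    have "F x = (\<lambda>i. F d i + F z i)" using add[of d z] by (simp add: d_def)
    moreover have "F d \<noteq> zvec" using F d by (auto simp: proper_at_zero_def)
    ultimately have "F x \<noteq> F z" by (auto simp: fun_eq_iff)
    then show "F x \<in> topspace ?E - {F z}" using Fc x by (auto simp: continuous_map_def)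
  qed
  have "hom_induced (int n) ?E (topspace ?E - {z}) ?E (topspace ?E - {F z}) F (euclid_orientation n g z)
     = hom_induced (int n) ?E ?P ?E (topspace ?E - {F z}) (F \<circ> translate z) g"
    unfolding euclid_orientation_def
    by (rule hom_induced_compose'[OF continuous_map_translate'[OF z] translate_neq[OF z] Fc Fm])
  also have "F \<circ> translate z = translate (F z) \<circ> F" using add by (auto simp: translate_def)
  also have "hom_induced (int n) ?E ?P ?E (topspace ?E - {F z}) (translate (F z) \<circ> F) g = euclid_orientation n g (F z)"
    unfolding euclid_orientation_def
    using hom_induced_compose'[OF Fc proper_at_zero_funcset[OF F] continuous_map_translate'[OF Fz] translate_neq[OF Fz], of "int n" g] Fg
    by simp
  finally show ?thesis .
qed

lemma local_degree_zero_Euclidean: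
  assumes g: "g \<in> carrier (local_group n)" "local_int n g = 1" and F: "proper_at_zero n F"
  shows "local_degree n (Euclidean_space n) (euclid_orientation n g) F zvec = endo_degree n F"
proof -
  let ?E = "Euclidean_space n" and ?P = "topspace (Euclidean_space n) - {zvec}"
  have iso: "isolates n ?E (topspace ?E) {zvec} F"
  proof -
    have z: "zvec \<in> topspace ?E" by (simp add: topspace_Euclidean_space)
    then have "closedin ?E {zvec}" by (rule closedin_Hausdorff_singleton[OF Hausdorff_Euclidean_space])
    then show ?thesis using F z by (auto simp: isolates_def proper_at_zero_def)
  qed
  have mu: "euclid_orientation n g zvec = g" by (rule euclid_orientation_zero[OF g(1)])
  have "local_degree n ?E (euclid_orientation n g) F zvec = map_degree n ?E (topspace ?E) {zvec} g F"
    using local_degree_eq[where \<mu>="euclid_orientation n g" and z=zvec, OF iso] mu g(1) by simp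
  also have "\<dots> = local_int n (hom_induced (int n) (subtopology ?E (topspace ?E)) ?P ?E ?P F g)"
  proof (rule map_degree_eq)
    show "hom_induced (int n) (subtopology ?E (topspace ?E)) ?P ?E ?P id g = g"
      using hom_induced_id[OF g(1)] by simp
  qed (use iso g in \<open>auto simp: isolates_def\<close>)
  also have "\<dots> = endo_degree n F" using endo_degree_eq[OF g, of F] by simp
  finally show ?thesis .
qed

section \<open>The quaternionic linear model\<close>

text \<open>In dimension \<open>n = 4 * m\<close> the space \<open>\<real>\<^sup>n\<close> is a quaternionic
  vector space; \<open>quat_i\<close> and \<open>quat_j\<close> are the multiplications by two
  anticommuting unit quaternions, acting on consecutive blocks of four coordinates.\<close>

definition quat_i :: "(nat \<Rightarrow> real) \<Rightarrow> nat \<Rightarrow> real" where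
  "quat_i x = (\<lambda>i. if even i then - x (i + 1) else x (i - 1))"

definition quat_j :: "(nat \<Rightarrow> real) \<Rightarrow> nat \<Rightarrow> real" where
  "quat_j x = (\<lambda>i. if i mod 4 = 0 then - x (i + 2) else if i mod 4 = 1 then x (i + 2)
      else if i mod 4 = 2 then x (i - 2) else - x (i - 2))"

definition rot :: "real \<Rightarrow> (nat \<Rightarrow> real) \<Rightarrow> nat \<Rightarrow> real" where
  "rot t x = (\<lambda>i. cos t * x i + sin t * quat_i x i)"

lemma quat_i_quat_i: "quat_i (quat_i x) i = - x i"
  by (auto simp: quat_i_def)

lemma mod4_cases:
  fixes i :: nat
  obtains m where "i = 4 * m" | m where "i = 4 * m + 1" | m where "i = 4 * m + 2" | m where "i = 4 * m + 3"
proof -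
  have "i = 4 * (i div 4) + i mod 4" "i mod 4 < 4" by simp_all
  then consider "i mod 4 = 0" | "i mod 4 = 1" | "i mod 4 = 2" | "i mod 4 = 3" by linarith
  then show thesis using that \<open>i = 4 * (i div 4) + i mod 4\<close> by cases (metis add.right_neutral)+
qed

lemma quat_j_simps:
  "quat_j x (4 * m) = - x (4 * m + 2)" "quat_j x (4 * m + 1) = x (4 * m + 3)"
  "quat_j x (4 * m + 2) = x (4 * m)" "quat_j x (4 * m + 3) = - x (4 * m + 1)"
proof -
  have m: "(4 * m) mod 4 = 0" "(4 * m + 1) mod 4 = 1" "(4 * m + 2) mod 4 = 2" "(4 * m + 3) mod 4 = 3" by presburger+
  show "quat_j x (4 * m) = - x (4 * m + 2)" by (simp add: quat_j_def)
  show "quat_j x (4 * m + 1) = x (4 * m + 3)" unfolding quat_j_def m by (simp add: numeral_3_eq_3)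
  show "quat_j x (4 * m + 2) = x (4 * m)" unfolding quat_j_def m by simp
  show "quat_j x (4 * m + 3) = - x (4 * m + 1)" unfolding quat_j_def m by (simp add: numeral_3_eq_3)
qed

lemma quat_i_simps:
  "quat_i x (4 * m) = - x (4 * m + 1)" "quat_i x (4 * m + 1) = x (4 * m)"
  "quat_i x (4 * m + 2) = - x (4 * m + 3)" "quat_i x (4 * m + 3) = x (4 * m + 2)"
  by (auto simp: quat_i_def numeral_3_eq_3)

lemma quat_j_quat_j: "quat_j (quat_j x) i = - x i"
  by (cases i rule: mod4_cases) (simp_all only: quat_j_simps minus_minus)

lemma quat_j_quat_i: "quat_j (quat_i x) i = - quat_i (quat_j x) i"
  by (cases i rule: mod4_cases) (simp_all only: quat_j_simps quat_i_simps minus_minus)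

lemma quat_i_linear: "quat_i (\<lambda>i. a * x i + b * y i) = (\<lambda>i. a * quat_i x i + b * quat_i y i)"
  by (auto simp: quat_i_def)

lemma quat_j_linear: "quat_j (\<lambda>i. a * x i + b * y i) = (\<lambda>i. a * quat_j x i + b * quat_j y i)"
  by (auto simp: quat_j_def)

lemma quat_i_closed:
  assumes "even n" "x \<in> topspace (Euclidean_space n)"
  shows "quat_i x \<in> topspace (Euclidean_space n)"
proof -
  have "quat_i x i = 0" if "i \<ge> n" for i
  proof (cases "even i")
    case True
    then show ?thesis using assms(2) that by (auto simp: quat_i_def topspace_Euclidean_space)
  next
    case False
    then have "i \<noteq> n" using assms(1) by auto
    then have "n \<le> i - 1" using that by simp
    then show ?thesis using assms(2) False by (auto simp: quat_i_def topspace_Euclidean_space)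
  qed
  then show ?thesis by (simp add: topspace_Euclidean_space)
qed

lemma quat_j_closed:
  assumes "n mod 4 = 0" "x \<in> topspace (Euclidean_space n)"
  shows "quat_j x \<in> topspace (Euclidean_space n)"
proof -
  have "quat_j x i = 0" if "i \<ge> n" for i
  proof -
    have x0: "x l = 0" if "l \<ge> n" for l using assms(2) that by (auto simp: topspace_Euclidean_space)
    obtain k where n: "n = 4 * k" using assms(1) by auto
    show ?thesis
    proof (cases i rule: mod4_cases)
      case (1 m) then have "4 * m + 2 \<ge> n" using that by simp
      then show ?thesis unfolding 1 quat_j_simps by (simp only: x0 minus_zero)
    next
      case (2 m) then have "4 * m + 3 \<ge> n" using that by simp
      then show ?thesis unfolding 2 quat_j_simps by (rule x0)
    next
      case (3 m) then have "4 * m \<ge> n" using that n by presburger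
      then show ?thesis unfolding 3 quat_j_simps using x0 by simp
    next
      case (4 m) then have "4 * m + 1 \<ge> n" using that n by presburger
      then show ?thesis unfolding 4 quat_j_simps using x0 by simp
    qed
  qed
  then show ?thesis by (simp add: topspace_Euclidean_space)
qed

lemma continuous_map_quat:
  assumes "n mod 4 = 0"
  shows "continuous_map (Euclidean_space n) (Euclidean_space n) quat_i"
    "continuous_map (Euclidean_space n) (Euclidean_space n) quat_j"
proof -
  have ev: "even n" using assms by presburger
  show "continuous_map (Euclidean_space n) (Euclidean_space n) quat_i"
    unfolding continuous_map_Euclidean_iff
  proof (intro conjI allI impI ballI)
    fix i
    have "continuous_map (Euclidean_space n) euclideanreal (\<lambda>x. - x (i + 1))"
      "continuous_map (Euclidean_space n) euclideanreal (\<lambda>x. x (i - 1))"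
      by (intro continuous_map_minus continuous_map_coord)+
    then show "continuous_map (Euclidean_space n) euclideanreal (\<lambda>x. quat_i x i)"
      by (cases "even i") (simp_all add: quat_i_def)
  qed (use quat_i_closed[OF ev] in \<open>auto simp: topspace_Euclidean_space\<close>)
  show "continuous_map (Euclidean_space n) (Euclidean_space n) quat_j"
    unfolding continuous_map_Euclidean_iff
  proof (intro conjI allI impI ballI)
    fix i
    have "continuous_map (Euclidean_space n) euclideanreal (\<lambda>x. - x l)"
      "continuous_map (Euclidean_space n) euclideanreal (\<lambda>x. x l)" for l
      by (intro continuous_map_minus continuous_map_coord)+
    then show "continuous_map (Euclidean_space n) euclideanreal (\<lambda>x. quat_j x i)"
      by (cases "i mod 4 = 0"; cases "i mod 4 = 1"; cases "i mod 4 = 2") (simp_all add: quat_j_def)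
  qed (use quat_j_closed[OF assms] in \<open>auto simp: topspace_Euclidean_space\<close>)
qed

text \<open>If \<open>I * I = - 1\<close>, the operator \<open>a + b * I\<close> has the inverse
  \<open>(a - b * I) / (a * a + b * b)\<close>. Hence, if \<open>b \<noteq> 0\<close>, the
  linear path from the identity to this operator consists of isomorphisms.\<close>

lemma complex_combination_nonzero:
  fixes I :: "(nat \<Rightarrow> real) \<Rightarrow> nat \<Rightarrow> real"
  assumes sq: "\<And>x i. I (I x) i = - x i" and lin: "\<And>a b x y. I (\<lambda>i. a * x i + b * y i) = (\<lambda>i. a * I x i + b * I y i)"
    and x: "x \<noteq> zvec" and ab: "a \<noteq> 0 \<or> b \<noteq> 0"
  shows "(\<lambda>i. a * x i + b * I x i) \<noteq> zvec"
proof
  assume z: "(\<lambda>i. a * x i + b * I x i) = zvec"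
  have "I zvec = zvec" using lin[of 0 x 0 x] by simp
  then have "(\<lambda>i. a * I x i + b * I (I x) i) = zvec" using lin[of a x b "I x"] z by simp
  then have 1: "a * I x i - b * x i = 0" for i using sq by (metis add_uminus_conv_diff mult_minus_right)
  have 2: "a * x i + b * I x i = 0" for i using z by meson
  have "(a\<^sup>2 + b\<^sup>2) * x i = a * (a * x i + b * I x i) - b * (a * I x i - b * x i)" for i
    by (simp add: power2_eq_square algebra_simps)
  then have h: "(a\<^sup>2 + b\<^sup>2) * x i = 0" for i using 1 2 by (metis diff_self mult_zero_right)
  have "a\<^sup>2 + b\<^sup>2 \<noteq> 0" using ab by (simp add: sum_power2_eq_zero_iff)
  then have "x i = 0" for i using h[of i] mult_eq_0_iff by blast
  then show False using x by auto
qed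

lemma rot_add: "rot s (rot t x) = rot (s + t) x"
proof
  fix i
  have "quat_i (rot t x) i = cos t * quat_i x i + sin t * quat_i (quat_i x) i"
    unfolding rot_def quat_i_linear ..
  moreover have "rot s (rot t x) i = cos s * rot t x i + sin s * quat_i (rot t x) i"
    by (subst rot_def) (rule refl)
  ultimately have "rot s (rot t x) i = cos s * rot t x i + sin s * (cos t * quat_i x i - sin t * x i)"
    by (simp add: quat_i_quat_i)
  then show "rot s (rot t x) i = rot (s + t) x i"
    by (simp add: rot_def cos_add sin_add algebra_simps)
qed

lemma rot_zero: "rot 0 x = x" by (simp add: rot_def)

lemma rot_funpow: "(rot t ^^ j) x = rot (real j * t) x"
  by (induction j) (simp_all add: rot_zero rot_add algebra_simps)

lemma rot_2pi: "rot (2 * pi) x = x" by (simp add: rot_def)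

lemma rot_zvec: "rot t zvec = zvec" by (auto simp: rot_def quat_i_def)

lemma rot_linear: "rot t (\<lambda>i. x i + y i) = (\<lambda>i. rot t x i + rot t y i)"
  using quat_i_linear[of 1 x 1 y] by (auto simp: rot_def algebra_simps)

lemma continuous_map_rot:
  assumes "n mod 4 = 0"
  shows "continuous_map (Euclidean_space n) (Euclidean_space n) (rot t)"
  unfolding rot_def
  by (intro continuous_map_Euclidean_space_add continuous_map_Euclidean_scale continuous_map_quat(1)[OF assms]) auto

lemma rot_nonzero: "x \<noteq> zvec \<Longrightarrow> rot t x \<noteq> zvec"
  unfolding rot_def
  by (rule complex_combination_nonzero[OF quat_i_quat_i quat_i_linear]) (auto, metis sin_zero_abs_cos_one abs_zero zero_neq_one)

lemma rot_fixed:
  assumes "rot t x = x" "x \<noteq> zvec"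
  shows "cos t = 1"
proof (rule ccontr)
  assume "cos t \<noteq> 1"
  then have "(\<lambda>i. (cos t - 1) * x i + sin t * quat_i x i) \<noteq> zvec"
    by (intro complex_combination_nonzero[OF quat_i_quat_i quat_i_linear assms(2)]) auto
  moreover have "(\<lambda>i. (cos t - 1) * x i + sin t * quat_i x i) = zvec"
    using fun_cong[OF assms(1)] by (auto simp: rot_def algebra_simps)
  ultimately show False by simp
qed

lemma l2_rot:
  assumes "even n"
  shows "l2 n (rot t x) = l2 n x"
proof -
  obtain m where n: "n = 2 * m" using assms by auto
  have "(\<Sum>i<2 * m. (rot t x i)\<^sup>2) = (\<Sum>i<2 * m. (x i)\<^sup>2)" for m
  proof (induction m)
    case (Suc m)
    let ?c = "cos t" and ?s = "sin t" and ?a = "x (2 * m)" and ?b = "x (Suc (2 * m))"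
    have "(?c * ?a - ?s * ?b)\<^sup>2 + (?c * ?b + ?s * ?a)\<^sup>2 = (?c\<^sup>2 + ?s\<^sup>2) * ?a\<^sup>2 + (?c\<^sup>2 + ?s\<^sup>2) * ?b\<^sup>2"
    proof -
      have "(c * a - s * b)\<^sup>2 + (c * b + s * a)\<^sup>2 = (c\<^sup>2 + s\<^sup>2) * a\<^sup>2 + (c\<^sup>2 + s\<^sup>2) * b\<^sup>2"
        for a b c s :: real by (simp add: power2_eq_square algebra_simps)
      then show ?thesis .
    qed
    then have "(rot t x (2 * m))\<^sup>2 + (rot t x (Suc (2 * m)))\<^sup>2 = ?a\<^sup>2 + ?b\<^sup>2"
      by (simp add: rot_def quat_i_def)
    then show ?case using Suc by simp
  qed simp
  then show ?thesis by (simp add: l2_def n)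
qed

lemma proper_at_zero_rot: "n mod 4 = 0 \<Longrightarrow> proper_at_zero n (rot t)"
  by (simp add: proper_at_zero_def continuous_map_rot rot_nonzero)

lemma proper_at_zero_id: "proper_at_zero n (\<lambda>x. x)" by (simp add: proper_at_zero_def)

lemma proper_at_zero_quat_j:
  assumes "n mod 4 = 0"
  shows "proper_at_zero n quat_j"
proof -
  have "quat_j x \<noteq> zvec" if "x \<noteq> zvec" for x
    using complex_combination_nonzero[where I=quat_j, OF quat_j_quat_j quat_j_linear that, of 0 1] by simp
  then show ?thesis using continuous_map_quat(2)[OF assms] by (simp add: proper_at_zero_def)
qed

lemma endo_degree_quat_j:
  assumes "n mod 4 = 0"
  shows "endo_degree n quat_j = 1"
proof -
  have "endo_degree n (\<lambda>x. x) = endo_degree n quat_j"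
  proof (rule endo_degree_linear_homotopy[OF proper_at_zero_id proper_at_zero_quat_j[OF assms]])
    fix x :: "nat \<Rightarrow> real" and t :: real assume "x \<noteq> zvec"
    then show "(\<lambda>i. (1 - t) * x i + t * quat_j x i) \<noteq> zvec"
      by (rule complex_combination_nonzero[OF quat_j_quat_j quat_j_linear]) auto
  qed
  then show ?thesis by (simp add: endo_degree_id)
qed

lemma endo_degree_rot:
  assumes "n mod 4 = 0" "sin t \<noteq> 0"
  shows "endo_degree n (rot t) = 1"
proof -
  have "endo_degree n (\<lambda>x. x) = endo_degree n (rot t)"
  proof (rule endo_degree_linear_homotopy[OF proper_at_zero_id proper_at_zero_rot[OF assms(1)]])
    fix x :: "nat \<Rightarrow> real" and u :: real assume x: "x \<noteq> zvec"
    have "(\<lambda>i. (1 - u + u * cos t) * x i + (u * sin t) * quat_i x i) \<noteq> zvec"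
      by (rule complex_combination_nonzero[OF quat_i_quat_i quat_i_linear x]) (use assms(2) in auto)
    then show "(\<lambda>i. (1 - u) * x i + u * rot t x i) \<noteq> zvec"
      by (simp add: rot_def algebra_simps)
  qed
  then show ?thesis by (simp add: endo_degree_id)
qed

lemma quat_j_rot: "quat_j (rot t x) = rot (- t) (quat_j x)"
proof
  fix i
  have "quat_j (rot t x) i = cos t * quat_j x i + sin t * quat_j (quat_i x) i"
    unfolding rot_def quat_j_linear ..
  then show "quat_j (rot t x) i = rot (- t) (quat_j x) i"
    by (simp add: rot_def quat_j_quat_i)
qed

locale rotation_model =
  fixes k n :: nat
  assumes k: "k \<ge> 3" and n: "n > 0" "n mod 4 = 0"
begin

definition \<tau> :: "(nat \<Rightarrow> real) \<Rightarrow> nat \<Rightarrow> real" where "\<tau> = rot (2 * pi / real k)"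

lemma even_n: "even n" using n by presburger

lemma \<tau>_funpow: "(\<tau> ^^ k) x = x"
  using k by (simp add: \<tau>_def rot_funpow rot_2pi)

lemma \<tau>_zvec: "\<tau> zvec = zvec" by (simp add: \<tau>_def rot_zvec)

lemma continuous_\<tau>: "continuous_map (Euclidean_space n) (Euclidean_space n) \<tau>"
  unfolding \<tau>_def by (rule continuous_map_rot[OF n(2)])

lemma proper_\<tau>: "proper_at_zero n \<tau>"
  unfolding \<tau>_def by (rule proper_at_zero_rot[OF n(2)])

lemma \<tau>_free:
  assumes "0 < j" "j < k" "x \<noteq> zvec"
  shows "(\<tau> ^^ j) x \<noteq> x"
proof
  let ?t = "real j * (2 * pi / real k)"
  assume "(\<tau> ^^ j) x = x"
  then have "cos ?t = 1" using rot_fixed assms(3) by (simp add: \<tau>_def rot_funpow)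
  then obtain m :: int where "?t = of_int m * 2 * pi" using cos_one_2pi_int by auto
  then have "real j = of_int m * real k" using k by (simp add: field_simps)
  then have "int j = m * int k" by (metis of_int_eq_iff of_int_mult of_int_of_nat_eq)
  moreover have "0 < int j" "int j < int k" using assms by auto
  ultimately show False by (metis dvd_triv_right zdvd_not_zless)
qed

lemma endo_degree_\<tau>: "endo_degree n \<tau> = 1"
  unfolding \<tau>_def
proof (rule endo_degree_rot[OF n(2)])
  have "0 < 2 * pi / real k" "2 * pi / real k < pi" using k by (auto simp: field_simps)
  then show "sin (2 * pi / real k) \<noteq> 0" using sin_gt_zero by force
qed

lemma l2_\<tau>: "l2 n (\<tau> x) = l2 n x"
  unfolding \<tau>_def by (rule l2_rot[OF even_n])

lemma \<tau>_topspace: "x \<in> topspace (Euclidean_space n) \<Longrightarrow> \<tau> x \<in> topspace (Euclidean_space n)"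
  using continuous_\<tau> by (auto simp: continuous_map_def)

lemma quat_j_\<tau>: "\<tau> (quat_j (\<tau> x)) = quat_j x"
  by (simp add: \<tau>_def quat_j_rot rot_add rot_zero)

end

section \<open>Equivariant self-maps of the linear sphere\<close>

lemma zvec_in_Euclidean: "zvec \<in> topspace (Euclidean_space n)"
  by (simp add: topspace_Euclidean_space)

lemma locally_Euclidean_Euclidean: "locally_Euclidean n (Euclidean_space n)"
  unfolding locally_Euclidean_def
  by (intro ballI exI[of _ "topspace (Euclidean_space n)"]) (simp add: homeomorphic_space_refl)

lemma continuous_map_l2: "continuous_map (Euclidean_space n) euclideanreal (l2 n)"
  using hom_gauge_l2 by (simp add: hom_gauge_def)

lemma l2_zero_iff: "x \<in> topspace (Euclidean_space n) \<Longrightarrow> l2 n x = 0 \<longleftrightarrow> x = zvec"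
  using hom_gauge_l2 by (simp add: hom_gauge_def)

lemma closedin_l2: "closed S \<Longrightarrow> closedin (Euclidean_space n) {x \<in> topspace (Euclidean_space n). l2 n x \<in> S}"
  by (rule closedin_continuous_map_preimage[OF continuous_map_l2]) simp

lemma openin_l2: "open S \<Longrightarrow> openin (Euclidean_space n) {x \<in> topspace (Euclidean_space n). l2 n x \<in> S}"
  by (rule openin_continuous_map_preimage[OF continuous_map_l2]) simp

lemma compactin_l2:
  assumes "closed S" "S \<subseteq> {..r}"
  shows "compactin (Euclidean_space n) {x \<in> topspace (Euclidean_space n). l2 n x \<in> S}"
proof (rule compactin_closed_in_cube[OF closedin_l2[OF assms(1)]])
  show "{x \<in> topspace (Euclidean_space n). l2 n x \<in> S} \<subseteq> cube n zvec r"
  proof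
    fix x assume x: "x \<in> {x \<in> topspace (Euclidean_space n). l2 n x \<in> S}"
    have "\<bar>x i\<bar> \<le> r" if "i < n" for i
    proof -
      have "(x i)\<^sup>2 \<le> (\<Sum>i<n. (x i)\<^sup>2)" using that by (intro member_le_sum) auto
      then have "\<bar>x i\<bar> \<le> l2 n x" unfolding l2_def by (metis real_sqrt_abs real_sqrt_le_mono)
      then show ?thesis using x assms(2) by auto
    qed
    then show "x \<in> cube n zvec r" using x by (simp add: cube_def)
  qed
qed

abbreviation shell :: "nat \<Rightarrow> real set \<Rightarrow> (nat \<Rightarrow> real) set" where
  "shell n S \<equiv> {x \<in> topspace (Euclidean_space n). l2 n x \<in> S}"

lemma radial_proper_at_zero:
  assumes "continuous_map (subtopology (Euclidean_space n) (gauge_sphere n (l2 n))) (punct n) f"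
  shows "proper_at_zero n (radial (l2 n) f)"
  unfolding proper_at_zero_def
  using continuous_map_radial[OF hom_gauge_l2] radial_nonzero[OF hom_gauge_l2 assms] assms
  by (auto simp: continuous_map_punct_iff)

lemma degree_sum_radial:
  assumes g: "g \<in> carrier (local_group n)" "local_int n g = 1" and F: "proper_at_zero n F" "F zvec = zvec"
    and Q: "Q \<subseteq> topspace (Euclidean_space n)" "zvec \<in> Q"
  shows "degree_sum n (Euclidean_space n) (euclid_orientation n g) F Q = endo_degree n F"
proof -
  have "zeros F Q = {zvec}" using F Q by (auto simp: zeros_def proper_at_zero_def)
  then show ?thesis using local_degree_zero_Euclidean[OF g F(1)] by (simp add: degree_sum_def)
qed

lemma radial_zvec: "radial N f zvec = zvec" by (simp add: radial_def)

text \<open>The homogeneous extension of \<open>f\<close>, with its only zero at the origin, and the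
  extension \<open>v\<close> without zeros agree on the boundary of the ball.\<close>

lemma radial_degree_extends:
  assumes n: "n > 0"
    and f: "continuous_map (subtopology (Euclidean_space n) (gauge_sphere n (l2 n))) (punct n) f"
    and v: "continuous_map (subtopology (Euclidean_space n) (shell n {..1})) (punct n) v"
    and eq: "\<And>x. x \<in> gauge_sphere n (l2 n) \<Longrightarrow> v x = f x"
  shows "endo_degree n (radial (l2 n) f) = 0"
proof -
  let ?E = "Euclidean_space n" and ?F = "radial (l2 n) f"
  obtain g where g: "g \<in> carrier (local_group n)" "local_int n g = 1" by (rule local_int_surj)
  let ?\<mu> = "euclid_orientation n g"
  have F: "proper_at_zero n ?F" by (rule radial_proper_at_zero[OF f])
  have Fc: "continuous_map (subtopology ?E S) ?E ?F" for S
    using F by (simp add: proper_at_zero_def continuous_map_from_subtopology)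
  have vnz: "v x \<noteq> zvec" if "x \<in> shell n {..1}" for x
    using v that by (auto simp: continuous_map_punct_iff)
  have zF: "zeros ?F (shell n {..1}) \<subseteq> {zvec}" using F by (auto simp: zeros_def proper_at_zero_def)
  have zv: "zeros v (shell n {..1}) = {}" using vnz by (auto simp: zeros_def)
  have "degree_sum n ?E ?\<mu> ?F (shell n {..<1}) = degree_sum n ?E ?\<mu> v (shell n {..<1})"
  proof (rule degree_sum_boundary[OF Hausdorff_Euclidean_space locally_Euclidean_Euclidean locally_oriented_Euclidean[OF n g(1)]])
    show "compactin ?E (shell n {..1})" by (rule compactin_l2) auto
    show "openin ?E (shell n {..<1})" by (rule openin_l2) simp
    show "finite (zeros ?F (shell n {..1}))" using zF finite_subset by blast
    show "finite (zeros v (shell n {..1}))" using zv by simp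
    show "continuous_map (subtopology ?E (shell n {..1})) ?E v" using v by (simp add: continuous_map_punct_iff)
    fix x assume "x \<in> shell n {..1} - shell n {..<1}"
    then have x: "x \<in> gauge_sphere n (l2 n)" by auto
    then show "?F x = v x \<and> ?F x \<noteq> zvec"
      using radial_on_sphere[OF hom_gauge_l2 x, of f] eq[OF x] vnz[of x] by simp
  qed (auto simp: Fc)
  moreover have "degree_sum n ?E ?\<mu> v (shell n {..<1}) = 0"
  proof -
    have "zeros v (shell n {..<1}) = {}" using vnz by (auto simp: zeros_def)
    then show ?thesis by (simp add: degree_sum_def)
  qed
  moreover have "degree_sum n ?E ?\<mu> ?F (shell n {..<1}) = endo_degree n ?F"
    by (rule degree_sum_radial[OF g F radial_zvec]) (auto simp: zvec_in_Euclidean l2_def)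
  ultimately show ?thesis by simp
qed

context rotation_model
begin

lemma \<tau>_scale: "\<tau> (\<lambda>i. a * x i) = (\<lambda>i. a * \<tau> x i)"
  using quat_i_linear[of a x 0 x] by (auto simp: \<tau>_def rot_def algebra_simps)

lemma radial_equivariant:
  assumes f: "\<And>x. x \<in> gauge_sphere n (l2 n) \<Longrightarrow> f (\<tau> x) = \<tau> (f x)" and x: "x \<in> topspace (Euclidean_space n)"
  shows "radial (l2 n) f (\<tau> x) = \<tau> (radial (l2 n) f x)"
proof (cases "x = zvec")
  case False
  have nz: "\<tau> x \<noteq> zvec" using proper_\<tau> x False by (auto simp: proper_at_zero_def)
  have "(\<lambda>j. \<tau> x j / l2 n x) = \<tau> (\<lambda>j. x j / l2 n x)" using \<tau>_scale[of "1 / l2 n x" x] by simp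
  then have "f (\<lambda>j. \<tau> x j / l2 n x) = \<tau> (f (\<lambda>j. x j / l2 n x))"
    using f gauge_normalize(1)[OF hom_gauge_l2 x False] by simp
  then show ?thesis using False nz by (simp add: radial_def l2_\<tau> \<tau>_scale)
qed (simp add: radial_zvec \<tau>_zvec)

lemma \<tau>_free_on:
  assumes "0 \<notin> S"
  shows "free_on k \<tau> (shell n S)"
proof -
  have "z \<noteq> zvec" if "z \<in> shell n S" for z
    using assms l2_zero_iff[of z n] that by auto
  then show ?thesis
    unfolding free_on_def using \<tau>_topspace l2_\<tau> \<tau>_free \<tau>_funpow by auto
qed

text \<open>Join the identity on the unit sphere equivariantly to the given map on the sphere of radius two.
  The zeros between the two spheres come in free orbits, so the degrees at the inner and the
  outer sphere differ by a multiple of \<open>k\<close>.\<close>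

theorem radial_degree_mod:
  assumes f: "continuous_map (subtopology (Euclidean_space n) (gauge_sphere n (l2 n))) (punct n) f"
    and fT: "\<And>x. x \<in> gauge_sphere n (l2 n) \<Longrightarrow> f (\<tau> x) = \<tau> (f x)"
  shows "int k dvd endo_degree n (radial (l2 n) f) - 1"
proof -
  let ?E = "Euclidean_space n" and ?F = "radial (l2 n) f"
  obtain g where g: "g \<in> carrier (local_group n)" "local_int n g = 1" by (rule local_int_surj)
  let ?\<mu> = "euclid_orientation n g"
  let ?C = "shell n {..2}" and ?Q = "shell n {..<2}" and ?M = "shell n {1..2}" and ?A = "shell n {1,2}"
    and ?B = "shell n {..1}" and ?P = "shell n {..<1}" and ?O = "shell n {1<..<2}"
  have F: "proper_at_zero n ?F" by (rule radial_proper_at_zero[OF f])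
  have Fc: "continuous_map (subtopology ?E S) ?E ?F" for S
    using F by (simp add: proper_at_zero_def continuous_map_from_subtopology)
  have Fnz: "?F x \<noteq> zvec" if "x \<in> topspace ?E" "l2 n x \<noteq> 0" for x
    using F that l2_zero_iff by (auto simp: proper_at_zero_def)
  have k0: "k > 0" using k by simp
  note E = Hausdorff_Euclidean_space[of n] locally_Euclidean_Euclidean[of n] locally_oriented_Euclidean[OF n(1) g(1)]
  define f0 where "f0 x = (if x \<in> shell n {1} then x else ?F x)" for x
  have A12: "shell n {1} \<union> shell n {2} = ?A" by auto
  have f0c: "continuous_map (subtopology ?E ?A) ?E f0"
    unfolding A12[symmetric] f0_def
  proof (rule paste_closed2)
    show "closedin ?E (shell n {1})" "closedin ?E (shell n {2})" by (rule closedin_l2; simp)+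
    show "continuous_map (subtopology ?E (shell n {1})) ?E (\<lambda>x. x)"
      by (simp add: continuous_map_from_subtopology)
  qed (auto simp: Fc)
  have f0P: "continuous_map (subtopology ?E ?A) (punct n) f0"
  proof -
    have "f0 x \<noteq> zvec" if "x \<in> ?A" for x
      using that Fnz[of x] l2_zero_iff[of x n] by (cases "l2 n x = 1") (auto simp: f0_def)
    then show ?thesis unfolding continuous_map_punct_iff using f0c by auto
  qed
  have \<tau>shell: "\<tau> x \<in> shell n S \<longleftrightarrow> x \<in> shell n S" if "x \<in> topspace ?E" for x S
    using that \<tau>_topspace l2_\<tau> by auto
  have f0T: "f0 (\<tau> x) = \<tau> (f0 x)" if "x \<in> ?A" for x
    using \<tau>shell[of x "{1}"] that radial_equivariant[of f x, OF fT] by (auto simp: f0_def)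
  obtain u1 where u1: "continuous_map (subtopology ?E ?M) ?E u1" "\<And>z. z \<in> ?A \<Longrightarrow> u1 z = f0 z"
    "\<And>z. z \<in> ?M \<Longrightarrow> u1 (\<tau> z) = \<tau> (u1 z)" "finite (zeros u1 ?M)"
  proof -
    have M1: "compactin ?E ?M" by (rule compactin_l2) auto
    have M2: "free_on k \<tau> ?M" by (rule \<tau>_free_on) auto
    have A1: "closedin ?E ?A" by (rule closedin_l2) auto
    have A2: "?A \<subseteq> ?M" by auto
    have Tk: "(\<tau> ^^ k) z = z" if "z \<in> topspace ?E" for z by (rule \<tau>_funpow)
    have A3: "\<tau> z \<in> ?A" if "z \<in> ?A" for z using \<tau>shell that by blast
    show thesis
      using equivariant_finite_zero_extension[where T=\<tau> and \<tau>=\<tau> and f=f0, OF E(1,2) continuous_\<tau> Tk k0 M1 M2 continuous_\<tau> Tk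
          \<tau>_zvec A1 A2 A3 f0P f0T] that by blast
  qed
  \<comment> \<open>inside the unit ball the identity, whose single zero counts one\<close>
  define u where "u x = (if x \<in> ?B then x else u1 x)" for x
  have BM: "?B \<union> ?M = ?C" by auto
  have uc: "continuous_map (subtopology ?E ?C) ?E u"
    unfolding BM[symmetric] u_def
  proof (rule paste_closed2)
    show "closedin ?E ?B" "closedin ?E ?M" by (rule closedin_l2; simp)+
    fix x assume "x \<in> ?B \<inter> ?M"
    then have "x \<in> shell n {1}" by auto
    then show "x = u1 x" using u1(2)[of x] by (simp add: f0_def)
  qed (use u1(1) in \<open>auto simp: continuous_map_from_subtopology\<close>)
  have finu: "finite (zeros u ?C)"
  proof (rule finite_subset)
    show "zeros u ?C \<subseteq> insert zvec (zeros u1 ?M)" by (auto simp: zeros_def u_def)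
  qed (use u1(4) in simp)
  have main: "degree_sum n ?E ?\<mu> ?F ?Q = degree_sum n ?E ?\<mu> u ?Q"
  proof (rule degree_sum_boundary[OF E])
    show "compactin ?E ?C" by (rule compactin_l2) auto
    show "openin ?E ?Q" by (rule openin_l2) simp
    have "zeros ?F ?C \<subseteq> {zvec}" using F by (auto simp: zeros_def proper_at_zero_def)
    then show "finite (zeros ?F ?C)" using finite_subset by blast
    fix x assume "x \<in> ?C - ?Q"
    then have x: "x \<in> topspace ?E" "l2 n x = 2" by auto
    then have "u x = ?F x" using u1(2)[of x] by (simp add: u_def f0_def)
    then show "?F x = u x \<and> ?F x \<noteq> zvec" using Fnz[of x] x by simp
  qed (use uc finu in \<open>auto simp: Fc\<close>)
  have fins: "finite (zeros u S)" if "S \<subseteq> ?C" for S using finu zeros_mono[OF that] finite_subset by blast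
  have PQ: "?P \<subseteq> ?C" "?O \<subseteq> ?C" "?P \<inter> ?O = {}" by auto
  have oP: "openin ?E ?P" and oO: "openin ?E ?O" by (rule openin_l2; simp)+
  have mu: "?\<mu> z \<in> carrier (local_homology n ?E {z})" if "z \<in> topspace ?E" for z
    using locally_oriented_carrier[OF E(3) that] .
  have "zeros u ?Q = zeros u (?P \<union> ?O)"
  proof
    show "zeros u ?Q \<subseteq> zeros u (?P \<union> ?O)"
    proof
      fix x assume x: "x \<in> zeros u ?Q"
      have "l2 n x \<noteq> 1"
      proof
        assume l: "l2 n x = 1"
        then have "u x = x" using x by (simp add: u_def zeros_def)
        then have "x = zvec" using x by (simp add: zeros_def)
        then show False using l by (simp add: l2_def)
      qed
      then show "x \<in> zeros u (?P \<union> ?O)" using x by (auto simp: zeros_def)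
    qed
  qed (auto simp: zeros_def)
  then have "degree_sum n ?E ?\<mu> u ?Q = degree_sum n ?E ?\<mu> u (?P \<union> ?O)" by (simp add: degree_sum_def)
  also have "\<dots> = degree_sum n ?E ?\<mu> u ?P + degree_sum n ?E ?\<mu> u ?O"
    by (rule degree_sum_Un[OF fins[OF PQ(1)] fins[OF PQ(2)]]) (auto simp: zeros_def)
  also have "degree_sum n ?E ?\<mu> u ?P = degree_sum n ?E ?\<mu> (\<lambda>x. x) ?P"
    by (rule degree_sum_cong[OF E(1) oP PQ(1) fins[OF PQ(1)] uc]) (use mu in \<open>auto simp: u_def\<close>)
  also have "\<dots> = 1"
    using degree_sum_radial[OF g proper_at_zero_id refl, of ?P] endo_degree_id zvec_in_Euclidean by (auto simp: l2_def)
  finally have sum: "degree_sum n ?E ?\<mu> u ?Q = 1 + degree_sum n ?E ?\<mu> u ?O" .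
  have "int k dvd degree_sum n ?E ?\<mu> u ?O"
  proof (rule degree_sum_free_dvd[OF E(1) continuous_\<tau> _ k0 mu _ oO PQ(2) _ uc fins[OF PQ(2)] _ continuous_\<tau> \<tau>_zvec _ endo_degree_\<tau>])
    show "free_on k \<tau> ?O" by (rule \<tau>_free_on) auto
    fix z assume z: "z \<in> topspace ?E"
    show "hom_induced (int n) ?E (topspace ?E - {z}) ?E (topspace ?E - {\<tau> z}) \<tau> (?\<mu> z) = ?\<mu> (\<tau> z)"
      by (rule euclid_orientation_equivariant[OF g(1) proper_\<tau> endo_degree_\<tau> _ z]) (simp add: \<tau>_def rot_linear)
  next
    fix z assume z: "z \<in> ?O"
    then have "\<tau> z \<notin> ?B" using l2_\<tau>[of z] by auto
    moreover have "z \<notin> ?B" "z \<in> ?M" using z by auto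
    ultimately show "u (\<tau> z) = \<tau> (u z)" using u1(3)[of z] by (simp only: u_def if_False)
  qed (use \<tau>_funpow proper_\<tau> in \<open>auto simp: proper_at_zero_def\<close>)
  moreover have "degree_sum n ?E ?\<mu> ?F ?Q = endo_degree n ?F"
    by (rule degree_sum_radial[OF g F radial_zvec]) (auto simp: zvec_in_Euclidean l2_def)
  ultimately show ?thesis using main sum by simp
qed

end

section \<open>Disks in manifolds\<close>

text \<open>Invariance of domain, applied in charts of \<open>X\<close>.\<close>

lemma openin_image_Euclidean:
  assumes X: "locally_Euclidean n X" and W: "openin (Euclidean_space n) W"
    and f: "continuous_map (subtopology (Euclidean_space n) W) X f" "inj_on f W"
  shows "openin X (f ` W)"
proof (subst openin_subopen, intro ballI)
  let ?E = "Euclidean_space n"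
  fix z assume "z \<in> f ` W"
  then obtain w where w: "w \<in> W" "z = f w" by blast
  have WE: "W \<subseteq> topspace ?E" using W openin_subset by blast
  have "f w \<in> topspace X" using f(1) w WE by (auto simp: continuous_map_def)
  then obtain U where U: "openin X U" "f w \<in> U" "subtopology X U homeomorphic_space ?E"
    using X by (auto simp: locally_Euclidean_def)
  obtain \<alpha> \<beta> where ab: "homeomorphic_maps (subtopology X U) ?E \<alpha> \<beta>"
    using U(3) by (auto simp: homeomorphic_space_def)
  have UX: "U \<subseteq> topspace X" using U(1) openin_subset by blast
  have \<alpha>: "continuous_map (subtopology X U) ?E \<alpha>" "\<And>x. x \<in> U \<Longrightarrow> \<beta> (\<alpha> x) = x"
    using ab UX by (auto simp: homeomorphic_maps_def)
  define W' where "W' = {q \<in> W. f q \<in> U}"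
  have "openin (subtopology ?E W) {q \<in> topspace (subtopology ?E W). f q \<in> U}"
    using openin_continuous_map_preimage[OF f(1) U(1)] .
  also have "{q \<in> topspace (subtopology ?E W). f q \<in> U} = W'" using WE by (auto simp: W'_def)
  finally have oW': "openin ?E W'" using W openin_trans_full by blast
  have "continuous_map (subtopology ?E W') (subtopology X U) f"
    unfolding continuous_map_in_subtopology
    using continuous_map_from_subtopology_mono[OF f(1), of W'] by (auto simp: W'_def)
  then have c: "continuous_map (subtopology ?E W') ?E (\<alpha> \<circ> f)"
    using \<alpha>(1) continuous_map_compose by blast
  have inj: "inj_on (\<alpha> \<circ> f) W'"
  proof (rule inj_onI)
    fix p q assume pq: "p \<in> W'" "q \<in> W'" "(\<alpha> \<circ> f) p = (\<alpha> \<circ> f) q"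
    then have "\<beta> (\<alpha> (f p)) = \<beta> (\<alpha> (f q))" by simp
    moreover have "\<beta> (\<alpha> (f p)) = f p" "\<beta> (\<alpha> (f q)) = f q" using \<alpha>(2) pq(1,2) by (auto simp: W'_def)
    ultimately have "f p = f q" by simp
    then show "p = q" using f(2) pq by (auto simp: W'_def inj_on_def)
  qed
  have o: "openin ?E ((\<alpha> \<circ> f) ` W')"
    using invariance_of_domain_Euclidean_space[OF oW' c inj] .
  have "openin (subtopology X U) {x \<in> topspace (subtopology X U). \<alpha> x \<in> (\<alpha> \<circ> f) ` W'}"
    using openin_continuous_map_preimage[OF \<alpha>(1) o] .
  also have "{x \<in> topspace (subtopology X U). \<alpha> x \<in> (\<alpha> \<circ> f) ` W'} = f ` W'"
  proof -
    have "x \<in> f ` W'" if x: "x \<in> U" "\<alpha> x \<in> (\<alpha> \<circ> f) ` W'" for x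
    proof -
      obtain q where q: "q \<in> W'" "\<alpha> x = \<alpha> (f q)" using x by auto
      then have "\<beta> (\<alpha> x) = \<beta> (\<alpha> (f q))" by simp
      then have "x = f q" using \<alpha>(2) x q(1) by (simp add: W'_def)
      then show ?thesis using q by blast
    qed
    then show ?thesis using UX by (auto simp: W'_def)
  qed
  finally have "openin X (f ` W')" using U(1) openin_trans_full by blast
  then show "\<exists>T. openin X T \<and> z \<in> T \<and> T \<subseteq> f ` W"
    using w U(2) by (intro exI[of _ "f ` W'"]) (auto simp: W'_def)
qed

lemma openin_subset_unit_ball:
  assumes U: "openin (Euclidean_space n) U" "U \<subseteq> shell n {..1}"
  shows "U \<subseteq> shell n {..<1}"
proof
  fix p assume p: "p \<in> U"
  have pE: "p \<in> topspace (Euclidean_space n)" "l2 n p \<le> 1" using p U(2) by auto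
  have "l2 n p \<noteq> 1"
  proof
    assume l: "l2 n p = 1"
    obtain m where m: "m > 0" "\<And>r. r < m \<Longrightarrow> cube n p r \<subseteq> U" using openin_contains_cube[OF U(1) p] by blast
    define r where "r = m / 2"
    have r: "r > 0" "cube n p r \<subseteq> U" using m by (auto simp: r_def)
    have "\<bar>p i\<bar> \<le> 1" if "i < n" for i
    proof -
      have "(p i)\<^sup>2 \<le> (\<Sum>i<n. (p i)\<^sup>2)" using that by (intro member_le_sum) auto
      then have "\<bar>p i\<bar> \<le> l2 n p" unfolding l2_def by (metis real_sqrt_abs real_sqrt_le_mono)
      then show ?thesis using l by simp
    qed
    then have "\<bar>(1 + r) * p i - p i\<bar> \<le> r" if "i < n" for i
      using r(1) that by (simp add: algebra_simps abs_mult mult_left_le)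
    then have "(\<lambda>i. (1 + r) * p i) \<in> cube n p r"
      using Euclidean_scale[OF pE(1)] by (simp add: cube_def)
    then have "l2 n (\<lambda>i. (1 + r) * p i) \<le> 1" using r(2) U(2) by auto
    then show False using gauge_scale[OF hom_gauge_l2, of "1 + r" n p] l r(1) by simp
  qed
  then show "p \<in> shell n {..<1}" using pE by auto
qed

text \<open>The chart is not assumed to extend beyond \<open>D\<close>: the boundary sphere of an invariant
  disk may be wild in the manifold.\<close>

definition disk_chart :: "nat \<Rightarrow> 'a topology \<Rightarrow> 'a set \<Rightarrow> ('a \<Rightarrow> nat \<Rightarrow> real) \<Rightarrow> ((nat \<Rightarrow> real) \<Rightarrow> 'a) \<Rightarrow> bool" where
  "disk_chart n X D \<psi> \<psi>' \<longleftrightarrow> D \<subseteq> topspace X \<and>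
     homeomorphic_maps (subtopology X D) (subtopology (Euclidean_space n) (shell n {..1})) \<psi> \<psi>'"

abbreviation boundary :: "'a topology \<Rightarrow> 'a set \<Rightarrow> 'a set" where
  "boundary X D \<equiv> D - X interior_of D"

lemma closed_disk_eq: "closed_disk n = subtopology (Euclidean_space n) (shell n {..1})"
proof -
  have "subtopology (Euclidean_space n) {x. (\<Sum>i<n. (x i)\<^sup>2) \<le> 1}
      = subtopology (Euclidean_space n) (topspace (Euclidean_space n) \<inter> {x. (\<Sum>i<n. (x i)\<^sup>2) \<le> 1})"
    by (rule subtopology_restrict[symmetric])
  also have "topspace (Euclidean_space n) \<inter> {x. (\<Sum>i<n. (x i)\<^sup>2) \<le> 1} = shell n {..1}"
    by (auto simp: l2_def)
  finally show ?thesis by (simp only: closed_disk_def)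
qed

lemma disk_chartD:
  assumes "disk_chart n X D \<psi> \<psi>'"
  shows "D \<subseteq> topspace X" "continuous_map (subtopology X D) (Euclidean_space n) \<psi>"
    "continuous_map (subtopology (Euclidean_space n) (shell n {..1})) X \<psi>'"
    "\<And>z. z \<in> D \<Longrightarrow> \<psi> z \<in> shell n {..1}" "\<And>q. q \<in> shell n {..1} \<Longrightarrow> \<psi>' q \<in> D"
    "\<And>z. z \<in> D \<Longrightarrow> \<psi>' (\<psi> z) = z" "\<And>q. q \<in> shell n {..1} \<Longrightarrow> \<psi> (\<psi>' q) = q"
proof -
  note h = assms[unfolded disk_chart_def homeomorphic_maps_def continuous_map_in_subtopology]
  show D: "D \<subseteq> topspace X" using h by blast
  then have t: "topspace (subtopology X D) = D" by auto
  have s: "topspace (subtopology (Euclidean_space n) (shell n {..1})) = shell n {..1}" by auto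
  show "continuous_map (subtopology X D) (Euclidean_space n) \<psi>"
    "continuous_map (subtopology (Euclidean_space n) (shell n {..1})) X \<psi>'" using h by blast+
  show "\<And>z. z \<in> D \<Longrightarrow> \<psi> z \<in> shell n {..1}" "\<And>q. q \<in> shell n {..1} \<Longrightarrow> \<psi>' q \<in> D"
    "\<And>z. z \<in> D \<Longrightarrow> \<psi>' (\<psi> z) = z" "\<And>q. q \<in> shell n {..1} \<Longrightarrow> \<psi> (\<psi>' q) = q"
    using h unfolding t s by blast+
qed

lemma disk_chart_compact:
  assumes "disk_chart n X D \<psi> \<psi>'"
  shows "compactin X D"
proof -
  have "\<psi>' ` shell n {..1} = D"
  proof
    show "\<psi>' ` shell n {..1} \<subseteq> D" using disk_chartD(5)[OF assms] by blast
    show "D \<subseteq> \<psi>' ` shell n {..1}"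
    proof
      fix z assume "z \<in> D"
      then show "z \<in> \<psi>' ` shell n {..1}" using disk_chartD(4,6)[OF assms] by (intro image_eqI[of _ _ "\<psi> z"]) simp_all
    qed
  qed
  moreover have "compactin (subtopology (Euclidean_space n) (shell n {..1})) (shell n {..1})"
    using compactin_l2[of "{..1}" 1 n] by (simp add: compactin_subtopology)
  ultimately show ?thesis
    using image_compactin[of _ "shell n {..1}", OF _ disk_chartD(3)[OF assms]] by simp
qed

text \<open>By invariance of domain the sphere is exactly the topological boundary of the disk. Hence a
  homeomorphism that preserves the disk preserves its sphere.\<close>

lemma interior_of_disk:
  assumes X: "locally_Euclidean n X" and D: "disk_chart n X D \<psi> \<psi>'"
  shows "X interior_of D = {z \<in> D. l2 n (\<psi> z) < 1}"
proof
  let ?E = "Euclidean_space n" and ?B = "shell n {..<1}"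
  note d = disk_chartD[OF D]
  have oB: "openin ?E ?B" by (rule openin_l2) simp
  have BC: "?B \<subseteq> shell n {..1}" by auto
  have "continuous_map (subtopology ?E ?B) X \<psi>'" using continuous_map_from_subtopology_mono[OF d(3) BC] .
  moreover have "inj_on \<psi>' ?B" 
  proof (rule inj_onI)
    fix p q assume pq: "p \<in> ?B" "q \<in> ?B" "\<psi>' p = \<psi>' q"
    have "p \<in> shell n {..1}" "q \<in> shell n {..1}" using pq(1,2) by auto
    then have "p = \<psi> (\<psi>' p)" "q = \<psi> (\<psi>' q)" by (simp_all only: d(7))
    then show "p = q" using pq(3) by metis
  qed
  ultimately have "openin X (\<psi>' ` ?B)" using openin_image_Euclidean[OF X oB] by blast
  moreover have "\<psi>' ` ?B = {z \<in> D. l2 n (\<psi> z) < 1}"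
  proof
    show "\<psi>' ` ?B \<subseteq> {z \<in> D. l2 n (\<psi> z) < 1}"
    proof (rule image_subsetI)
      fix q assume q: "q \<in> ?B"
      then have "q \<in> shell n {..1}" by auto
      then show "\<psi>' q \<in> {z \<in> D. l2 n (\<psi> z) < 1}" using d(5,7)[of q] q by simp
    qed
    show "{z \<in> D. l2 n (\<psi> z) < 1} \<subseteq> \<psi>' ` ?B"
    proof
      fix z assume z: "z \<in> {z \<in> D. l2 n (\<psi> z) < 1}"
      then have "\<psi> z \<in> shell n {..1}" "\<psi>' (\<psi> z) = z" using d(4,6) by blast+
      moreover from this z have "\<psi> z \<in> ?B" by simp
      ultimately show "z \<in> \<psi>' ` ?B" by (metis image_eqI)
    qed
  qed
  ultimately have "openin X {z \<in> D. l2 n (\<psi> z) < 1}" by simp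
  then show "{z \<in> D. l2 n (\<psi> z) < 1} \<subseteq> X interior_of D" by (intro interior_of_maximal) blast
  show "X interior_of D \<subseteq> {z \<in> D. l2 n (\<psi> z) < 1}"
  proof
    fix z assume z: "z \<in> X interior_of D"
    have zD: "z \<in> D" using z interior_of_subset by fastforce
    have "z \<in> topspace X" using zD d(1) by blast
    then obtain U where U: "openin X U" "z \<in> U" "subtopology X U homeomorphic_space ?E"
      using X by (auto simp: locally_Euclidean_def)
    obtain \<alpha> \<beta> where ab: "homeomorphic_maps (subtopology X U) ?E \<alpha> \<beta>"
      using U(3) by (auto simp: homeomorphic_space_def)
    have UX: "U \<subseteq> topspace X" using U(1) openin_subset by blast
    have \<alpha>: "continuous_map (subtopology X U) ?E \<alpha>" "\<And>x. x \<in> U \<Longrightarrow> \<beta> (\<alpha> x) = x"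
      and \<beta>: "continuous_map ?E X \<beta>" "\<And>q. q \<in> topspace ?E \<Longrightarrow> \<beta> q \<in> U" "\<And>q. q \<in> topspace ?E \<Longrightarrow> \<alpha> (\<beta> q) = q"
      using ab UX unfolding homeomorphic_maps_def continuous_map_in_subtopology by (auto simp: image_subset_iff Pi_iff)
    define W where "W = {q \<in> topspace ?E. \<beta> q \<in> X interior_of D}"
    have oW: "openin ?E W"
      unfolding W_def by (rule openin_continuous_map_preimage[OF \<beta>(1)]) (simp add: openin_interior_of)
    have \<beta>D: "\<beta> q \<in> D" if "q \<in> W" for q using that interior_of_subset by (fastforce simp: W_def)
    have "continuous_map (subtopology ?E W) (subtopology X D) \<beta>"
      unfolding continuous_map_in_subtopology using \<beta>(1) \<beta>D
      by (auto simp: continuous_map_from_subtopology)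
    then have c: "continuous_map (subtopology ?E W) ?E (\<psi> \<circ> \<beta>)" using d(2) continuous_map_compose by blast
    have inj: "inj_on (\<psi> \<circ> \<beta>) W"
    proof (rule inj_onI)
      fix p q assume pq: "p \<in> W" "q \<in> W" "(\<psi> \<circ> \<beta>) p = (\<psi> \<circ> \<beta>) q"
      then have "\<psi>' (\<psi> (\<beta> p)) = \<psi>' (\<psi> (\<beta> q))" by simp
      then have "\<beta> p = \<beta> q" using d(6) \<beta>D pq by simp
      then have "\<alpha> (\<beta> p) = \<alpha> (\<beta> q)" by simp
      then show "p = q" using \<beta>(3) pq by (simp add: W_def)
    qed
    have "openin ?E ((\<psi> \<circ> \<beta>) ` W)" using invariance_of_domain_Euclidean_space[OF oW c inj] .
    moreover have "(\<psi> \<circ> \<beta>) ` W \<subseteq> shell n {..1}"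
    proof
      fix y assume "y \<in> (\<psi> \<circ> \<beta>) ` W"
      then obtain q where "q \<in> W" "y = \<psi> (\<beta> q)" by auto
      then show "y \<in> shell n {..1}" using d(4)[OF \<beta>D] by simp
    qed
    ultimately have "(\<psi> \<circ> \<beta>) ` W \<subseteq> ?B" by (rule openin_subset_unit_ball)
    moreover have "\<alpha> z \<in> W"
    proof -
      have "\<alpha> z \<in> topspace ?E" using \<alpha>(1) U(2) UX by (auto simp: continuous_map_def)
      then show ?thesis using \<alpha>(2) U(2) z by (simp add: W_def)
    qed
    ultimately have "\<psi> (\<beta> (\<alpha> z)) \<in> ?B" by auto
    then show "z \<in> {z \<in> D. l2 n (\<psi> z) < 1}" using \<alpha>(2) U(2) zD by simp
  qed
qed

lemma boundary_disk:
  assumes X: "locally_Euclidean n X" and D: "disk_chart n X D \<psi> \<psi>'"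
  shows "boundary X D = {z \<in> D. \<psi> z \<in> gauge_sphere n (l2 n)}"
proof -
  have "z \<in> boundary X D \<longleftrightarrow> z \<in> D \<and> \<psi> z \<in> gauge_sphere n (l2 n)" for z
    using disk_chartD(4)[OF D, of z] unfolding interior_of_disk[OF X D] by auto
  then show ?thesis by blast
qed

lemma boundary_disk_chart:
  assumes X: "locally_Euclidean n X" and D: "disk_chart n X D \<psi> \<psi>'"
  shows "homeomorphic_maps (subtopology X (boundary X D)) (subtopology (Euclidean_space n) (gauge_sphere n (l2 n))) \<psi> \<psi>'"
proof -
  let ?E = "Euclidean_space n" and ?S = "gauge_sphere n (l2 n)"
  note d = disk_chartD[OF D]
  have SC: "?S \<subseteq> shell n {..1}" by auto
  have b: "boundary X D \<subseteq> D" by blast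
  have "continuous_map (subtopology X (boundary X D)) ?E \<psi>" using continuous_map_from_subtopology_mono[OF d(2) b] .
  moreover have "continuous_map (subtopology ?E ?S) X \<psi>'" using continuous_map_from_subtopology_mono[OF d(3) SC] .
  moreover have "\<psi> z \<in> ?S" if "z \<in> boundary X D" for z using that unfolding boundary_disk[OF X D] by blast
  moreover have "\<psi>' q \<in> boundary X D" if "q \<in> ?S" for q
  proof -
    have "q \<in> shell n {..1}" using that SC by blast
    then show ?thesis using that d(5,7)[of q] unfolding boundary_disk[OF X D] by simp
  qed
  moreover have "\<psi>' (\<psi> z) = z" if "z \<in> boundary X D" for z using that b d(6) by blast
  moreover have "\<psi> (\<psi>' q) = q" if "q \<in> ?S" for q using that SC d(7) by blast
  ultimately show ?thesis
    unfolding homeomorphic_maps_def continuous_map_in_subtopology by (auto simp: Pi_iff image_subset_iff)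
qed

lemma closedin_boundary:
  assumes "Hausdorff_space X" "disk_chart n X D \<psi> \<psi>'"
  shows "closedin X D" "closedin X (boundary X D)"
proof -
  show D: "closedin X D" using compactin_imp_closedin[OF assms(1) disk_chart_compact[OF assms(2)]] .
  then show "closedin X (boundary X D)" by (simp add: closedin_diff openin_interior_of)
qed

lemma disk_chart_image:
  assumes D: "disk_chart n X D \<psi> \<psi>'" and s: "homeomorphic_maps X X s s'"
  shows "disk_chart n X (s ` D) (\<psi> \<circ> s') (s \<circ> \<psi>')"
proof -
  note d = disk_chartD[OF D]
  have s1: "continuous_map X X s" "continuous_map X X s'" "\<And>x. x \<in> topspace X \<Longrightarrow> s' (s x) = x" "\<And>x. x \<in> topspace X \<Longrightarrow> s (s' x) = x"
    using s by (auto simp: homeomorphic_maps_def)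
  have sD: "s ` D \<subseteq> topspace X" using s1(1) d(1) by (auto simp: continuous_map_def)
  have s'D: "s' z \<in> D" if "z \<in> s ` D" for z using that s1(3) d(1) by auto
  have "continuous_map (subtopology X (s ` D)) (subtopology X D) s'"
    unfolding continuous_map_in_subtopology using s1(2) s'D by (auto simp: continuous_map_from_subtopology)
  then have "continuous_map (subtopology X (s ` D)) (Euclidean_space n) (\<psi> \<circ> s')"
    using d(2) continuous_map_compose by blast
  moreover have "continuous_map (subtopology (Euclidean_space n) (shell n {..1})) X (s \<circ> \<psi>')"
    using continuous_map_compose[OF d(3) s1(1)] .
  moreover have "\<psi> (s' z) \<in> shell n {..1} \<and> s (\<psi>' (\<psi> (s' z))) = z" if "z \<in> s ` D" for z
    using d(4,6)[OF s'D[OF that]] s1(4) sD that by auto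
  moreover have "s (\<psi>' q) \<in> s ` D \<and> \<psi> (s' (s (\<psi>' q))) = q" if "q \<in> shell n {..1}" for q
  proof -
    have "\<psi>' q \<in> D" using d(5)[OF that] .
    then show ?thesis using d(7)[OF that] s1(3) d(1) by auto
  qed
  ultimately show ?thesis
    unfolding disk_chart_def homeomorphic_maps_def continuous_map_in_subtopology using sD
    by (auto simp: Pi_iff image_subset_iff)
qed

section \<open>The sphere without a point\<close>

text \<open>The sphere without \<open>p\<close> is homeomorphic to a hyperplane, which is a retract of
  \<open>\<real>\<^sup>n\<close>. The inversion
  \<open>q \<mapsto> (q - p) / (1 - q \<bullet> p)\<close> maps it to the hyperplane of all
  \<open>w\<close> with \<open>w \<bullet> p = - 1\<close>, with inverse
  \<open>w \<mapsto> p + 2 * w / (w \<bullet> w)\<close>; preceded by the orthogonal projection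
  onto the hyperplane, this inverse is defined on the whole space.\<close>

lemma extendable_sphere_minus_point:
  assumes Y: "normal_space Y" and p: "p \<in> gauge_sphere n (l2 n)"
  shows "extendable Y (subtopology (Euclidean_space n) (gauge_sphere n (l2 n) - {p}))"
proof -
  let ?E = "Euclidean_space n" and ?S = "gauge_sphere n (l2 n)"
  define d where "d v w = (\<Sum>i<n. v i * w i :: real)" for v w
  have d_add: "d (\<lambda>i. u i + v i) w = d u w + d v w" "d w (\<lambda>i. u i + v i) = d w u + d w v"
    and d_diff: "d (\<lambda>i. u i - v i) w = d u w - d v w" "d w (\<lambda>i. u i - v i) = d w u - d w v"
    and d_scale: "d (\<lambda>i. a * u i) w = a * d u w" "d w (\<lambda>i. a * u i) = a * d w u"
    for u v w a
    by (simp_all add: d_def algebra_simps sum.distrib sum_subtractf sum_distrib_left)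
  have d_commute: "d v w = d w v" for v w by (simp add: d_def mult.commute)
  have l2d: "l2 n v = sqrt (d v v)" for v by (simp add: l2_def d_def power2_eq_square)
  have dnn: "d v v \<ge> 0" for v by (simp add: d_def sum_nonneg)
  have d0: "d v v = 0 \<longleftrightarrow> v = zvec" if "v \<in> topspace ?E" for v
    using l2_zero_iff[OF that] dnn[of v] by (simp add: l2d)
  have S_iff: "v \<in> ?S \<longleftrightarrow> v \<in> topspace ?E \<and> d v v = 1" for v by (simp add: l2d)
  have pE: "p \<in> topspace ?E" and pp: "d p p = 1" using p S_iff by auto
  have dc: "continuous_map Z euclideanreal (\<lambda>x. d (f x) (g x))"
    if "continuous_map Z ?E f" "continuous_map Z ?E g" for Z :: "(nat \<Rightarrow> real) topology" and f g
    unfolding d_def by (intro continuous_map_sum continuous_map_real_mult continuous_map_Euclidean_coord[OF that(1)] continuous_map_Euclidean_coord[OF that(2)]) auto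
  have cadd: "continuous_map Z ?E (\<lambda>x i. f x i + g x i)" "continuous_map Z ?E (\<lambda>x i. f x i - g x i)"
    if "continuous_map Z ?E f" "continuous_map Z ?E g" for Z :: "(nat \<Rightarrow> real) topology" and f g
    using that unfolding continuous_map_Euclidean_iff by (auto intro!: continuous_map_add continuous_map_diff)
  have cp: "continuous_map Z ?E (\<lambda>_. p)" for Z :: "(nat \<Rightarrow> real) topology" using pE by simp
  define e where "e q = (\<lambda>i. (1 / (1 - d q p)) * (q i - p i))" for q
  define w where "w x = (\<lambda>i. x i - (d x p + 1) * p i)" for x
  define c where "c x = 2 / d (w x) (w x)" for x
  define r where "r x = (\<lambda>i. p i + c x * w x i)" for x
  have dqp: "d q p \<noteq> 1" if "q \<in> ?S - {p}" for q
  proof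
    assume "d q p = 1"
    then have "d (\<lambda>i. q i - p i) (\<lambda>i. q i - p i) = 0"
      using that S_iff[of q] pp by (simp only: d_diff d_commute[of p q]) simp
    moreover have "(\<lambda>i. q i - p i) \<in> topspace ?E" using that pE by (simp add: topspace_Euclidean_space)
    ultimately have "(\<lambda>i. q i - p i) = zvec" using d0 by blast
    then have "q = p" by (simp add: fun_eq_iff)
    then show False using that by simp
  qed
  have wE: "w x \<in> topspace ?E" if "x \<in> topspace ?E" for x
    using that pE by (simp add: w_def topspace_Euclidean_space)
  have wp: "d (w x) p = - 1" for x by (simp add: w_def d_diff d_scale pp)
  have ww: "d (w x) (w x) \<noteq> 0" if "x \<in> topspace ?E" for x
  proof
    assume "d (w x) (w x) = 0"
    then have "w x = zvec" using d0 wE that by blast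
    then show False using wp[of x] by (simp add: d_def)
  qed
  have cw: "c x * d (w x) (w x) = 2" if "x \<in> topspace ?E" for x using ww[OF that] by (simp add: c_def)
  have wc: "continuous_map ?E ?E w"
    unfolding w_def by (intro cadd continuous_map_Euclidean_scale cp continuous_map_add dc) auto
  have rc: "continuous_map ?E ?E r"
    unfolding r_def c_def
    by (intro cadd continuous_map_Euclidean_scale cp wc continuous_map_real_divide dc) (use ww in auto)
  have rS: "r x \<in> ?S - {p}" if x: "x \<in> topspace ?E" for x
  proof -
    have "r x \<in> topspace ?E" using rc x by (auto simp: continuous_map_def)
    moreover have "d (r x) (r x) = 1"
    proof -
      have "d (r x) (r x) = 1 - 2 * c x + c x * (c x * d (w x) (w x))"
        unfolding r_def d_add d_scale d_commute[of p "w x"] pp wp by (simp add: algebra_simps)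
      then show ?thesis unfolding cw[OF x] by simp
    qed
    moreover have "r x \<noteq> p"
    proof
      assume "r x = p"
      then have "d (r x) p = d p p" by simp
      then have "c x = 0" unfolding r_def d_add d_scale pp wp by simp
      then show False using cw[OF x] by simp
    qed
    ultimately show ?thesis using S_iff by blast
  qed
  have ec: "continuous_map (subtopology ?E (?S - {p})) ?E e"
    unfolding e_def
    by (intro cadd continuous_map_Euclidean_scale cp continuous_map_real_divide dc continuous_map_diff)
      (use dqp in \<open>auto simp: continuous_map_from_subtopology\<close>)
  have re: "r (e q) = q" if q: "q \<in> ?S - {p}" for q
  proof -
    have qq: "d q q = 1" using q S_iff by blast
    have n1: "1 - d q p \<noteq> 0" using dqp[OF q] by simp
    define a where "a = 1 / (1 - d q p)"
    have a: "a * (1 - d q p) = 1" "a \<noteq> 0" using n1 by (simp_all add: a_def)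
    have ea: "e q = (\<lambda>i. a * (q i - p i))" by (simp add: e_def a_def)
    have "d (e q) p = - (a * (1 - d q p))" unfolding ea d_scale d_diff pp by (simp add: algebra_simps)
    then have ep: "d (e q) p = - 1" using a by simp
    then have we: "w (e q) = e q" by (simp add: w_def)
    have "d (e q) (e q) = 2 * a * (a * (1 - d q p))"
      unfolding ea d_scale d_diff pp qq d_commute[of p q] by (simp add: algebra_simps)
    then have "d (e q) (e q) = 2 * a" using a by simp
    then have ca: "c (e q) * a = 1" using a(2) by (simp add: c_def we)
    have "r (e q) = (\<lambda>i. p i + (c (e q) * a) * (q i - p i))" by (simp add: r_def we) (simp add: ea mult.assoc)
    then show ?thesis unfolding ca by simp
  qed
  show ?thesis
  proof (rule extendable_retract[OF extendable_Euclidean[OF Y, of n]])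
    show "continuous_map ?E (subtopology ?E (?S - {p})) r"
      unfolding continuous_map_in_subtopology using rc rS by auto
    show "continuous_map (subtopology ?E (?S - {p})) ?E e" by (rule ec)
    show "r (e q) = q" if "q \<in> topspace (subtopology ?E (?S - {p}))" for q using re that by auto
  qed
qed

section \<open>Degrees on the boundary of a disk\<close>

text \<open>Compare \<open>u\<close> with the homogeneous extension of \<open>f \<circ> \<psi>'\<close>
  composed with the chart, which has the same boundary values and a single zero.\<close>

lemma degree_sum_disk:
  assumes X: "Hausdorff_space X" "locally_Euclidean n X" "locally_oriented n X \<mu>"
    and D: "disk_chart n X D \<psi> \<psi>'"
    and f: "continuous_map (subtopology X (boundary X D)) (punct n) f"
    and u: "continuous_map (subtopology X D) (Euclidean_space n) u" "finite (zeros u D)"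
    and uf: "\<And>z. z \<in> boundary X D \<Longrightarrow> u z = f z"
  shows "degree_sum n X \<mu> u (X interior_of D) = endo_degree n (radial (l2 n) (f \<circ> \<psi>')) * local_degree n X \<mu> \<psi> (\<psi>' zvec)"
proof -
  let ?E = "Euclidean_space n" and ?S = "gauge_sphere n (l2 n)" and ?Q = "X interior_of D"
  note d = disk_chartD[OF D]
  define F where "F = radial (l2 n) (f \<circ> \<psi>')"
  have "continuous_map (subtopology ?E ?S) (subtopology X (boundary X D)) \<psi>'"
    using boundary_disk_chart[OF X(2) D] by (simp add: homeomorphic_maps_def)
  then have f\<psi>: "continuous_map (subtopology ?E ?S) (punct n) (f \<circ> \<psi>')" using f continuous_map_compose by blast
  have F: "proper_at_zero n F" unfolding F_def by (rule radial_proper_at_zero[OF f\<psi>])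
  have Fc: "continuous_map ?E ?E F" and Fnz: "\<And>q. q \<in> topspace ?E \<Longrightarrow> q \<noteq> zvec \<Longrightarrow> F q \<noteq> zvec"
    using F by (auto simp: proper_at_zero_def)
  have F0: "F zvec = zvec" by (simp add: F_def radial_zvec)
  define x0 where "x0 = \<psi>' zvec"
  have z0: "zvec \<in> shell n {..1}" by (simp add: zvec_in_Euclidean l2_def)
  have x0: "x0 \<in> D" "\<psi> x0 = zvec" using d(5,7)[OF z0] by (auto simp: x0_def)
  have x0Q: "x0 \<in> ?Q" unfolding interior_of_disk[OF X(2) D] using x0 by (simp add: l2_def)
  have QD: "?Q \<subseteq> D" by (rule interior_of_subset)
  have oQ: "openin X ?Q" by simp
  have \<psi>0: "z = x0" if "z \<in> D" "\<psi> z = zvec" for z using d(6)[OF that(1)] that(2) by (simp add: x0_def)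
  have w: "continuous_map (subtopology X D) ?E (F \<circ> \<psi>)" using continuous_map_compose[OF d(2) Fc] .
  have w0: "z = x0" if "z \<in> D" "(F \<circ> \<psi>) z = zvec" for z
    using \<psi>0[OF that(1)] Fnz[of "\<psi> z"] d(4)[OF that(1)] that(2) by auto
  have zw: "zeros (F \<circ> \<psi>) D \<subseteq> {x0}" using w0 by (auto simp: zeros_def)
  have zQ: "zeros (F \<circ> \<psi>) ?Q = {x0}" using zw x0Q QD x0(2) F0 by (auto simp: zeros_def)
  have z\<psi>: "zeros \<psi> ?Q = {x0}" using \<psi>0 QD x0Q x0(2) by (auto simp: zeros_def)
  have "degree_sum n X \<mu> u ?Q = degree_sum n X \<mu> (F \<circ> \<psi>) ?Q"
  proof (rule degree_sum_boundary[OF X disk_chart_compact[OF D] oQ QD u w])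
    show "finite (zeros (F \<circ> \<psi>) D)" using zw finite_subset by blast
    fix z assume z: "z \<in> D - ?Q"
    have "\<psi> z \<in> ?S" using z unfolding boundary_disk[OF X(2) D] by blast
    then have "F (\<psi> z) = f (\<psi>' (\<psi> z))" unfolding F_def using radial_on_sphere[OF hom_gauge_l2] by fastforce
    then have "F (\<psi> z) = f z" using d(6) z by simp
    moreover have "f z \<noteq> zvec" using f z d(1) by (auto simp: continuous_map_punct_iff)
    ultimately show "u z = (F \<circ> \<psi>) z \<and> u z \<noteq> zvec" using uf[OF z] by simp
  qed
  also have "\<dots> = local_degree n X \<mu> (F \<circ> \<psi>) x0" by (simp add: degree_sum_def zQ)
  also have "\<dots> = endo_degree n F * local_degree n X \<mu> \<psi> x0"
  proof -
    have \<mu>: "\<mu> x0 \<in> carrier (local_homology n X {x0})"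
      using locally_oriented_carrier[OF X(3)] x0(1) d(1) by blast
    have i: "isolates n X ?Q {x0} \<psi>"
      using isolates_zeros[OF X(1) oQ QD _ d(2)] z\<psi> by simp
    have i': "isolates n X ?Q {x0} (F \<circ> \<psi>)"
      using isolates_zeros[OF X(1) oQ QD _ w] zQ by simp
    show ?thesis
      using local_degree_eq[where \<mu>=\<mu> and z=x0, OF i \<mu>] local_degree_eq[where \<mu>=\<mu> and z=x0, OF i' \<mu>] map_degree_compose[OF i \<mu> Fc Fnz] by simp
  qed
  finally show ?thesis by (simp add: F_def x0_def)
qed

lemma disk_isolates:
  assumes X: "Hausdorff_space X" "locally_Euclidean n X" and D: "disk_chart n X D \<psi> \<psi>'"
  shows "isolates n X (X interior_of D) {\<psi>' zvec} \<psi>"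
proof -
  note d = disk_chartD[OF D]
  have z0: "zvec \<in> shell n {..1}" by (simp add: zvec_in_Euclidean l2_def)
  have QD: "X interior_of D \<subseteq> D" by (rule interior_of_subset)
  have "z = \<psi>' zvec" if "z \<in> D" "\<psi> z = zvec" for z using d(6)[OF that(1)] that(2) by simp
  moreover have "\<psi>' zvec \<in> X interior_of D"
    unfolding interior_of_disk[OF X(2) D] using d(5,7)[OF z0] by (simp add: l2_def)
  ultimately have z: "zeros \<psi> (X interior_of D) = {\<psi>' zvec}" using QD d(7)[OF z0] by (auto simp: zeros_def)
  then show ?thesis using isolates_zeros[OF X(1) openin_interior_of QD _ d(2)] by simp
qed

lemma hom_int_pow_integer:
  assumes "h \<in> hom G integer_group" "group G" "a \<in> carrier G"
  shows "h (a [^]\<^bsub>G\<^esub> (m::int)) = m * h a"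
proof -
  interpret group_hom G integer_group h
    using assms by (simp add: group_hom_def group_hom_axioms_def)
  show ?thesis using hom_int_pow[OF assms(3), of m] assms by (simp)
qed

text \<open>The chart \<open>\<psi>\<close> maps some local homology class at the centre to a generator, and
  this class is a multiple of the generator given by the orientation.\<close>

lemma disk_degree_unit:
  assumes X: "Hausdorff_space X" "locally_Euclidean n X" and \<mu>: "orientation n X \<mu>"
    and D: "disk_chart n X D \<psi> \<psi>'"
  shows "local_degree n X \<mu> \<psi> (\<psi>' zvec) dvd 1"
proof -
  let ?E = "Euclidean_space n" and ?P = "topspace (Euclidean_space n) - {zvec}" and ?B = "shell n {..<1}"
  let ?R = "relative_homology_group (int n)" and ?h = "hom_induced (int n)"
  define Q where "Q = X interior_of D"
  define x0 where "x0 = \<psi>' zvec"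
  note d = disk_chartD[OF D]
  have i: "isolates n X Q {x0} \<psi>" unfolding Q_def x0_def by (rule disk_isolates[OF X D])
  then have Q: "openin X Q" "closedin X {x0}" "{x0} \<subseteq> Q" "continuous_map (subtopology X Q) ?E \<psi>"
    by (auto simp: isolates_def)
  have QX: "Q \<subseteq> topspace X" using Q(1) openin_subset by blast
  have Qeq: "Q = {z \<in> D. l2 n (\<psi> z) < 1}" unfolding Q_def by (rule interior_of_disk[OF X(2) D])
  have x0X: "x0 \<in> topspace X" using Q(3) QX by blast
  have \<mu>0: "\<mu> x0 \<in> carrier (local_homology n X {x0})"
    and gen: "subgroup_generated (local_homology n X {x0}) {\<mu> x0} = local_homology n X {x0}"
    using \<mu> x0X unfolding orientation_def by blast+
  obtain g where g: "g \<in> carrier (local_group n)" "local_int n g = 1" by (rule local_int_surj)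
  have oB: "openin ?E ?B" by (rule openin_l2) simp
  have cB: "closedin ?E {zvec}"
    using closedin_Hausdorff_singleton[OF Hausdorff_Euclidean_space] zvec_in_Euclidean by blast
  have zB: "{zvec} \<subseteq> ?B" by (simp add: zvec_in_Euclidean l2_def)
  obtain a where a: "a \<in> carrier (?R (subtopology ?E ?B) (?B - {zvec}))"
     "?h (subtopology ?E ?B) (?B - {zvec}) ?E ?P id a = g"
    using excision_lift[OF oB cB zB g(1)] .
  define b where "b = ?h (subtopology ?E ?B) (?B - {zvec}) (subtopology X Q) (Q - {x0}) \<psi>' a"
  have B1: "q \<in> shell n {..1}" if "q \<in> ?B" for q using that by auto
  have \<psi>'Q: "\<psi>' q \<in> Q" if "q \<in> ?B" for q
    using d(5,7)[OF B1[OF that]] that unfolding Qeq by simp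
  have \<psi>'c: "continuous_map (subtopology ?E ?B) (subtopology X Q) \<psi>'"
    unfolding continuous_map_in_subtopology
    using continuous_map_from_subtopology_mono[OF d(3), of ?B] \<psi>'Q B1 by (auto simp: subset_iff Pi_iff image_subset_iff)
  have \<psi>'0: "\<psi>' \<in> ?B - {zvec} \<rightarrow> Q - {x0}"
  proof
    fix q assume q: "q \<in> ?B - {zvec}"
    have "\<psi>' q \<noteq> x0"
    proof
      assume "\<psi>' q = x0"
      then have "\<psi> (\<psi>' q) = \<psi> (\<psi>' zvec)" by (simp add: x0_def)
      then show False using d(7)[OF B1, of q] d(7)[OF B1, of zvec] q zB by simp
    qed
    then show "\<psi>' q \<in> Q - {x0}" using \<psi>'Q q by blast
  qed
  define \<nu> where "\<nu> = ?h (subtopology X Q) (Q - {x0}) X (topspace X - {x0}) id b"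
  have b: "b \<in> carrier (?R (subtopology X Q) (Q - {x0}))" unfolding b_def by (rule hom_induced_carrier)
  have "map_degree n X Q {x0} \<nu> \<psi> = local_int n (?h (subtopology X Q) (Q - {x0}) ?E ?P \<psi> b)"
    using map_degree_eq[OF Q(1-3) b] by (simp add: \<nu>_def)
  also have "?h (subtopology X Q) (Q - {x0}) ?E ?P \<psi> b = ?h (subtopology ?E ?B) (?B - {zvec}) ?E ?P (\<psi> \<circ> \<psi>') a"
    unfolding b_def using hom_induced_compose'[OF \<psi>'c \<psi>'0 Q(4) isolates_funcset[OF i], of "int n" a] by simp
  also have "\<dots> = ?h (subtopology ?E ?B) (?B - {zvec}) ?E ?P id a"
    by (rule hom_induced_eq[THEN fun_cong]) (use d(7)[OF B1] in auto)
  also have "local_int n \<dots> = 1" using a(2) g(2) by simp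
  finally have one: "map_degree n X Q {x0} \<nu> \<psi> = 1" .
  have "\<nu> \<in> carrier (local_homology n X {x0})" unfolding \<nu>_def by (rule hom_induced_carrier)
  then have "\<nu> \<in> carrier (subgroup_generated (local_homology n X {x0}) {\<mu> x0})" using gen by simp
  then obtain m :: int where m: "\<nu> = \<mu> x0 [^]\<^bsub>local_homology n X {x0}\<^esub> m"
    using group.carrier_subgroup_generated_by_singleton[OF group_relative_homology_group \<mu>0] by auto
  obtain a0 where a0: "a0 \<in> carrier (?R (subtopology X Q) (Q - {x0}))"
     "?h (subtopology X Q) (Q - {x0}) X (topspace X - {x0}) id a0 = \<mu> x0"
    using excision_lift[OF Q(1-3) \<mu>0] .
  let ?G = "?R (subtopology X Q) (Q - {x0})"
  let ?am = "a0 [^]\<^bsub>?G\<^esub> m"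
  have amG: "?am \<in> carrier ?G" using group.int_pow_closed[OF group_relative_homology_group a0(1)] .
  have am: "?h (subtopology X Q) (Q - {x0}) X (topspace X - {x0}) id ?am = \<nu>"
    using group_hom.hom_int_pow[OF _ a0(1), of "local_homology n X {x0}" "?h (subtopology X Q) (Q - {x0}) X (topspace X - {x0}) id" m]
      a0(2) m by (simp add: group_hom_def group_hom_axioms_def hom_induced_hom)
  have "1 = local_int n (?h (subtopology X Q) (Q - {x0}) ?E ?P \<psi> ?am)"
    using one map_degree_eq[OF Q(1-3) amG am, of \<psi>] by simp
  also have "\<dots> = m * local_int n (?h (subtopology X Q) (Q - {x0}) ?E ?P \<psi> a0)"
  proof -
    have "local_int n \<circ> ?h (subtopology X Q) (Q - {x0}) ?E ?P \<psi> \<in> hom ?G integer_group"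
      by (rule hom_compose[OF hom_induced_hom local_int_hom])
    then show ?thesis using hom_int_pow_integer[OF _ group_relative_homology_group a0(1), of "local_int n \<circ> ?h (subtopology X Q) (Q - {x0}) ?E ?P \<psi>" m] by simp
  qed
  also have "local_int n (?h (subtopology X Q) (Q - {x0}) ?E ?P \<psi> a0) = local_degree n X \<mu> \<psi> x0"
    using map_degree_eq[OF Q(1-3) a0, of \<psi>] local_degree_eq[where \<mu>=\<mu> and z=x0, OF i \<mu>0] by simp
  finally show ?thesis unfolding x0_def by (metis dvd_triv_right)
qed

lemma disk_degree_image:
  assumes X: "Hausdorff_space X" "locally_Euclidean n X" and D: "disk_chart n X D \<psi> \<psi>'"
    and s: "homeomorphic_maps X X s s'"
    and \<mu>: "\<And>z. z \<in> topspace X \<Longrightarrow> \<mu> z \<in> carrier (local_homology n X {z})"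
    and \<mu>s: "\<And>z. z \<in> topspace X \<Longrightarrow> hom_induced (int n) X (topspace X - {z}) X (topspace X - {s z}) s (\<mu> z) = \<mu> (s z)"
  shows "local_degree n X \<mu> (\<psi> \<circ> s') ((s \<circ> \<psi>') zvec) = local_degree n X \<mu> \<psi> (\<psi>' zvec)"
proof -
  define Q where "Q = X interior_of D"
  define x0 where "x0 = \<psi>' zvec"
  have i: "isolates n X Q {x0} \<psi>" unfolding Q_def x0_def by (rule disk_isolates[OF X D])
  then have Q: "openin X Q" "closedin X {x0}" "{x0} \<subseteq> Q" by (auto simp: isolates_def)
  have QX: "Q \<subseteq> topspace X" using Q(1) openin_subset by blast
  have x0X: "x0 \<in> topspace X" using Q(3) QX by blast
  have sx: "s x0 \<in> topspace X" using s x0X by (auto simp: homeomorphic_maps_def continuous_map_def)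
  have DX: "D \<subseteq> topspace X" using disk_chartD(1)[OF D] .
  have sh: "homeomorphic_map X X s" using s homeomorphic_maps_map by blast
  have i2: "isolates n X (s ` Q) (s ` {x0}) (\<psi> \<circ> s')"
    using disk_isolates[OF X disk_chart_image[OF D s]] homeomorphic_map_interior_of[OF sh DX]
    by (simp add: Q_def x0_def)
  have "local_degree n X \<mu> (\<psi> \<circ> s') (s x0) = map_degree n X (s ` Q) (s ` {x0}) (\<mu> (s x0)) (\<psi> \<circ> s')"
    using local_degree_eq[where \<mu>=\<mu> and z="s x0", OF _ \<mu>[OF sx]] i2 by simp
  also have "\<dots> = map_degree n X Q {x0} (\<mu> x0) (\<psi> \<circ> s' \<circ> s)"
    using map_degree_homeomorphic[OF sh i2 Q \<mu>[OF x0X]] \<mu>s[OF x0X] by simp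
  also have "\<dots> = map_degree n X Q {x0} (\<mu> x0) \<psi>"
    by (rule map_degree_cong) (use s in \<open>simp add: homeomorphic_maps_def\<close>)
  also have "\<dots> = local_degree n X \<mu> \<psi> x0"
    using local_degree_eq[where \<mu>=\<mu> and z=x0, OF i \<mu>[OF x0X]] by simp
  finally show ?thesis by (simp add: x0_def)
qed

context rotation_model
begin

lemma sphere_compact_Hausdorff:
  "compact_space (subtopology (Euclidean_space n) (gauge_sphere n (l2 n)))"
  "Hausdorff_space (subtopology (Euclidean_space n) (gauge_sphere n (l2 n)))"
  using compactin_l2[of "{1}" 1 n] by (simp_all add: compact_space_subtopology Hausdorff_space_subtopology Hausdorff_Euclidean_space)

lemma sphere_free:
  "continuous_map (subtopology (Euclidean_space n) (gauge_sphere n (l2 n))) (subtopology (Euclidean_space n) (gauge_sphere n (l2 n))) \<tau>"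
  "free_on k \<tau> (topspace (subtopology (Euclidean_space n) (gauge_sphere n (l2 n))))"
proof -
  show "continuous_map (subtopology (Euclidean_space n) (gauge_sphere n (l2 n))) (subtopology (Euclidean_space n) (gauge_sphere n (l2 n))) \<tau>"
    unfolding continuous_map_in_subtopology using continuous_\<tau> \<tau>_topspace l2_\<tau>
    by (auto simp: continuous_map_from_subtopology)
  have "shell n {1} = topspace (subtopology (Euclidean_space n) (gauge_sphere n (l2 n)))" by auto
  then show "free_on k \<tau> (topspace (subtopology (Euclidean_space n) (gauge_sphere n (l2 n))))"
    using \<tau>_free_on[of "{1}"] by simp
qed

text \<open>An equivariant map from the linear sphere to \<open>Z\<close> extends over the ball, because
  \<open>Z\<close> is an absolute extensor. Followed by an equivariant map from a compact subset
  of \<open>Z\<close> to the punctured space, it would have degree zero by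
  \<open>radial_degree_extends\<close> and degree \<open>1\<close> modulo \<open>k\<close> by
  \<open>radial_degree_mod\<close>.\<close>

lemma no_free_action_on_extensor:
  fixes Z :: "'a topology"
  assumes Z: "Hausdorff_space Z" and T: "continuous_map Z Z T" and free: "free_on k T (topspace Z)"
    and ext: "\<And>Y :: (nat \<Rightarrow> real) topology. compact_space Y \<Longrightarrow> Hausdorff_space Y \<Longrightarrow> extendable Y Z"
    and K: "\<And>K. compactin Z K \<Longrightarrow> extendable (subtopology Z K) (punct n)"
  shows False
proof -
  let ?E = "Euclidean_space n" and ?S = "gauge_sphere n (l2 n)" and ?C = "shell n {..1}"
  have k0: "k > 0" using k by simp
  have Tk: "(T ^^ k) z = z" if "z \<in> topspace Z" for z using free that by (auto simp: free_on_def)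
  have \<tau>k: "(\<tau> ^^ k) q = q" if "q \<in> topspace (punct n)" for q by (rule \<tau>_funpow)
  have \<tau>P: "continuous_map (punct n) (punct n) \<tau>"
    unfolding continuous_map_punct_iff using proper_\<tau> continuous_\<tau>
    by (auto simp: punct_def continuous_map_from_subtopology proper_at_zero_def)
  obtain h where h: "continuous_map (subtopology ?E ?S) Z h" "\<And>q. q \<in> ?S \<Longrightarrow> h (\<tau> q) = T (h q)"
  proof (rule equivariant_extension[where A="{}" and f="\<lambda>_. undefined" and \<tau>=T and Q=Z,
      OF sphere_compact_Hausdorff sphere_free k0 T Tk ext[OF sphere_compact_Hausdorff]])
    fix g assume "continuous_map (subtopology ?E ?S) Z g"
      "\<And>z. z \<in> topspace (subtopology ?E ?S) \<Longrightarrow> g (\<tau> z) = T (g z)"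
    then show thesis using that by simp
  qed auto
  have Cc: "compact_space (subtopology ?E ?C)" "Hausdorff_space (subtopology ?E ?C)"
    using compactin_l2[of "{..1}" 1 n] by (simp_all add: compact_space_subtopology Hausdorff_space_subtopology Hausdorff_Euclidean_space)
  have SC: "?S \<subseteq> ?C" by auto
  have "closedin (subtopology ?E ?C) ?S"
  proof -
    have "closedin ?E (shell n {1})" by (rule closedin_l2) simp
    then show ?thesis using SC by (simp add: closedin_subset_topspace)
  qed
  moreover have "continuous_map (subtopology (subtopology ?E ?C) ?S) Z h"
    using h(1) SC by (simp add: subtopology_subtopology inf_absorb2)
  ultimately obtain H where H: "continuous_map (subtopology ?E ?C) Z H" "\<And>q. q \<in> ?S \<Longrightarrow> H q = h q"
    using extendableD[OF ext[OF Cc]] by blast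
  define K' where "K' = orbit_union k T (H ` ?C)"
  have "compactin Z (H ` ?C)"
    using image_compactin[OF _ H(1), of ?C] compactin_l2[of "{..1}" 1 n] by (simp add: compactin_subtopology)
  then have K'c: "compactin Z K'"
    unfolding K'_def orbit_union_def
    by (intro compactin_Union) (auto intro: image_compactin continuous_map_funpow[OF T])
  have HK: "H q \<in> K'" if "q \<in> ?C" for q
    using that k0 unfolding K'_def orbit_union_def by (auto intro!: bexI[of _ 0])
  have K'Z: "K' \<subseteq> topspace Z" using K'c compactin_subset_topspace by blast
  have TK: "T z \<in> K'" if "z \<in> K'" for z
  proof -
    obtain j q where j: "j < k" "q \<in> ?C" "z = (T ^^ j) (H q)"
      using \<open>z \<in> K'\<close> unfolding K'_def orbit_union_def by auto
    have HZ: "H q \<in> topspace Z" using H(1) j(2) by (auto simp: continuous_map_def)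
    show ?thesis
    proof (cases "Suc j = k")
      case True
      then have "T z = (T ^^ k) (H q)" using j(3) by auto
      then have "T z = H q" using Tk[OF HZ] by simp
      then show ?thesis using HK[OF j(2)] by simp
    next
      case False
      then have "Suc j < k" "T z = (T ^^ Suc j) (H q)" using j by auto
      then show ?thesis using j(2) unfolding K'_def orbit_union_def by blast
    qed
  qed
  have Yc: "compact_space (subtopology Z K')" "Hausdorff_space (subtopology Z K')"
    using K'c Z by (simp_all add: compact_space_subtopology Hausdorff_space_subtopology Hausdorff_Euclidean_space)
  have YT: "continuous_map (subtopology Z K') (subtopology Z K') T"
    unfolding continuous_map_in_subtopology using T TK by (auto simp: continuous_map_from_subtopology)
  have Yf: "free_on k T (topspace (subtopology Z K'))"
    using free TK K'Z by (auto simp: free_on_def)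
  obtain f where f: "continuous_map (subtopology Z K') (punct n) f" "\<And>z. z \<in> K' \<Longrightarrow> f (T z) = \<tau> (f z)"
  proof (rule equivariant_extension[where A="{}" and f="\<lambda>_. undefined" and \<tau>=\<tau> and Q="punct n",
      OF Yc YT Yf k0 \<tau>P \<tau>k K[OF K'c]])
    fix g assume "continuous_map (subtopology Z K') (punct n) g"
      "\<And>z. z \<in> topspace (subtopology Z K') \<Longrightarrow> g (T z) = \<tau> (g z)"
    then show thesis using that K'Z by auto
  qed auto
  have "continuous_map (subtopology ?E ?C) (subtopology Z K') H"
    unfolding continuous_map_in_subtopology using H(1) HK by auto
  then have v: "continuous_map (subtopology ?E ?C) (punct n) (f \<circ> H)" using f(1) continuous_map_compose by blast
  have g: "continuous_map (subtopology ?E ?S) (punct n) (f \<circ> H)"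
    using continuous_map_from_subtopology_mono[OF v SC] .
  have "int k dvd endo_degree n (radial (l2 n) (f \<circ> H)) - 1"
  proof (rule radial_degree_mod[OF g])
    fix q assume q: "q \<in> ?S"
    then have "\<tau> q \<in> ?S" using \<tau>_topspace l2_\<tau> by auto
    then have "H (\<tau> q) = T (H q)" using h(2)[OF q] H(2) q by simp
    then show "(f \<circ> H) (\<tau> q) = \<tau> ((f \<circ> H) q)" using f(2)[OF HK] q SC by auto
  qed
  moreover have "endo_degree n (radial (l2 n) (f \<circ> H)) = 0"
    by (rule radial_degree_extends[OF n(1) g v]) simp
  ultimately show False using k by simp
qed

text \<open>The number \<open>a\<close> is the degree of an equivariant map \<open>h\<close> from the linear
  sphere to \<open>Y\<close>, and \<open>radial_degree_mod\<close> applies to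
  \<open>f \<circ> h\<close>.\<close>

lemma sphere_degree_inverse:
  assumes \<psi>: "homeomorphic_maps Y (subtopology (Euclidean_space n) (gauge_sphere n (l2 n))) \<psi> \<psi>'"
    and T: "continuous_map Y Y T" and Tk: "\<And>z. z \<in> topspace Y \<Longrightarrow> (T ^^ k) z = z"
  obtains a where "\<And>f. continuous_map Y (punct n) f \<Longrightarrow> (\<And>z. z \<in> topspace Y \<Longrightarrow> f (T z) = \<tau> (f z)) \<Longrightarrow>
    int k dvd a * endo_degree n (radial (l2 n) (f \<circ> \<psi>')) - 1"
proof -
  let ?E = "Euclidean_space n" and ?S = "gauge_sphere n (l2 n)"
  have k0: "k > 0" using k by simp
  have \<psi>1: "continuous_map Y (subtopology ?E ?S) \<psi>" "continuous_map (subtopology ?E ?S) Y \<psi>'"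
    "\<And>z. z \<in> topspace Y \<Longrightarrow> \<psi>' (\<psi> z) = z"
    using \<psi> by (auto simp: homeomorphic_maps_def)
  have PS: "continuous_map (punct n) (subtopology ?E ?S) (\<lambda>x i. (1 / l2 n x) * x i)"
  proof -
    have pE: "continuous_map (punct n) ?E (\<lambda>x. x)" by (simp add: punct_def continuous_map_from_subtopology)
    have "l2 n x \<noteq> 0" if "x \<in> topspace (punct n)" for x
      using that l2_zero_iff[of x n] by (auto simp: topspace_punct topspace_Euclidean_space)
    then have "continuous_map (punct n) ?E (\<lambda>x i. (1 / l2 n x) * x i)"
      by (intro continuous_map_Euclidean_scale pE continuous_map_real_divide)
        (auto simp: punct_def continuous_map_from_subtopology continuous_map_l2)
    moreover have "(\<lambda>i. (1 / l2 n x) * x i) \<in> ?S" if "x \<in> topspace (punct n)" for x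
      using gauge_normalize(1)[OF hom_gauge_l2, of x n] that by (auto simp: topspace_punct topspace_Euclidean_space)
    ultimately show ?thesis unfolding continuous_map_in_subtopology by auto
  qed
  have SP: "continuous_map (subtopology ?E ?S) (punct n) (\<lambda>x. x)"
    unfolding continuous_map_punct_iff using l2_zero_iff by (auto simp: continuous_map_from_subtopology l2_def)
  have ext: "extendable (subtopology ?E ?S) Y"
  \<comment> \<open>a sphere is a retract of the punctured space\<close>
  proof (rule extendable_retract[OF extendable_sphere[OF n(1)]])
    show "continuous_map (punct n) Y (\<psi>' \<circ> (\<lambda>x i. (1 / l2 n x) * x i))" using continuous_map_compose[OF PS \<psi>1(2)] .
    show "continuous_map Y (punct n) \<psi>" using continuous_map_compose[OF \<psi>1(1) SP] by (simp add: o_def)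
    fix z assume z: "z \<in> topspace Y"
    then have "l2 n (\<psi> z) = 1" using \<psi>1(1) by (auto simp: continuous_map_def)
    then show "(\<psi>' \<circ> (\<lambda>x i. (1 / l2 n x) * x i)) (\<psi> z) = z" using \<psi>1(3)[OF z] by simp
  qed
  obtain h where h: "continuous_map (subtopology ?E ?S) Y h" "\<And>q. q \<in> ?S \<Longrightarrow> h (\<tau> q) = T (h q)"
  proof (rule equivariant_extension[where A="{}" and f="\<lambda>_. undefined" and \<tau>=T and Q=Y,
      OF sphere_compact_Hausdorff sphere_free k0 T Tk ext])
    fix g assume "continuous_map (subtopology ?E ?S) Y g"
      "\<And>z. z \<in> topspace (subtopology ?E ?S) \<Longrightarrow> g (\<tau> z) = T (g z)"
    then show thesis using that by simp
  qed auto
  define G where "G = radial (l2 n) (\<psi> \<circ> h)"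
  have \<psi>h: "continuous_map (subtopology ?E ?S) (subtopology ?E ?S) (\<psi> \<circ> h)" using continuous_map_compose[OF h(1) \<psi>1(1)] .
  have G: "proper_at_zero n G"
    unfolding G_def using radial_proper_at_zero continuous_map_compose[OF \<psi>h SP] by (simp add: o_def)
  show thesis
  proof (rule that)
    fix f assume f: "continuous_map Y (punct n) f" "\<And>z. z \<in> topspace Y \<Longrightarrow> f (T z) = \<tau> (f z)"
    let ?F = "radial (l2 n) (f \<circ> \<psi>')"
    have fP: "continuous_map (subtopology ?E ?S) (punct n) (f \<circ> \<psi>')" using continuous_map_compose[OF \<psi>1(2) f(1)] .
    have fh: "continuous_map (subtopology ?E ?S) (punct n) (f \<circ> h)" using continuous_map_compose[OF h(1) f(1)] .
    have hY: "h q \<in> topspace Y" if "q \<in> ?S" for q using h(1) that by (auto simp: continuous_map_def)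
    have "endo_degree n (radial (l2 n) (f \<circ> h)) = endo_degree n (?F \<circ> G)"
    proof (rule endo_degree_cong)
      fix x assume x: "x \<in> topspace ?E"
      show "radial (l2 n) (f \<circ> h) x = (?F \<circ> G) x"
      proof (cases "x = zvec")
        case False
        define q where "q = (\<lambda>j. x j / l2 n x)"
        have q: "q \<in> ?S" and l: "l2 n x > 0" unfolding q_def using gauge_normalize[OF hom_gauge_l2 x False] by auto
        define p where "p = \<psi> (h q)"
        have p: "p \<in> ?S" using \<psi>h q by (auto simp: continuous_map_def p_def)
        have Gx: "G x = (\<lambda>i. l2 n x * p i)" using False by (simp add: G_def radial_def p_def q_def)
        have lG: "l2 n (G x) = l2 n x" unfolding Gx using gauge_scale[OF hom_gauge_l2, of "l2 n x" n p] l p by simp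
        have "G x \<noteq> zvec" using G x False by (simp add: proper_at_zero_def)
        then have "?F (G x) = (\<lambda>i. l2 n x * f (\<psi>' p) i)"
          unfolding radial_def lG using l by (simp add: Gx)
        also have "\<psi>' p = h q" unfolding p_def using \<psi>1(3) hY q by blast
        finally have FG: "?F (G x) = (\<lambda>i. l2 n x * f (h q) i)" .
        show ?thesis unfolding o_apply[of ?F G] FG using False by (simp add: radial_def q_def)
      qed (simp add: radial_zvec G_def)
    qed
    also have "\<dots> = endo_degree n ?F * endo_degree n G"
      by (rule endo_degree_compose[OF radial_proper_at_zero[OF fP] G])
    finally have eq: "endo_degree n (radial (l2 n) (f \<circ> h)) = endo_degree n G * endo_degree n ?F" by simp
    have "int k dvd endo_degree n (radial (l2 n) (f \<circ> h)) - 1"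
      by (rule radial_degree_mod[OF fh]) (use h(2) f(2) hY in auto)
    then show "int k dvd endo_degree n G * endo_degree n ?F - 1" unfolding eq .
  qed
qed

text \<open>The operator \<open>quat_j\<close> is linear, so it commutes with the homogeneous extension, and
  its degree is \<open>1\<close>.\<close>

lemma radial_degree_quat_j:
  assumes g: "continuous_map (subtopology (Euclidean_space n) (gauge_sphere n (l2 n))) (punct n) g"
  shows "endo_degree n (radial (l2 n) (quat_j \<circ> g)) = endo_degree n (radial (l2 n) g)"
proof -
  have "endo_degree n (radial (l2 n) (quat_j \<circ> g)) = endo_degree n (quat_j \<circ> radial (l2 n) g)"
  proof (rule endo_degree_cong)
    fix x assume "x \<in> topspace (Euclidean_space n)"
    have "quat_j (\<lambda>i. a * v i) = (\<lambda>i. a * quat_j v i)" for a v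
      using quat_j_linear[of a v 0 v] by simp
    then show "radial (l2 n) (quat_j \<circ> g) x = (quat_j \<circ> radial (l2 n) g) x"
      using quat_j_linear[of 0 x 0 x] by (simp add: radial_def)
  qed
  then show ?thesis
    using endo_degree_compose[OF proper_at_zero_quat_j radial_proper_at_zero[OF g]] endo_degree_quat_j n by simp
qed

end

section \<open>An invariant disk and its reflection\<close>

locale dihedral_disk = rotation_model +
  fixes X :: "'a topology" and \<mu> :: "'a \<Rightarrow> 'a chain set" and T s :: "'a \<Rightarrow> 'a" and x :: 'a
    and D :: "'a set" and \<psi> :: "'a \<Rightarrow> nat \<Rightarrow> real" and \<psi>' :: "(nat \<Rightarrow> real) \<Rightarrow> 'a"
  assumes odd_k: "odd k"
    and X: "compact_space X" "Hausdorff_space X" "locally_Euclidean n X"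
    and \<mu>: "orientation n X \<mu>"
    and T: "continuous_map X X T" and s: "continuous_map X X s"
    and Tk: "z \<in> topspace X \<Longrightarrow> (T ^^ k) z = z"
    and ss: "z \<in> topspace X \<Longrightarrow> s (s z) = z"
    and TsT: "z \<in> topspace X \<Longrightarrow> T (s (T z)) = s z"
    and \<mu>T: "z \<in> topspace X \<Longrightarrow> hom_induced (int n) X (topspace X - {z}) X (topspace X - {T z}) T (\<mu> z) = \<mu> (T z)"
    and \<mu>s: "z \<in> topspace X \<Longrightarrow> hom_induced (int n) X (topspace X - {z}) X (topspace X - {s z}) s (\<mu> z) = \<mu> (s z)"
    and Tx: "T x = x" and sx: "s x \<noteq> x"
    and free: "z \<in> topspace X \<Longrightarrow> z \<noteq> x \<Longrightarrow> z \<noteq> s x \<Longrightarrow> 0 < j \<Longrightarrow> j < k \<Longrightarrow> (T ^^ j) z \<noteq> z"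
    and D: "disk_chart n X D \<psi> \<psi>'" and xD: "x \<in> X interior_of D" and TD: "T ` D = D"
begin

abbreviation y :: 'a where "y \<equiv> s x"
abbreviation S :: "'a set" where "S \<equiv> boundary X D"

text \<open>For a map of finite order this two-sided condition is equivalent to invariance; it is preserved
  by complements without further argument.\<close>

definition inv_set :: "'a set \<Rightarrow> bool" where
  "inv_set A \<longleftrightarrow> A \<subseteq> topspace X \<and> (\<forall>z\<in>topspace X. T z \<in> A \<longleftrightarrow> z \<in> A)"

lemma k0: "k > 0" using k by simp

lemma oriented: "locally_oriented n X \<mu>"
  using \<mu> unfolding locally_oriented_def oriented_near_def orientation_def by blast

lemma TX: "z \<in> topspace X \<Longrightarrow> T z \<in> topspace X" and sX: "z \<in> topspace X \<Longrightarrow> s z \<in> topspace X"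
  using T s by (auto simp: continuous_map_def)

lemma T_homeo: "homeomorphic_map X X T"
  using homeomorphic_map_funpow[of X T k 1, OF T Tk] k0 by simp

lemma s_homeo: "homeomorphic_maps X X s s"
  using s ss by (simp add: homeomorphic_maps_def)

lemma T_inj: "inj_on T (topspace X)"
  using T_homeo homeomorphic_imp_injective_map by blast

lemma xX: "x \<in> topspace X"
  using xD interior_of_subset_topspace by fastforce

lemma Ty: "T y = y" using TsT[OF xX] Tx by simp

lemma DX: "D \<subseteq> topspace X" using disk_chartD(1)[OF D] .

lemma free_on_set:
  assumes "A \<subseteq> topspace X" "x \<notin> A" "y \<notin> A" "\<And>z. z \<in> A \<Longrightarrow> T z \<in> A"
  shows "free_on k T A"
  unfolding free_on_def
proof (intro ballI conjI allI impI)
  fix z assume z: "z \<in> A"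
  show "T z \<in> A" using assms(4)[OF z] .
  have zX: "z \<in> topspace X" "z \<noteq> x" "z \<noteq> y" using assms z by auto
  show "(T ^^ k) z = z" using Tk zX(1) .
  fix j assume "0 < j \<and> j < k"
  then show "(T ^^ j) z \<noteq> z" using free zX by blast
qed

lemma inv_setD: "inv_set A \<Longrightarrow> z \<in> A \<Longrightarrow> T z \<in> A" "inv_set A \<Longrightarrow> A \<subseteq> topspace X"
  by (auto simp: inv_set_def)

lemma free_on_inv_set: "inv_set A \<Longrightarrow> x \<notin> A \<Longrightarrow> y \<notin> A \<Longrightarrow> free_on k T A"
  by (rule free_on_set) (auto dest: inv_setD)

lemma inv_set_ops:
  "inv_set A \<Longrightarrow> inv_set B \<Longrightarrow> inv_set (A \<union> B)" "inv_set A \<Longrightarrow> inv_set B \<Longrightarrow> inv_set (A \<inter> B)"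
  "inv_set A \<Longrightarrow> inv_set B \<Longrightarrow> inv_set (A - B)" "inv_set (topspace X)"
  using TX by (auto simp: inv_set_def)

lemma inv_set_image_T: "A \<subseteq> topspace X \<Longrightarrow> T ` A = A \<Longrightarrow> inv_set A"
  unfolding inv_set_def using T_inj by (metis image_eqI inj_on_image_mem_iff subset_refl)

lemma inv_set_D: "inv_set D" using inv_set_image_T[OF DX TD] .

lemma inv_set_int: "inv_set (X interior_of D)"
proof (rule inv_set_image_T)
  show "T ` (X interior_of D) = X interior_of D"
    using homeomorphic_map_interior_of[OF T_homeo DX] TD by simp
qed (simp add: interior_of_subset_topspace)

lemma s_image_iff: "A \<subseteq> topspace X \<Longrightarrow> z \<in> topspace X \<Longrightarrow> z \<in> s ` A \<longleftrightarrow> s z \<in> A"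
  using ss by (metis image_eqI imageE subsetD)

lemma inv_set_s:
  assumes "inv_set A"
  shows "inv_set (s ` A)"
proof -
  have A: "A \<subseteq> topspace X" using inv_setD(2)[OF assms] .
  have "T z \<in> s ` A \<longleftrightarrow> z \<in> s ` A" if z: "z \<in> topspace X" for z
  proof -
    have "T z \<in> s ` A \<longleftrightarrow> s (T z) \<in> A" by (rule s_image_iff[OF A TX[OF z]])
    also have "\<dots> \<longleftrightarrow> T (s (T z)) \<in> A" using assms sX[OF TX[OF z]] by (simp add: inv_set_def)
    also have "\<dots> \<longleftrightarrow> z \<in> s ` A" using s_image_iff[OF A z] TsT[OF z] by simp
    finally show ?thesis .
  qed
  then show ?thesis using A sX by (auto simp: inv_set_def)
qed

abbreviation "D' \<equiv> s ` D"
abbreviation "S' \<equiv> boundary X D'"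

lemma D': "disk_chart n X D' (\<psi> \<circ> s) (s \<circ> \<psi>')"
  using disk_chart_image[OF D s_homeo] .

lemma D'X: "D' \<subseteq> topspace X" using disk_chartD(1)[OF D'] .

lemma int_D': "X interior_of D' = s ` (X interior_of D)"
  using homeomorphic_map_interior_of[OF _ DX] s_homeo homeomorphic_maps_map by blast

lemma inv_sets: "inv_set D" "inv_set (X interior_of D)" "inv_set D'" "inv_set (X interior_of D')" "inv_set S" "inv_set S'"
proof -
  show a: "inv_set D" "inv_set (X interior_of D)" by (rule inv_set_D inv_set_int)+
  show b: "inv_set D'" "inv_set (X interior_of D')" unfolding int_D' by (rule inv_set_s a)+
  show "inv_set S" "inv_set S'" by (rule inv_set_ops(3) a b)+
qed

lemma closed_sets: "closedin X D" "closedin X D'" "closedin X S" "closedin X S'"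
  using closedin_boundary[OF X(2) D] closedin_boundary[OF X(2) D'] by blast+

lemma mem_D'_iff: "z \<in> topspace X \<Longrightarrow> z \<in> D' \<longleftrightarrow> s z \<in> D" "z \<in> topspace X \<Longrightarrow> z \<in> X interior_of D' \<longleftrightarrow> s z \<in> X interior_of D"
  unfolding int_D' by (rule s_image_iff[OF DX] s_image_iff[OF interior_of_subset_topspace]; assumption)+

lemma S'_eq: "S' = s ` S"
proof -
  have "z \<in> S' \<longleftrightarrow> z \<in> s ` S" if "z \<in> topspace X" for z
    using mem_D'_iff[OF that] s_image_iff[OF _ that, of S] DX by blast
  moreover have "s ` S \<subseteq> topspace X" using sX DX by blast
  ultimately show ?thesis using D'X by blast
qed

lemma extendable_S: "extendable (subtopology X S) (punct n)"
proof (rule extendable_homeomorphic_space[OF extendable_sphere[OF n(1)]])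
  show "subtopology (Euclidean_space n) (gauge_sphere n (l2 n)) homeomorphic_space subtopology X S"
    using boundary_disk_chart[OF X(3) D] homeomorphic_space_def homeomorphic_space_sym by blast
qed

lemma extendable_S': "extendable (subtopology X S') (punct n)"
proof (rule extendable_homeomorphic_space[OF extendable_sphere[OF n(1)]])
  show "subtopology (Euclidean_space n) (gauge_sphere n (l2 n)) homeomorphic_space subtopology X S'"
    using boundary_disk_chart[OF X(3) D'] homeomorphic_space_def homeomorphic_space_sym by blast
qed

lemma subspace_action:
  assumes "inv_set A"
  shows "continuous_map (subtopology X A) (subtopology X A) T" "topspace (subtopology X A) = A"
proof -
  show "topspace (subtopology X A) = A" using inv_setD(2)[OF assms] by auto
  then show "continuous_map (subtopology X A) (subtopology X A) T"
    unfolding continuous_map_in_subtopology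
    using T inv_setD(1)[OF assms] by (auto simp: continuous_map_from_subtopology)
qed

text \<open>Otherwise \<open>S - {y}\<close>, a sphere without a point, would carry a free action of the
  cyclic group.\<close>

lemma y_not_boundary: "y \<notin> S"
proof
  assume yS: "y \<in> S"
  let ?E = "Euclidean_space n" and ?Sph = "gauge_sphere n (l2 n)"
  define Z where "Z = subtopology X (S - {y})"
  have xS: "x \<notin> S" using xD by blast
  have SX: "S \<subseteq> topspace X" using DX by blast
  have inv: "inv_set (S - {y})"
  proof -
    have "T z = y \<longleftrightarrow> z = y" if "z \<in> topspace X" for z
      using inj_onD[OF T_inj, of z y] Ty that sX[OF xX] by auto
    then show ?thesis using inv_sets(5) by (auto simp: inv_set_def)
  qed
  have ZS: "topspace Z = S - {y}" using SX by (auto simp: Z_def)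
  have bm: "homeomorphic_maps (subtopology X S) (subtopology ?E ?Sph) \<psi> \<psi>'"
    by (rule boundary_disk_chart[OF X(3) D])
  have b: "continuous_map (subtopology X S) (subtopology ?E ?Sph) \<psi>" "continuous_map (subtopology ?E ?Sph) (subtopology X S) \<psi>'"
    "\<And>z. z \<in> S \<Longrightarrow> \<psi>' (\<psi> z) = z" "\<And>q. q \<in> ?Sph \<Longrightarrow> \<psi> (\<psi>' q) = q"
    using bm SX by (auto simp: homeomorphic_maps_def)
  have \<psi>S: "\<psi> z \<in> ?Sph" if "z \<in> S" for z using b(1) that SX by (auto simp: continuous_map_def)
  have \<psi>'S: "\<psi>' q \<in> S" if "q \<in> ?Sph" for q using b(2) that by (auto simp: continuous_map_def)
  show False
  proof (rule no_free_action_on_extensor[of Z T])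
    show "Hausdorff_space Z" unfolding Z_def using X(2) by (rule Hausdorff_space_subtopology)
    show "continuous_map Z Z T" unfolding Z_def by (rule subspace_action[OF inv])
    show "free_on k T (topspace Z)" unfolding ZS using free_on_inv_set[OF inv] xS by blast
  next
    fix Y :: "(nat \<Rightarrow> real) topology" assume Y: "compact_space Y" "Hausdorff_space Y"
    have "normal_space Y" using Y compact_Hausdorff_or_regular_imp_normal_space by blast
    then have e: "extendable Y (subtopology ?E (?Sph - {\<psi> y}))"
      using extendable_sphere_minus_point \<psi>S[OF yS] by blast
    show "extendable Y Z"
    proof (rule extendable_retract[OF e])
      have "continuous_map (subtopology ?E (?Sph - {\<psi> y})) X \<psi>'"
        using continuous_map_from_subtopology_mono[of ?E ?Sph X \<psi>' "?Sph - {\<psi> y}"] b(2)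
        by (auto simp: continuous_map_in_subtopology)
      moreover have "\<psi>' q \<in> S - {y}" if "q \<in> ?Sph - {\<psi> y}" for q
      proof -
        have q: "q \<in> ?Sph" "q \<noteq> \<psi> y" using that by blast+
        have "\<psi>' q \<noteq> y" using b(4)[OF q(1)] q(2) by metis
        then show ?thesis using \<psi>'S[OF q(1)] by blast
      qed
      ultimately show "continuous_map (subtopology ?E (?Sph - {\<psi> y})) Z \<psi>'"
        unfolding Z_def continuous_map_in_subtopology by auto
      have "continuous_map Z ?E \<psi>"
        unfolding Z_def using continuous_map_from_subtopology_mono[of X S ?E \<psi> "S - {y}"] b(1)
        by (auto simp: continuous_map_in_subtopology)
      moreover have "\<psi> z \<in> ?Sph - {\<psi> y}" if "z \<in> S - {y}" for z
      proof -
        have z: "z \<in> S" "z \<noteq> y" using that by blast+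
        have "\<psi> z \<noteq> \<psi> y" using b(3)[OF z(1)] b(3)[OF yS] z(2) by metis
        then show ?thesis using \<psi>S[OF z(1)] by blast
      qed
      ultimately show "continuous_map Z (subtopology ?E (?Sph - {\<psi> y})) \<psi>"
        unfolding continuous_map_in_subtopology using ZS by blast
      show "\<psi>' (\<psi> z) = z" if "z \<in> topspace Z" for z using b(3) that ZS by blast
    qed
  next
    fix K assume K: "compactin Z K"
    have KS: "K \<subseteq> S - {y}" using compactin_subset_topspace[OF K] ZS by simp
    have "compactin X K" using K by (simp add: Z_def compactin_subtopology)
    then have "closedin X K" using compactin_imp_closedin X(2) by blast
    then have "extendable (subtopology X K) (punct n)" using extendable_subset[OF extendable_S] KS by blast
    moreover have "subtopology Z K = subtopology X K" unfolding Z_def using KS by (simp add: subtopology_subtopology inf_absorb2)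
    ultimately show "extendable (subtopology Z K) (punct n)" by simp
  qed
qed

lemma fixed_not_boundary: "x \<notin> S \<union> S'" "y \<notin> S \<union> S'"
proof -
  have xS: "x \<notin> S" using xD by blast
  moreover have "x \<notin> S'"
    using mem_D'_iff[OF xX] y_not_boundary by blast
  moreover have "y \<notin> S'"
    using mem_D'_iff[OF sX[OF xX]] ss[OF xX] xS by auto
  ultimately show "x \<notin> S \<union> S'" "y \<notin> S \<union> S'" using y_not_boundary by blast+
qed

text \<open>Over the complement of \<open>P\<close> the extension is equivariant; over \<open>P\<close>,
  which contains the fixed points, it is an arbitrary one, obtained from the same theorem for
  the trivial group.\<close>

lemma equivariant_extension_outside:
  assumes A: "closedin X A" "inv_set A" and P: "openin X P" "inv_set P" "x \<in> P" "y \<in> P"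
    and PA: "closedin X (P \<union> A)" "P \<inter> A = {}"
    and f: "continuous_map (subtopology X A) (punct n) f" and fT: "\<And>z. z \<in> A \<Longrightarrow> f (T z) = \<tau> (f z)"
  obtains u where "continuous_map X (Euclidean_space n) u" "\<And>z. z \<in> A \<Longrightarrow> u z = f z"
    "finite (zeros u (topspace X))" "\<And>N. openin X N \<Longrightarrow> inv_set N \<Longrightarrow> N \<inter> P = {} \<Longrightarrow> int k dvd degree_sum n X \<mu> u N"
proof -
  let ?E = "Euclidean_space n"
  define M where "M = topspace X - P"
  have AX: "A \<subseteq> topspace X" and PX: "P \<subseteq> topspace X" using A(1) P(1) closedin_subset openin_subset by blast+
  have M: "closedin X M" unfolding M_def using P(1) by blast
  have Mc: "compactin X M" using closedin_compact_space X(1) M by blast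
  have Minv: "inv_set M" unfolding M_def by (rule inv_set_ops(3)[OF inv_set_ops(4) P(2)])
  have Mfree: "free_on k T M" using free_on_inv_set[OF Minv] P(3,4) by (simp add: M_def)
  have AM: "A \<subseteq> M" unfolding M_def using PA(2) AX by blast
  have \<tau>k: "(\<tau> ^^ k) q = q" if "q \<in> topspace ?E" for q by (rule \<tau>_funpow)
  obtain u1 where u1: "continuous_map (subtopology X M) ?E u1" "\<And>z. z \<in> A \<Longrightarrow> u1 z = f z"
    "\<And>z. z \<in> M \<Longrightarrow> u1 (T z) = \<tau> (u1 z)" "finite (zeros u1 M)"
    using equivariant_finite_zero_extension[where T=T and \<tau>=\<tau> and f=f and A=A, OF X(2,3) T Tk k0 Mc Mfree continuous_\<tau> \<tau>k \<tau>_zvec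
        A(1) AM inv_setD(1)[OF A(2)] f fT] by blast
  define K where "K = P \<union> A"
  have Kc: "compactin X K" using closedin_compact_space X(1) PA(1) unfolding K_def by blast
  have Kfree: "free_on 1 (\<lambda>z. z) K" by (auto simp: free_on_def)
  have AK: "A \<subseteq> K" by (simp add: K_def)
  obtain u2 where u2: "continuous_map (subtopology X K) ?E u2" "\<And>z. z \<in> A \<Longrightarrow> u2 z = f z" "finite (zeros u2 K)"
  proof -
    have c: "continuous_map X X (\<lambda>z. z)" "continuous_map ?E ?E (\<lambda>z. z)" by simp_all
    have one: "((\<lambda>z. z) ^^ 1) z = z" for z :: 'b by simp
    show thesis
      by (rule equivariant_finite_zero_extension[where T="\<lambda>z. z" and \<tau>="\<lambda>z. z" and f=f and A=A and k=1, OF X(2,3) c(1) one _ Kc Kfree c(2) one _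
        A(1) AK _ f]) (auto intro: that)
  qed
  define u where "u z = (if z \<in> K then u2 z else u1 z)" for z
  have KM: "K \<union> M = topspace X" using AX PX by (auto simp: K_def M_def)
  have "continuous_map (subtopology X (K \<union> M)) ?E u"
    unfolding u_def
  proof (rule paste_closed2)
    show "closedin X K" using PA(1) by (simp add: K_def)
    fix z assume "z \<in> K \<inter> M"
    then have "z \<in> A" by (auto simp: K_def M_def)
    then show "u2 z = u1 z" using u1(2) u2(2) by simp
  qed (use M u1(1) u2(1) in auto)
  then have uc: "continuous_map X ?E u" by (simp add: KM)
  have uA: "u z = f z" if "z \<in> A" for z using that u2(2) AK by (auto simp: u_def)
  have "zeros u (topspace X) \<subseteq> zeros u2 K \<union> zeros u1 M" by (auto simp: zeros_def u_def KM[symmetric])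
  then have fin: "finite (zeros u (topspace X))" using u1(4) u2(3) finite_subset by blast
  have uM: "u z = u1 z" if "z \<in> M" for z
    using that uA u1(2) by (auto simp: u_def K_def M_def)
  show thesis
  proof (rule that[OF uc uA fin])
    fix N assume N: "openin X N" "inv_set N" "N \<inter> P = {}"
    have NX: "N \<subseteq> topspace X" and NM: "N \<subseteq> M" using N openin_subset by (auto simp: M_def)
    have Nfree: "free_on k T N" using free_on_inv_set[OF N(2)] N(3) P(3,4) by blast
    have \<mu>c: "\<mu> z \<in> carrier (local_homology n X {z})" if "z \<in> topspace X" for z
      using locally_oriented_carrier[OF oriented that] .
    have uT: "u (T z) = \<tau> (u z)" if "z \<in> N" for z
    proof -
      have "z \<in> M" "T z \<in> M" using NM that inv_setD(1)[OF N(2) that] by blast+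
      then show ?thesis using uM u1(3) by simp
    qed
    have finN: "finite (zeros u N)" using fin zeros_mono[OF NX] finite_subset by blast
    have \<tau>nz: "\<tau> q \<noteq> zvec" if "q \<in> topspace ?E" "q \<noteq> zvec" for q using proper_\<tau> that by (simp add: proper_at_zero_def)
    have uc': "continuous_map (subtopology X (topspace X)) ?E u" using uc by simp
    show "int k dvd degree_sum n X \<mu> u N"
      by (rule degree_sum_free_dvd[where \<tau>=\<tau> and T=T, OF X(2) T Tk k0 \<mu>c \<mu>T N(1) NX Nfree uc' finN uT continuous_\<tau> \<tau>_zvec \<tau>nz endo_degree_\<tau>])
  qed
qed

text \<open>A nonzero constant map has no zeros.\<close>

lemma degree_sum_total:
  assumes u: "continuous_map X (Euclidean_space n) u" "finite (zeros u (topspace X))"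
  shows "degree_sum n X \<mu> u (topspace X) = 0"
proof -
  define c :: "nat \<Rightarrow> real" where "c = (\<lambda>i. if i = 0 then 1 else 0)"
  have c: "c \<in> topspace (Euclidean_space n)" "c \<noteq> zvec"
    using n(1) by (auto simp: c_def topspace_Euclidean_space fun_eq_iff)
  have z: "zeros (\<lambda>_. c) (topspace X) = {}" using c(2) by (auto simp: zeros_def)
  have "degree_sum n X \<mu> u (topspace X) = degree_sum n X \<mu> (\<lambda>_. c) (topspace X)"
    by (rule degree_sum_boundary[OF X(2,3) oriented]) (use X(1) u z c(1) in \<open>auto simp: compact_space_def\<close>)
  then show ?thesis by (simp add: degree_sum_def z)
qed

theorem no_dihedral_disk: False
proof -
  let ?E = "Euclidean_space n" and ?I = "X interior_of D" and ?I' = "X interior_of D'"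
  have SX: "S \<subseteq> topspace X" "S' \<subseteq> topspace X" using DX D'X by blast+
  define Y where "Y = subtopology X (S \<union> S')"
  have invS: "inv_set (S \<union> S')" by (rule inv_set_ops inv_sets)+
  have clS: "closedin X (S \<union> S')" using closed_sets by blast
  note YT = subspace_action[OF invS, folded Y_def]
  have Yc: "compact_space Y" "Hausdorff_space Y"
    using closedin_compact_space[OF X(1) clS] X(2) unfolding Y_def by (simp_all add: compact_space_subtopology Hausdorff_space_subtopology)
  have Yf: "free_on k T (topspace Y)" unfolding YT(2) using free_on_inv_set[OF invS] fixed_not_boundary by blast
  have Ye: "extendable Y (punct n)"
    unfolding Y_def by (rule extendable_Un[OF extendable_S extendable_S' closed_sets(3,4)])
  have \<tau>k: "(\<tau> ^^ k) q = q" if "q \<in> topspace (punct n)" for q by (rule \<tau>_funpow)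
  have \<tau>P: "continuous_map (punct n) (punct n) \<tau>"
    unfolding continuous_map_punct_iff using proper_\<tau> continuous_\<tau>
    by (auto simp: punct_def continuous_map_from_subtopology proper_at_zero_def)
  obtain f where f: "continuous_map Y (punct n) f" "\<And>z. z \<in> S \<union> S' \<Longrightarrow> f (T z) = \<tau> (f z)"
  proof (rule equivariant_extension[where A="{}" and f="\<lambda>_. undefined" and \<tau>=\<tau> and Q="punct n",
      OF Yc YT(1) Yf k0 \<tau>P \<tau>k Ye])
    fix g assume "continuous_map Y (punct n) g" "\<And>z. z \<in> topspace Y \<Longrightarrow> g (T z) = \<tau> (g z)"
    then show thesis using that YT(2) by simp
  qed auto
  have fS: "continuous_map (subtopology X S) (punct n) f" "continuous_map (subtopology X S') (punct n) f"
    using continuous_map_from_subtopology_mono[OF f(1)[unfolded Y_def]] by blast+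
  define b where "b = endo_degree n (radial (l2 n) (f \<circ> \<psi>'))"
  define b' where "b' = endo_degree n (radial (l2 n) (f \<circ> (s \<circ> \<psi>')))"
  note bm = boundary_disk_chart[OF X(3) D]
  obtain a where a: "\<And>f. continuous_map (subtopology X S) (punct n) f \<Longrightarrow> (\<And>z. z \<in> S \<Longrightarrow> f (T z) = \<tau> (f z)) \<Longrightarrow>
      int k dvd a * endo_degree n (radial (l2 n) (f \<circ> \<psi>')) - 1"
    using sphere_degree_inverse[OF bm subspace_action(1)[OF inv_sets(5)]] Tk subspace_action(2)[OF inv_sets(5)] SX by (metis subsetD)
  have ab: "int k dvd a * b - 1" unfolding b_def by (rule a[OF fS(1)]) (use f(2) in blast)
  have ab': "int k dvd a * b' - 1"
  proof -
    have "continuous_map (subtopology X S) (subtopology X S') s"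
      unfolding continuous_map_in_subtopology using s SX S'_eq by (auto simp: continuous_map_from_subtopology)
    then have fs: "continuous_map (subtopology X S) (punct n) (f \<circ> s)" using fS(2) continuous_map_compose by blast
    have qP: "continuous_map (punct n) (punct n) quat_j"
      unfolding continuous_map_punct_iff using proper_at_zero_quat_j[OF n(2)]
      by (auto simp: punct_def continuous_map_from_subtopology proper_at_zero_def)
    \<comment> \<open>the twist by \<open>quat_j\<close> turns \<open>f \<circ> s\<close>, which is equivariant up to inversion, into an equivariant map\<close>
    have "int k dvd a * endo_degree n (radial (l2 n) ((quat_j \<circ> (f \<circ> s)) \<circ> \<psi>')) - 1"
    proof (rule a)
      show "continuous_map (subtopology X S) (punct n) (quat_j \<circ> (f \<circ> s))" using continuous_map_compose[OF fs qP] .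
      fix z assume z: "z \<in> S"
      have zX: "z \<in> topspace X" using z SX by blast
      have "s (T z) \<in> S'" unfolding S'_eq using inv_setD(1)[OF inv_sets(5) z] by blast
      then have "f (s z) = \<tau> (f (s (T z)))" using f(2) TsT[OF zX] by (metis UnI2)
      then have "\<tau> (quat_j (f (s z))) = quat_j (f (s (T z)))" using quat_j_\<tau> by simp
      then show "(quat_j \<circ> (f \<circ> s)) (T z) = \<tau> ((quat_j \<circ> (f \<circ> s)) z)" by simp
    qed
    moreover have "endo_degree n (radial (l2 n) ((quat_j \<circ> (f \<circ> s)) \<circ> \<psi>')) = b'"
    proof -
      have "continuous_map (subtopology ?E (gauge_sphere n (l2 n))) (punct n) ((f \<circ> s) \<circ> \<psi>')"
        using continuous_map_compose[OF _ fs] bm by (auto simp: homeomorphic_maps_def)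
      from radial_degree_quat_j[OF this] show ?thesis by (simp add: b'_def o_assoc)
    qed
    ultimately show ?thesis by simp
  qed
  define e where "e = local_degree n X \<mu> \<psi> (\<psi>' zvec)"
  have e1: "e dvd 1" unfolding e_def by (rule disk_degree_unit[OF X(2,3) \<mu> D])
  have \<mu>c: "\<mu> z \<in> carrier (local_homology n X {z})" if "z \<in> topspace X" for z
    using locally_oriented_carrier[OF oriented that] .
  have e': "local_degree n X \<mu> (\<psi> \<circ> s) ((s \<circ> \<psi>') zvec) = e"
    unfolding e_def by (rule disk_degree_image[OF X(2,3) D s_homeo \<mu>c \<mu>s])
  have sub: "finite (zeros u B)" if "finite (zeros u (topspace X))" "B \<subseteq> topspace X" for u :: "'a \<Rightarrow> nat \<Rightarrow> real" and B
    using that zeros_mono finite_subset by metis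
  have dI: "degree_sum n X \<mu> u ?I = b * e"
    if "continuous_map X ?E u" "finite (zeros u (topspace X))" "\<And>z. z \<in> S \<Longrightarrow> u z = f z" for u
    unfolding b_def e_def
    by (rule degree_sum_disk[OF X(2,3) oriented D fS(1) _ sub[OF that(2) DX] that(3)]) (use that(1) in \<open>simp_all add: continuous_map_from_subtopology\<close>)
  have dI': "degree_sum n X \<mu> u ?I' = b' * e"
    if "continuous_map X ?E u" "finite (zeros u (topspace X))" "\<And>z. z \<in> S' \<Longrightarrow> u z = f z" for u
    unfolding b'_def e'[symmetric]
    by (rule degree_sum_disk[OF X(2,3) oriented D' fS(2) _ sub[OF that(2) D'X] that(3)]) (use that(1) in \<open>simp_all add: continuous_map_from_subtopology\<close>)
  have ID: "?I \<subseteq> D" "?I' \<subseteq> D'" by (rule interior_of_subset)+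
  have IX: "?I \<subseteq> topspace X" by (rule interior_of_subset_topspace)
  have fnz: "f z \<noteq> zvec" if "z \<in> S \<union> S'" for z
    using f(1) that YT(2) by (auto simp: continuous_map_punct_iff)
  have sumUn: "degree_sum n X \<mu> u C = degree_sum n X \<mu> u A + degree_sum n X \<mu> u B"
    if "finite (zeros u (topspace X))" "A \<subseteq> topspace X" "B \<subseteq> topspace X" "A \<inter> B = {}" "zeros u C = zeros u (A \<union> B)" for u A B C
  proof -
    have "zeros u A \<inter> zeros u B = {}" using that(4) by (auto simp: zeros_def)
    then have "degree_sum n X \<mu> u (A \<union> B) = degree_sum n X \<mu> u A + degree_sum n X \<mu> u B"
      using degree_sum_Un[OF sub[OF that(1,2)] sub[OF that(1,3)]] by blast
    then show ?thesis using that(5) by (simp add: degree_sum_def)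
  qed
  have unit: "int k dvd c" if "int k dvd c * e" for c
  proof -
    obtain e2 where "1 = e * e2" using e1 by (auto simp: dvd_def)
    then have "c = c * e * e2" by (simp add: mult.assoc)
    then show ?thesis using that by (metis dvd_mult2)
  qed
  \<comment> \<open>both fixed points may lie in the same disk\<close>
  show False
  proof (cases "y \<in> ?I")
    case True
    have P: "closedin X (?I \<union> S)"
    proof -
      have "?I \<union> S = D" using ID by blast
      then show ?thesis using closed_sets(1) by simp
    qed
    have fT: "f (T z) = \<tau> (f z)" if "z \<in> S" for z using f(2) that by blast
    obtain u where u: "continuous_map X ?E u" "\<And>z. z \<in> S \<Longrightarrow> u z = f z" "finite (zeros u (topspace X))"
      "\<And>N. openin X N \<Longrightarrow> inv_set N \<Longrightarrow> N \<inter> ?I = {} \<Longrightarrow> int k dvd degree_sum n X \<mu> u N"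
      using equivariant_extension_outside[OF closed_sets(3) inv_sets(5) openin_interior_of inv_sets(2) xD True P _ fS(1) fT] by blast
    define N where "N = topspace X - D"
    have N: "openin X N" "inv_set N" "N \<inter> ?I = {}"
      using closed_sets(1) inv_set_ops(3)[OF inv_set_ops(4) inv_sets(1)] ID by (auto simp: N_def)
    have "zeros u (topspace X) = zeros u (?I \<union> N)"
      using u(2) fnz DX IX by (auto simp: zeros_def N_def)
    then have "0 = degree_sum n X \<mu> u ?I + degree_sum n X \<mu> u N"
      using sumUn[OF u(3), of ?I N "topspace X"] N IX degree_sum_total[OF u(1,3)] by (auto simp: N_def)
    then have "b * e = - degree_sum n X \<mu> u N" using dI[OF u(1,3,2)] by simp
    then have "int k dvd b * e" using u(4)[OF N] by simp
    then have "int k dvd b" by (rule unit)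
    then have "int k dvd 1" using ab by (metis dvd_diff_right_iff dvd_mult)
    then show False using k by simp
  next
    case False
    then have yD: "y \<notin> D" using y_not_boundary by blast
    have xD': "x \<notin> D'" using mem_D'_iff[OF xX] yD by simp
    have yI': "y \<in> ?I'" using mem_D'_iff(2)[OF sX[OF xX]] ss[OF xX] xD by simp
    \<comment> \<open>the two disks may overlap; their intersection does not contain the fixed points and counts as free\<close>
    define P1 where "P1 = ?I - D'"
    define P2 where "P2 = ?I' - D"
    define J where "J = ?I \<inter> ?I'"
    define N where "N = topspace X - (D \<union> D')"
    have J: "openin X J" "inv_set J" unfolding J_def by (auto intro: openin_Int inv_set_ops inv_sets)
    have N: "openin X N" "inv_set N"
      unfolding N_def using closed_sets inv_set_ops inv_sets by (auto intro!: openin_diff closedin_Un)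
    have P: "openin X (P1 \<union> P2)" "inv_set (P1 \<union> P2)" "x \<in> P1 \<union> P2" "y \<in> P1 \<union> P2"
      unfolding P1_def P2_def using closed_sets inv_set_ops inv_sets xD xD' yI' yD
      by (auto intro!: openin_Un openin_diff)
    have sets: "P1 \<inter> J = {}" "P2 \<inter> J = {}" "P1 \<inter> P2 = {}" "N \<inter> P1 = {}" "N \<inter> P2 = {}" "N \<inter> J = {}"
      "(P1 \<union> P2) \<inter> (S \<union> S') = {}" "P1 \<union> P2 \<union> (S \<union> S') = topspace X - (J \<union> N)"
      "topspace X = (S \<union> S') \<union> (P1 \<union> P2 \<union> J \<union> N)" "?I = P1 \<union> J \<union> (?I \<inter> S')" "?I' = P2 \<union> J \<union> (?I' \<inter> S)"
      using ID DX D'X by (auto simp: P1_def P2_def J_def N_def)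
    have subs: "P1 \<subseteq> topspace X" "P2 \<subseteq> topspace X" "J \<subseteq> topspace X" "N \<subseteq> topspace X"
      using ID DX D'X by (auto simp: P1_def P2_def J_def N_def)
    have clP: "closedin X (P1 \<union> P2 \<union> (S \<union> S'))" unfolding sets(8) using J(1) N(1) by blast
    have fc: "continuous_map (subtopology X (S \<union> S')) (punct n) f" using f(1) by (simp add: Y_def)
    obtain u where u: "continuous_map X ?E u" "\<And>z. z \<in> S \<union> S' \<Longrightarrow> u z = f z" "finite (zeros u (topspace X))"
      "\<And>N. openin X N \<Longrightarrow> inv_set N \<Longrightarrow> N \<inter> (P1 \<union> P2) = {} \<Longrightarrow> int k dvd degree_sum n X \<mu> u N"
      using equivariant_extension_outside[OF clS invS P clP sets(7) fc f(2)] by blast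
    have unz: "u z \<noteq> zvec" if "z \<in> S \<union> S'" for z using u(2) fnz that by simp
    let ?d = "degree_sum n X \<mu> u"
    have zI: "zeros u ?I = zeros u (P1 \<union> J)" using unz by (subst sets(10)) (auto simp: zeros_def)
    have zI': "zeros u ?I' = zeros u (P2 \<union> J)" using unz by (subst sets(11)) (auto simp: zeros_def)
    have zX: "zeros u (topspace X) = zeros u ((P1 \<union> P2) \<union> (J \<union> N))" using unz by (subst sets(9)) (auto simp: zeros_def)
    have "?d ?I = ?d P1 + ?d J" by (rule sumUn[OF u(3) _ _ _ zI]) (use subs sets in auto)
    moreover have "?d ?I' = ?d P2 + ?d J" by (rule sumUn[OF u(3) _ _ _ zI']) (use subs sets in auto)
    moreover have "?d (topspace X) = ?d (P1 \<union> P2) + ?d (J \<union> N)" by (rule sumUn[OF u(3) _ _ _ zX]) (use subs sets in auto)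
    moreover have "?d (P1 \<union> P2) = ?d P1 + ?d P2" by (rule sumUn[OF u(3) _ _ _ refl]) (use subs sets in auto)
    moreover have "?d (J \<union> N) = ?d J + ?d N" by (rule sumUn[OF u(3) _ _ _ refl]) (use subs sets in auto)
    moreover have "?d ?I = b * e" using dI[OF u(1,3)] u(2) by blast
    moreover have "?d ?I' = b' * e" using dI'[OF u(1,3)] u(2) by blast
    ultimately have "(b + b') * e = ?d J - ?d N" using degree_sum_total[OF u(1,3)] by (simp add: algebra_simps)
    moreover have "int k dvd ?d J" "int k dvd ?d N" using u(4)[OF J] u(4)[OF N] sets by blast+
    ultimately have "int k dvd (b + b') * e" by (simp add: dvd_diff)
    then have "int k dvd b + b'" by (rule unit)
    then have "int k dvd a * (b + b')" by simp
    moreover have "int k dvd (a * b - 1) + (a * b' - 1)" using ab ab' by (rule dvd_add)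
    ultimately have "int k dvd a * (b + b') - ((a * b - 1) + (a * b' - 1))" by (rule dvd_diff)
    then have "int k dvd int 2" by (simp add: algebra_simps)
    then have "k dvd 2" by (simp only: int_dvd_int_iff)
    then have "k \<le> 2" by (rule dvd_imp_le) simp
    then show False using k by simp
  qed
qed

end

section \<open>The action of the dihedral group\<close>

locale dihedral_action =
  fixes k n :: nat and X :: "'a topology" and \<phi> :: "int \<times> bool \<Rightarrow> 'a \<Rightarrow> 'a"
  assumes k: "k \<ge> 3" "odd k" and n: "n > 0" "n mod 4 = 0"
    and manifold: "closed_manifold n X"
    and action: "topological_action (dihedral_group k) X \<phi>"
    and oriented: "orientation_preserving_action n (dihedral_group k) X \<phi>"
    and tame: "tame_action n (dihedral_group k) X \<phi>"
    and type: "type_2_2_k k X \<phi>"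
begin

abbreviation "G \<equiv> dihedral_group k"
abbreviation "T \<equiv> \<phi> (1, False)"
abbreviation "s \<equiv> \<phi> (0, True)"

lemma ga: "group_action G (topspace X) \<phi>" using action by (simp add: topological_action_def)

lemma G_group: "group G" using group_dihedral_group k by simp

lemma carrier_G: "(i, b) \<in> carrier G \<longleftrightarrow> 0 \<le> i \<and> i < int k" by (auto simp: dihedral_group_def)

lemma mult_G: "(i, a) \<otimes>\<^bsub>G\<^esub> (j, b) = ((if a then i - j else i + j) mod int k, a \<noteq> b)"
  by (simp add: dihedral_group_def)

lemma one_G: "\<one>\<^bsub>G\<^esub> = (0, False)" by (simp add: dihedral_group_def)

lemma act_mult:
  assumes "g \<in> carrier G" "h \<in> carrier G" "z \<in> topspace X"
  shows "\<phi> g (\<phi> h z) = \<phi> (g \<otimes>\<^bsub>G\<^esub> h) z"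
  using group_action.composition_rule[OF ga assms(3,1,2)] by simp

lemma act_one: "z \<in> topspace X \<Longrightarrow> \<phi> (0, False) z = z"
  using group_action.id_eq_one[OF ga] by (metis one_G restrict_apply')

lemma gens: "(1, False) \<in> carrier G" "(0, True) \<in> carrier G" using k by (auto simp: carrier_G)

lemma T_funpow: "z \<in> topspace X \<Longrightarrow> (T ^^ j) z = \<phi> (int j mod int k, False) z"
proof (induction j)
  case 0
  then show ?case using act_one by simp
next
  case (Suc j)
  have c: "(int j mod int k, False) \<in> carrier G" using k by (auto simp: carrier_G)
  show ?case using Suc act_mult[OF gens(1) c Suc.prems] by (simp add: mult_G mod_simps add.commute)
qed

lemma mem_rotation: "(i, b) \<in> rotation_subgroup k \<longleftrightarrow> 0 \<le> i \<and> i < int k \<and> \<not> b"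
  by (auto simp: rotation_subgroup_def)

lemma stabilizer_conjugate:
  assumes "z \<in> topspace X" "g \<in> carrier G" "stabilizer G \<phi> (\<phi> g z) = {\<one>\<^bsub>G\<^esub>}" "h \<in> stabilizer G \<phi> z"
  shows "h = \<one>\<^bsub>G\<^esub>"
proof -
  interpret group G by (rule G_group)
  have h: "h \<in> carrier G" "\<phi> h z = z" using assms(4) by (auto simp: stabilizer_def)
  let ?c = "g \<otimes>\<^bsub>G\<^esub> h \<otimes>\<^bsub>G\<^esub> inv\<^bsub>G\<^esub> g"
  have c: "?c \<in> carrier G" using assms(2) h(1) by simp
  have cg: "?c \<otimes>\<^bsub>G\<^esub> g = g \<otimes>\<^bsub>G\<^esub> h" using assms(2) h(1) by (simp add: m_assoc)
  have "\<phi> ?c (\<phi> g z) = \<phi> (g \<otimes>\<^bsub>G\<^esub> h) z" using act_mult[OF c assms(2,1)] cg by simp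
  also have "\<dots> = \<phi> g z" using act_mult[OF assms(2) h(1) assms(1)] h(2) by simp
  finally have "?c \<in> stabilizer G \<phi> (\<phi> g z)" using c by (simp add: stabilizer_def)
  then have "?c = \<one>\<^bsub>G\<^esub>" using assms(3) by blast
  then have "g \<otimes>\<^bsub>G\<^esub> h = g" using cg assms(2) by simp
  then show ?thesis using l_cancel_one[OF assms(2) h(1)] by simp
qed

theorem no_dihedral_action: False
proof -
  interpret group G by (rule G_group)
  define A where "A = {S \<in> singular_orbits G X \<phi>. \<forall>x\<in>S. stabilizer G \<phi> x = rotation_subgroup k}"
  define B where "B = {S \<in> singular_orbits G X \<phi>. \<forall>x\<in>S. card (stabilizer G \<phi> x) = 2}"
  have AB: "singular_orbits G X \<phi> = A \<union> B" "card A = 1" using type by (simp_all add: type_2_2_k_def Let_def A_def B_def)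
  obtain S0 where S0: "A = {S0}" using AB(2) card_1_singletonE by blast
  then have "S0 \<in> A" by simp
  then have "S0 \<in> orbits G (topspace X) \<phi>" "\<forall>x\<in>S0. stabilizer G \<phi> x = rotation_subgroup k"
    by (auto simp: A_def singular_orbits_def)
  then obtain x where x: "x \<in> topspace X" "S0 = orbit G \<phi> x" "stabilizer G \<phi> x = rotation_subgroup k"
    using group_action.orbit_refl[OF ga] by (auto simp: orbits_def)
  have stab: "\<phi> (i, b) x = x \<longleftrightarrow> \<not> b" if "0 \<le> i" "i < int k" for i b
    using x(3) mem_rotation[of i b] that carrier_G[of i b] by (auto simp: stabilizer_def)
  have free: "(T ^^ j) z \<noteq> z" if z: "z \<in> topspace X" "z \<noteq> x" "z \<noteq> s x" and j: "0 < j" "j < k" for z j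
  proof
    assume "(T ^^ j) z = z"
    then have fz: "\<phi> (int j, False) z = z" using T_funpow[OF z(1), of j] j by simp
    have jG: "(int j, False) \<in> carrier G" using j by (simp add: carrier_G)
    have jst: "(int j, False) \<in> stabilizer G \<phi> z" using fz jG by (simp add: stabilizer_def)
    have "stabilizer G \<phi> w \<noteq> {\<one>\<^bsub>G\<^esub>}" if "w \<in> orbit G \<phi> z" for w
      using stabilizer_conjugate[OF z(1) _ _ jst] that j by (auto simp: orbit_def one_G)
    then have "orbit G \<phi> z \<in> singular_orbits G X \<phi>" using z(1) by (auto simp: singular_orbits_def orbits_def)
    then consider "orbit G \<phi> z \<in> A" | "orbit G \<phi> z \<in> B" using AB(1) by blast
    \<comment> \<open>the orbit of \<open>x\<close> consists of the two points \<open>x\<close> and \<open>s x\<close>; a group of order two cannot contain a nontrivial rotation, whose order is odd\<close>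
    then show False
    proof cases
      case 1
      then have "z \<in> orbit G \<phi> x" using S0 x(2) group_action.orbit_refl[OF ga z(1)] by simp
      then obtain i b where g: "(i, b) \<in> carrier G" "z = \<phi> (i, b) x" by (auto simp: orbit_def)
      show False
      proof (cases b)
        case True
        have c: "((- i) mod int k, False) \<in> carrier G" using k by (auto simp: carrier_G)
        have "s (\<phi> ((- i) mod int k, False) x) = \<phi> (i, True) x"
          using act_mult[OF gens(2) c x(1)] g(1) by (simp add: mult_G mod_simps carrier_G)
        moreover have "\<phi> ((- i) mod int k, False) x = x" using stab c by (simp add: carrier_G)
        ultimately show False using g(2) True z(3) by simp
      next
        case False
        then show False using g stab z(2) by (simp add: carrier_G)
      qed
    next
      case 2
      then have card: "card (stabilizer G \<phi> z) = 2" using group_action.orbit_refl[OF ga z(1)] by (auto simp: B_def)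
      then have fin: "finite (stabilizer G \<phi> z)" by (metis card.infinite zero_neq_numeral)
      have one: "(0, False) \<in> stabilizer G \<phi> z" using group_action.stabilizer_one_closed[OF ga z(1)] by (simp add: one_G)
      have two: "((2 * int j) mod int k, False) \<in> stabilizer G \<phi> z"
        using group_action.stabilizer_m_closed[OF ga z(1) jst jst] by (simp add: mult_G)
      have "{(0, False), (int j, False)} \<subseteq> stabilizer G \<phi> z" using one jst by blast
      then have "stabilizer G \<phi> z = {(0, False), (int j, False)}"
        using card_subset_eq[OF fin, of "{(0, False), (int j, False)}"] card j by simp
      then have "(2 * int j) mod int k = 0 \<or> (2 * int j) mod int k = int j" using two by auto
      then have "int k dvd 2 * int j \<or> int k dvd int j"
      proof
        assume "(2 * int j) mod int k = int j"
        then have "int k dvd 2 * int j - int j" by (metis dvd_minus_mod)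
        then show ?thesis by simp
      qed auto
      moreover have "coprime (int k) 2" using k(2) by simp
      ultimately have "int k dvd int j" using coprime_dvd_mult_right_iff by blast
      then show False using j by (auto dest: zdvd_imp_le)
    qed
  qed
  obtain \<mu> where \<mu>: "orientation n X \<mu>" "\<And>g z. g \<in> carrier G \<Longrightarrow> z \<in> topspace X \<Longrightarrow>
      hom_induced (int n) X (topspace X - {z}) X (topspace X - {\<phi> g z}) (\<phi> g) (\<mu> z) = \<mu> (\<phi> g z)"
    using oriented by (auto simp: orientation_preserving_action_def)
  obtain D where D: "D \<subseteq> topspace X" "x \<in> X interior_of D" "subtopology X D homeomorphic_space closed_disk n"
    "\<forall>g\<in>stabilizer G \<phi> x. \<phi> g ` D = D"
    using tame x(1) by (auto simp: tame_action_def)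
  have TD: "T ` D = D" using D(4) x(3) k by (simp add: mem_rotation)
  obtain \<psi> \<psi>' where \<psi>: "disk_chart n X D \<psi> \<psi>'"
    using D(1,3) by (auto simp: disk_chart_def homeomorphic_space_def closed_disk_eq)
  have cont: "continuous_map X X (\<phi> g)" if "g \<in> carrier G" for g
    using action that homeomorphic_imp_continuous_map by (auto simp: topological_action_def)
  have TsT: "T (s (T z)) = s z" if z: "z \<in> topspace X" for z
    using act_mult[OF gens(1) m_closed[OF gens(2,1)] z] act_mult[OF gens(2,1) z] k by (simp add: mult_G mod_simps)
  have ss: "s (s z) = z" if "z \<in> topspace X" for z
    using act_mult[OF gens(2,2) that] act_one[OF that] by (simp add: mult_G)
  have "dihedral_disk k n X \<mu> T s x D \<psi> \<psi>'"
  proof unfold_locales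
    show "compact_space X" "Hausdorff_space X" "locally_Euclidean n X"
      using manifold by (auto simp: closed_manifold_def locally_Euclidean_def)
    show "(T ^^ k) z = z" if "z \<in> topspace X" for z using T_funpow[OF that, of k] act_one[OF that] by simp
    show "T x = x" "s x \<noteq> x" using stab[of 1 False] stab[of 0 True] k by auto
  qed (use k n \<mu> cont gens TsT ss free \<psi> D(2) TD in auto)
  then show False by (rule dihedral_disk.no_dihedral_disk)
qed

end

theorem mainTheorem4:
  fixes k n :: nat
  assumes "k \<ge> 3" and "odd k" and "n > 0" and "n mod 4 = 0"
  shows "\<not> (\<exists>(X :: 'a topology) \<phi>.
            closed_manifold n X \<and> orientable n X \<and>
            topological_action (dihedral_group k) X \<phi> \<and>
            orientation_preserving_action n (dihedral_group k) X \<phi> \<and>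
            pseudofree_action (dihedral_group k) X \<phi> \<and>
            tame_action n (dihedral_group k) X \<phi> \<and>
            type_2_2_k k X \<phi>)"
proof (intro notI, elim exE conjE)
  fix X :: "'a topology" and \<phi>
  assume "closed_manifold n X" "topological_action (dihedral_group k) X \<phi>"
    "orientation_preserving_action n (dihedral_group k) X \<phi>"
    "tame_action n (dihedral_group k) X \<phi>" "type_2_2_k k X \<phi>"
  then interpret dihedral_action k n X \<phi>
    using assms by unfold_locales
  show False by (rule no_dihedral_action)
qed



end
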